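(* Assume that the simplicial space $X_\bullet$ is proper and simplicially NDR. Then there are natural homotopy equivalences $$K(n,t):\Sigma^{n+1}\big(S^t(X_n)/S^{t+1}(X_n)\big)\longrightarrow\bigvee_{J_t}\Sigma^{t+1}\big(F_{n-t}|X_\bullet|/F_{n-t-1}|X_\bullet|\big),$$ where $J_t$ runs over all admissible sequences with $t=|J_t|$ and $t$ is a fixed integer such that $0\le t\le n$. Thus there are natural homotopy equivalences $$\Theta(n):\Sigma^{n+1}(X_n)\longrightarrow\bigvee_{0\le t\le n}\ \bigvee_{J_t}\Sigma^{t+1}\big(F_{n-t}|X_\bullet|/F_{n-t-1}|X_\bullet|\big),$$ where $J_t$ runs over all admissible sequences with $t=|J_t|$.
   Context: A simplicial space $X_\bullet$ is a set of topological spaces $X_n$, $n\ge0$, together with continuous maps $d_i:X_n\to X_{n-1}$ (faces) and $s_j:X_n\to X_{n+1}$ (degeneracies) which satisfy the simplicial identities. $\Sigma$ denotes suspension and $\bigvee$ denotes a wedge (bouquet). Degeneracy filtration: $S^0(X_n)=X_n$, $S^t(X_n)=\bigcup s_{i_1}s_{i_2}\cdots s_{i_t}(X_{n-t})\subset X_n$, with $S(X_n)=S^1(X_n)$, and $S^{n+1}(X_n)$ is empty by convention. $|X_\bullet|$ is the geometric realization, with the compactly generated weak Hausdorff topology, and $F_j|X_\bullet|$ is its natural filtration: $F_j|X_\bullet|$ is the image of $\coprod_{i\le j}X_i\times\Delta^i$, with $F_{-1}|X_\bullet|$ empty. A pair of spaces $(X,A)$ is an NDR pair if there are a map $u:X\to[0,1]$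 and a homotopy $h:X\times[0,1]\to X$ such that $A=u^{-1}(0)$; $h(x,0)=x$ for all $x\in X$; $h(a,t)\in A$ for all $(a,t)\in A\times[0,1]$; and if $u(x)<1$ then $h(x,1)\in A$. It is a strong NDR pair if in addition $u(x)<1$ implies $u(h(x,t))<1$. $X_\bullet$ is proper if each pair $(X_n,S(X_n))$ is a strong NDR pair for all $n$; it is simplicially NDR if each $(S^{t-1}(X_n),S^t(X_n))$ is an NDR pair for all $t-1\ge0$ and all $n$. For a sequence $I=(i_r,i_{r-1},\dots,i_1)$ write $|I|=r$; such sequences index the subspaces $s_I(X_{n-r})=s_{i_r}s_{i_{r-1}}\cdots s_{i_1}(X_{n-r})$ of $X_n$. The sequence $I$ is admissible if $i_r>i_{r-1}>\cdots>i_1$.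
   Formalization: Each X_n is assumed compactly generated weak Hausdorff; for arbitrary spaces the claim fails at n=t=0, e.g. for the constant simplicial space on the four-point model of the circle, whose realization in the compactly generated weak Hausdorff topology is a point. *)

theory Defs
  imports "HOL-Homology.Simplices"
begin

text \<open>
  Spaces are topologies in the sense of \<^theory>\<open>HOL-Analysis.Abstract_Topology\<close>, with an explicit
  carrier. No space is assumed to have a base point.
\<close>

section \<open>Compactly generated weak Hausdorff spaces\<close>

text \<open>
  Both notions test a space against continuous maps from compact Hausdorff spaces. It suffices to
  let the test spaces range over one large enough type. Given a test map \<open>f\<close> from \<open>K\<close> to \<open>X\<close>, choose
  one point in each fibre: the closure of these points in \<open>K\<close> has the same image as \<open>K\<close> and has at
  most as many elements as the double power set of the image, so it can be carried by
  \<^typ>\<open>'a set set\<close>. This settles the weak Hausdorff property; and if \<open>X\<close> is weak Hausdorff, then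
  images of test maps are compact Hausdorff subspaces of \<open>X\<close>, and these subspaces already detect the
  compactly generated topology. (The library's \<open>k_space\<close> is weaker: it tests against all compact
  subspaces, Hausdorff or not.)
\<close>

definition test_map :: "'k topology \<Rightarrow> 'a topology \<Rightarrow> ('k \<Rightarrow> 'a) \<Rightarrow> bool" where
  "test_map K X f \<longleftrightarrow> compact_space K \<and> Hausdorff_space K \<and> continuous_map K X f"

definition weak_Hausdorff_space :: "'a topology \<Rightarrow> bool" where
  "weak_Hausdorff_space X \<longleftrightarrow>
     (\<forall>(K :: 'a set set topology) f. test_map K X f \<longrightarrow> closedin X (f ` topspace K))"

definition compactly_generated_space :: "'a topology \<Rightarrow> bool" where
  "compactly_generated_space X \<longleftrightarrow>
     (\<forall>S \<subseteq> topspace X.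
        (\<forall>(K :: 'a set set topology) f. test_map K X f \<longrightarrow> closedin K {k \<in> topspace K. f k \<in> S})
        \<longrightarrow> closedin X S)"

definition cgwh_space :: "'a topology \<Rightarrow> bool" where
  "cgwh_space X \<longleftrightarrow> compactly_generated_space X \<and> weak_Hausdorff_space X"


section \<open>Quotients, wedges and suspensions\<close>

text \<open>
  The quotient topology on \<open>f ` topspace X\<close>. All identification spaces below have this form, \<open>f\<close>
  sending a point to a canonical name of its class.
\<close>

definition quotient_topology :: "'a topology \<Rightarrow> ('a \<Rightarrow> 'b) \<Rightarrow> 'b topology" where
  "quotient_topology X f =
     topology (\<lambda>U. U \<subseteq> f ` topspace X \<and> openin X {x \<in> topspace X. f x \<in> U})"

lemma istopology_quotient_topology:
  "istopology (\<lambda>U. U \<subseteq> f ` topspace X \<and> openin X {x \<in> topspace X. f x \<in> U})"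
proof -
  let ?pre = "\<lambda>U. {x \<in> topspace X. f x \<in> U}"
  have int: "?pre (S \<inter> T) = ?pre S \<inter> ?pre T" for S T
    by blast
  have un: "?pre (\<Union>\<K>) = \<Union> (?pre ` \<K>)" for \<K>
    by blast
  have "openin X (?pre (S \<inter> T))" if "openin X (?pre S)" "openin X (?pre T)" for S T
    unfolding int using that by (rule openin_Int)
  moreover have "openin X (?pre (\<Union>\<K>))" if "\<And>U. U \<in> \<K> \<Longrightarrow> openin X (?pre U)" for \<K>
    unfolding un using that by (intro openin_Union) blast
  ultimately show ?thesis
    unfolding istopology_def by (intro conjI allI impI) blast+
qed

lemma openin_quotient_topology:
  "openin (quotient_topology X f) U \<longleftrightarrow>
     U \<subseteq> f ` topspace X \<and> openin X {x \<in> topspace X. f x \<in> U}"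
  unfolding quotient_topology_def
  by (simp add: topology_inverse' [OF istopology_quotient_topology])

lemma topspace_quotient_topology: "topspace (quotient_topology X f) = f ` topspace X"
proof (rule antisym)
  show "topspace (quotient_topology X f) \<subseteq> f ` topspace X"
    using openin_topspace [of "quotient_topology X f"] unfolding openin_quotient_topology
    by (rule conjunct1)
  have "{x \<in> topspace X. f x \<in> f ` topspace X} = topspace X"
    by auto
  then have "openin (quotient_topology X f) (f ` topspace X)"
    by (simp add: openin_quotient_topology)
  then show "f ` topspace X \<subseteq> topspace (quotient_topology X f)"
    by (rule openin_subset)
qed

lemma quotient_map_quotient_topology: "quotient_map X (quotient_topology X f) f"
  unfolding quotient_map_def openin_quotient_topology topspace_quotient_topology by simp

text \<open>The space \<open>X / A\<close>, with \<^const>\<open>None\<close> as the class of \<open>A\<close>. In particular \<open>X / {}\<close> is \<open>X\<close>.\<close>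

definition collapse :: "'a set \<Rightarrow> 'a \<Rightarrow> 'a option" where
  "collapse A x = (if x \<in> A then None else Some x)"

definition quotient_space :: "'a topology \<Rightarrow> 'a set \<Rightarrow> 'a option topology" where
  "quotient_space X A = quotient_topology X (collapse A)"

text \<open>The map from \<open>X / A\<close> to \<open>Y / B\<close> induced by a map \<open>f\<close> of pairs.\<close>

definition quotient_space_map :: "'b set \<Rightarrow> ('a \<Rightarrow> 'b) \<Rightarrow> 'a option \<Rightarrow> 'b option" where
  "quotient_space_map B f c = (case c of None \<Rightarrow> None | Some x \<Rightarrow> collapse B (f x))"

text \<open>
  The wedge of the spaces \<open>Z i\<close>, \<open>i \<in> I\<close>, all of which have \<open>b\<close> as base point; \<^const>\<open>None\<close> is the
  base point of the wedge.
\<close>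

definition wedge_incl :: "'b \<Rightarrow> 'i \<times> 'b \<Rightarrow> ('i \<times> 'b) option" where
  "wedge_incl b p = (if snd p = b then None else Some p)"

definition wedge :: "'b \<Rightarrow> 'i set \<Rightarrow> ('i \<Rightarrow> 'b topology) \<Rightarrow> ('i \<times> 'b) option topology" where
  "wedge b I Z = quotient_topology (sum_topology Z I) (wedge_incl b)"

definition wedge_map :: "'c \<Rightarrow> ('i \<Rightarrow> 'b \<Rightarrow> 'c) \<Rightarrow> ('i \<times> 'b) option \<Rightarrow> ('i \<times> 'c) option" where
  "wedge_map b' g w = (case w of None \<Rightarrow> None | Some (i, z) \<Rightarrow> wedge_incl b' (i, g i z))"

text \<open>
  Unreduced suspension: the quotient of \<open>X \<times> [0,1]\<close> by the relation that makes each of the two ends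
  one point, \<open>South\<close> or \<open>North\<close>. The spaces have no base points, so the reduced suspension is not
  available. A datatype closed under forming suspension points allows iteration; the constructor
  \<open>Pt\<close> embeds the unsuspended space. \<open>South\<close> serves as the base point of a suspension.

  The map of iterated suspensions induced by \<open>f\<close> is the map function of the datatype.
\<close>

datatype 'a susp = Pt 'a | South | North | Mid "'a susp" real

definition susp_point :: "'a susp \<times> real \<Rightarrow> 'a susp" where
  "susp_point p = (if snd p = 0 then South else if snd p = 1 then North else Mid (fst p) (snd p))"

definition suspension :: "'a susp topology \<Rightarrow> 'a susp topology" where
  "suspension X = quotient_topology (prod_topology X (top_of_set {0..1})) susp_point"

definition iterated_suspension :: "nat \<Rightarrow> 'a topology \<Rightarrow> 'a susp topology" where
  "iterated_suspension k X = (suspension ^^ k) (quotient_topology X Pt)"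


section \<open>NDR pairs\<close>

definition NDR_data ::
  "'a topology \<Rightarrow> 'a set \<Rightarrow> ('a \<Rightarrow> real) \<Rightarrow> ('a \<times> real \<Rightarrow> 'a) \<Rightarrow> bool" where
  "NDR_data X A u h \<longleftrightarrow>
     continuous_map X (top_of_set {0..1}) u \<and>
     continuous_map (prod_topology X (top_of_set {0..1})) X h \<and>
     A = {x \<in> topspace X. u x = 0} \<and>
     (\<forall>x \<in> topspace X. h (x, 0) = x) \<and>
     (\<forall>a \<in> A. \<forall>t \<in> {0..1}. h (a, t) \<in> A) \<and>
     (\<forall>x \<in> topspace X. u x < 1 \<longrightarrow> h (x, 1) \<in> A)"

definition NDR_pair :: "'a topology \<Rightarrow> 'a set \<Rightarrow> bool" where
  "NDR_pair X A \<longleftrightarrow> (\<exists>u h. NDR_data X A u h)"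

definition strong_NDR_pair :: "'a topology \<Rightarrow> 'a set \<Rightarrow> bool" where
  "strong_NDR_pair X A \<longleftrightarrow>
     (\<exists>u h. NDR_data X A u h \<and>
        (\<forall>x \<in> topspace X. \<forall>t \<in> {0..1}. u x < 1 \<longrightarrow> u (h (x, t)) < 1))"


section \<open>Simplicial spaces\<close>

text \<open>
  \<open>level X n\<close> is the space $X_n$, \<open>face X n i\<close> is $d_i : X_n \to X_{n-1}$ (for \<open>n \<ge> 1\<close>, \<open>i \<le> n\<close>)
  and \<open>degen X n j\<close> is $s_j : X_n \to X_{n+1}$ (for \<open>j \<le> n\<close>); other values are irrelevant.
\<close>

record 'a simpl_space =
  level :: "nat \<Rightarrow> 'a topology"
  face :: "nat \<Rightarrow> nat \<Rightarrow> 'a \<Rightarrow> 'a"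
  degen :: "nat \<Rightarrow> nat \<Rightarrow> 'a \<Rightarrow> 'a"

definition simplicial_space :: "'a simpl_space \<Rightarrow> bool" where
  "simplicial_space X \<longleftrightarrow>
     (\<forall>n. \<forall>i \<le> Suc n. continuous_map (level X (Suc n)) (level X n) (face X (Suc n) i)) \<and>
     (\<forall>n. \<forall>j \<le> n. continuous_map (level X n) (level X (Suc n)) (degen X n j)) \<and>
     (\<forall>n i j. \<forall>x \<in> topspace (level X (n + 2)). i < j \<and> j \<le> n + 2 \<longrightarrow>
        face X (n + 1) i (face X (n + 2) j x) = face X (n + 1) (j - 1) (face X (n + 2) i x)) \<and>
     (\<forall>n i j. \<forall>x \<in> topspace (level X n). i \<le> j \<and> j \<le> n \<longrightarrow>
        degen X (n + 1) i (degen X n j x) = degen X (n + 1) (j + 1) (degen X n i x)) \<and>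
     (\<forall>n i j. \<forall>x \<in> topspace (level X n). i < j \<and> j \<le> n \<longrightarrow>
        face X (n + 1) i (degen X n j x) = degen X (n - 1) (j - 1) (face X n i x)) \<and>
     (\<forall>n j. \<forall>x \<in> topspace (level X n). j \<le> n \<longrightarrow>
        face X (n + 1) j (degen X n j x) = x \<and> face X (n + 1) (j + 1) (degen X n j x) = x) \<and>
     (\<forall>n i j. \<forall>x \<in> topspace (level X n). j + 1 < i \<and> i \<le> n + 1 \<longrightarrow>
        face X (n + 1) i (degen X n j x) = degen X (n - 1) j (face X n (i - 1) x))"

definition simplicial_map ::
  "'a simpl_space \<Rightarrow> 'b simpl_space \<Rightarrow> (nat \<Rightarrow> 'a \<Rightarrow> 'b) \<Rightarrow> bool" where
  "simplicial_map X Y f \<longleftrightarrow>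
     (\<forall>n. continuous_map (level X n) (level Y n) (f n)) \<and>
     (\<forall>n. \<forall>x \<in> topspace (level X (Suc n)). \<forall>i \<le> Suc n.
        f n (face X (Suc n) i x) = face Y (Suc n) i (f (Suc n) x)) \<and>
     (\<forall>n. \<forall>x \<in> topspace (level X n). \<forall>j \<le> n.
        f (Suc n) (degen X n j x) = degen Y n j (f n x))"

text \<open>
  \<open>degen_filtration X t n\<close> is $S^t(X_n)$, the union of the sets
  $s_{i_1} s_{i_2} \cdots s_{i_t}(X_{n-t})$; it is empty for \<open>t > n\<close>.
\<close>

fun degen_filtration :: "'a simpl_space \<Rightarrow> nat \<Rightarrow> nat \<Rightarrow> 'a set" where
  "degen_filtration X 0 n = topspace (level X n)"
| "degen_filtration X (Suc t) 0 = {}"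
| "degen_filtration X (Suc t) (Suc n) = (\<Union>i\<le>n. degen X n i ` degen_filtration X t n)"

definition proper :: "'a simpl_space \<Rightarrow> bool" where
  "proper X \<longleftrightarrow> (\<forall>n. strong_NDR_pair (level X n) (degen_filtration X 1 n))"

definition simplicially_NDR :: "'a simpl_space \<Rightarrow> bool" where
  "simplicially_NDR X \<longleftrightarrow>
     (\<forall>n t. t \<ge> 1 \<longrightarrow>
        NDR_pair (subtopology (level X n) (degen_filtration X (t - 1) n)) (degen_filtration X t n))"

text \<open>
  The admissible sequences $(i_t, \dots, i_1)$ for which $s_{i_t} \cdots s_{i_1}$ is defined as a map
  from $X_{n-t}$ to $X_n$: this means $i_k \le n - t + k - 1$ for all \<open>k\<close>, which for a
  strictly decreasing sequence amounts to $i_t < n$.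
\<close>

definition admissible :: "nat \<Rightarrow> nat \<Rightarrow> nat list set" where
  "admissible n t = {J. length J = t \<and> sorted_wrt (>) J \<and> (\<forall>i \<in> set J. i < n)}"


section \<open>Geometric realization\<close>

definition simplex_space :: "nat \<Rightarrow> (nat \<Rightarrow> real) topology" where
  "simplex_space n = subtopology (powertop_real UNIV) (standard_simplex n)"

text \<open>
  The map \<open>simplical_face i\<close> of the library is the coface map, inserting a zero at position \<open>i\<close>; the
  codegeneracy adds the coordinates \<open>j\<close> and \<open>j + 1\<close>.
\<close>

definition codegeneracy :: "nat \<Rightarrow> (nat \<Rightarrow> real) \<Rightarrow> nat \<Rightarrow> real" where
  "codegeneracy j p = (\<lambda>i. if i < j then p i else if i = j then p j + p (Suc j) else p (Suc i))"

type_synonym 'a rpoint = "nat \<times> 'a \<times> (nat \<Rightarrow> real)"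

inductive realization_step :: "'a simpl_space \<Rightarrow> 'a rpoint \<Rightarrow> 'a rpoint \<Rightarrow> bool"
  for X :: "'a simpl_space" where
  face: "\<lbrakk>x \<in> topspace (level X (Suc n)); p \<in> standard_simplex n; i \<le> Suc n\<rbrakk> \<Longrightarrow>
    realization_step X (n, face X (Suc n) i x, p) (Suc n, x, simplical_face i p)"
| degen: "\<lbrakk>x \<in> topspace (level X n); p \<in> standard_simplex (Suc n); j \<le> n\<rbrakk> \<Longrightarrow>
    realization_step X (Suc n, degen X n j x, p) (n, x, codegeneracy j p)"

definition realization_class :: "'a simpl_space \<Rightarrow> 'a rpoint \<Rightarrow> 'a rpoint set" where
  "realization_class X a = {b. equivclp (realization_step X) a b}"

text \<open>
  The realization has the quotient topology. It is only used for levelwise compactly generated weak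
  Hausdorff \<open>X\<close>, and there this is the realization formed in compactly generated weak Hausdorff
  spaces: products with the compact Hausdorff simplices need no retopologization, and the quotient
  is already weak Hausdorff, since the degeneracies are split and hence closed inclusions, so that
  each filtration stage is a pushout of its predecessor along a closed inclusion.
\<close>

definition realization :: "'a simpl_space \<Rightarrow> 'a rpoint set topology" where
  "realization X =
     quotient_topology
       (sum_topology (\<lambda>n. prod_topology (level X n) (simplex_space n)) UNIV)
       (realization_class X)"

text \<open>The index is an integer because $F_{-1}|X_\bullet|$, the empty set, is needed.\<close>

definition realization_filtration :: "'a simpl_space \<Rightarrow> int \<Rightarrow> 'a rpoint set set" where
  "realization_filtration X j =
     realization_class X `
       {(i, x, p). int i \<le> j \<and> x \<in> topspace (level X i) \<and> p \<in> standard_simplex i}"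

text \<open>
  The map \<open>|f| : |X| \<rightarrow> |Y|\<close>. The members of a class have images in one and the same class, which is
  therefore the union below.
\<close>

definition realization_map ::
  "'b simpl_space \<Rightarrow> (nat \<Rightarrow> 'a \<Rightarrow> 'b) \<Rightarrow> 'a rpoint set \<Rightarrow> 'b rpoint set" where
  "realization_map Y f c = (\<Union>(n, x, p) \<in> c. realization_class Y (n, f n x, p))"


section \<open>The spaces and maps to be compared\<close>

text \<open>$S^t(X_n)/S^{t+1}(X_n)$ and its functoriality in \<open>X\<close>\<close>

definition degen_quotient :: "nat \<Rightarrow> nat \<Rightarrow> 'a simpl_space \<Rightarrow> 'a option topology" where
  "degen_quotient n t X =
     quotient_space (subtopology (level X n) (degen_filtration X t n)) (degen_filtration X (t + 1) n)"

definition degen_quotient_map ::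
  "nat \<Rightarrow> nat \<Rightarrow> 'b simpl_space \<Rightarrow> (nat \<Rightarrow> 'a \<Rightarrow> 'b) \<Rightarrow> 'a option \<Rightarrow> 'b option" where
  "degen_quotient_map n t Y f = quotient_space_map (degen_filtration Y (t + 1) n) (f n)"

text \<open>$F_j|X_\bullet|/F_{j-1}|X_\bullet|$ and its functoriality in \<open>X\<close>\<close>

definition realization_quotient :: "int \<Rightarrow> 'a simpl_space \<Rightarrow> 'a rpoint set option topology" where
  "realization_quotient j X =
     quotient_space (subtopology (realization X) (realization_filtration X j))
       (realization_filtration X (j - 1))"

definition realization_quotient_map ::
  "int \<Rightarrow> 'b simpl_space \<Rightarrow> (nat \<Rightarrow> 'a \<Rightarrow> 'b) \<Rightarrow> 'a rpoint set option \<Rightarrow> 'b rpoint set option" where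
  "realization_quotient_map j Y f =
     quotient_space_map (realization_filtration Y (j - 1)) (realization_map Y f)"

text \<open>$\bigvee_{J_t} \Sigma^{t+1}(F_{n-t}|X_\bullet|/F_{n-t-1}|X_\bullet|)$ and its functoriality in \<open>X\<close>\<close>

definition realization_wedge ::
  "nat \<Rightarrow> nat \<Rightarrow> 'a simpl_space \<Rightarrow> (nat list \<times> 'a rpoint set option susp) option topology" where
  "realization_wedge n t X =
     wedge South (admissible n t)
       (\<lambda>J. iterated_suspension (t + 1) (realization_quotient (int n - int t) X))"

definition realization_wedge_map ::
  "nat \<Rightarrow> nat \<Rightarrow> 'b simpl_space \<Rightarrow> (nat \<Rightarrow> 'a \<Rightarrow> 'b) \<Rightarrow>
   (nat list \<times> 'a rpoint set option susp) option \<Rightarrow>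
   (nat list \<times> 'b rpoint set option susp) option" where
  "realization_wedge_map n t Y f =
     wedge_map South (\<lambda>J. map_susp (realization_quotient_map (int n - int t) Y f))"


section \<open>Natural homotopy equivalences\<close>

definition homotopy_equivalence_map :: "'a topology \<Rightarrow> 'b topology \<Rightarrow> ('a \<Rightarrow> 'b) \<Rightarrow> bool" where
  "homotopy_equivalence_map X Y f \<longleftrightarrow>
     continuous_map X Y f \<and>
     (\<exists>g. continuous_map Y X g \<and>
        homotopic_with (\<lambda>_. True) X X (g \<circ> f) id \<and>
        homotopic_with (\<lambda>_. True) Y Y (f \<circ> g) id)"

text \<open>
  \<open>A\<close> and \<open>B\<close> are functors on the simplicial spaces in the class \<open>\<C>\<close>; \<open>FA Y f\<close> and \<open>FB Y f\<close> are
  the maps induced by a simplicial map \<open>f\<close> into \<open>Y\<close>. The naturality squares commute up to homotopy.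
\<close>

definition natural_homotopy_equivalence ::
  "'a simpl_space set \<Rightarrow>
   ('a simpl_space \<Rightarrow> 'b topology) \<Rightarrow> ('a simpl_space \<Rightarrow> (nat \<Rightarrow> 'a \<Rightarrow> 'a) \<Rightarrow> 'b \<Rightarrow> 'b) \<Rightarrow>
   ('a simpl_space \<Rightarrow> 'c topology) \<Rightarrow> ('a simpl_space \<Rightarrow> (nat \<Rightarrow> 'a \<Rightarrow> 'a) \<Rightarrow> 'c \<Rightarrow> 'c) \<Rightarrow>
   ('a simpl_space \<Rightarrow> 'b \<Rightarrow> 'c) \<Rightarrow> bool" where
  "natural_homotopy_equivalence \<C> A FA B FB K \<longleftrightarrow>
     (\<forall>X \<in> \<C>. homotopy_equivalence_map (A X) (B X) (K X)) \<and>
     (\<forall>X \<in> \<C>. \<forall>Y \<in> \<C>. \<forall>f. simplicial_map X Y f \<longrightarrow>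
        homotopic_with (\<lambda>_. True) (A X) (B Y) (K Y \<circ> FA Y f) (FB Y f \<circ> K X))"

end

theory Submission
  imports Defs "HOL-Analysis.Abstract_Topological_Spaces" "HOL-Library.List_Lexorder" "HOL-Library.Confluence"
begin

text \<open>
  For an admissible word \<open>J\<close> of length \<open>t\<close>, the iterated face $d_J$ is left inverse to $s_J$, and
  $d_J s_K$ has degenerate values if \<open>J\<close> precedes \<open>K\<close> lexicographically. Put $Y_m = X_m/S(X_m)$. The
  space $S^t(X_n)/S^{t+1}(X_n)$ is the wedge of its subspaces $s_K Y_{n-t}$, on which the maps to
  $Y_{n-t}$ induced by the $d_J$ form a triangular matrix. After one suspension the product of the
  loop families given by the $d_J$ is therefore an equivalence to $\bigvee_J \Sigma Y_{n-t}$.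
  Since the $d_J$ are defined on all of $X_n$, multiplying the products for $t = n, \dots, 0$
  splits $\Sigma X_n$: on $S^t(X_n)$, the factors already found are a stable retraction onto
  $S^{t+1}(X_n)$.

  The quotient $F_j/F_{j-1}$ is $X_j \times \Delta^j$ with the degenerate and the boundary points
  collapsed. Viewing $\Delta^j$ as an iterated cone, one obtains a map
  $\Sigma^j Y_j \to F_j/F_{j-1}$, which collapses a contractible NDR subspace. All these maps are
  given by formulas in the faces, hence the naturality squares commute strictly.
\<close>

section \<open>Families of paths\<close>

text \<open>The spaces need not be CW complexes and have no base points, so homology and Whitehead's
  theorem do not apply and every homotopy inverse is written down. This is why an equivalence from
  \<open>\<Sigma>A\<close> to \<open>V\<close> is recorded as a family of paths in \<open>V\<close>
  indexed by \<open>A\<close>: such families can be multiplied, inverted, extended to a larger space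
  and descended to a quotient. The main obstacle is injectivity of the pull-back along X
  \<rightarrow> X/A: a loop family on X/A that dies on X need not die. The obstruction is a map out
  of the double suspension of A, and a stable retraction of X to A removes it.

  Unreduced suspension does not commute with wedges; moving n further suspensions into the wedge is
  again an instance of the triangular argument, with an identity matrix. With m = n - t the count is
  \<Sigma>^n \<Sigma> Y_m = \<Sigma>^{t+1} \<Sigma>^m Y_m. The description of F_j/F_{j-1} rests on
  confluence: each point of the realization has exactly one irreducible representative.\<close>

abbreviation I01 :: "real topology" where
  "I01 \<equiv> top_of_set {0..1}"

lemma continuous_map_comp:
  "continuous_map X Y f \<Longrightarrow> continuous_map Y Z g \<Longrightarrow> continuous_map X Z (\<lambda>x. g (f x))"
  using continuous_map_compose[of X Y f Z g] by (simp add: o_def)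

lemma continuous_map_app: "continuous_map X Y f \<Longrightarrow> x \<in> topspace X \<Longrightarrow> f x \<in> topspace Y"
  by (auto simp: continuous_map_def)

lemma continuous_map_I01I:
  assumes "continuous_map X euclideanreal f" "\<And>x. x \<in> topspace X \<Longrightarrow> 0 \<le> f x \<and> f x \<le> 1"
  shows "continuous_map X I01 f"
  using assms by (auto simp: continuous_map_in_subtopology)

lemma continuous_map_I01D: "continuous_map X I01 f \<Longrightarrow> continuous_map X euclideanreal f"
  by (simp add: continuous_map_in_subtopology)

lemma continuous_map_fst_comp:
  "continuous_map X (prod_topology Y Z) f \<Longrightarrow> continuous_map X Y (\<lambda>x. fst (f x))"
  by (rule continuous_map_comp[OF _ continuous_map_fst])

lemma continuous_map_snd_comp:
  "continuous_map X (prod_topology Y Z) f \<Longrightarrow> continuous_map X Z (\<lambda>x. snd (f x))"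
  by (rule continuous_map_comp[OF _ continuous_map_snd])

lemma continuous_map_paste_le:
  assumes r: "continuous_map X euclideanreal r"
    and "continuous_map X Y f" "continuous_map X Y g"
    and "\<And>x. x \<in> topspace X \<Longrightarrow> r x = c \<Longrightarrow> f x = g x"
  shows "continuous_map X Y (\<lambda>x. if r x \<le> c then f x else g x)"
  by (rule continuous_map_cases_le) (use assms in \<open>auto intro: continuous_map_from_subtopology\<close>)

lemma continuous_map_paste_closed:
  assumes "closedin X A" "closedin X B" "topspace X \<subseteq> A \<union> B"
    and "continuous_map (subtopology X A) Y f" "continuous_map (subtopology X B) Y g"
    and "\<And>x. x \<in> A \<Longrightarrow> k x = f x" "\<And>x. x \<in> B \<Longrightarrow> k x = g x"
  shows "continuous_map X Y k"
proof (rule pasting_lemma_closed[of "{True, False}" X "\<lambda>b. if b then A else B" Y "\<lambda>b. if b then f else g"])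
  show "\<exists>j. j \<in> {True, False} \<and> x \<in> (if j then A else B) \<and> k x = (if j then f else g) x"
    if "x \<in> topspace X" for x
    using that assms(3,6,7) by (cases "x \<in> A") auto
  show "(if i then f else g) x = (if j then f else g) x"
    if "x \<in> topspace X \<inter> (if i then A else B) \<inter> (if j then A else B)" for i j x
    using that assms(6)[of x] assms(7)[of x] by (auto split: if_splits)
qed (use assms in auto)

named_theorems cint
lemmas [cint] = continuous_map_pairedI continuous_map_I01I continuous_map_fst_comp
  continuous_map_snd_comp continuous_map_real_mult continuous_map_add continuous_map_diff
  continuous_map_real_max continuous_map_real_min continuous_map_canonical_const

text \<open>A family of paths from \<open>x\<close> to \<open>y\<close> indexed by \<open>A\<close>
  is a map out of the unreduced suspension of \<open>A\<close> that sends the poles to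
  \<open>x\<close> and \<open>y\<close>. Up to homotopy these families form a groupoid under
  concatenation, which replaces the group of loops where the two ends differ.\<close>

definition pathfam :: "'a topology \<Rightarrow> 'z topology \<Rightarrow> 'z \<Rightarrow> 'z \<Rightarrow> ('a \<times> real \<Rightarrow> 'z) \<Rightarrow> bool" where
  "pathfam A Z x y p \<longleftrightarrow> continuous_map (prod_topology A I01) Z p \<and>
     (\<forall>a \<in> topspace A. p (a, 0) = x \<and> p (a, 1) = y)"

definition pathfam_homotopic ::
  "'a topology \<Rightarrow> 'z topology \<Rightarrow> 'z \<Rightarrow> 'z \<Rightarrow> ('a \<times> real \<Rightarrow> 'z) \<Rightarrow> ('a \<times> real \<Rightarrow> 'z) \<Rightarrow> bool" where
  "pathfam_homotopic A Z x y p q \<longleftrightarrow>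
     homotopic_with (\<lambda>k. \<forall>a \<in> topspace A. k (a, 0) = x \<and> k (a, 1) = y) (prod_topology A I01) Z p q"

lemma pathfam_homotopic_alt:
  "pathfam_homotopic A Z x y p q \<longleftrightarrow>
     (\<exists>h. continuous_map (prod_topology I01 (prod_topology A I01)) Z h \<and>
       (\<forall>a \<in> topspace A. \<forall>s \<in> {0..1}. h (0, (a, s)) = p (a, s)) \<and>
       (\<forall>a \<in> topspace A. \<forall>s \<in> {0..1}. h (1, (a, s)) = q (a, s)) \<and>
       (\<forall>t \<in> {0..1}. \<forall>a \<in> topspace A. h (t, (a, 0)) = x \<and> h (t, (a, 1)) = y))"
  unfolding pathfam_homotopic_def
  by (subst homotopic_with) auto

lemma pathfam_homotopic_refl: "pathfam A Z x y p \<Longrightarrow> pathfam_homotopic A Z x y p p"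
  by (simp add: pathfam_homotopic_def pathfam_def)

lemma pathfam_homotopic_sym:
  "pathfam_homotopic A Z x y p q \<Longrightarrow> pathfam_homotopic A Z x y q p"
  unfolding pathfam_homotopic_def by (rule homotopic_with_symD)

lemma pathfam_homotopic_trans [trans]:
  "pathfam_homotopic A Z x y p q \<Longrightarrow> pathfam_homotopic A Z x y q r \<Longrightarrow> pathfam_homotopic A Z x y p r"
  unfolding pathfam_homotopic_def by (rule homotopic_with_trans)

lemma pathfam_homotopic_imp_pathfam:
  assumes "pathfam_homotopic A Z x y p q"
  shows "pathfam A Z x y p" "pathfam A Z x y q"
  using homotopic_with_imp_continuous_maps[OF assms[unfolded pathfam_homotopic_def]]
    homotopic_with_imp_property[OF assms[unfolded pathfam_homotopic_def]]
  by (auto simp: pathfam_def)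

lemma pathfam_cong:
  assumes "\<And>a s. a \<in> topspace A \<Longrightarrow> s \<in> {0..1} \<Longrightarrow> p (a, s) = q (a, s)" "pathfam A Z x y p"
  shows "pathfam A Z x y q"
  using assms unfolding pathfam_def by (auto elim!: continuous_map_eq)

lemma pathfam_homotopic_eq:
  assumes "pathfam A Z x y p" "\<And>a s. a \<in> topspace A \<Longrightarrow> s \<in> {0..1} \<Longrightarrow> p (a, s) = q (a, s)"
  shows "pathfam_homotopic A Z x y p q"
  unfolding pathfam_homotopic_def
  by (rule homotopic_with_equal) (use assms pathfam_cong[OF assms(2,1)] in \<open>auto simp: pathfam_def\<close>)

lemma pathfam_const: "z \<in> topspace Z \<Longrightarrow> pathfam A Z z z (\<lambda>_. z)"
  by (simp add: pathfam_def)

lemma pathfam_mono: "pathfam A (subtopology Z S) x y p \<Longrightarrow> pathfam A Z x y p"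
  unfolding pathfam_def using continuous_map_into_fulltopology by blast

lemma pathfam_compose_left:
  assumes "pathfam A Z x y p" "continuous_map Z Z' g"
  shows "pathfam A Z' (g x) (g y) (g \<circ> p)"
  using assms continuous_map_compose[of "prod_topology A I01" Z p Z' g] by (auto simp: pathfam_def)

lemma pathfam_compose_right:
  assumes "pathfam A Z x y p" "continuous_map A' A r"
  shows "pathfam A' Z x y (\<lambda>(a, s). p (r a, s))"
proof -
  have p: "continuous_map (prod_topology A I01) Z p" using assms by (simp add: pathfam_def)
  have "continuous_map (prod_topology A' I01) Z (\<lambda>w. p (r (fst w), snd w))"
    by (rule continuous_map_comp[OF _ p])
      (intro cint continuous_map_comp[OF continuous_map_fst assms(2)] continuous_map_snd)
  moreover have "r a \<in> topspace A" if "a \<in> topspace A'" for a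
    using continuous_map_image_subset_topspace[OF assms(2)] that by blast
  ultimately show ?thesis using assms(1) by (auto simp: pathfam_def case_prod_unfold)
qed

lemma pathfam_restrict:
  assumes "pathfam A Z x y p"
  shows "pathfam (subtopology A S) Z x y p"
  using pathfam_compose_right[OF assms continuous_map_id_subt] by simp

lemma pathfam_homotopic_compose_left:
  assumes "pathfam_homotopic A Z x y p q" "continuous_map Z Z' g"
  shows "pathfam_homotopic A Z' (g x) (g y) (g \<circ> p) (g \<circ> q)"
  using assms unfolding pathfam_homotopic_def
  by (rule homotopic_with_compose_continuous_map_left) auto

lemma pathfam_homotopic_map:
  assumes "homotopic_with (\<lambda>k. k x = x' \<and> k y = y') Z Z' g g'" "pathfam A Z x y p"
  shows "pathfam_homotopic A Z' x' y' (g \<circ> p) (g' \<circ> p)"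
  using assms unfolding pathfam_homotopic_def pathfam_def
  by (auto intro: homotopic_with_compose_continuous_map_right[OF assms(1)])

lemma pathfam_homotopic_compose_right:
  assumes "pathfam_homotopic A Z x y p q" "continuous_map A' A r"
  shows "pathfam_homotopic A' Z x y (\<lambda>(a, s). p (r a, s)) (\<lambda>(a, s). q (r a, s))"
proof -
  have c: "continuous_map (prod_topology A' I01) (prod_topology A I01) (\<lambda>(a, s). (r a, s))"
    unfolding case_prod_unfold
    by (intro cint continuous_map_comp[OF continuous_map_fst assms(2)] continuous_map_snd)
  have "r a \<in> topspace A" if "a \<in> topspace A'" for a
    using continuous_map_image_subset_topspace[OF assms(2)] that by blast
  with homotopic_with_compose_continuous_map_right[OF assms(1)[unfolded pathfam_homotopic_def] c,
      where q = "\<lambda>k. \<forall>a \<in> topspace A'. k (a, 0) = x \<and> k (a, 1) = y"]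
  show ?thesis unfolding pathfam_homotopic_def by (simp add: o_def case_prod_unfold)
qed

lemma pathfam_homotopic_mono:
  assumes "pathfam_homotopic A (subtopology Z S) x y p q"
  shows "pathfam_homotopic A Z x y p q"
  using pathfam_homotopic_compose_left[OF assms continuous_map_id_subt] by simp

text \<open>The interval is convex, so \<open>\<phi>\<close> and \<open>\<psi>\<close> are joined by
  the straight-line homotopy. The unit, inverse and associativity laws below are instances: one
  family traversed at different speeds.\<close>

lemma pathfam_homotopic_reparam:
  assumes p: "continuous_map (prod_topology A I01) Z p"
    and \<phi>: "continuous_map I01 I01 \<phi>" and \<psi>: "continuous_map I01 I01 \<psi>"
    and ends: "\<phi> 0 = \<psi> 0" "\<phi> 1 = \<psi> 1"
    and x: "\<And>a. a \<in> topspace A \<Longrightarrow> p (a, \<phi> 0) = x"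
    and y: "\<And>a. a \<in> topspace A \<Longrightarrow> p (a, \<phi> 1) = y"
  shows "pathfam_homotopic A Z x y (\<lambda>(a, s). p (a, \<phi> s)) (\<lambda>(a, s). p (a, \<psi> s))"
proof -
  let ?r = "\<lambda>w. (1 - fst w) * \<phi> (snd (snd w)) + fst w * \<psi> (snd (snd w))"
  let ?X = "prod_topology I01 (prod_topology A I01)"
  have s: "continuous_map ?X I01 (\<lambda>w. snd (snd w))"
    by (rule continuous_map_snd_comp[OF continuous_map_snd])
  have t: "continuous_map ?X euclideanreal (\<lambda>w. fst w)"
    by (rule continuous_map_I01D[OF continuous_map_fst])
  have a: "continuous_map ?X A (\<lambda>w. fst (snd w))"
    by (rule continuous_map_fst_comp[OF continuous_map_snd])
  have r: "continuous_map ?X I01 ?r"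
  proof (rule continuous_map_I01I)
    show "continuous_map ?X euclideanreal ?r"
      by (intro cint t continuous_map_I01D[OF continuous_map_comp[OF s \<phi>]]
          continuous_map_I01D[OF continuous_map_comp[OF s \<psi>]])
    fix w assume "w \<in> topspace ?X"
    then have w: "0 \<le> fst w" "fst w \<le> 1" "snd (snd w) \<in> {0..1}" by auto
    have "\<phi> (snd (snd w)) \<in> {0..1}" "\<psi> (snd (snd w)) \<in> {0..1}"
      using w(3) continuous_map_image_subset_topspace[OF \<phi>] continuous_map_image_subset_topspace[OF \<psi>]
      by (auto simp: image_subset_iff)
    then show "0 \<le> ?r w \<and> ?r w \<le> 1"
      using w(1,2) convex_bound_le[of "\<phi> (snd (snd w))" 1 "\<psi> (snd (snd w))" "1 - fst w" "fst w"]
      by auto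
  qed
  have "continuous_map ?X Z (\<lambda>w. p (fst (snd w), ?r w))"
    by (rule continuous_map_comp[OF _ p]) (intro continuous_map_pairedI a r)
  then show ?thesis unfolding pathfam_homotopic_alt
    using ends x y by (intro exI[of _ "\<lambda>w. p (fst (snd w), ?r w)"]) (auto simp flip: distrib_right simp: algebra_simps)
qed

section \<open>The groupoid of path families\<close>

definition join_fam :: "('a \<times> real \<Rightarrow> 'z) \<Rightarrow> ('a \<times> real \<Rightarrow> 'z) \<Rightarrow> 'a \<times> real \<Rightarrow> 'z" where
  "join_fam p q w = (if snd w \<le> 1/2 then p (fst w, 2 * snd w) else q (fst w, 2 * snd w - 1))"

definition rev_fam :: "('a \<times> real \<Rightarrow> 'z) \<Rightarrow> 'a \<times> real \<Rightarrow> 'z" where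
  "rev_fam p w = p (fst w, 1 - snd w)"

lemma continuous_map_join_fam:
  assumes p: "continuous_map (prod_topology A I01) Z p" and q: "continuous_map (prod_topology A I01) Z q"
    and pq: "\<And>a. a \<in> topspace A \<Longrightarrow> p (a, 1) = q (a, 0)"
  shows "continuous_map (prod_topology A I01) Z (join_fam p q)"
proof -
  let ?X = "prod_topology A I01"
  have s: "continuous_map ?X euclideanreal snd"
    by (rule continuous_map_I01D[OF continuous_map_snd])
  \<comment> \<open>Clamping with \<open>min\<close> and \<open>max\<close> makes both branches
    continuous on the whole product, so they can be pasted without passing to subspaces. On [0,1]
    the result agrees with \<open>join_fam\<close>.\<close>
  have "continuous_map ?X Z (\<lambda>w. if snd w \<le> 1/2 then p (fst w, min 1 (2 * snd w))
      else q (fst w, max 0 (2 * snd w - 1)))"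
  proof (rule continuous_map_paste_le[OF s])
    show "continuous_map ?X Z (\<lambda>w. p (fst w, min 1 (2 * snd w)))"
      by (rule continuous_map_comp[OF _ p]) (intro cint continuous_map_fst s, auto)
    show "continuous_map ?X Z (\<lambda>w. q (fst w, max 0 (2 * snd w - 1)))"
      by (rule continuous_map_comp[OF _ q]) (intro cint continuous_map_fst s, auto)
  qed (use pq in auto)
  then show ?thesis
    by (rule continuous_map_eq) (auto simp: join_fam_def)
qed

lemma pathfam_join:
  assumes "pathfam A Z x y p" "pathfam A Z y z q"
  shows "pathfam A Z x z (join_fam p q)"
  using assms continuous_map_join_fam[of A Z p q] by (auto simp: pathfam_def join_fam_def)

lemma pathfam_rev:
  assumes "pathfam A Z x y p"
  shows "pathfam A Z y x (rev_fam p)"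
proof -
  have s: "continuous_map (prod_topology A I01) euclideanreal snd"
    by (rule continuous_map_I01D[OF continuous_map_snd])
  have "continuous_map (prod_topology A I01) Z (\<lambda>w. p (fst w, 1 - snd w))"
    by (rule continuous_map_comp[of _ "prod_topology A I01"])
      (use assms in \<open>auto simp: pathfam_def intro!: cint continuous_map_fst s\<close>)
  then show ?thesis using assms by (auto simp: pathfam_def rev_fam_def[abs_def])
qed

lemma join_fam_comp: "g \<circ> join_fam p q = join_fam (g \<circ> p) (g \<circ> q)"
  by (auto simp: join_fam_def)

lemma rev_fam_comp: "g \<circ> rev_fam p = rev_fam (g \<circ> p)"
  by (auto simp: rev_fam_def)

lemma pathfam_homotopic_join:
  assumes "pathfam_homotopic A Z x y p p'" "pathfam_homotopic A Z y z q q'"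
  shows "pathfam_homotopic A Z x z (join_fam p q) (join_fam p' q')"
proof -
  let ?X = "prod_topology I01 (prod_topology A I01)"
  obtain h where h: "continuous_map ?X Z h"
    "\<And>a s. a \<in> topspace A \<Longrightarrow> s \<in> {0..1} \<Longrightarrow> h (0, (a, s)) = p (a, s) \<and> h (1, (a, s)) = p' (a, s)"
    "\<And>t a. t \<in> {0..1} \<Longrightarrow> a \<in> topspace A \<Longrightarrow> h (t, (a, 0)) = x \<and> h (t, (a, 1)) = y"
    using assms(1) unfolding pathfam_homotopic_alt by blast
  obtain k where k: "continuous_map ?X Z k"
    "\<And>a s. a \<in> topspace A \<Longrightarrow> s \<in> {0..1} \<Longrightarrow> k (0, (a, s)) = q (a, s) \<and> k (1, (a, s)) = q' (a, s)"
    "\<And>t a. t \<in> {0..1} \<Longrightarrow> a \<in> topspace A \<Longrightarrow> k (t, (a, 0)) = y \<and> k (t, (a, 1)) = z"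
    using assms(2) unfolding pathfam_homotopic_alt by blast
  \<comment> \<open>The two homotopies are read as path families indexed by
    \<open>I01 \<times> A\<close>, so that continuity of their concatenation is
    \<open>continuous_map_join_fam\<close> again.\<close>
  have re: "continuous_map (prod_topology (prod_topology I01 A) I01) ?X
      (\<lambda>w. (fst (fst w), (snd (fst w), snd w)))"
    by (intro continuous_map_pairedI continuous_map_fst_comp[OF continuous_map_fst]
        continuous_map_snd_comp[OF continuous_map_fst] continuous_map_snd)
  have re': "continuous_map ?X (prod_topology (prod_topology I01 A) I01)
      (\<lambda>w. ((fst w, fst (snd w)), snd (snd w)))"
    by (intro continuous_map_pairedI continuous_map_fst_comp[OF continuous_map_snd]
        continuous_map_snd_comp[OF continuous_map_snd] continuous_map_fst)
  let ?j = "join_fam (\<lambda>w. h (fst (fst w), (snd (fst w), snd w))) (\<lambda>w. k (fst (fst w), (snd (fst w), snd w)))"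
  have "continuous_map (prod_topology (prod_topology I01 A) I01) Z ?j"
    by (rule continuous_map_join_fam)
      (use continuous_map_comp[OF re h(1)] continuous_map_comp[OF re k(1)] h(3) k(3) in auto)
  from continuous_map_comp[OF re' this]
  show ?thesis unfolding pathfam_homotopic_alt
    by (intro exI[of _ "\<lambda>w. ?j ((fst w, fst (snd w)), snd (snd w))"])
      (use h k in \<open>auto simp: join_fam_def\<close>)
qed

lemma pathfam_homotopic_rev:
  assumes "pathfam_homotopic A Z x y p p'"
  shows "pathfam_homotopic A Z y x (rev_fam p) (rev_fam p')"
proof -
  have s: "continuous_map (prod_topology A I01) euclideanreal snd"
    by (rule continuous_map_I01D[OF continuous_map_snd])
  have "continuous_map (prod_topology A I01) (prod_topology A I01) (\<lambda>w. (fst w, 1 - snd w))"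
    by (intro cint continuous_map_fst s) auto
  from homotopic_with_compose_continuous_map_right[OF assms[unfolded pathfam_homotopic_def] this,
      where q = "\<lambda>k. \<forall>a \<in> topspace A. k (a, 0) = y \<and> k (a, 1) = x"]
  show ?thesis unfolding pathfam_homotopic_def rev_fam_def[abs_def] by (simp add: o_def)
qed

lemma pathfam_homotopic_reparam':
  assumes p: "pathfam A Z u v p" and \<phi>: "continuous_on {0..1} \<phi>"
    and \<psi>: "continuous_on {0..1} \<psi>"
    and "\<And>s. s \<in> {0..1} \<Longrightarrow> 0 \<le> \<phi> s \<and> \<phi> s \<le> 1" "\<And>s. s \<in> {0..1} \<Longrightarrow> 0 \<le> \<psi> s \<and> \<psi> s \<le> 1"
    and ends: "\<phi> 0 = \<psi> 0" "\<phi> 1 = \<psi> 1"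
    and x: "\<And>a. a \<in> topspace A \<Longrightarrow> p (a, \<phi> 0) = x"
    and y: "\<And>a. a \<in> topspace A \<Longrightarrow> p (a, \<phi> 1) = y"
    and f: "\<And>a s. a \<in> topspace A \<Longrightarrow> s \<in> {0..1} \<Longrightarrow> f (a, s) = p (a, \<phi> s)"
    and g: "\<And>a s. a \<in> topspace A \<Longrightarrow> s \<in> {0..1} \<Longrightarrow> g (a, s) = p (a, \<psi> s)"
  shows "pathfam_homotopic A Z x y f g"
proof -
  have "pathfam_homotopic A Z x y (\<lambda>(a, s). p (a, \<phi> s)) (\<lambda>(a, s). p (a, \<psi> s))"
    by (rule pathfam_homotopic_reparam) (use assms in \<open>auto intro!: continuous_map_I01I simp: pathfam_def\<close>)
  then show ?thesis unfolding pathfam_homotopic_alt using f g by auto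
qed

lemma pathfam_homotopic_join_const_right:
  assumes "pathfam A Z x y p"
  shows "pathfam_homotopic A Z x y (join_fam p (\<lambda>_. y)) p"
proof (rule pathfam_homotopic_reparam'[OF assms, of "\<lambda>s. min 1 (2 * s)" "\<lambda>s. s"])
  show "join_fam p (\<lambda>_. y) (a, s) = p (a, min 1 (2 * s))" if "a \<in> topspace A" "s \<in> {0..1}" for a s
    using assms that by (cases "s \<le> 1/2") (auto simp: join_fam_def pathfam_def)
qed (use assms in \<open>auto simp: pathfam_def intro!: continuous_intros\<close>)

lemma pathfam_homotopic_join_const_left:
  assumes "pathfam A Z x y p"
  shows "pathfam_homotopic A Z x y (join_fam (\<lambda>_. x) p) p"
proof (rule pathfam_homotopic_reparam'[OF assms, of "\<lambda>s. max 0 (2 * s - 1)" "\<lambda>s. s"])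
  show "join_fam (\<lambda>_. x) p (a, s) = p (a, max 0 (2 * s - 1))" if "a \<in> topspace A" "s \<in> {0..1}" for a s
    using assms that by (cases "s \<le> 1/2") (auto simp: join_fam_def pathfam_def)
qed (use assms in \<open>auto simp: pathfam_def intro!: continuous_intros\<close>)

lemma pathfam_homotopic_join_rev:
  assumes "pathfam A Z x y p"
  shows "pathfam_homotopic A Z x x (join_fam p (rev_fam p)) (\<lambda>_. x)"
proof (rule pathfam_homotopic_reparam'[OF assms, of "\<lambda>s. min (2 * s) (2 - 2 * s)" "\<lambda>s. 0"])
  show "join_fam p (rev_fam p) (a, s) = p (a, min (2 * s) (2 - 2 * s))" for a s
    by (auto simp: join_fam_def rev_fam_def min_def)
qed (use assms in \<open>auto simp: pathfam_def intro!: continuous_intros\<close>)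

lemma rev_rev_fam [simp]: "rev_fam (rev_fam p) = p"
  by (auto simp: rev_fam_def)

lemma pathfam_homotopic_join_assoc:
  assumes "pathfam A Z x y p" "pathfam A Z y z q" "pathfam A Z z w r"
  shows "pathfam_homotopic A Z x w (join_fam (join_fam p q) r) (join_fam p (join_fam q r))"
proof (rule pathfam_homotopic_reparam'[OF pathfam_join[OF pathfam_join[OF assms(1,2)] assms(3)],
      of "\<lambda>s. s" "\<lambda>s. max (min (s / 2) (1/4)) (max (min (s - 1/4) (1/2)) (min 1 (2 * s - 1)))"])
  fix a and s :: real assume a: "a \<in> topspace A" and s: "s \<in> {0..1}"
  \<comment> \<open>The left bracketing changes paths at 1/4 and 1/2, the right one at 1/2 and 3/4.
    The piecewise linear map carrying the second subdivision to the first has slopes 1/2, 1 and 2;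
    written as a maximum of clamped linear pieces it is visibly continuous.\<close>
  consider "s \<le> 1/2" | "1/2 < s" "s \<le> 3/4" | "3/4 < s" by linarith
  then show "join_fam p (join_fam q r) (a, s) = join_fam (join_fam p q) r (a,
    max (min (s / 2) (1/4)) (max (min (s - 1/4) (1/2)) (min 1 (2 * s - 1))))"
  proof cases
    case 1
    then have "max (min (s / 2) (1/4)) (max (min (s - 1/4) (1/2)) (min 1 (2 * s - 1))) = s / 2"
      using s by (auto simp: max_def min_def)
    then show ?thesis using 1 s by (simp add: join_fam_def)
  next
    case 2
    then have "max (min (s / 2) (1/4)) (max (min (s - 1/4) (1/2)) (min 1 (2 * s - 1))) = s - 1/4"
      using s by (auto simp: max_def min_def)
    then show ?thesis using 2 s by (simp add: join_fam_def algebra_simps)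
  next
    case 3
    then have "max (min (s / 2) (1/4)) (max (min (s - 1/4) (1/2)) (min 1 (2 * s - 1))) = 2 * s - 1"
      using s by (auto simp: max_def min_def)
    then show ?thesis using 3 s by (simp add: join_fam_def algebra_simps)
  qed
qed (use assms in \<open>auto simp: join_fam_def pathfam_def le_max_iff_disj
       intro!: continuous_intros\<close>)

lemma pathfam_homotopic_cancel_right:
  assumes "pathfam A Z x y p" "pathfam A Z y z q"
  shows "pathfam_homotopic A Z x y (join_fam (join_fam p q) (rev_fam q)) p"
proof -
  have "pathfam_homotopic A Z x y (join_fam (join_fam p q) (rev_fam q)) (join_fam p (join_fam q (rev_fam q)))"
    by (rule pathfam_homotopic_join_assoc[OF assms pathfam_rev[OF assms(2)]])
  also have "pathfam_homotopic A Z x y \<dots> (join_fam p (\<lambda>_. y))"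
    by (rule pathfam_homotopic_join[OF pathfam_homotopic_refl[OF assms(1)] pathfam_homotopic_join_rev[OF assms(2)]])
  also have "pathfam_homotopic A Z x y \<dots> p"
    by (intro pathfam_homotopic_join_const_right assms)
  finally show ?thesis .
qed

lemma pathfam_homotopic_cancel_right':
  assumes "pathfam A Z x y p" "pathfam A Z z y q"
  shows "pathfam_homotopic A Z x y (join_fam (join_fam p (rev_fam q)) q) p"
  using pathfam_homotopic_cancel_right[OF assms(1) pathfam_rev[OF assms(2)]] by simp

section \<open>Suspensions and quotients by NDR subspaces\<close>

lemma locally_compact_I01: "locally_compact_space I01"
  by (simp add: compact_imp_locally_compact_space compact_space_subtopology)

lemma Hausdorff_I01: "Hausdorff_space I01"
  by (simp add: Hausdorff_space_subtopology)

section \<open>The unreduced suspension and maps out of it\<close>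

lemma quotient_map_susp_point:
  "quotient_map (prod_topology A I01) (suspension A) susp_point"
  unfolding suspension_def by (rule quotient_map_quotient_topology)

lemma topspace_suspension:
  "topspace (suspension A) = susp_point ` (topspace A \<times> {0..1})"
  using quotient_imp_surjective_map[OF quotient_map_susp_point, of A] by simp

lemma suspensionE:
  assumes "z \<in> topspace (suspension A)"
  obtains a s where "a \<in> topspace A" "s \<in> {0..1}" "z = susp_point (a, s)"
  using assms unfolding topspace_suspension by auto

lemma susp_point_simps [simp]:
  "susp_point (a, 0) = South" "susp_point (a, 1) = North"
  by (auto simp: susp_point_def)

lemma susp_point_in: "a \<in> topspace A \<Longrightarrow> s \<in> {0..1} \<Longrightarrow> susp_point (a, s) \<in> topspace (suspension A)"
  unfolding topspace_suspension by blast

lemma South_in_suspension: "South \<in> topspace (suspension A) \<longleftrightarrow> topspace A \<noteq> {}"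
proof
  assume "topspace A \<noteq> {}"
  then obtain a where "a \<in> topspace A" by blast
  then show "South \<in> topspace (suspension A)" using susp_point_in[of a A 0] by auto
qed (auto elim!: suspensionE)

lemma North_in_suspension: "North \<in> topspace (suspension A) \<longleftrightarrow> topspace A \<noteq> {}"
proof
  assume "topspace A \<noteq> {}"
  then obtain a where "a \<in> topspace A" by blast
  then show "North \<in> topspace (suspension A)" using susp_point_in[of a A 1] by auto
qed (auto elim!: suspensionE)

lemma pathfam_susp_point: "pathfam A (suspension A) South North susp_point"
  unfolding pathfam_def using quotient_imp_continuous_map[OF quotient_map_susp_point] by auto

lemma susp_point_eqD:
  assumes "susp_point (a, s) = susp_point (a', s')"
  shows "s = s' \<and> (s = 0 \<or> s = 1 \<or> a = a')"
  using assms by (auto simp: susp_point_def split: if_splits)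

text \<open>Products with the locally compact Hausdorff interval preserve quotient maps. Hence a
  homotopy on a suspension can be defined before the ends are identified.\<close>

lemma quotient_map_homotopy_susp_point:
  "quotient_map (prod_topology I01 (prod_topology A I01)) (prod_topology I01 (suspension A))
     (\<lambda>(t, w). (t, susp_point w))"
  by (intro quotient_map_prod_right locally_compact_I01 quotient_map_susp_point disjI1 Hausdorff_I01)

text \<open>Points of a suspension are poles or of the form \<open>Mid\<close>, so the value at
  \<open>Pt\<close> is never reached. The values at the poles are separate arguments, since reading
  them off \<open>p\<close> would require a point of the index space.\<close>

definition susp_lift :: "'z \<Rightarrow> 'z \<Rightarrow> ('a susp \<times> real \<Rightarrow> 'z) \<Rightarrow> 'a susp \<Rightarrow> 'z" where
  "susp_lift x y p z = (case z of South \<Rightarrow> x | North \<Rightarrow> y | Mid a s \<Rightarrow> p (a, s) | Pt _ \<Rightarrow> undefined)"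

lemma susp_lift_simps [simp]:
  "susp_lift x y p South = x" "susp_lift x y p North = y" "susp_lift x y p (Mid a s) = p (a, s)"
  by (simp_all add: susp_lift_def)

lemma susp_lift_point:
  assumes "pathfam A Z x y p" "a \<in> topspace A"
  shows "susp_lift x y p (susp_point (a, s)) = p (a, s)"
  using assms by (auto simp: susp_point_def pathfam_def)

lemma continuous_map_susp_lift:
  assumes "pathfam A Z x y p"
  shows "continuous_map (suspension A) Z (susp_lift x y p)"
proof (rule continuous_compose_quotient_map[OF quotient_map_susp_point])
  have "continuous_map (prod_topology A I01) Z p" using assms by (simp add: pathfam_def)
  then show "continuous_map (prod_topology A I01) Z (susp_lift x y p \<circ> susp_point)"
    by (rule continuous_map_eq) (auto simp: susp_lift_point[OF assms])
qed

lemma susp_lift_homotopic: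
  assumes "pathfam_homotopic A Z x y p q"
  shows "homotopic_with (\<lambda>k. k South = x \<and> k North = y) (suspension A) Z (susp_lift x y p) (susp_lift x y q)"
proof (cases "topspace A = {}")
  case True
  then have e: "topspace (suspension A) = {}" by (simp add: topspace_suspension)
  show ?thesis by (rule homotopic_with_equal) (auto simp: e continuous_map_def)
next
  case False
  let ?X = "prod_topology I01 (prod_topology A I01)"
  obtain h where h: "continuous_map ?X Z h"
    "\<And>a s. a \<in> topspace A \<Longrightarrow> s \<in> {0..1} \<Longrightarrow> h (0, (a, s)) = p (a, s) \<and> h (1, (a, s)) = q (a, s)"
    "\<And>t a. t \<in> {0..1} \<Longrightarrow> a \<in> topspace A \<Longrightarrow> h (t, (a, 0)) = x \<and> h (t, (a, 1)) = y"
    using assms unfolding pathfam_homotopic_alt by blast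
  let ?h = "\<lambda>(t, z). susp_lift x y (\<lambda>w. h (t, w)) z"
  have c: "continuous_map (prod_topology I01 (suspension A)) Z ?h"
  proof (rule continuous_compose_quotient_map[OF quotient_map_homotopy_susp_point])
    show "continuous_map ?X Z (?h \<circ> (\<lambda>(t, w). (t, susp_point w)))"
      by (rule continuous_map_eq[OF h(1)]) (auto simp: susp_point_def h(3))
  qed
  note pq = pathfam_homotopic_imp_pathfam[OF assms]
  have "continuous_map (prod_topology I01 (suspension A)) Z ?h \<and>
    (\<forall>z \<in> topspace (suspension A). ?h (0, z) = susp_lift x y p z) \<and>
    (\<forall>z \<in> topspace (suspension A). ?h (1, z) = susp_lift x y q z) \<and>
    (\<forall>t \<in> {0..1}. ?h (t, South) = x \<and> ?h (t, North) = y)"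
    using c h(2) by (auto elim!: suspensionE simp: susp_point_def)
  then show ?thesis
    using False by (subst homotopic_with) (auto simp: South_in_suspension North_in_suspension intro!: exI[of _ ?h])
qed

lemma continuous_map_suspension_subtopology:
  "continuous_map (suspension (subtopology X A)) (suspension X) id"
proof (rule continuous_compose_quotient_map[OF quotient_map_susp_point])
  show "continuous_map (prod_topology (subtopology X A) I01) (suspension X) (id \<circ> susp_point)"
    using pathfam_restrict[OF pathfam_susp_point[of X], of A] by (simp add: pathfam_def)
qed

text \<open>The projection from \<open>X\<close> to \<open>X/A\<close> up to homeomorphism: it will
  occur as \<open>collapse\<close>, as a retraction \<open>\<pi> i\<close> and as
  \<open>susp_to_filtration\<close>. For empty \<open>A\<close> the point \<open>y0\<close> is
  unconstrained.\<close>

definition collapses :: "'a topology \<Rightarrow> 'a set \<Rightarrow> 'b topology \<Rightarrow> ('a \<Rightarrow> 'b) \<Rightarrow> 'b \<Rightarrow> bool" where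
  "collapses X A Y q y0 \<longleftrightarrow> quotient_map X Y q \<and> (\<forall>x \<in> A. q x = y0) \<and>
     (\<forall>x \<in> topspace X. \<forall>x' \<in> topspace X. q x = q x' \<longrightarrow> x = x' \<or> x \<in> A \<and> x' \<in> A)"

text \<open>The product with a locally compact Hausdorff space is again a quotient map.
  \<open>T\<close> will be the interval for loop families and the square for their
  homotopies.\<close>

lemma collapses_lift:
  assumes "collapses X A Y q y0" "locally_compact_space T" "Hausdorff_space T"
    and "continuous_map (prod_topology X T) Z f"
    and "\<And>a b t. a \<in> A \<Longrightarrow> b \<in> A \<Longrightarrow> a \<in> topspace X \<Longrightarrow> b \<in> topspace X \<Longrightarrow> t \<in> topspace T \<Longrightarrow> f (a, t) = f (b, t)"
  obtains g where "continuous_map (prod_topology Y T) Z g"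
    "\<And>x t. x \<in> topspace X \<Longrightarrow> t \<in> topspace T \<Longrightarrow> g (q x, t) = f (x, t)"
proof -
  have q: "quotient_map (prod_topology X T) (prod_topology Y T) (\<lambda>(x, t). (q x, t))"
    using assms(1-3) by (intro quotient_map_prod_left) (auto simp: collapses_def)
  obtain g where g: "continuous_map (prod_topology Y T) Z g"
    "\<And>w. w \<in> topspace (prod_topology X T) \<Longrightarrow> g ((\<lambda>(x, t). (q x, t)) w) = f w"
  proof (rule quotient_map_lift_exists[OF q assms(4)])
    fix v w assume "v \<in> topspace (prod_topology X T)" "w \<in> topspace (prod_topology X T)"
      "(\<lambda>(x, t). (q x, t)) v = (\<lambda>(x, t). (q x, t)) w"
    moreover obtain x t x' t' where "v = (x, t)" "w = (x', t')" by (metis surj_pair)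
    ultimately have xt: "v = (x, t)" "w = (x', t)" "x \<in> topspace X" "x' \<in> topspace X" "t \<in> topspace T" "q x = q x'"
      by auto
    then have "x = x' \<or> x \<in> A \<and> x' \<in> A" using assms(1) unfolding collapses_def by blast
    then show "f v = f w" using xt assms(5) by auto
  qed blast
  show ?thesis
    by (rule that[OF g(1)]) (use g(2) in force)
qed

lemma collapses_image: "collapses X A Y q y0 \<Longrightarrow> topspace Y = q ` topspace X"
  unfolding collapses_def using quotient_imp_surjective_map by metis

lemma collapses_continuous: "collapses X A Y q y0 \<Longrightarrow> continuous_map X Y q"
  unfolding collapses_def using quotient_imp_continuous_map by metis

section \<open>Loop families on the quotient of an NDR pair\<close>

lemma NDR_data_closed: "NDR_data X A u h \<Longrightarrow> closedin X A"
proof -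
  assume a: "NDR_data X A u h"
  then have "continuous_map X (top_of_set {0..1}) u" "A = {x \<in> topspace X. u x \<in> {0}}"
    by (auto simp: NDR_data_def)
  moreover have "closedin (top_of_set {0..1::real}) {0}"
    by (simp add: closed_subset)
  ultimately show ?thesis
    by (simp only: closedin_continuous_map_preimage)
qed

lemma NDR_dataD:
  assumes "NDR_data X A u h"
  shows "continuous_map X I01 u" "continuous_map (prod_topology X I01) X h"
    "\<And>x. x \<in> topspace X \<Longrightarrow> h (x, 0) = x" "\<And>x. x \<in> A \<Longrightarrow> u x = 0" "A \<subseteq> topspace X"
    "\<And>a t. a \<in> A \<Longrightarrow> t \<in> {0..1} \<Longrightarrow> h (a, t) \<in> A"
    "\<And>x. x \<in> topspace X \<Longrightarrow> u x < 1 \<Longrightarrow> h (x, 1) \<in> A"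
    "\<And>x. x \<in> topspace X \<Longrightarrow> 0 \<le> u x \<and> u x \<le> 1"
    "\<And>x t. x \<in> topspace X \<Longrightarrow> t \<in> {0..1} \<Longrightarrow> h (x, t) \<in> topspace X"
    "\<And>x. x \<in> topspace X \<Longrightarrow> u x = 0 \<Longrightarrow> x \<in> A"
proof -
  show "continuous_map X I01 u" "continuous_map (prod_topology X I01) X h"
    "\<And>x. x \<in> topspace X \<Longrightarrow> h (x, 0) = x" "\<And>x. x \<in> A \<Longrightarrow> u x = 0" "A \<subseteq> topspace X"
    "\<And>a t. a \<in> A \<Longrightarrow> t \<in> {0..1} \<Longrightarrow> h (a, t) \<in> A"
    "\<And>x. x \<in> topspace X \<Longrightarrow> u x < 1 \<Longrightarrow> h (x, 1) \<in> A"
    "\<And>x. x \<in> topspace X \<Longrightarrow> u x = 0 \<Longrightarrow> x \<in> A"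
    using assms by (auto simp: NDR_data_def)
  show "0 \<le> u x \<and> u x \<le> 1" if "x \<in> topspace X" for x
    using continuous_map_app[OF \<open>continuous_map X I01 u\<close> that] by simp
  show "h (x, t) \<in> topspace X" if "x \<in> topspace X" "t \<in> {0..1}" for x t
    using continuous_map_app[OF \<open>continuous_map (prod_topology X I01) X h\<close>, of "(x, t)"] that by simp
qed

text \<open>
  The homotopies \<open>h\<close> of an NDR pair preserve \<open>A\<close> but need not fix it pointwise, so the pair need
  not have the homotopy extension property. The following substitute for it suffices.
\<close>

lemma NDR_extension:
  assumes ndr: "NDR_data X A u h" and F: "continuous_map (prod_topology X T) Z F"
    and K: "continuous_map (prod_topology (prod_topology (subtopology X A) T) I01) Z K"
    and FK: "\<And>a t. a \<in> A \<Longrightarrow> t \<in> topspace T \<Longrightarrow> K ((a, t), 1) = F (a, t)"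
  shows "continuous_map (prod_topology (prod_topology X T) I01) Z
    (\<lambda>w. if u (fst (fst w)) < 1 then K ((h (fst (fst w), 1), snd (fst w)), max (u (fst (fst w))) (snd w))
         else F (h (fst (fst w), 1), snd (fst w)))" (is "continuous_map ?P Z ?E")
proof -
  note nd = NDR_dataD[OF ndr]
  have x: "continuous_map ?P X (\<lambda>w. fst (fst w))"
    by (intro continuous_map_fst_comp[OF continuous_map_fst])
  have t: "continuous_map ?P T (\<lambda>w. snd (fst w))"
    by (intro continuous_map_snd_comp[OF continuous_map_fst])
  have s: "continuous_map ?P I01 snd" by (rule continuous_map_snd)
  have u: "continuous_map ?P I01 (\<lambda>w. u (fst (fst w)))" by (rule continuous_map_comp[OF x nd(1)])
  have h: "continuous_map ?P X (\<lambda>w. h (fst (fst w), 1))"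
    by (rule continuous_map_comp[OF _ nd(2)]) (intro continuous_map_pairedI x, auto)
  \<comment> \<open>If \<open>u x < 1\<close> then \<open>h (x, 1)\<close> lies in \<open>A\<close>,
    so the closed sets \<open>C\<close> and \<open>D\<close> cover. Where they meet, the parameter
    \<open>max u t\<close> is 1 and \<open>K\<close> agrees with \<open>F\<close>. At time 1 the map
    is therefore \<open>F\<close> after \<open>h (_, 1)\<close>, while at time 0 its restriction to
    \<open>A\<close> factors through \<open>K\<close> at time 0.\<close>
  define C where "C = {w \<in> topspace ?P. h (fst (fst w), 1) \<in> A}"
  define D where "D = {w \<in> topspace ?P. u (fst (fst w)) \<in> {1}}"
  have c: "closedin ?P C" unfolding C_def
    by (rule closedin_continuous_map_preimage[OF h NDR_data_closed[OF ndr]])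
  have d: "closedin ?P D" unfolding D_def
    by (rule closedin_continuous_map_preimage[OF u]) (simp add: closed_subset)
  let ?m = "\<lambda>w. max (u (fst (fst w))) (snd w)"
  have m: "continuous_map ?P I01 ?m"
    by (rule continuous_map_I01I) (use nd(8) in \<open>auto intro!: cint continuous_map_I01D[OF u] continuous_map_I01D[OF s] simp: le_max_iff_disj\<close>)
  show ?thesis
  proof (rule continuous_map_paste_closed[OF c d])
    show "topspace ?P \<subseteq> C \<union> D"
    proof
      fix w assume w: "w \<in> topspace ?P"
      then have "fst (fst w) \<in> topspace X" by auto
      then show "w \<in> C \<union> D" using nd(7,8)[of "fst (fst w)"] w unfolding C_def D_def by force
    qed
    have "continuous_map (subtopology ?P C) (subtopology X A) (\<lambda>w. h (fst (fst w), 1))"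
      by (rule continuous_map_into_subtopology[OF continuous_map_from_subtopology[OF h]]) (auto simp: C_def)
    then have "continuous_map (subtopology ?P C) (prod_topology (prod_topology (subtopology X A) T) I01)
       (\<lambda>w. ((h (fst (fst w), 1), snd (fst w)), ?m w))"
      by (intro continuous_map_pairedI continuous_map_from_subtopology[OF t] continuous_map_from_subtopology[OF m])
    then show "continuous_map (subtopology ?P C) Z (\<lambda>w. K ((h (fst (fst w), 1), snd (fst w)), ?m w))"
      by (rule continuous_map_comp[OF _ K])
    have "continuous_map ?P (prod_topology X T) (\<lambda>w. (h (fst (fst w), 1), snd (fst w)))"
      by (intro continuous_map_pairedI h t)
    then show "continuous_map (subtopology ?P D) Z (\<lambda>w. F (h (fst (fst w), 1), snd (fst w)))"
      by (intro continuous_map_from_subtopology continuous_map_comp[OF _ F])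
    fix w
    show "?E w = K ((h (fst (fst w), 1), snd (fst w)), ?m w)" if "w \<in> C"
    proof (cases "u (fst (fst w)) < 1")
      case False
      with that nd(8)[of "fst (fst w)"] have "u (fst (fst w)) = 1" "snd w \<le> 1" "snd (fst w) \<in> topspace T"
        unfolding C_def by auto
      then show ?thesis using that FK by (auto simp: C_def max_def)
    qed auto
    show "?E w = F (h (fst (fst w), 1), snd (fst w))" if "w \<in> D"
      using that by (auto simp: D_def)
  qed
qed

text \<open>Exactness of the cofibre sequence at \<open>X\<close>. The family \<open>l\<close> is
  homotopic to its composite with \<open>h (_, 1)\<close>, and \<open>NDR_extension\<close> deforms
  the latter along the null homotopy to a family that is constant on \<open>A\<close>. The descended
  family is even strictly constant at \<open>y0\<close>, which \<open>descend_null_homotopy\<close>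
  needs.\<close>

lemma descend_loops:
  assumes ndr: "NDR_data X A u h" and q: "collapses X A Y q y0" and A: "A \<noteq> {}"
    and l: "pathfam X Z z z l" and n: "pathfam_homotopic (subtopology X A) Z z z (\<lambda>_. z) l"
  shows "\<exists>m. pathfam Y Z z z m \<and> (\<forall>s \<in> {0..1}. m (y0, s) = z) \<and>
    pathfam_homotopic X Z z z (\<lambda>(x, s). m (q x, s)) l"
proof -
  note nd = NDR_dataD[OF ndr]
  let ?AA = "subtopology X A"
  have tA: "topspace ?AA = A" using nd(5) by auto
  obtain M where M: "continuous_map (prod_topology I01 (prod_topology ?AA I01)) Z M"
    "\<And>a s. a \<in> A \<Longrightarrow> s \<in> {0..1} \<Longrightarrow> M (0, (a, s)) = z"
    "\<And>a s. a \<in> A \<Longrightarrow> s \<in> {0..1} \<Longrightarrow> M (1, (a, s)) = l (a, s)"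
    "\<And>t a. t \<in> {0..1} \<Longrightarrow> a \<in> A \<Longrightarrow> M (t, (a, 0)) = z \<and> M (t, (a, 1)) = z"
    using n unfolding pathfam_homotopic_alt tA by blast
  define K where "K = (\<lambda>w. M (snd w, fst w))"
  have K: "continuous_map (prod_topology (prod_topology ?AA I01) I01) Z K" unfolding K_def
    by (rule continuous_map_comp[OF _ M(1)]) (intro continuous_map_pairedI continuous_map_snd continuous_map_fst)
  have lc: "continuous_map (prod_topology X I01) Z l" using l by (simp add: pathfam_def)
  define E where "E = (\<lambda>w. if u (fst (fst w)) < 1 then K ((h (fst (fst w), 1), snd (fst w)), max (u (fst (fst w))) (snd w))
         else l (h (fst (fst w), 1), snd (fst w)))"
  have E: "continuous_map (prod_topology (prod_topology X I01) I01) Z E"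
    unfolding E_def by (rule NDR_extension[OF ndr lc K]) (simp add: K_def M)
  have le: "l (x, 0) = z \<and> l (x, 1) = z" if "x \<in> topspace X" for x
    using l that by (auto simp: pathfam_def)
  have Eends: "E ((x, 0), t) = z \<and> E ((x, 1), t) = z" if "x \<in> topspace X" "t \<in> {0..1}" for x t
    using that nd(7,8)[of x] nd(9)[of x 1] le by (auto simp: E_def K_def M(4) le_max_iff_disj)
  have E1: "E ((x, s), 1) = l (h (x, 1), s)" if "x \<in> topspace X" "s \<in> {0..1}" for x s
    using that nd(7,8)[of x] by (auto simp: E_def K_def M(3) max_def)
  have "continuous_map (prod_topology X I01) Z (\<lambda>w. E (w, 0))"
    by (rule continuous_map_comp[OF _ E]) (intro continuous_map_pairedI continuous_map_id[unfolded id_def], auto)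
  then obtain m where m: "continuous_map (prod_topology Y I01) Z m"
    "\<And>x s. x \<in> topspace X \<Longrightarrow> s \<in> topspace I01 \<Longrightarrow> m (q x, s) = E ((x, s), 0)"
  proof (rule collapses_lift[OF q locally_compact_I01 Hausdorff_I01])
    show "E ((a, t), 0) = E ((b, t), 0)" if "a \<in> A" "b \<in> A" "t \<in> topspace I01" for a b t
      using that nd(4,5,6,7) by (auto simp: E_def K_def M(2))
  qed auto
  have mz: "m (q x, 0) = z \<and> m (q x, 1) = z" if "x \<in> topspace X" for x
    using that m(2)[of x] Eends[of x 0] by auto
  have "pathfam Y Z z z m" unfolding pathfam_def using m(1) mz collapses_image[OF q] by auto
  moreover have "m (y0, s) = z" if s: "s \<in> {0..1}" for s
  proof -
    obtain a where a: "a \<in> A" using A by blast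
    then have "q a = y0" "a \<in> topspace X" using q nd(5) by (auto simp: collapses_def)
    with m(2)[of a s] s a nd(4,6) show ?thesis by (auto simp: E_def K_def M(2))
  qed
  moreover have "pathfam_homotopic X Z z z (\<lambda>(x, s). m (q x, s)) l"
  proof -
    have 1: "pathfam_homotopic X Z z z l (\<lambda>(x, s). l (h (x, 1), s))"
    proof -
      have "continuous_map (prod_topology I01 (prod_topology X I01)) Z (\<lambda>w. l (h (fst (snd w), fst w), snd (snd w)))"
        by (rule continuous_map_comp[OF _ lc]) (intro continuous_map_pairedI continuous_map_comp[OF _ nd(2)]
            continuous_map_fst continuous_map_fst_comp[OF continuous_map_snd] continuous_map_snd_comp[OF continuous_map_snd])
      then show ?thesis unfolding pathfam_homotopic_alt
        by (intro exI[of _ "\<lambda>w. l (h (fst (snd w), fst w), snd (snd w))"]) (use nd(3,9) le in auto)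
    qed
    have 2: "pathfam_homotopic X Z z z (\<lambda>(x, s). m (q x, s)) (\<lambda>(x, s). l (h (x, 1), s))"
    proof -
      have "continuous_map (prod_topology I01 (prod_topology X I01)) Z (\<lambda>w. E (snd w, fst w))"
        by (rule continuous_map_comp[OF _ E]) (intro continuous_map_pairedI continuous_map_fst continuous_map_snd)
      then show ?thesis unfolding pathfam_homotopic_alt
        by (intro exI[of _ "\<lambda>w. E (snd w, fst w)"]) (use m(2) E1 Eends in auto)
    qed
    show ?thesis using pathfam_homotopic_trans[OF 2 pathfam_homotopic_sym[OF 1]] .
  qed
  ultimately show ?thesis by blast
qed

text \<open>
  For a fixed null homotopy \<open>H\<close> of the loops \<open>m \<circ> q\<close>, the restriction of \<open>H\<close> to \<open>A\<close> is a family of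
  double loops. Composing it with the stable retraction \<open>r\<close> extends it to \<open>X\<close>, and subtracting the
  extension from \<open>H\<close> yields a null homotopy whose restriction to \<open>A\<close> is trivial.
\<close>

lemma descend_null_homotopy:
  assumes ndr: "NDR_data X A u h" and q: "collapses X A Y q y0" and A: "A \<noteq> {}"
    and m: "pathfam Y Z z z m" "\<And>s. s \<in> {0..1} \<Longrightarrow> m (y0, s) = z"
    and null: "pathfam_homotopic X Z z z (\<lambda>(x, s). m (q x, s)) (\<lambda>_. z)"
    and r: "pathfam X (suspension (subtopology X A)) South North r"
      "pathfam_homotopic (subtopology X A) (suspension (subtopology X A)) South North r susp_point"
  shows "pathfam_homotopic Y Z z z m (\<lambda>_. z)"
proof -
  note nd = NDR_dataD[OF ndr]
  let ?AA = "subtopology X A"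
  let ?S = "suspension ?AA"
  have tA: "topspace ?AA = A" using nd(5) by auto
  have SN: "South \<in> topspace ?S" "North \<in> topspace ?S"
    using A tA by (auto simp: South_in_suspension North_in_suspension)
  obtain H where H: "continuous_map (prod_topology I01 (prod_topology X I01)) Z H"
    "\<And>x s. x \<in> topspace X \<Longrightarrow> s \<in> {0..1} \<Longrightarrow> H (0, (x, s)) = m (q x, s)"
    "\<And>x s. x \<in> topspace X \<Longrightarrow> s \<in> {0..1} \<Longrightarrow> H (1, (x, s)) = z"
    "\<And>t x. t \<in> {0..1} \<Longrightarrow> x \<in> topspace X \<Longrightarrow> H (t, (x, 0)) = z \<and> H (t, (x, 1)) = z"
    using null unfolding pathfam_homotopic_alt by fastforce
  have HA: "continuous_map (prod_topology I01 (prod_topology ?AA I01)) Z H"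
  proof -
    have "continuous_map (prod_topology I01 (prod_topology ?AA I01)) (prod_topology I01 (prod_topology X I01))
        (\<lambda>w. (fst w, (fst (snd w), snd (snd w))))"
      by (intro continuous_map_pairedI continuous_map_fst continuous_map_snd_comp[OF continuous_map_snd]
          continuous_map_into_fulltopology[OF continuous_map_fst_comp[OF continuous_map_snd]])
    from continuous_map_comp[OF this H(1)] show ?thesis by simp
  qed
  \<comment> \<open>As \<open>H\<close> is constant at both ends of the loops, its restriction to
    \<open>A\<close> factors through the suspension. The resulting \<open>b\<close> is constant at
    times 0 and 1, at time 0 because \<open>m\<close> is constant at \<open>y0\<close>; this double
    loop family is what keeps \<open>H\<close> from descending.\<close>
  obtain b where b: "continuous_map (prod_topology I01 ?S) Z b"
    "\<And>t a s. t \<in> {0..1} \<Longrightarrow> a \<in> A \<Longrightarrow> s \<in> {0..1} \<Longrightarrow> b (t, susp_point (a, s)) = H (t, (a, s))"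
  proof (rule quotient_map_lift_exists[OF quotient_map_homotopy_susp_point HA])
    fix v w
    assume "v \<in> topspace (prod_topology I01 (prod_topology ?AA I01))"
      "w \<in> topspace (prod_topology I01 (prod_topology ?AA I01))"
      "(\<lambda>(t, w). (t, susp_point w)) v = (\<lambda>(t, w). (t, susp_point w)) w"
    moreover obtain t a s t' a' s' where "v = (t, (a, s))" "w = (t', (a', s'))"
      by (metis surj_pair)
    ultimately show "H v = H w" using susp_point_eqD[of a s a' s'] H(4) by auto
  next
    fix g assume g: "continuous_map (prod_topology I01 ?S) Z g"
      "\<And>w. w \<in> topspace (prod_topology I01 (prod_topology ?AA I01)) \<Longrightarrow> g ((\<lambda>(t, w). (t, susp_point w)) w) = H w"
    show thesis
    proof (rule that[OF g(1)])
      show "g (t, susp_point (a, s)) = H (t, (a, s))" if "t \<in> {0..1}" "a \<in> A" "s \<in> {0..1}" for t a s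
        using g(2)[of "(t, (a, s))"] that tA by auto
    qed
  qed
  have qA: "q a = y0" if "a \<in> A" for a using q that by (auto simp: collapses_def)
  have b0: "b (0, w) = z" and b1: "b (1, w) = z" if "w \<in> topspace ?S" for w
  proof -
    obtain a s where as: "a \<in> A" "s \<in> {0..1}" "w = susp_point (a, s)"
      using \<open>w \<in> topspace ?S\<close> suspensionE tA by metis
    then have "a \<in> topspace X" using nd(5) by auto
    with as b(2) H(2,3) m(2) qA show "b (0, w) = z" "b (1, w) = z" by auto
  qed
  obtain a0 where a0: "a0 \<in> A" "a0 \<in> topspace X" using A nd(5) by blast
  have bS: "b (t, South) = z" and bN: "b (t, North) = z" if "t \<in> {0..1}" for t
    using b(2)[OF that a0(1), of 0] b(2)[OF that a0(1), of 1] H(4)[OF that a0(2)] by auto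
  \<comment> \<open>On \<open>A\<close> the retraction \<open>r\<close> is homotopic to the
    meridians, so going along a meridian and back along \<open>r\<close> is null.\<close>
  have "pathfam_homotopic ?AA ?S South South (join_fam susp_point (rev_fam r)) (join_fam susp_point (rev_fam susp_point))"
    by (rule pathfam_homotopic_join[OF pathfam_homotopic_refl[OF pathfam_susp_point] pathfam_homotopic_rev[OF r(2)]])
  also have "pathfam_homotopic ?AA ?S South South \<dots> (\<lambda>_. South)"
    by (rule pathfam_homotopic_join_rev[OF pathfam_susp_point])
  finally have "pathfam_homotopic ?AA ?S South South (\<lambda>_. South) (join_fam susp_point (rev_fam r))"
    by (rule pathfam_homotopic_sym)
  then obtain M where M: "continuous_map (prod_topology I01 (prod_topology ?AA I01)) ?S M"
    "\<And>a s. a \<in> A \<Longrightarrow> s \<in> {0..1} \<Longrightarrow> M (0, (a, s)) = South"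
    "\<And>a s. a \<in> A \<Longrightarrow> s \<in> {0..1} \<Longrightarrow> M (1, (a, s)) = join_fam susp_point (rev_fam r) (a, s)"
    "\<And>t a. t \<in> {0..1} \<Longrightarrow> a \<in> A \<Longrightarrow> M (t, (a, 0)) = South \<and> M (t, (a, 1)) = South"
    unfolding pathfam_homotopic_alt tA by blast
  have Min: "M (t, (a, s)) \<in> topspace ?S" if "t \<in> {0..1}" "a \<in> A" "s \<in> {0..1}" for t a s
    using continuous_map_image_subset_topspace[OF M(1)] that tA by force
  have rc: "continuous_map (prod_topology X I01) ?S r"
    and r0: "\<And>x. x \<in> topspace X \<Longrightarrow> r (x, 0) = South \<and> r (x, 1) = North"
    using r(1) by (auto simp: pathfam_def)
  have rin: "r (x, s) \<in> topspace ?S" if "x \<in> topspace X" "s \<in> {0..1}" for x s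
    using continuous_map_image_subset_topspace[OF rc] that by force
  let ?T = "prod_topology I01 I01"
  \<comment> \<open>\<open>H\<close> followed by the reverse of \<open>b\<close> after
    \<open>r\<close>; the second half makes sense on all of \<open>X\<close>. On \<open>A\<close> it
    is \<open>b\<close> applied to the loops that \<open>M\<close> contracts, hence \<open>K\<close>
    below.\<close>
  define F where "F = (\<lambda>w. if snd (snd w) \<le> 1/2 then H (fst (snd w), (fst w, 2 * snd (snd w)))
    else b (fst (snd w), r (fst w, 2 - 2 * snd (snd w))))"
  have F: "continuous_map (prod_topology X ?T) Z F"
  proof -
    let ?X = "prod_topology X ?T"
    have s: "continuous_map ?X euclideanreal (\<lambda>w. snd (snd w))"
      by (rule continuous_map_I01D[OF continuous_map_snd_comp[OF continuous_map_snd]])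
    have t: "continuous_map ?X I01 (\<lambda>w. fst (snd w))"
      by (rule continuous_map_fst_comp[OF continuous_map_snd])
    have "continuous_map ?X Z (\<lambda>w. if snd (snd w) \<le> 1/2 then H (fst (snd w), (fst w, min 1 (2 * snd (snd w))))
      else b (fst (snd w), r (fst w, min 1 (2 - 2 * snd (snd w)))))"
    proof (rule continuous_map_paste_le[OF s])
      show "continuous_map ?X Z (\<lambda>w. H (fst (snd w), (fst w, min 1 (2 * snd (snd w)))))"
        by (rule continuous_map_comp[OF _ H(1)]) (intro cint continuous_map_fst s t, auto)
      have "continuous_map ?X ?S (\<lambda>w. r (fst w, min 1 (2 - 2 * snd (snd w))))"
        by (rule continuous_map_comp[OF _ rc]) (intro cint continuous_map_fst s t, auto)
      then show "continuous_map ?X Z (\<lambda>w. b (fst (snd w), r (fst w, min 1 (2 - 2 * snd (snd w)))))"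
        by (intro continuous_map_comp[OF _ b(1)] continuous_map_pairedI t)
    qed (use H(4) r0 bN in auto)
    then show ?thesis by (rule continuous_map_eq) (auto simp: F_def)
  qed
  define K where "K = (\<lambda>w. b (fst (snd (fst w)), M (snd w, (fst (fst w), snd (snd (fst w))))))"
  have K: "continuous_map (prod_topology (prod_topology ?AA ?T) I01) Z K" unfolding K_def
    by (intro continuous_map_comp[OF _ b(1)] continuous_map_comp[OF _ M(1)] continuous_map_pairedI continuous_map_snd
        continuous_map_fst_comp[OF continuous_map_fst] continuous_map_fst_comp[OF continuous_map_snd_comp[OF continuous_map_fst]]
        continuous_map_snd_comp[OF continuous_map_snd_comp[OF continuous_map_fst]])
  define E where "E = (\<lambda>w. if u (fst (fst w)) < 1 then K ((h (fst (fst w), 1), snd (fst w)), max (u (fst (fst w))) (snd w))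
         else F (h (fst (fst w), 1), snd (fst w)))"
  have E: "continuous_map (prod_topology (prod_topology X ?T) I01) Z E"
    unfolding E_def
  proof (rule NDR_extension[OF ndr F K])
    fix a t assume "a \<in> A" "t \<in> topspace ?T"
    moreover obtain t1 s where "t = (t1, s)" by (cases t)
    ultimately have a: "a \<in> A" "t1 \<in> {0..1}" "s \<in> {0..1}" "t = (t1, s)" by auto
    then show "K ((a, t), 1) = F (a, t)"
      by (cases "s \<le> 1/2") (simp_all add: K_def F_def M(3) join_fam_def rev_fam_def b(2) algebra_simps)
  qed
  have E0: "continuous_map (prod_topology X ?T) Z (\<lambda>w. E (w, 0))"
    by (rule continuous_map_comp[OF _ E]) (intro continuous_map_pairedI continuous_map_id[unfolded id_def], auto)
  obtain G where G: "continuous_map (prod_topology Y ?T) Z G"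
    "\<And>x w. x \<in> topspace X \<Longrightarrow> w \<in> topspace ?T \<Longrightarrow> G (q x, w) = E ((x, w), 0)"
  proof (rule collapses_lift[OF q _ _ E0])
    show "locally_compact_space ?T"
      by (simp add: compact_imp_locally_compact_space compact_space_subtopology compact_Times)
    show "Hausdorff_space ?T"
      by (simp add: Hausdorff_space_subtopology)
    show "E ((a, t), 0) = E ((b, t), 0)" if "a \<in> A" "b \<in> A" "t \<in> topspace ?T" for a b t
      using that nd(4,5,6,7) by (auto simp: E_def K_def M(2))
  qed auto
  \<comment> \<open>The extension obtained below lives over \<open>h (_, 1)\<close>. So it has to be
    compared with \<open>m\<close> along the deformation \<open>hb\<close> of \<open>Y\<close>
    induced by \<open>h\<close>.\<close>
  have "continuous_map (prod_topology X I01) Y (\<lambda>w. q (h w))"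
    by (rule continuous_map_comp[OF nd(2) collapses_continuous[OF q]])
  then obtain hb where hb: "continuous_map (prod_topology Y I01) Y hb"
    "\<And>x s. x \<in> topspace X \<Longrightarrow> s \<in> topspace I01 \<Longrightarrow> hb (q x, s) = q (h (x, s))"
    by (rule collapses_lift[OF q locally_compact_I01 Hausdorff_I01]) (use qA nd(6) in auto)
  \<comment> \<open>At time 0 the second half of \<open>F\<close> is constant because
    \<open>b\<close> is, so \<open>G\<close> begins not with \<open>m\<close> but with
    \<open>m\<close> followed by a constant loop.\<close>
  let ?m = "join_fam m (\<lambda>_. z)"
  have zZ: "z \<in> topspace Z"
    using b0[OF SN(1)] continuous_map_image_subset_topspace[OF b(1)] SN(1) by force
  have m': "pathfam Y Z z z ?m" by (rule pathfam_join[OF m(1) pathfam_const[OF zZ]])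
  have mc: "continuous_map (prod_topology Y I01) Z ?m" and
    mz: "\<And>y. y \<in> topspace Y \<Longrightarrow> ?m (y, 0) = z \<and> ?m (y, 1) = z" using m' by (auto simp: pathfam_def)
  have qin: "q x \<in> topspace Y" if "x \<in> topspace X" for x using that collapses_image[OF q] by auto
  have "pathfam_homotopic Y Z z z m ?m"
    by (rule pathfam_homotopic_sym[OF pathfam_homotopic_join_const_right[OF m(1)]])
  also have "pathfam_homotopic Y Z z z ?m (\<lambda>(y, s). ?m (hb (y, 1), s))"
  proof -
    have "continuous_map (prod_topology I01 (prod_topology Y I01)) Z (\<lambda>w. ?m (hb (fst (snd w), fst w), snd (snd w)))"
      by (rule continuous_map_comp[OF _ mc]) (intro continuous_map_pairedI continuous_map_comp[OF _ hb(1)]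
          continuous_map_fst continuous_map_fst_comp[OF continuous_map_snd] continuous_map_snd_comp[OF continuous_map_snd])
    then show ?thesis unfolding pathfam_homotopic_alt
      by (intro exI[of _ "\<lambda>w. ?m (hb (fst (snd w), fst w), snd (snd w))"])
        (use nd(3,9) hb(2) mz qin in \<open>auto simp: collapses_image[OF q]\<close>)
  qed
  also have "pathfam_homotopic Y Z z z (\<lambda>(y, s). ?m (hb (y, 1), s)) (\<lambda>_. z)"
  proof -
    have c: "continuous_map (prod_topology I01 (prod_topology Y I01)) Z (\<lambda>w. G (fst (snd w), (fst w, snd (snd w))))"
      by (rule continuous_map_comp[OF _ G(1)]) (intro continuous_map_pairedI
          continuous_map_fst continuous_map_fst_comp[OF continuous_map_snd] continuous_map_snd_comp[OF continuous_map_snd])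
    have g0: "G (q x, (0, s)) = ?m (hb (q x, 1), s)" and g1: "G (q x, (1, s)) = z"
      if x: "x \<in> topspace X" and s: "s \<in> {0..1}" for x s
    proof -
      have hx: "h (x, 1) \<in> topspace X" using nd(9) x by auto
      have eq: "hb (q x, 1) = q (h (x, 1))" using hb(2) x by auto
      have "G (q x, (0, s)) = ?m (q (h (x, 1)), s) \<and> G (q x, (1, s)) = z"
      proof (cases "u x < 1")
        case True
        then have hA: "h (x, 1) \<in> A" using nd(7) x by auto
        have "M (max (u x) 0, (h (x, 1), s)) \<in> topspace ?S"
          using nd(8)[OF x] hA s by (intro Min) (auto simp: max_def)
        then show ?thesis
          using True x s G(2) b0 b1 hA qA m(2) by (auto simp: E_def K_def join_fam_def)
      next
        case False
        then show ?thesis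
          using x s hx G(2) b0 b1 rin H(2,3) by (auto simp: E_def F_def join_fam_def)
      qed
      then show "G (q x, (0, s)) = ?m (hb (q x, 1), s)" "G (q x, (1, s)) = z" using eq by auto
    qed
    have ge: "G (q x, (t, 0)) = z \<and> G (q x, (t, 1)) = z" if x: "x \<in> topspace X" and t: "t \<in> {0..1}" for x t
    proof -
      have hx: "h (x, 1) \<in> topspace X" using nd(9) x by auto
      show ?thesis
      proof (cases "u x < 1")
        case True
        then have hA: "h (x, 1) \<in> A" using nd(7) x by auto
        show ?thesis
          using True x t G(2) hA nd(8)[OF x] M(4) bS by (auto simp: E_def K_def max_def)
      next
        case False
        then show ?thesis
          using x t hx G(2) r0 H(4) bS by (auto simp: E_def F_def)
      qed
    qed
    show ?thesis unfolding pathfam_homotopic_alt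
      by (intro exI[of _ "\<lambda>w. G (fst (snd w), (fst w, snd (snd w)))"])
        (use c g0 g1 ge in \<open>auto simp: collapses_image[OF q]\<close>)
  qed
  finally show ?thesis .
qed

lemma collapses_NDR:
  assumes ndr: "NDR_data X A u h" and q: "collapses X A Y q y0" and A: "A \<noteq> {}"
  obtains u' h' where "NDR_data Y {y0} u' h'"
proof -
  note nd = NDR_dataD[OF ndr]
  have qA: "q a = y0" if "a \<in> A" for a using q that by (auto simp: collapses_def)
  have qq: "quotient_map X Y q" and
    inj: "\<And>x x'. x \<in> topspace X \<Longrightarrow> x' \<in> topspace X \<Longrightarrow> q x = q x' \<Longrightarrow> x = x' \<or> x \<in> A \<and> x' \<in> A"
    using q unfolding collapses_def by blast+
  obtain u' where u': "continuous_map Y I01 u'" "\<And>x. x \<in> topspace X \<Longrightarrow> u' (q x) = u x"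
  proof (rule quotient_map_lift_exists[OF qq nd(1)])
    show "u x = u y" if "x \<in> topspace X" "y \<in> topspace X" "q x = q y" for x y
      using inj[OF that] nd(4) by auto
  qed blast
  have "continuous_map (prod_topology X I01) Y (\<lambda>w. q (h w))"
    by (rule continuous_map_comp[OF nd(2) collapses_continuous[OF q]])
  then obtain h' where h': "continuous_map (prod_topology Y I01) Y h'"
    "\<And>x s. x \<in> topspace X \<Longrightarrow> s \<in> topspace I01 \<Longrightarrow> h' (q x, s) = q (h (x, s))"
    by (rule collapses_lift[OF q locally_compact_I01 Hausdorff_I01]) (use qA nd(6) in auto)
  obtain a where a: "a \<in> A" using A by blast
  then have a': "a \<in> topspace X" "q a = y0" using nd(5) qA by auto
  have z: "u' y = 0 \<longleftrightarrow> y = y0" if "y \<in> topspace Y" for y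
  proof -
    have "y \<in> q ` topspace X" using that collapses_image[OF q] by simp
    then obtain x where "x \<in> topspace X" "y = q x" by blast
    then show ?thesis using u'(2) nd(4,10) qA inj[OF _ a'(1)] a'(2) a by metis
  qed
  have "NDR_data Y {y0} u' h'" unfolding NDR_data_def
  proof (intro conjI ballI impI u'(1) h'(1))
    show "{y0} = {x \<in> topspace Y. u' x = 0}"
      using z a' collapses_image[OF q] by blast
    show "h' (x, 0) = x" if "x \<in> topspace Y" for x
      using that h'(2) nd(3) collapses_image[OF q] by auto
    show "h' (y, t) \<in> {y0}" if "y \<in> {y0}" "t \<in> {0..1}" for y t
      using that h'(2)[OF a'(1)] a'(2) qA nd(6)[OF a] by auto
    show "h' (x, 1) \<in> {y0}" if "x \<in> topspace Y" "u' x < 1" for x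
      using that h'(2) u'(2) qA nd(7) collapses_image[OF q] by auto
  qed
  then show ?thesis by (rule that)
qed

lemma collapses_id: "topspace Y \<supseteq> {y0} \<Longrightarrow> collapses Y {y0} Y id y0"
  by (auto simp: collapses_def quotient_map_def)
    (metis Collect_conj_eq Collect_mem_eq inf.absorb_iff2)+

text \<open>Over the base point the family is now only null homotopic. \<open>descend_loops\<close>,
  applied to the pair of \<open>Y\<close> and \<open>{y0}\<close> with the identity as collapse,
  replaces it by a homotopic family that is constant there.\<close>

lemma descend_null_homotopy':
  assumes ndr: "NDR_data X A u h" and q: "collapses X A Y q y0" and A: "A \<noteq> {}"
    and m: "pathfam Y Z z z m" "pathfam_homotopic (subtopology Y {y0}) Z z z m (\<lambda>_. z)"
    and null: "pathfam_homotopic X Z z z (\<lambda>(x, s). m (q x, s)) (\<lambda>_. z)"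
    and r: "pathfam X (suspension (subtopology X A)) South North r"
      "pathfam_homotopic (subtopology X A) (suspension (subtopology X A)) South North r susp_point"
  shows "pathfam_homotopic Y Z z z m (\<lambda>_. z)"
proof -
  obtain u' h' where n: "NDR_data Y {y0} u' h'" by (rule collapses_NDR[OF ndr q A])
  have y0: "y0 \<in> topspace Y" using NDR_dataD(5)[OF n] by simp
  obtain m' where m': "pathfam Y Z z z m'" "\<And>s. s \<in> {0..1} \<Longrightarrow> m' (y0, s) = z"
    "pathfam_homotopic Y Z z z (\<lambda>(x, s). m' (id x, s)) m"
    using descend_loops[OF n collapses_id _ m(1) pathfam_homotopic_sym[OF m(2)]] y0 by auto
  then have mm: "pathfam_homotopic Y Z z z m' m" by simp
  have "pathfam_homotopic X Z z z (\<lambda>(x, s). m' (q x, s)) (\<lambda>_. z)"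
    by (rule pathfam_homotopic_trans[OF pathfam_homotopic_compose_right[OF mm collapses_continuous[OF q]] null])
  from descend_null_homotopy[OF ndr q A m'(1,2) this r]
  show ?thesis by (rule pathfam_homotopic_trans[OF pathfam_homotopic_sym[OF mm]])
qed

lemma join_fam_const [simp]: "join_fam (\<lambda>_. z) (\<lambda>_. z) = (\<lambda>_. z)"
  by (auto simp: join_fam_def)

lemma rev_fam_const [simp]: "rev_fam (\<lambda>_. z) = (\<lambda>_. z)"
  by (auto simp: rev_fam_def)

text \<open>All partial homotopies are stationary on \<open>E\<close>, with the common values
  \<open>e\<close>, and distinct pieces meet only there. So homotopies found separately on the
  pieces fit together.\<close>

lemma homotopic_with_paste:
  assumes fin: "finite I" and clo: "\<And>i. i \<in> I \<Longrightarrow> closedin W (T i)" and cov: "topspace W \<subseteq> \<Union> (T ` I)"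
    and int: "\<And>i j. i \<in> I \<Longrightarrow> j \<in> I \<Longrightarrow> i \<noteq> j \<Longrightarrow> T i \<inter> T j \<subseteq> E" and E: "E \<subseteq> topspace W"
    and hom: "\<And>i. i \<in> I \<Longrightarrow> homotopic_with (\<lambda>k. \<forall>x \<in> E \<inter> T i. k x = e x) (subtopology W (T i)) Z f g"
  shows "homotopic_with (\<lambda>k. \<forall>x \<in> E. k x = e x) W Z f g"
proof -
  have T: "T i \<subseteq> topspace W" if "i \<in> I" for i using clo[OF that] closedin_subset by blast
  have "\<forall>i. \<exists>h. i \<in> I \<longrightarrow> continuous_map (prod_topology I01 (subtopology W (T i))) Z h \<and>
     (\<forall>x. h (0, x) = f x) \<and> (\<forall>x. h (1, x) = g x) \<and> (\<forall>t \<in> {0..1}. \<forall>x \<in> E \<inter> T i. h (t, x) = e x)"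
    using hom unfolding homotopic_with_def by blast
  then obtain h where h: "\<And>i. i \<in> I \<Longrightarrow> continuous_map (prod_topology I01 (subtopology W (T i))) Z (h i)"
    "\<And>i x. i \<in> I \<Longrightarrow> h i (0, x) = f x" "\<And>i x. i \<in> I \<Longrightarrow> h i (1, x) = g x"
    "\<And>i t x. i \<in> I \<Longrightarrow> t \<in> {0..1} \<Longrightarrow> x \<in> E \<Longrightarrow> x \<in> T i \<Longrightarrow> h i (t, x) = e x"
    by (metis IntI)
  define H where "H w = h (SOME i. i \<in> I \<and> snd w \<in> T i) w" for w
  have H: "H (t, x) = h i (t, x)" if "i \<in> I" "x \<in> T i" "t \<in> {0..1}" for i t x
  proof -
    let ?j = "SOME i. i \<in> I \<and> x \<in> T i"
    have j: "?j \<in> I \<and> x \<in> T ?j" by (rule someI[of _ i]) (use that in auto)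
    show ?thesis
    proof (cases "?j = i")
      case False
      then have "x \<in> E" using int[of ?j i] j that by auto
      then show ?thesis using h(4) j that unfolding H_def by auto
    qed (simp add: H_def)
  qed
  have "continuous_map (prod_topology I01 W) Z H"
  proof (rule pasting_lemma_closed[OF fin, of _ "\<lambda>i. {0..1} \<times> T i" _ h])
    show "closedin (prod_topology I01 W) ({0..1} \<times> T i)" if "i \<in> I" for i
      using clo[OF that] by (simp add: closedin_prod_Times_iff)
    show "continuous_map (subtopology (prod_topology I01 W) ({0..1} \<times> T i)) Z (h i)" if "i \<in> I" for i
      using h(1)[OF that] by (simp add: subtopology_Times subtopology_subtopology)
    show "h i x = h j x" if "i \<in> I" "j \<in> I" "x \<in> topspace (prod_topology I01 W) \<inter> {0..1} \<times> T i \<inter> {0..1} \<times> T j" for i j x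
      using that H[of i "snd x" "fst x"] H[of j "snd x" "fst x"] by auto
    show "\<exists>j. j \<in> I \<and> x \<in> {0..1} \<times> T j \<and> H x = h j x" if "x \<in> topspace (prod_topology I01 W)" for x
    proof -
      have "snd x \<in> topspace W" using that by auto
      then obtain i where "i \<in> I" "snd x \<in> T i" using cov by blast
      then show ?thesis using H[of i "snd x" "fst x"] that by (intro exI[of _ i]) auto
    qed
  qed
  then have "continuous_map (prod_topology I01 W) Z H \<and>
     (\<forall>x\<in>topspace W. H (0, x) = f x) \<and> (\<forall>x\<in>topspace W. H (1, x) = g x) \<and> (\<forall>t \<in> {0..1}. \<forall>x \<in> E. H (t, x) = e x)"
  proof (intro conjI ballI)
    fix x assume "x \<in> topspace W"
    then obtain i where "i \<in> I" "x \<in> T i" using cov by blast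
    then show "H (0, x) = f x" "H (1, x) = g x" using H[of i x] h by auto
  next
    fix t x assume t: "t \<in> {0..1::real}" and x: "x \<in> E"
    then obtain i where "i \<in> I" "x \<in> T i" using cov E by blast
    then show "H (t, x) = e x" using H[of i x t] h(4) t x by auto
  qed
  then show ?thesis using E by (subst homotopic_with) (auto simp: subset_iff)
qed

section \<open>Splittings of suspensions\<close>

text \<open>The end point of the families \<open>merid\<close>: North if there is no base point, and
  South, where the meridians close up, if there is one.\<close>

definition pole :: "'a option \<Rightarrow> 'b susp" where
  "pole b = (case b of None \<Rightarrow> North | Some _ \<Rightarrow> South)"

definition ret :: "'a susp option \<Rightarrow> 'c \<times> real \<Rightarrow> 'a susp" where
  "ret b w = (case b of None \<Rightarrow> North | Some a \<Rightarrow> susp_point (a, 1 - snd w))"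

text \<open>
  The family of meridians of a suspension, in the pointed case made into loops by returning
  along the meridian through the base point.
\<close>

definition merid :: "'a susp option \<Rightarrow> 'a susp \<times> real \<Rightarrow> 'a susp" where
  "merid b = join_fam susp_point (ret b)"

lemma pathfam_ret:
  assumes "topspace A \<noteq> {}" "\<And>a. b = Some a \<Longrightarrow> a \<in> topspace A"
  shows "pathfam X (suspension A) North (pole b) (ret b)"
proof (cases b)
  case None
  then show ?thesis using assms(1) by (simp add: pole_def ret_def[abs_def] pathfam_const North_in_suspension)
next
  case (Some a)
  have "continuous_map (prod_topology X I01) (prod_topology A I01) (\<lambda>w. (a, 1 - snd w))"
    using assms(2)[OF Some] by (intro cint continuous_map_I01D[OF continuous_map_snd]) auto
  from continuous_map_comp[OF this] pathfam_susp_point[of A]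
  have "continuous_map (prod_topology X I01) (suspension A) (\<lambda>w. susp_point (a, 1 - snd w))"
    by (simp add: pathfam_def)
  then show ?thesis by (simp add: Some pathfam_def ret_def[abs_def] pole_def)
qed

lemma pathfam_merid:
  assumes "topspace A \<noteq> {}" "\<And>a. b = Some a \<Longrightarrow> a \<in> topspace A"
  shows "pathfam A (suspension A) South (pole b) (merid b)"
  unfolding merid_def by (rule pathfam_join[OF pathfam_susp_point pathfam_ret[OF assms]])

text \<open>
  Here \<open>f\<close> exhibits \<open>V\<close> as the suspension of \<open>A\<close>: the unreduced suspension if \<open>b\<close> is \<^const>\<open>None\<close>,
  with poles \<open>x\<close> and \<open>y\<close>; the reduced suspension with base point \<open>x = y\<close> if \<open>b\<close> is the base
  point of \<open>A\<close>.
\<close>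

definition splits ::
  "'a susp option \<Rightarrow> 'a susp topology \<Rightarrow> 'v topology \<Rightarrow> 'v \<Rightarrow> 'v \<Rightarrow> ('a susp \<times> real \<Rightarrow> 'v) \<Rightarrow> bool" where
  "splits b A V x y f \<longleftrightarrow>
     pathfam A V x y f \<and> x \<in> topspace V \<and> y \<in> topspace V \<and>
     (\<forall>a. b = Some a \<longrightarrow> a \<in> topspace A \<and> y = x \<and>
        pathfam_homotopic (subtopology A {a}) V x x f (\<lambda>_. x)) \<and>
     (\<exists>g. continuous_map V (suspension A) g \<and> g x = South \<and> g y = pole b \<and>
        pathfam_homotopic A (suspension A) South (pole b) (g \<circ> f) (merid b) \<and>
        homotopic_with (\<lambda>k. k x = x \<and> k y = y) V V (susp_lift x y f \<circ> g) id)"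

text \<open>The return leg is either constant at North or the reversed meridian through the base
  point, and along the latter \<open>f\<close> is null by the condition in
  \<open>splits\<close>.\<close>

lemma susp_lift_ret:
  assumes f: "pathfam A V x y f" and b: "\<And>a. b = Some a \<Longrightarrow> a \<in> topspace A \<and> y = x \<and>
        pathfam_homotopic (subtopology A {a}) V x x f (\<lambda>_. x)"
    and y: "y \<in> topspace V"
  shows "pathfam_homotopic X V y y (susp_lift x y f \<circ> ret b) (\<lambda>_. y)"
proof (cases b)
  case None
  then show ?thesis using pathfam_homotopic_refl[OF pathfam_const[OF y, of X]]
    by (simp add: ret_def[abs_def] o_def)
next
  case (Some a)
  have "continuous_map X (subtopology A {a}) (\<lambda>_. a)" using b[OF Some] by auto
  from pathfam_homotopic_compose_right[OF pathfam_homotopic_rev[OF b[OF Some, THEN conjunct2, THEN conjunct2]] this]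
  have "pathfam_homotopic X V x x (\<lambda>(_, s). rev_fam f (a, s)) (\<lambda>(_, s). x)" by (simp add: rev_fam_def)
  moreover have "susp_lift x y f (susp_point (a, 1 - s)) = rev_fam f (a, s)" for s
    using b[OF Some] susp_lift_point[OF f] by (simp add: rev_fam_def)
  ultimately show ?thesis using b[OF Some]
    by (simp add: case_prod_unfold ret_def[abs_def] o_def Some)
qed

lemma susp_lift_merid:
  assumes f: "pathfam A V x y f" and b: "\<And>a. b = Some a \<Longrightarrow> a \<in> topspace A \<and> y = x \<and>
        pathfam_homotopic (subtopology A {a}) V x x f (\<lambda>_. x)"
    and y: "y \<in> topspace V"
  shows "pathfam_homotopic A V x y (susp_lift x y f \<circ> merid b) f"
proof -
  have "pathfam_homotopic A V x y (susp_lift x y f \<circ> susp_point) f"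
    by (rule pathfam_homotopic_sym[OF pathfam_homotopic_eq[OF f]]) (simp add: susp_lift_point[OF f])
  from pathfam_homotopic_join[OF this susp_lift_ret[OF f b y]]
  have "pathfam_homotopic A V x y (susp_lift x y f \<circ> merid b) (join_fam f (\<lambda>_. y))"
    by (simp add: merid_def join_fam_comp)
  then show ?thesis by (rule pathfam_homotopic_trans[OF _ pathfam_homotopic_join_const_right[OF f]])
qed

text \<open>
  Because \<open>f\<close> is defined on all of \<open>X\<close>, composing it with an inverse of its restriction yields a
  stable retraction of \<open>X\<close> to \<open>A\<close>.
\<close>

theorem splits_step:
  assumes ndr: "NDR_data X A u h" and q: "collapses X A Y q y0"
    and W: "closedin W U" "closedin W V" "U \<union> V = topspace W" "U \<inter> V = {w}"
    and sA: "splits b (subtopology X A) (subtopology W V) w y f"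
    and f: "pathfam X (subtopology W V) w y f"
    and sY: "splits (Some y0) Y (subtopology W U) w w \<phi>"
  shows "splits b X W w y (join_fam (\<lambda>(x, s). \<phi> (q x, s)) f)"
proof -
  note nd = NDR_dataD[OF ndr]
  let ?AA = "subtopology X A" and ?WV = "subtopology W V" and ?WU = "subtopology W U"
  let ?SA = "suspension ?AA" and ?SX = "suspension X" and ?SY = "suspension Y"
  have tA: "topspace ?AA = A" using nd(5) by auto
  obtain gV where gV: "continuous_map ?WV ?SA gV" "gV w = South" "gV y = pole b"
    "pathfam_homotopic ?AA ?SA South (pole b) (gV \<circ> f) (merid b)"
    "homotopic_with (\<lambda>k. k w = w \<and> k y = y) ?WV ?WV (susp_lift w y f \<circ> gV) id"
    using sA unfolding splits_def by blast
  have wy: "w \<in> V" "y \<in> V" "w \<in> topspace W" "y \<in> topspace W" and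
    b: "\<And>a. b = Some a \<Longrightarrow> a \<in> A \<and> a \<in> topspace X \<and> y = w \<and> pathfam_homotopic (subtopology ?AA {a}) ?WV w w f (\<lambda>_. w)"
    using sA unfolding splits_def by auto
  obtain gU where gU: "continuous_map ?WU ?SY gU" "gU w = South"
    "pathfam_homotopic Y ?SY South South (gU \<circ> \<phi>) (merid (Some y0))"
    "homotopic_with (\<lambda>k. k w = w \<and> k w = w) ?WU ?WU (susp_lift w w \<phi> \<circ> gU) id"
    using sY unfolding splits_def pole_def by auto
  have \<phi>: "pathfam Y ?WU w w \<phi>" and y0: "y0 \<in> topspace Y"
    and \<phi>0: "pathfam_homotopic (subtopology Y {y0}) ?WU w w \<phi> (\<lambda>_. w)"
    using sY unfolding splits_def by auto
  have wU: "w \<in> U" using W(4) by blast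
  have "South \<in> topspace ?SA" using continuous_map_app[OF gV(1), of w] gV(2) wy by simp
  then have A: "A \<noteq> {}" using tA by (auto simp: South_in_suspension)
  have X: "topspace X \<noteq> {}" using A nd(5) by auto
  have qA: "q a = y0" if "a \<in> A" for a using q that by (auto simp: collapses_def)
  have qc: "continuous_map X Y q" by (rule collapses_continuous[OF q])
  have iA: "continuous_map ?SA ?SX id" by (rule continuous_map_suspension_subtopology)

  \<comment> \<open>The stable retraction: \<open>f\<close> is defined on all of \<open>X\<close>,
    and \<open>gV\<close> inverts its restriction to \<open>A\<close>.\<close>
  define r where "r = gV \<circ> f"
  have r: "pathfam X ?SA South (pole b) r"
    using pathfam_compose_left[OF f gV(1)] unfolding r_def gV(2,3) .
  have rA: "pathfam_homotopic ?AA ?SA South (pole b) r (merid b)" using gV(4) unfolding r_def .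
  have rX: "pathfam X ?SX South (pole b) r" using pathfam_compose_left[OF r iA] by simp
  have mX: "pathfam X ?SX South (pole b) (merid b)" by (rule pathfam_merid[OF X]) (use b in auto)
  have mA: "pathfam ?AA ?SA South (pole b) (merid b)"
    by (rule pathfam_merid) (use A tA b in auto)
  \<comment> \<open>The identity minus the retraction, in the groupoid of path families. It is null
    on \<open>A\<close> and therefore descends to a family \<open>\<mu>\<close> on
    \<open>Y\<close>.\<close>
  define l where "l = join_fam (merid b) (rev_fam r)"
  have l: "pathfam X ?SX South South l"
    unfolding l_def by (rule pathfam_join[OF mX pathfam_rev[OF rX]])
  have "pathfam_homotopic ?AA ?SA South South l (join_fam (merid b) (rev_fam (merid b)))"
    unfolding l_def by (rule pathfam_homotopic_join[OF pathfam_homotopic_refl[OF mA] pathfam_homotopic_rev[OF rA]])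
  also have "pathfam_homotopic ?AA ?SA South South \<dots> (\<lambda>_. South)"
    by (rule pathfam_homotopic_join_rev[OF mA])
  finally have "pathfam_homotopic ?AA ?SA South South l (\<lambda>_. South)" .
  from pathfam_homotopic_compose_left[OF this iA]
  have "pathfam_homotopic ?AA ?SX South South (\<lambda>_. South) l"
    by (simp add: o_def pathfam_homotopic_sym)
  then obtain \<mu> where \<mu>: "pathfam Y ?SX South South \<mu>" "\<And>s. s \<in> {0..1} \<Longrightarrow> \<mu> (y0, s) = South"
    "pathfam_homotopic X ?SX South South (\<lambda>(x, s). \<mu> (q x, s)) l"
    using descend_loops[OF ndr q A l] by blast
  define \<mu>' where "\<mu>' = susp_lift South South \<mu>"
  have \<mu>'c: "continuous_map ?SY ?SX \<mu>'" unfolding \<mu>'_def by (rule continuous_map_susp_lift[OF \<mu>(1)])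
  have \<mu>'S: "\<mu>' South = South" by (simp add: \<mu>'_def)
  \<comment> \<open>The homotopy inverse. On \<open>V\<close> it is the inverse known for
    \<open>A\<close>; a point of \<open>U\<close> is first sent to \<open>\<Sigma>Y\<close> and from
    there into \<open>\<Sigma>X\<close> by the descended difference \<open>\<mu>'\<close>. Both
    prescriptions send \<open>w\<close> to South.\<close>
  define G where "G v = (if v \<in> V then gV v else \<mu>' (gU v))" for v
  have GU: "G v = \<mu>' (gU v)" if "v \<in> U" for v
  proof (cases "v \<in> V")
    case True
    then have "v = w" using that W(4) by blast
    then show ?thesis using gV(2) gU(2) \<mu>'S True by (simp add: G_def)
  qed (simp add: G_def)
  have Gc: "continuous_map W ?SX G"
  proof (rule continuous_map_paste_closed[OF W(2,1)])
    show "topspace W \<subseteq> V \<union> U" using W(3) by blast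
    show "continuous_map ?WV ?SX gV" using continuous_map_compose[OF gV(1) iA] by simp
    show "continuous_map ?WU ?SX (\<lambda>v. \<mu>' (gU v))" by (rule continuous_map_comp[OF gU(1) \<mu>'c])
  qed (auto simp: G_def GU[unfolded G_def])
  define \<psi> where "\<psi> = (\<lambda>(x, s). \<phi> (q x, s))"
  have \<psi>U: "pathfam X ?WU w w \<psi>" unfolding \<psi>_def by (rule pathfam_compose_right[OF \<phi> qc])
  have \<psi>: "pathfam X W w w \<psi>" by (rule pathfam_mono[OF \<psi>U])
  have fW: "pathfam X W w y f" by (rule pathfam_mono[OF f])
  define F where "F = join_fam \<psi> f"
  have F: "pathfam X W w y F" unfolding F_def by (rule pathfam_join[OF \<psi> fW])

  have GF: "pathfam_homotopic X ?SX South (pole b) (G \<circ> F) (merid b)"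
  proof -
    have 1: "pathfam_homotopic X ?SX South South (G \<circ> \<psi>) l"
    proof -
      have "pathfam_homotopic Y ?SX South South (\<mu>' \<circ> (gU \<circ> \<phi>)) (\<mu>' \<circ> merid (Some y0))"
        using pathfam_homotopic_compose_left[OF gU(3) \<mu>'c] \<mu>'S by simp
      also have "pathfam_homotopic Y ?SX South South (\<mu>' \<circ> merid (Some y0)) \<mu>" unfolding \<mu>'_def
      proof (rule susp_lift_merid[OF \<mu>(1)])
        have S: "South \<in> topspace ?SX" using X by (simp add: South_in_suspension)
        show "a \<in> topspace Y \<and> South = South \<and> pathfam_homotopic (subtopology Y {a}) ?SX South South \<mu> (\<lambda>_. South)"
          if "Some y0 = Some a" for a
          using that y0 \<mu>(2) pathfam_restrict[OF \<mu>(1)] by (auto intro!: pathfam_homotopic_eq)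
        show "South \<in> topspace ?SX" by (rule S)
      qed
      finally have "pathfam_homotopic X ?SX South South (\<lambda>(x, s). (\<mu>' \<circ> (gU \<circ> \<phi>)) (q x, s)) (\<lambda>(x, s). \<mu> (q x, s))"
        by (rule pathfam_homotopic_compose_right[OF _ qc])
      note 2 = pathfam_homotopic_trans[OF this \<mu>(3)]
      have "pathfam_homotopic X ?SX South South (G \<circ> \<psi>) (\<lambda>(x, s). (\<mu>' \<circ> (gU \<circ> \<phi>)) (q x, s))"
      proof (rule pathfam_homotopic_sym[OF pathfam_homotopic_eq[OF pathfam_homotopic_imp_pathfam(1)[OF 2]]])
        fix a and s :: real assume "a \<in> topspace X" "s \<in> {0..1}"
        then have "\<psi> (a, s) \<in> U"
          using \<psi>U continuous_map_app[of "prod_topology X I01" ?WU \<psi> "(a, s)"] by (auto simp: pathfam_def)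
        then show "(\<lambda>(x, s). (\<mu>' \<circ> (gU \<circ> \<phi>)) (q x, s)) (a, s) = (G \<circ> \<psi>) (a, s)"
          using GU by (auto simp: \<psi>_def)
      qed
      from pathfam_homotopic_trans[OF this 2] show ?thesis .
    qed
    have 2: "pathfam_homotopic X ?SX South (pole b) (G \<circ> f) r"
    proof (rule pathfam_homotopic_sym[OF pathfam_homotopic_eq[OF rX]])
      fix a and s :: real assume "a \<in> topspace X" "s \<in> {0..1}"
      then have "f (a, s) \<in> V"
        using f continuous_map_app[of "prod_topology X I01" ?WV f "(a, s)"] by (auto simp: pathfam_def)
      then show "r (a, s) = (G \<circ> f) (a, s)" by (simp add: G_def r_def)
    qed
    \<comment> \<open>The product of \<open>l\<close> and \<open>r\<close> is meridian times inverse
      of \<open>r\<close> times \<open>r\<close>, which cancels to the meridian.\<close>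
    have "pathfam_homotopic X ?SX South (pole b) (G \<circ> F) (join_fam l r)"
      unfolding F_def join_fam_comp by (rule pathfam_homotopic_join[OF 1 2])
    also have "pathfam_homotopic X ?SX South (pole b) \<dots> (merid b)"
      unfolding l_def by (rule pathfam_homotopic_cancel_right'[OF mX rX])
    finally show ?thesis .
  qed

  define F' where "F' = susp_lift w y F"
  have F'c: "continuous_map ?SX W F'" unfolding F'_def by (rule continuous_map_susp_lift[OF F])
  have F'AA: "continuous_map ?SA W F'" using continuous_map_compose[OF iA F'c] by simp
  have F'S: "F' South = w" by (simp add: F'_def)
  have bX: "a \<in> topspace X \<and> y = w \<and> pathfam_homotopic (subtopology X {a}) W w w F (\<lambda>_. w)" if "b = Some a" for a
  proof -
    have a: "a \<in> A" "a \<in> topspace X" "y = w" and fa: "pathfam_homotopic (subtopology ?AA {a}) ?WV w w f (\<lambda>_. w)"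
      using b[OF that] by auto
    have "subtopology ?AA {a} = subtopology X {a}" using a by (simp add: subtopology_subtopology)
    then have f': "pathfam_homotopic (subtopology X {a}) W w w f (\<lambda>_. w)"
      using pathfam_homotopic_mono[OF fa] by simp
    have "continuous_map (subtopology X {a}) (subtopology Y {y0}) q"
      by (rule continuous_map_into_subtopology[OF continuous_map_from_subtopology[OF qc]]) (use qA a in auto)
    from pathfam_homotopic_mono[OF pathfam_homotopic_compose_right[OF \<phi>0 this]]
    have "pathfam_homotopic (subtopology X {a}) W w w \<psi> (\<lambda>_. w)"
      unfolding \<psi>_def by (simp add: case_prod_unfold)
    from pathfam_homotopic_join[OF this f']
    have "pathfam_homotopic (subtopology X {a}) W w w F (join_fam (\<lambda>_. w) (\<lambda>_. w))" unfolding F_def .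
    then show ?thesis using a by simp
  qed
  \<comment> \<open>Over \<open>A\<close> the factor \<open>\<psi>\<close> runs through the base
    point of \<open>Y\<close>, where \<open>\<phi>\<close> is null. What remains is
    \<open>f\<close>, which \<open>gV\<close> inverts.\<close>
  have FA: "pathfam_homotopic ?AA W w y F f"
  proof -
    have "continuous_map ?AA (subtopology Y {y0}) q"
      by (rule continuous_map_into_subtopology[OF continuous_map_from_subtopology[OF qc]]) (use qA in auto)
    from pathfam_homotopic_mono[OF pathfam_homotopic_compose_right[OF \<phi>0 this]]
    have "pathfam_homotopic ?AA W w w \<psi> (\<lambda>_. w)"
      unfolding \<psi>_def by (simp add: case_prod_unfold)
    from pathfam_homotopic_join[OF this pathfam_homotopic_refl[OF pathfam_restrict[OF fW]]]
    show ?thesis unfolding F_def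
      by (rule pathfam_homotopic_trans[OF _ pathfam_homotopic_join_const_left[OF pathfam_restrict[OF fW]]])
  qed
  have HV: "homotopic_with (\<lambda>k. k w = w \<and> k y = y) ?WV W (F' \<circ> gV) id"
  proof -
    have "homotopic_with (\<lambda>k. k w = w \<and> k y = y) ?WV W (F' \<circ> gV) (susp_lift w y f \<circ> gV)" unfolding F'_def
    proof (rule homotopic_with_compose_continuous_map_right[OF susp_lift_homotopic[OF FA] gV(1)])
      show "(j \<circ> gV) w = w \<and> (j \<circ> gV) y = y" if "j South = w \<and> j North = y" for j
        using that gV(2,3) b by (cases b) (auto simp: pole_def)
    qed
    also have "homotopic_with (\<lambda>k. k w = w \<and> k y = y) ?WV W (susp_lift w y f \<circ> gV) id"
      using homotopic_with_compose_continuous_map_left[OF gV(5) continuous_map_id_subt] by auto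
    finally (homotopic_with_trans) show ?thesis .
  qed
  have HU: "homotopic_with (\<lambda>k. k w = w) ?WU W ((F' \<circ> \<mu>') \<circ> gU) id"
  proof -
    define m where "m = F' \<circ> \<mu>"
    have m: "pathfam Y W w w m" unfolding m_def using pathfam_compose_left[OF \<mu>(1) F'c] F'S by simp
    have \<phi>W: "pathfam Y W w w \<phi>" by (rule pathfam_mono[OF \<phi>])
    have mm: "pathfam Y W w w (join_fam m (rev_fam \<phi>))" by (rule pathfam_join[OF m pathfam_rev[OF \<phi>W]])
    \<comment> \<open>Both families live on \<open>Y\<close> and are compared after pulling back to
      \<open>X\<close>: there \<open>F'\<close> turns \<open>l\<close> into \<open>F\<close> times
      the inverse of \<open>f\<close>, which cancels to \<open>\<psi>\<close>. The pull-back is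
      injective by \<open>descend_null_homotopy'\<close>, with \<open>r\<close> providing the stable
      retraction.\<close>
    have m\<phi>: "pathfam_homotopic Y W w w m \<phi>"
    proof -
      have "pathfam_homotopic Y W w w (join_fam m (rev_fam \<phi>)) (\<lambda>_. w)"
      proof (rule descend_null_homotopy'[OF ndr q A mm])
        have "pathfam_homotopic (subtopology Y {y0}) W w w m (\<lambda>_. w)"
          using pathfam_restrict[OF m] \<mu>(2) F'S by (intro pathfam_homotopic_eq) (auto simp: m_def)
        from pathfam_homotopic_join[OF this pathfam_homotopic_rev[OF pathfam_homotopic_mono[OF \<phi>0]]]
        show "pathfam_homotopic (subtopology Y {y0}) W w w (join_fam m (rev_fam \<phi>)) (\<lambda>_. w)"
          by simp
        have "pathfam_homotopic X W w w (F' \<circ> (\<lambda>(x, s). \<mu> (q x, s))) (F' \<circ> l)"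
          using pathfam_homotopic_compose_left[OF \<mu>(3) F'c] F'S by simp
        moreover have "F' \<circ> (\<lambda>(x, s). \<mu> (q x, s)) = (\<lambda>(x, s). m (q x, s))" by (auto simp: m_def)
        ultimately have "pathfam_homotopic X W w w (\<lambda>(x, s). m (q x, s)) (F' \<circ> l)" by simp
        also have "pathfam_homotopic X W w w (F' \<circ> l) (join_fam F (rev_fam f))"
        proof -
          have 1: "pathfam_homotopic X W w y (F' \<circ> merid b) F"
            unfolding F'_def by (rule susp_lift_merid[OF F bX wy(4)])
          have "pathfam_homotopic X W w y ((F' \<circ> gV) \<circ> f) (id \<circ> f)"
            by (rule pathfam_homotopic_map[OF HV f])
          then have 2: "pathfam_homotopic X W w y (F' \<circ> r) f" by (simp add: r_def o_assoc)
          show ?thesis unfolding l_def join_fam_comp rev_fam_comp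
            by (rule pathfam_homotopic_join[OF 1 pathfam_homotopic_rev[OF 2]])
        qed
        also have "pathfam_homotopic X W w w (join_fam F (rev_fam f)) \<psi>"
          unfolding F_def by (rule pathfam_homotopic_cancel_right[OF \<psi> fW])
        finally have "pathfam_homotopic X W w w (\<lambda>(x, s). m (q x, s)) \<psi>" .
        from pathfam_homotopic_join[OF this pathfam_homotopic_refl[OF pathfam_rev[OF \<psi>]]]
        have "pathfam_homotopic X W w w (join_fam (\<lambda>(x, s). m (q x, s)) (rev_fam \<psi>)) (\<lambda>_. w)"
          by (rule pathfam_homotopic_trans[OF _ pathfam_homotopic_join_rev[OF \<psi>]])
        moreover have "(\<lambda>(x, s). join_fam m (rev_fam \<phi>) (q x, s)) = join_fam (\<lambda>(x, s). m (q x, s)) (rev_fam \<psi>)"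
          by (auto simp: join_fam_def rev_fam_def \<psi>_def)
        ultimately show "pathfam_homotopic X W w w (\<lambda>(x, s). join_fam m (rev_fam \<phi>) (q x, s)) (\<lambda>_. w)" by simp
        have rt: "pathfam X' ?SA North (pole b) (ret b)" for X' :: "'a susp topology"
          by (rule pathfam_ret) (use A tA b in auto)
        \<comment> \<open>\<open>r\<close> ends at \<open>pole b\<close>. Undoing the return leg
          makes it end at North, as required of a family representing a map of unreduced
          suspensions.\<close>
        show "pathfam X ?SA South North (join_fam r (rev_fam (ret b)))"
          by (rule pathfam_join[OF r pathfam_rev[OF rt]])
        have "pathfam_homotopic ?AA ?SA South North (join_fam r (rev_fam (ret b))) (join_fam (merid b) (rev_fam (ret b)))"
          by (rule pathfam_homotopic_join[OF rA pathfam_homotopic_refl[OF pathfam_rev[OF rt]]])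
        also have "pathfam_homotopic ?AA ?SA South North \<dots> susp_point"
          unfolding merid_def by (rule pathfam_homotopic_cancel_right[OF pathfam_susp_point rt])
        finally show "pathfam_homotopic ?AA ?SA South North (join_fam r (rev_fam (ret b))) susp_point" .
      qed
      from pathfam_homotopic_join[OF this pathfam_homotopic_refl[OF \<phi>W]]
      have "pathfam_homotopic Y W w w (join_fam (join_fam m (rev_fam \<phi>)) \<phi>) \<phi>"
        by (rule pathfam_homotopic_trans[OF _ pathfam_homotopic_join_const_left[OF \<phi>W]])
      then show ?thesis
        by (rule pathfam_homotopic_trans[OF pathfam_homotopic_sym[OF pathfam_homotopic_cancel_right'[OF m \<phi>W]]])
    qed
    have "homotopic_with (\<lambda>k. k w = w) ?WU W (susp_lift w w m \<circ> gU) (susp_lift w w \<phi> \<circ> gU)"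
      by (rule homotopic_with_compose_continuous_map_right[OF susp_lift_homotopic[OF m\<phi>] gU(1)]) (use gU(2) in auto)
    also have "homotopic_with (\<lambda>k. k w = w) ?WU W (susp_lift w w \<phi> \<circ> gU) id"
      using homotopic_with_compose_continuous_map_left[OF gU(4) continuous_map_id_subt] by auto
    finally (homotopic_with_trans) have h: "homotopic_with (\<lambda>k. k w = w) ?WU W (susp_lift w w m \<circ> gU) id" .
    have eq: "((F' \<circ> \<mu>') \<circ> gU) v = (susp_lift w w m \<circ> gU) v" if v: "v \<in> topspace ?WU" for v
    proof -
      obtain a s where "gU v = susp_point (a, s)" using continuous_map_app[OF gU(1) v] suspensionE by metis
      then show ?thesis by (auto simp: \<mu>'_def m_def susp_point_def F'S)
    qed
    show ?thesis
      by (rule homotopic_with_eq[OF h eq]) (use wU wy in auto)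
  qed
  have FG: "homotopic_with (\<lambda>k. \<forall>x \<in> {w, y}. k x = id x) W W (F' \<circ> G) id"
  proof (rule homotopic_with_paste[of "{True, False}" _ "\<lambda>c. if c then V else U"])
    fix i :: bool
    show "homotopic_with (\<lambda>k. \<forall>x\<in>{w, y} \<inter> (if i then V else U). k x = id x)
           (subtopology W (if i then V else U)) W (F' \<circ> G) id"
    proof (cases i)
      case True
      have "homotopic_with (\<lambda>k. k w = w \<and> k y = y) ?WV W (F' \<circ> G) id"
        by (rule homotopic_with_eq[OF HV]) (use wy in \<open>auto simp: G_def\<close>)
      then show ?thesis using True by (auto elim!: homotopic_with_mono)
    next
      case False
      have "homotopic_with (\<lambda>k. k w = w) ?WU W (F' \<circ> G) id"
        by (rule homotopic_with_eq[OF HU]) (use wU wy in \<open>auto simp: GU\<close>)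
      then show ?thesis using False W(4) wy by (auto elim!: homotopic_with_mono)
    qed
  qed (use W wy in auto)
  have "homotopic_with (\<lambda>k. k w = w \<and> k y = y) W W (F' \<circ> G) id"
    by (rule homotopic_with_mono[OF FG]) auto
  moreover have "G w = South" "G y = pole b" using gV(2,3) wy by (auto simp: G_def)
  ultimately have "splits b X W w y F"
    unfolding splits_def using F wy bX GF Gc F'_def by blast
  then show ?thesis unfolding F_def \<psi>_def .
qed

section \<open>Basic splittings and the homotopy equivalence given by a splitting\<close>

lemma pathfam_merid_pointed:
  assumes a: "a \<in> topspace A"
  shows "pathfam A (suspension A) South South (merid (Some a))"
proof -
  have "topspace A \<noteq> {}" using a by blast
  from pathfam_merid[OF this, of "Some a"] a show ?thesis by (simp add: pole_def)
qed

text \<open>The start of the inductive product of loop families. Over a single point every meridian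
  is the one through the base point, and going there and back is null.\<close>

lemma splits_point:
  assumes A: "topspace A = {a}" and V: "topspace V = {v}"
  shows "splits (Some a) A V v v (\<lambda>_. v)"
proof -
  have S: "South \<in> topspace (suspension A)" using A by (simp add: South_in_suspension)
  have "pathfam_homotopic A (suspension A) South South (merid (Some a)) (join_fam susp_point (rev_fam susp_point))"
    by (rule pathfam_homotopic_eq[OF pathfam_merid_pointed])
      (use A in \<open>auto simp: merid_def join_fam_def ret_def rev_fam_def\<close>)
  also have "pathfam_homotopic A (suspension A) South South \<dots> (\<lambda>_. South)"
    by (rule pathfam_homotopic_join_rev[OF pathfam_susp_point])
  finally have 1: "pathfam_homotopic A (suspension A) South South (\<lambda>_. South) (merid (Some a))"
    by (rule pathfam_homotopic_sym)
  have "homotopic_with (\<lambda>k. k v = v \<and> k v = v) V V (susp_lift v v (\<lambda>_. v) \<circ> (\<lambda>_. South)) id"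
    by (rule homotopic_with_equal) (use V in auto)
  then show ?thesis unfolding splits_def
    using 1 S V A by (auto simp: pole_def pathfam_const o_def pathfam_homotopic_refl intro!: exI[of _ "\<lambda>_. South"])
qed

lemma susp_lift_susp_point: "z \<in> topspace (suspension A) \<Longrightarrow> susp_lift South North susp_point z = z"
  by (auto elim!: suspensionE simp: susp_point_def)

lemma susp_lift_merid_id:
  assumes A: "topspace A \<noteq> {}" and b: "\<And>a. b = Some a \<Longrightarrow> a \<in> topspace A"
  shows "homotopic_with (\<lambda>k. k South = South) (suspension A) (suspension A) (susp_lift South (pole b) (merid b)) id"
proof (cases b)
  case None
  have "pathfam_homotopic A (suspension A) South North (merid None) susp_point"
    using pathfam_homotopic_join_const_right[OF pathfam_susp_point] by (simp add: merid_def ret_def[abs_def])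
  from susp_lift_homotopic[OF this]
  have h: "homotopic_with (\<lambda>k. k South = South) (suspension A) (suspension A)
     (susp_lift South North (merid None)) (susp_lift South North susp_point)"
    by (rule homotopic_with_mono) auto
  show ?thesis unfolding None pole_def
    by (simp, rule homotopic_with_eq[OF h]) (use A in \<open>auto simp: susp_lift_susp_point South_in_suspension\<close>)
next
  case (Some a)
  have a: "a \<in> topspace A" using b Some by blast
  let ?m = "merid (Some a)"
  have m: "pathfam A (suspension A) South South ?m"
    by (rule pathfam_merid_pointed[OF a])
  \<comment> \<open>The return leg is cut off gradually: at time t only the part [0, 1 - t/2] of
    each loop is traversed. North accordingly slides along the meridian through \<open>a\<close>
    from South to its own place, and South stays fixed.\<close>
  let ?h = "\<lambda>(t, z). susp_lift South (susp_point (a, t)) (\<lambda>w. ?m (fst w, snd w * (1 - t / 2))) z"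
  have me: "?m (x, s * (1 - t / 2)) = susp_lift South (susp_point (a, t)) (\<lambda>w. ?m (fst w, snd w * (1 - t / 2))) (susp_point (x, s))"
    if "s \<in> {0..1}" "t \<in> {0..1}" for x s t
  proof (cases "s = 1")
    case True
    then show ?thesis using that by (auto simp: merid_def join_fam_def ret_def)
  qed (auto simp: susp_point_def merid_def join_fam_def)
  have "continuous_map (prod_topology I01 (suspension A)) (suspension A) ?h"
  proof (rule continuous_compose_quotient_map[OF quotient_map_homotopy_susp_point])
    let ?X = "prod_topology I01 (prod_topology A I01)"
    have "continuous_map ?X (prod_topology A I01) (\<lambda>w. (fst (snd w), snd (snd w) * (1 - fst w / 2)))"
    proof (intro continuous_map_pairedI continuous_map_fst_comp[OF continuous_map_snd] continuous_map_I01I)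
      show "continuous_map ?X euclideanreal (\<lambda>w. snd (snd w) * (1 - fst w / 2))"
        by (intro cint continuous_map_real_divide continuous_map_I01D[OF continuous_map_fst]
            continuous_map_I01D[OF continuous_map_snd_comp[OF continuous_map_snd]]) auto
    qed (auto intro: mult_le_one)
    moreover have "continuous_map (prod_topology A I01) (suspension A) ?m" using m by (simp add: pathfam_def)
    ultimately have "continuous_map ?X (suspension A) (\<lambda>w. ?m (fst (snd w), snd (snd w) * (1 - fst w / 2)))"
      by (rule continuous_map_comp)
    then show "continuous_map ?X (suspension A) (?h \<circ> (\<lambda>(t, w). (t, susp_point w)))"
      by (rule continuous_map_eq) (auto simp: me)
  qed
  moreover have "?h (0, z) = susp_lift South (pole b) (merid b) z \<and> ?h (1, z) = id z"
    if z: "z \<in> topspace (suspension A)" for z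
  proof -
    obtain x s where "s \<in> {0..1}" "z = susp_point (x, s)" using z by (auto elim: suspensionE)
    then show ?thesis using Some
      by (auto simp: susp_point_def pole_def merid_def join_fam_def)
  qed
  ultimately show ?thesis using A
    by (subst homotopic_with) (auto simp: South_in_suspension intro!: exI[of _ ?h])
qed

text \<open>On the side of \<open>\<Sigma>A\<close> the composite is the self-map given by the
  meridian families. By \<open>susp_lift_merid_id\<close> this is homotopic to the identity also
  when the meridians have been closed up to loops.\<close>

lemma splits_imp_homotopy_equivalence:
  assumes "splits b A V x y f"
  shows "homotopy_equivalence_map (suspension A) V (susp_lift x y f)"
proof -
  obtain g where f: "pathfam A V x y f" "x \<in> topspace V" and g: "continuous_map V (suspension A) g" "g x = South" "g y = pole b"
    "pathfam_homotopic A (suspension A) South (pole b) (g \<circ> f) (merid b)"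
    "homotopic_with (\<lambda>k. k x = x \<and> k y = y) V V (susp_lift x y f \<circ> g) id"
    and b: "\<And>a. b = Some a \<Longrightarrow> a \<in> topspace A"
    using assms unfolding splits_def by blast
  have "South \<in> topspace (suspension A)" using continuous_map_app[OF g(1) f(2)] g(2) by simp
  then have A: "topspace A \<noteq> {}" by (simp add: South_in_suspension)
  have "homotopic_with (\<lambda>_. True) (suspension A) (suspension A) (susp_lift South (pole b) (g \<circ> f)) (susp_lift South (pole b) (merid b))"
    by (rule homotopic_with_mono[OF susp_lift_homotopic[OF g(4)]]) auto
  also have "homotopic_with (\<lambda>_. True) (suspension A) (suspension A) (susp_lift South (pole b) (merid b)) id"
    by (rule homotopic_with_mono[OF susp_lift_merid_id[OF A b]]) auto
  finally (homotopic_with_trans) have h: "homotopic_with (\<lambda>_. True) (suspension A) (suspension A) (susp_lift South (pole b) (g \<circ> f)) id" .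
  have "homotopic_with (\<lambda>_. True) (suspension A) (suspension A) (g \<circ> susp_lift x y f) id"
    by (rule homotopic_with_eq[OF h]) (auto elim!: suspensionE simp: susp_point_def g(2,3))
  moreover have "homotopic_with (\<lambda>_. True) V V (susp_lift x y f \<circ> g) id"
    by (rule homotopic_with_mono[OF g(5)]) auto
  ultimately show ?thesis unfolding homotopy_equivalence_map_def
    using continuous_map_susp_lift[OF f(1)] g(1) by blast
qed

text \<open>Closing up the meridians along the one through \<open>a\<close> changes the
  homeomorphism only up to homotopy. Each wedge summand enters the induction in this form.\<close>

lemma splits_homeomorphic_pointed:
  assumes e: "homeomorphic_maps (suspension A) V e e'" and a: "a \<in> topspace A"
  shows "splits (Some a) A V (e South) (e South) (e \<circ> merid (Some a))"
proof -
  have A: "topspace A \<noteq> {}" using a by blast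
  have ec: "continuous_map (suspension A) V e" "continuous_map V (suspension A) e'"
    and ee: "\<And>z. z \<in> topspace (suspension A) \<Longrightarrow> e' (e z) = z" "\<And>v. v \<in> topspace V \<Longrightarrow> e (e' v) = v"
    using e by (auto simp: homeomorphic_maps_def)
  have S: "South \<in> topspace (suspension A)" using A by (simp add: South_in_suspension)
  have m: "pathfam A (suspension A) South South (merid (Some a))"
    by (rule pathfam_merid_pointed[OF a])
  let ?Aa = "subtopology A {a}"
  have "pathfam_homotopic ?Aa (suspension A) South South (merid (Some a)) (join_fam susp_point (rev_fam susp_point))"
    by (rule pathfam_homotopic_eq[OF pathfam_restrict[OF m]])
      (use a in \<open>auto simp: merid_def join_fam_def ret_def rev_fam_def\<close>)
  also have "pathfam_homotopic ?Aa (suspension A) South South \<dots> (\<lambda>_. South)"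
    by (rule pathfam_homotopic_join_rev[OF pathfam_restrict[OF pathfam_susp_point]])
  finally have 1: "pathfam_homotopic ?Aa V (e South) (e South) (e \<circ> merid (Some a)) (\<lambda>_. e South)"
    using pathfam_homotopic_compose_left[OF _ ec(1)] by (force simp: o_def)
  have 2: "pathfam_homotopic A (suspension A) South South (e' \<circ> (e \<circ> merid (Some a))) (merid (Some a))"
  proof (rule pathfam_homotopic_sym[OF pathfam_homotopic_eq[OF m]])
    fix x and s :: real assume "x \<in> topspace A" "s \<in> {0..1}"
    then have "merid (Some a) (x, s) \<in> topspace (suspension A)"
      using m continuous_map_app[of "prod_topology A I01" "suspension A" "merid (Some a)" "(x, s)"]
      by (auto simp: pathfam_def)
    then show "merid (Some a) (x, s) = (e' \<circ> (e \<circ> merid (Some a))) (x, s)" by (simp add: ee)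
  qed
  have "homotopic_with (\<lambda>k. k (e South) = e South) V V ((e \<circ> susp_lift South South (merid (Some a))) \<circ> e') ((e \<circ> id) \<circ> e')"
    using homotopic_with_compose_continuous_map_right[OF homotopic_with_compose_continuous_map_left[OF
        susp_lift_merid_id[OF A, of "Some a"] ec(1), where q = "\<lambda>k. k South = e South"] ec(2),
        where q = "\<lambda>k. k (e South) = e South"] a ee(1)[OF S]
    by (auto simp: pole_def)
  then have h: "homotopic_with (\<lambda>k. k (e South) = e South) V V (e \<circ> susp_lift South South (merid (Some a)) \<circ> e') ((e \<circ> id) \<circ> e')" .
  have "homotopic_with (\<lambda>k. k (e South) = e South \<and> k (e South) = e South) V V
      (susp_lift (e South) (e South) (e \<circ> merid (Some a)) \<circ> e') id"
    unfolding conj_absorb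
  proof (rule homotopic_with_eq[OF h])
    fix v assume v: "v \<in> topspace V"
    obtain x s where "e' v = susp_point (x, s)" using continuous_map_app[OF ec(2) v] by (auto elim: suspensionE)
    then show "(susp_lift (e South) (e South) (e \<circ> merid (Some a)) \<circ> e') v = (e \<circ> susp_lift South South (merid (Some a)) \<circ> e') v"
      by (auto simp: susp_point_def)
  qed (use ee(2) continuous_map_app[OF ec(1) S] in auto)
  then show ?thesis unfolding splits_def
    using 1 2 a continuous_map_app[OF ec(1) S] pathfam_compose_left[OF m ec(1)] ec(2) ee(1)[OF S]
    by (auto simp: pole_def intro!: exI[of _ e'])
qed

lemma splits_homeomorphic_unpointed:
  assumes e: "homeomorphic_maps (suspension A) V e e'" and A: "topspace A \<noteq> {}"
  shows "splits None A V (e South) (e North) (e \<circ> susp_point)"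
proof -
  have ec: "continuous_map (suspension A) V e" "continuous_map V (suspension A) e'"
    and ee: "\<And>z. z \<in> topspace (suspension A) \<Longrightarrow> e' (e z) = z" "\<And>v. v \<in> topspace V \<Longrightarrow> e (e' v) = v"
    using e by (auto simp: homeomorphic_maps_def)
  have S: "South \<in> topspace (suspension A)" "North \<in> topspace (suspension A)"
    using A by (simp_all add: South_in_suspension North_in_suspension)
  have "pathfam_homotopic A (suspension A) South North (e' \<circ> (e \<circ> susp_point)) susp_point"
    by (rule pathfam_homotopic_sym[OF pathfam_homotopic_eq[OF pathfam_susp_point]]) (simp add: ee susp_point_in)
  also have "pathfam_homotopic A (suspension A) South North susp_point (merid None)"
    using pathfam_homotopic_sym[OF pathfam_homotopic_join_const_right[OF pathfam_susp_point]]
    by (simp add: merid_def ret_def[abs_def])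
  finally have 1: "pathfam_homotopic A (suspension A) South North (e' \<circ> (e \<circ> susp_point)) (merid None)" .
  have 2: "(susp_lift (e South) (e North) (e \<circ> susp_point) \<circ> e') v = v" if v: "v \<in> topspace V" for v
  proof -
    obtain x s where "e' v = susp_point (x, s)" using continuous_map_app[OF ec(2) v] by (auto elim: suspensionE)
    then have "(susp_lift (e South) (e North) (e \<circ> susp_point) \<circ> e') v = e (e' v)"
      by (auto simp: susp_point_def)
    then show ?thesis using ee(2) v by simp
  qed
  have V: "e South \<in> topspace V" "e North \<in> topspace V" using continuous_map_app[OF ec(1)] S by auto
  have "homotopic_with (\<lambda>k. k (e South) = e South \<and> k (e North) = e North) V V
      (susp_lift (e South) (e North) (e \<circ> susp_point) \<circ> e') id"
    by (rule homotopic_with_symD, rule homotopic_with_equal) (use 2 V in auto)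
  then show ?thesis unfolding splits_def
    using 1 V pathfam_compose_left[OF pathfam_susp_point ec(1)] ec(2) ee(1) S
    by (auto simp: pole_def intro!: exI[of _ e'])
qed

section \<open>Wedges\<close>

lemma wedge_incl_simps [simp]: "wedge_incl b (i, b) = None"
  by (simp add: wedge_incl_def)

lemma quotient_map_wedge: "quotient_map (sum_topology Z I) (wedge b I Z) (wedge_incl b)"
  unfolding wedge_def by (rule quotient_map_quotient_topology)

lemma topspace_wedge: "topspace (wedge b I Z) = wedge_incl b ` (SIGMA i:I. topspace (Z i))"
  using quotient_imp_surjective_map[OF quotient_map_wedge[of Z I b]] by (simp add: o_def)

lemma wedgeE:
  assumes "w \<in> topspace (wedge b I Z)"
  obtains i z where "i \<in> I" "z \<in> topspace (Z i)" "w = wedge_incl b (i, z)"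
  using assms unfolding topspace_wedge by auto

lemma continuous_map_wedge:
  assumes "\<And>i. i \<in> I \<Longrightarrow> continuous_map (Z i) C (\<lambda>z. f (wedge_incl b (i, z)))"
  shows "continuous_map (wedge b I Z) C f"
proof (rule continuous_compose_quotient_map[OF quotient_map_wedge])
  show "continuous_map (sum_topology Z I) C (f \<circ> wedge_incl b)"
    unfolding continuous_map_def
  proof (intro conjI allI impI)
    show "f \<circ> wedge_incl b \<in> topspace (sum_topology Z I) \<rightarrow> topspace C"
      using continuous_map_app[OF assms] by auto
    fix U assume U: "openin C U"
    show "openin (sum_topology Z I) {x \<in> topspace (sum_topology Z I). (f \<circ> wedge_incl b) x \<in> U}"
      unfolding openin_sum_topology
    proof (intro conjI ballI)
      fix i assume i: "i \<in> I"
      have "{x. (i, x) \<in> {x \<in> topspace (sum_topology Z I). (f \<circ> wedge_incl b) x \<in> U}}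
          = {x \<in> topspace (Z i). f (wedge_incl b (i, x)) \<in> U}" using i by auto
      then show "openin (Z i) {x. (i, x) \<in> {x \<in> topspace (sum_topology Z I). (f \<circ> wedge_incl b) x \<in> U}}"
        using openin_continuous_map_preimage[OF assms[OF i] U] by simp
    qed auto
  qed
qed

lemma continuous_map_wedge_incl:
  "i \<in> I \<Longrightarrow> continuous_map (Z i) (wedge b I Z) (\<lambda>z. wedge_incl b (i, z))"
  using continuous_map_compose[OF continuous_map_component_injection quotient_imp_continuous_map[OF quotient_map_wedge]]
  by (force simp: o_def)

definition wedge_proj :: "'b \<Rightarrow> 'i \<Rightarrow> ('i \<times> 'b) option \<Rightarrow> 'b" where
  "wedge_proj b i w = (case w of None \<Rightarrow> b | Some (k, z) \<Rightarrow> if k = i then z else b)"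

lemma wedge_proj_incl: "wedge_proj b i (wedge_incl b (k, z)) = (if k = i then z else b)"
  by (auto simp: wedge_proj_def wedge_incl_def)

lemma continuous_map_wedge_proj:
  assumes "b \<in> topspace (Z i)"
  shows "continuous_map (wedge b I Z) (Z i) (wedge_proj b i)"
proof (rule continuous_map_wedge)
  show "continuous_map (Z k) (Z i) (\<lambda>z. wedge_proj b i (wedge_incl b (k, z)))" for k
    using assms by (cases "k = i") (auto simp: wedge_proj_incl)
qed

text \<open>It contains the base point even for empty \<open>J\<close>, so that parts with disjoint
  index sets meet exactly in the base point.\<close>

definition wedge_part :: "'i set \<Rightarrow> ('i \<times> 'b) option set" where
  "wedge_part J = {w. \<forall>i z. w = Some (i, z) \<longrightarrow> i \<in> J}"

lemma wedge_part_simps [simp]: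
  "None \<in> wedge_part J" "Some (i, z) \<in> wedge_part J \<longleftrightarrow> i \<in> J"
  by (auto simp: wedge_part_def)

lemma wedge_part_Int: "wedge_part J \<inter> wedge_part K = wedge_part (J \<inter> K)"
  by (auto simp: wedge_part_def)

lemma wedge_part_empty: "wedge_part {} = {None}"
  unfolding wedge_part_def by auto (metis not_None_eq surj_pair)

lemma wedge_part_Un: "wedge_part J \<union> wedge_part K = wedge_part (J \<union> K)"
proof -
  have "w \<in> wedge_part J \<union> wedge_part K \<longleftrightarrow> w \<in> wedge_part (J \<union> K)" for w :: "('a \<times> 'b) option"
    by (cases w) auto
  then show ?thesis by blast
qed

lemma wedge_part_mono: "J \<subseteq> K \<Longrightarrow> wedge_part J \<subseteq> wedge_part K"
  by (auto simp: wedge_part_def)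

lemma wedge_incl_part: "i \<in> J \<Longrightarrow> wedge_incl b (i, z) \<in> wedge_part J"
  by (auto simp: wedge_incl_def)

lemma topspace_wedge_subset: "topspace (wedge b I Z) \<subseteq> wedge_part I"
  by (auto elim!: wedgeE simp: wedge_incl_part)

lemma closedin_wedge_part:
  assumes "\<And>i. i \<in> I \<Longrightarrow> closedin (Z i) {b}"
  shows "closedin (wedge b I Z) (topspace (wedge b I Z) \<inter> wedge_part J)"
proof -
  let ?S = "{p \<in> topspace (sum_topology Z I). wedge_incl b p \<in> topspace (wedge b I Z) \<inter> wedge_part J}"
  have "closedin (sum_topology Z I) ?S"
    unfolding closedin_sum_topology
  proof (intro conjI ballI)
    fix i assume i: "i \<in> I"
    have "{x. (i, x) \<in> ?S} = (if i \<in> J then topspace (Z i) else {b})"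
      using i closedin_subset[OF assms[OF i]] by (auto simp: topspace_wedge wedge_incl_def split: if_splits)
    then show "closedin (Z i) {x. (i, x) \<in> ?S}" using assms[OF i] by auto
  qed auto
  then show ?thesis
    using quotient_map_wedge[of Z I b] unfolding quotient_map_closedin by (meson inf_le1)
qed

lemma subtopology_wedge_part:
  assumes "M \<subseteq> N"
  shows "subtopology (subtopology W (wedge_part N)) (topspace (subtopology W (wedge_part N)) \<inter> wedge_part M)
    = subtopology W (wedge_part M)"
proof -
  have "wedge_part N \<inter> wedge_part M = wedge_part M"
    using assms by (simp add: wedge_part_Int inf.absorb2)
  then show ?thesis by (metis subtopology_restrict subtopology_subtopology)
qed

lemma closedin_subtopology_wedge_part:
  assumes "closedin W (topspace W \<inter> wedge_part M)"
  shows "closedin (subtopology W S) (topspace (subtopology W S) \<inter> wedge_part M)"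
proof -
  have "topspace (subtopology W S) \<inter> wedge_part M = (topspace W \<inter> wedge_part M) \<inter> S" by auto
  then show ?thesis using assms closedin_subtopology by blast
qed

lemma wedge_None: "i \<in> I \<Longrightarrow> b \<in> topspace (Z i) \<Longrightarrow> None \<in> topspace (wedge b I Z)"
  unfolding topspace_wedge by (force simp: wedge_incl_def)

lemma homeomorphic_wedge_summand:
  assumes i: "i \<in> I" and b: "b \<in> topspace (Z i)"
  shows "homeomorphic_maps (Z i) (subtopology (wedge b I Z) (wedge_part {i}))
    (\<lambda>z. wedge_incl b (i, z)) (wedge_proj b i)"
  unfolding homeomorphic_maps_def
proof (intro conjI ballI)
  show "continuous_map (Z i) (subtopology (wedge b I Z) (wedge_part {i})) (\<lambda>z. wedge_incl b (i, z))"
    by (rule continuous_map_into_subtopology[OF continuous_map_wedge_incl[OF i]]) (auto simp: wedge_incl_part)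
  show "continuous_map (subtopology (wedge b I Z) (wedge_part {i})) (Z i) (wedge_proj b i)"
    by (rule continuous_map_from_subtopology[OF continuous_map_wedge_proj[of b Z i, OF b]])
  show "wedge_incl b (i, wedge_proj b i w) = w"
    if "w \<in> topspace (subtopology (wedge b I Z) (wedge_part {i}))" for w
  proof (cases w)
    case (Some a)
    moreover obtain k z where "a = (k, z)" by (cases a)
    ultimately have "k = i" "Some (i, z) \<in> topspace (wedge b I Z)" "w = Some (i, z)" using that by auto
    moreover from this have "z \<noteq> b" by (auto elim!: wedgeE simp: wedge_incl_def split: if_splits)
    ultimately show ?thesis by (simp add: wedge_proj_def wedge_incl_def)
  qed (simp add: wedge_proj_def)
qed (simp add: wedge_proj_incl)

text \<open>The preimage in the cylinder is its closed bottom. The intersection covers the case of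
  empty \<open>A\<close>, when the suspension has no poles.\<close>

lemma closedin_South:
  shows "closedin (suspension A) ({South} \<inter> topspace (suspension A))"
proof -
  have "{w \<in> topspace (prod_topology A I01). susp_point w \<in> {South} \<inter> topspace (suspension A)} =
     {w \<in> topspace (prod_topology A I01). snd w \<in> {0}}"
  proof -
    have "susp_point w = South \<longleftrightarrow> snd w = 0" for w :: "'a susp \<times> real" by (simp add: susp_point_def)
    moreover have "susp_point w \<in> topspace (suspension A)" if "w \<in> topspace (prod_topology A I01)" for w
      using continuous_map_app[OF quotient_imp_continuous_map[OF quotient_map_susp_point] that] .
    ultimately show ?thesis by auto
  qed
  moreover have "closedin (prod_topology A I01) {w \<in> topspace (prod_topology A I01). snd w \<in> {0}}"
    by (rule closedin_continuous_map_preimage[OF continuous_map_snd]) (simp add: closed_subset)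
  moreover have "closedin (prod_topology A I01) {w \<in> topspace (prod_topology A I01). susp_point w \<in> U} \<longleftrightarrow>
      closedin (suspension A) U" if "U \<subseteq> topspace (suspension A)" for U
    using quotient_map_susp_point[of A] that unfolding quotient_map_closedin by blast
  from this[OF inf_le2[of "{South}" "topspace (suspension A)"]] calculation show ?thesis by simp
qed

text \<open>The product of the loop families that run through the summand \<open>i\<close> as
  prescribed by \<open>\<pi> i\<close>. The index set is a list because the factors need not commute
  and because triangularity refers to an order.\<close>

primrec wedge_loops :: "('i \<Rightarrow> 'c susp) \<Rightarrow> ('i \<Rightarrow> 'a \<Rightarrow> 'c susp) \<Rightarrow> 'i list \<Rightarrow> 'a \<times> real \<Rightarrow> ('i \<times> 'c susp) option" where
  "wedge_loops y \<pi> [] = (\<lambda>_. None)"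
| "wedge_loops y \<pi> (i # L) = join_fam (\<lambda>(x, s). wedge_incl South (i, merid (Some (y i)) (\<pi> i x, s))) (wedge_loops y \<pi> L)"

text \<open>The spaces \<open>Y i\<close> are retracts of \<open>Yo\<close> with common base point
  \<open>p\<close>, so the matrix with entries \<open>\<pi> i \<circ> \<sigma> k\<close> has
  identities on the diagonal. Its vanishing on one side of the diagonal depends on the order of a
  list and is a premise of \<open>splits_loops\<close>. \<open>J\<close> indexes the retracts and
  \<open>I\<close> the ambient wedge, since the product also has to serve as one factor inside a
  larger wedge.\<close>

locale triangular_wedge =
  fixes Yo :: "'a susp topology" and p :: "'a susp" and I J :: "'i set" and Y :: "'i \<Rightarrow> 'c susp topology"
    and y :: "'i \<Rightarrow> 'c susp" and \<sigma> :: "'i \<Rightarrow> 'c susp \<Rightarrow> 'a susp" and \<pi> :: "'i \<Rightarrow> 'a susp \<Rightarrow> 'c susp"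
  assumes I: "I \<noteq> {}" "J \<subseteq> I" and Y: "\<And>i. i \<in> I \<Longrightarrow> topspace (Y i) \<noteq> {}"
    and y: "\<And>i. i \<in> J \<Longrightarrow> y i \<in> topspace (Y i)" and p: "p \<in> topspace Yo" "closedin Yo {p}"
    and \<sigma>c: "\<And>i. i \<in> J \<Longrightarrow> continuous_map (Y i) Yo (\<sigma> i)"
    and \<pi>c: "\<And>i. i \<in> J \<Longrightarrow> continuous_map Yo (Y i) (\<pi> i)"
    and \<pi>\<sigma>: "\<And>i z. i \<in> J \<Longrightarrow> z \<in> topspace (Y i) \<Longrightarrow> \<pi> i (\<sigma> i z) = z"
    and \<sigma>y: "\<And>i. i \<in> J \<Longrightarrow> \<sigma> i (y i) = p" and \<pi>p: "\<And>i. i \<in> J \<Longrightarrow> \<pi> i p = y i"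
    and \<sigma>cl: "\<And>i. i \<in> J \<Longrightarrow> closedin Yo (\<sigma> i ` topspace (Y i))"
    and ndr: "\<And>i. i \<in> J \<Longrightarrow> NDR_pair (Y i) {y i}"
begin

abbreviation "W \<equiv> wedge South I (\<lambda>i. suspension (Y i))"

definition part :: "'i list \<Rightarrow> 'a susp set" where
  "part L = {p} \<union> (\<Union>i\<in>set L. \<sigma> i ` topspace (Y i))"

abbreviation "loops \<equiv> wedge_loops y \<pi>"

lemma W_None: "None \<in> topspace W"
proof -
  obtain i where "i \<in> I" using I by blast
  then show ?thesis using wedge_None[of i I South "\<lambda>i. suspension (Y i)"] Y by (simp add: South_in_suspension)
qed

lemma closed_part_W: "closedin W (topspace W \<inter> wedge_part M)"
proof (rule closedin_wedge_part)
  fix i assume "i \<in> I"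
  then have "South \<in> topspace (suspension (Y i))" using Y by (simp add: South_in_suspension)
  then show "closedin (suspension (Y i)) {South}" using closedin_South[of "Y i"] by simp
qed

lemma pathfam_summand:
  assumes "i \<in> J"
  shows "pathfam (Y i) (subtopology W (wedge_part {i})) None None (\<lambda>w. wedge_incl South (i, merid (Some (y i)) w))"
proof -
  have "continuous_map (suspension (Y i)) (subtopology W (wedge_part {i})) (\<lambda>z. wedge_incl South (i, z))"
    by (rule continuous_map_into_subtopology[OF continuous_map_wedge_incl[OF subsetD[OF I(2) assms]]]) (auto simp: wedge_incl_part)
  from pathfam_compose_left[OF pathfam_merid_pointed[OF y[OF assms]] this] show ?thesis by (simp add: o_def)
qed

text \<open>The index space \<open>E\<close> is arbitrary, since the same product is formed for the
  retractions of \<open>Yo\<close> and for the faces on the whole of X_n.\<close>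

lemma pathfam_wedge_loops:
  assumes "\<And>i. i \<in> J \<Longrightarrow> continuous_map E (Y i) (\<pi>' i)"
  shows "set L \<subseteq> J \<Longrightarrow> pathfam E (subtopology W (wedge_part (set L))) None None (wedge_loops y \<pi>' L)"
proof (induction L)
  case Nil
  then show ?case using W_None by (simp add: pathfam_const)
next
  case (Cons i L)
  have sub: "pathfam E (subtopology W (wedge_part (set (i # L)))) None None f"
    if "pathfam E (subtopology W (wedge_part M)) None None f" "M \<subseteq> set (i # L)" for f M
  proof -
    have "continuous_map (subtopology W (wedge_part M)) (subtopology W (wedge_part (set (i # L)))) id"
      by (rule continuous_map_into_subtopology[OF continuous_map_id_subt]) (use wedge_part_mono[OF that(2)] in auto)
    from pathfam_compose_left[OF that(1) this] show ?thesis by simp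
  qed
  have "pathfam E (subtopology W (wedge_part {i})) None None (\<lambda>(x, s). wedge_incl South (i, merid (Some (y i)) (\<pi>' i x, s)))"
    using pathfam_compose_right[OF pathfam_summand assms, of i] Cons.prems by simp
  from sub[OF this] have 1: "pathfam E (subtopology W (wedge_part (set (i # L)))) None None
      (\<lambda>(x, s). wedge_incl South (i, merid (Some (y i)) (\<pi>' i x, s)))" by simp
  have "pathfam E (subtopology W (wedge_part (set (i # L)))) None None (wedge_loops y \<pi>' L)"
    by (rule sub[OF Cons.IH]) (use Cons.prems in auto)
  from pathfam_join[OF 1 this] show ?case by simp
qed

lemma closed_part: "set L \<subseteq> J \<Longrightarrow> closedin Yo (part L)"
  unfolding part_def by (intro closedin_Un p closedin_Union) (auto intro: \<sigma>cl)

lemma part_subset: "set L \<subseteq> J \<Longrightarrow> part L \<subseteq> topspace Yo"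
  using closed_part closedin_subset by blast

text \<open>Putting \<open>i\<close> in front of \<open>L\<close> enlarges \<open>part L\<close> by
  the retract \<open>\<sigma> i\<close>. By triangularity \<open>\<pi> i\<close> sends
  \<open>part L\<close> to the base point, so on the enlarged part it is the collapse of
  \<open>part L\<close>, and \<open>splits_step\<close> applies. The family for \<open>L\<close>
  extends over the enlarged part because the retractions are defined on all of
  \<open>Yo\<close>.\<close>

lemma splits_loops:
  "set L \<subseteq> J \<Longrightarrow> distinct L \<Longrightarrow> sorted_wrt (\<lambda>i k. \<forall>z \<in> topspace (Y k). \<pi> i (\<sigma> k z) = y i) L \<Longrightarrow>
    splits (Some p) (subtopology Yo (part L)) (subtopology W (wedge_part (set L))) None None (loops L)"
proof (induction L)
  case Nil
  then show ?case using W_None p by (auto simp: part_def wedge_part_empty intro!: splits_point)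
next
  case (Cons i L)
  then have i: "i \<in> J" "i \<notin> set L" and L: "set L \<subseteq> J" "distinct L"
    and kill: "\<And>k z. k \<in> set L \<Longrightarrow> z \<in> topspace (Y k) \<Longrightarrow> \<pi> i (\<sigma> k z) = y i"
    and sp: "splits (Some p) (subtopology Yo (part L)) (subtopology W (wedge_part (set L))) None None (loops L)"
    by auto
  let ?X = "subtopology Yo (part (i # L))" and ?W = "subtopology W (wedge_part (set (i # L)))"
  let ?Si = "\<sigma> i ` topspace (Y i)"
  have partC: "part (i # L) = ?Si \<union> part L" by (auto simp: part_def)
  have tX: "topspace ?X = part (i # L)" using part_subset[of "i # L"] i L by auto
  have pL: "p \<in> part L" by (simp add: part_def)
  have \<pi>L: "\<pi> i x = y i" if "x \<in> part L" for x using that kill \<pi>p[OF i(1)] by (auto simp: part_def)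
  have Sin: "\<sigma> i (y i) = p" by (rule \<sigma>y[OF i(1)])
  have \<pi>0: "x \<in> part L" if "x \<in> part (i # L)" "\<pi> i x = y i" for x
    using that \<pi>\<sigma>[OF i(1)] Sin pL unfolding partC by auto
  have \<sigma>\<pi>: "\<sigma> i (\<pi> i x) = x" if "x \<in> ?Si" for x using that \<pi>\<sigma>[OF i(1)] by auto
  have Sip: "x = p" if "x \<in> ?Si" "x \<in> part L" for x using \<sigma>\<pi>[OF that(1)] \<pi>L[OF that(2)] Sin by simp
  obtain u h where uh: "NDR_data (Y i) {y i} u h" using ndr[OF i(1)] unfolding NDR_pair_def by blast
  note nd = NDR_dataD[OF uh]
  have \<pi>X: "continuous_map ?X (Y i) (\<pi> i)" by (rule continuous_map_from_subtopology[OF \<pi>c[OF i(1)]])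
  \<comment> \<open>The deformation of \<open>Y i\<close> to its base point is carried over to the
    new retract, while \<open>part L\<close> does not move. The two prescriptions agree at the
    common point \<open>p\<close> because \<open>h\<close> fixes \<open>y i\<close>.\<close>
  define H where "H = (\<lambda>(x, t). if x \<in> part L then x else \<sigma> i (h (\<pi> i x, t)))"
  have HS: "H (x, t) = \<sigma> i (h (\<pi> i x, t))" if "x \<in> ?Si" "t \<in> {0..1}" for x t
  proof (cases "x \<in> part L")
    case True
    then have "x = p" using Sip that by blast
    moreover have "h (y i, t) = y i" using nd(6)[of "y i" t] that by simp
    ultimately show ?thesis using True \<pi>p[OF i(1)] Sin by (simp add: H_def)
  qed (simp add: H_def)
  have Hc: "continuous_map (prod_topology ?X I01) ?X H"
  proof -
    let ?P = "prod_topology ?X I01"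
    have cl: "closedin ?P (C \<times> {0..1})" if "closedin Yo C" "C \<subseteq> part (i # L)" for C
    proof -
      have "closedin ?X C" using that closed_part[of "i # L"] i L by (auto simp: closedin_closed_subtopology)
      then show ?thesis by (simp add: closedin_prod_Times_iff)
    qed
    have "continuous_map ?P Yo H"
    proof (rule continuous_map_paste_closed[OF cl[OF \<sigma>cl[OF i(1)]] cl[OF closed_part[OF L(1)]]])
      show "topspace ?P \<subseteq> ?Si \<times> {0..1} \<union> part L \<times> {0..1}" using tX partC by auto
      have "continuous_map ?P Yo (\<lambda>w. \<sigma> i (h (\<pi> i (fst w), snd w)))"
        by (intro continuous_map_comp[OF _ \<sigma>c[OF i(1)]] continuous_map_comp[OF _ nd(2)] continuous_map_pairedI
            continuous_map_comp[OF continuous_map_fst \<pi>X] continuous_map_snd)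
      then show "continuous_map (subtopology ?P (?Si \<times> {0..1})) Yo (\<lambda>w. \<sigma> i (h (\<pi> i (fst w), snd w)))"
        by (rule continuous_map_from_subtopology)
      show "continuous_map (subtopology ?P (part L \<times> {0..1})) Yo fst"
        by (rule continuous_map_from_subtopology[OF continuous_map_into_fulltopology[OF continuous_map_fst]])
    qed (use HS in \<open>auto simp: H_def partC\<close>)
    moreover have "H w \<in> part (i # L)" if "w \<in> topspace ?P" for w
    proof -
      obtain x t where "w = (x, t)" by (cases w)
      then have w: "w = (x, t)" "x \<in> part (i # L)" "t \<in> {0..1}" using that tX by simp_all
      then have "\<pi> i x \<in> topspace (Y i)" using continuous_map_app[OF \<pi>X] tX by auto
      then show ?thesis using w nd(9) by (auto simp: H_def partC)
    qed
    ultimately show ?thesis by (auto intro: continuous_map_into_subtopology)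
  qed
  have NDR: "NDR_data ?X (part L) (u \<circ> \<pi> i) H"
    unfolding NDR_data_def
  proof (intro conjI ballI impI Hc)
    show "continuous_map ?X I01 (u \<circ> \<pi> i)" by (rule continuous_map_compose[OF \<pi>X nd(1)])
    show "part L = {x \<in> topspace ?X. (u \<circ> \<pi> i) x = 0}"
    proof -
      have "(u \<circ> \<pi> i) x = 0 \<longleftrightarrow> x \<in> part L" if "x \<in> part (i # L)" for x
      proof
        assume "(u \<circ> \<pi> i) x = 0"
        then have "\<pi> i x = y i" using nd(10)[of "\<pi> i x"] continuous_map_app[OF \<pi>X, unfolded tX, OF that] by simp
        then show "x \<in> part L" by (rule \<pi>0[OF that])
      next
        assume "x \<in> part L"
        then show "(u \<circ> \<pi> i) x = 0" using \<pi>L nd(4) by simp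
      qed
      then show ?thesis using tX partC by blast
    qed
    show "H (x, 0) = x" if "x \<in> topspace ?X" for x
    proof (cases "x \<in> part L")
      case False
      then have "x \<in> ?Si" using that tX partC by blast
      then show ?thesis using False \<sigma>\<pi> nd(3) continuous_map_app[OF \<pi>X that] by (simp add: H_def)
    qed (simp add: H_def)
    show "H (a, t) \<in> part L" if "a \<in> part L" for a t using that by (simp add: H_def)
    show "H (x, 1) \<in> part L" if "x \<in> topspace ?X" "(u \<circ> \<pi> i) x < 1" for x
      using that nd(7)[of "\<pi> i x"] continuous_map_app[OF \<pi>X that(1)] Sin pL by (auto simp: H_def)
  qed
  have col: "collapses ?X (part L) (Y i) (\<pi> i) (y i)"
    unfolding collapses_def
  proof (intro conjI ballI impI)
    have "retraction_maps ?X (Y i) (\<pi> i) (\<sigma> i)"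
      unfolding retraction_maps_def
      using \<pi>X \<pi>\<sigma>[OF i(1)] by (auto intro!: continuous_map_into_subtopology \<sigma>c[OF i(1)] simp: partC)
    then show "quotient_map ?X (Y i) (\<pi> i)"
      by (intro retraction_imp_quotient_map) (auto simp: retraction_map_def)
    show "\<pi> i x = y i" if "x \<in> part L" for x by (rule \<pi>L[OF that])
    show "x = x' \<or> x \<in> part L \<and> x' \<in> part L"
      if "x \<in> topspace ?X" "x' \<in> topspace ?X" "\<pi> i x = \<pi> i x'" for x x'
    proof (cases "x \<in> part L \<or> x' \<in> part L")
      case True
      then have "\<pi> i x = y i" "\<pi> i x' = y i" using \<pi>L that(3) by metis+
      then show ?thesis using \<pi>0 that tX by blast
    next
      case False
      then show ?thesis using that tX partC \<sigma>\<pi> by (metis UnE)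
    qed
  qed
  let ?U = "topspace ?W \<inter> wedge_part {i}" and ?V = "topspace ?W \<inter> wedge_part (set L)"
  have WU: "subtopology ?W ?U = subtopology W (wedge_part {i})" "subtopology ?W ?V = subtopology W (wedge_part (set L))"
    by (rule subtopology_wedge_part; auto)+
  have "splits (Some p) ?X ?W None None
     (join_fam (\<lambda>(x, s). (\<lambda>w. wedge_incl South (i, merid (Some (y i)) w)) (\<pi> i x, s)) (loops L))"
  proof (rule splits_step[OF NDR col, of _ ?U ?V])
    show "closedin ?W ?U" "closedin ?W ?V" by (rule closedin_subtopology_wedge_part[OF closed_part_W])+
    show "?U \<union> ?V = topspace ?W"
    proof -
      have "topspace ?W \<subseteq> wedge_part {i} \<union> wedge_part (set L)" by (simp add: wedge_part_Un)
      then show ?thesis by blast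
    qed
    have "wedge_part {i} \<inter> wedge_part (set L) = {None}" using i(2) by (simp add: wedge_part_Int wedge_part_empty)
    moreover have "None \<in> topspace ?W" using W_None by simp
    ultimately show "?U \<inter> ?V = {None}" by blast
    have "subtopology ?X (part L) = subtopology Yo (part L)"
      using partC by (simp add: subtopology_subtopology inf.absorb2)
    then show "splits (Some p) (subtopology ?X (part L)) (subtopology ?W ?V) None None (loops L)"
      unfolding WU using sp by simp
    show "pathfam ?X (subtopology ?W ?V) None None (loops L)"
      unfolding WU by (rule pathfam_restrict[OF pathfam_wedge_loops[OF \<pi>c L(1)]])
    have S: "South \<in> topspace (suspension (Y i))" using y[OF i(1)] by (force simp: South_in_suspension)
    from splits_homeomorphic_pointed[OF homeomorphic_wedge_summand[OF subsetD[OF I(2) i(1)], of South "\<lambda>i. suspension (Y i)", OF S] y[OF i(1)]]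
    show "splits (Some (y i)) (Y i) (subtopology ?W ?U) None None (\<lambda>w. wedge_incl South (i, merid (Some (y i)) w))"
      unfolding WU by (simp add: o_def)
  qed
  then show ?case by simp
qed

end

section \<open>Iterated faces and degeneracies\<close>

text \<open>Here \<open>n\<close> is the dimension of the target and the head of the word is the
  outermost degeneracy. In \<open>faces\<close> it is the dimension of the source and the head acts
  first, so a word of faces cancels the same word of degeneracies letter by letter.\<close>

fun degens :: "'a simpl_space \<Rightarrow> nat \<Rightarrow> nat list \<Rightarrow> 'a \<Rightarrow> 'a" where
  "degens X n [] x = x"
| "degens X n (i # J) x = degen X (n - 1) i (degens X (n - 1) J x)"

fun faces :: "'a simpl_space \<Rightarrow> nat \<Rightarrow> nat list \<Rightarrow> 'a \<Rightarrow> 'a" where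
  "faces X n [] x = x"
| "faces X n (i # J) x = faces X (n - 1) J (face X n i x)"

lemma admissible_0: "admissible n 0 = {[]}"
  by (auto simp: admissible_def)

lemma admissible_Cons: "i # J \<in> admissible n (Suc t) \<longleftrightarrow> i < n \<and> J \<in> admissible i t"
  by (auto simp: admissible_def)

lemma admissible_mono: "n \<le> m \<Longrightarrow> J \<in> admissible n t \<Longrightarrow> J \<in> admissible m t"
  by (auto simp: admissible_def)

lemma admissible_SucE:
  assumes "J \<in> admissible n (Suc t)"
  obtains i J' m where "J = i # J'" "n = Suc m" "i \<le> m" "J' \<in> admissible i t" "J' \<in> admissible m t"
proof -
  obtain i J' where J: "J = i # J'" using assms by (cases J) (auto simp: admissible_def)
  moreover obtain m where "n = Suc m" using assms J by (cases n) (auto simp: admissible_Cons)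
  moreover from assms J have "i < n" "J' \<in> admissible i t" by (simp_all add: admissible_Cons)
  ultimately show ?thesis using admissible_mono[of i m J' t] that[of i J' m] by simp
qed

lemma admissible_le: "J \<in> admissible n t \<Longrightarrow> t \<le> n"
proof (induction t arbitrary: J n)
  case (Suc t)
  from Suc.prems show ?case by (rule admissible_SucE) (use Suc.IH in force)
qed simp

lemma finite_admissible: "finite (admissible n t)"
proof (rule finite_subset)
  show "admissible n t \<subseteq> {J. set J \<subseteq> {..<n} \<and> length J = t}" by (auto simp: admissible_def)
qed (simp add: finite_lists_length_eq)

lemma length_admissible: "J \<in> admissible n t \<Longrightarrow> length J = t"
  by (simp add: admissible_def)

locale simplicial =
  fixes X :: "'a simpl_space"
  assumes simplicial: "simplicial_space X"
begin

abbreviation "L n \<equiv> topspace (level X n)"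
abbreviation "D \<equiv> degen_filtration X"

lemma face_cont: "i \<le> Suc n \<Longrightarrow> continuous_map (level X (Suc n)) (level X n) (face X (Suc n) i)"
  and degen_cont: "j \<le> n \<Longrightarrow> continuous_map (level X n) (level X (Suc n)) (degen X n j)"
  and face_face: "x \<in> L (Suc (Suc n)) \<Longrightarrow> i < j \<Longrightarrow> j \<le> Suc (Suc n) \<Longrightarrow>
        face X (Suc n) i (face X (Suc (Suc n)) j x) = face X (Suc n) (j - 1) (face X (Suc (Suc n)) i x)"
  and degen_degen: "x \<in> L n \<Longrightarrow> i \<le> j \<Longrightarrow> j \<le> n \<Longrightarrow>
        degen X (Suc n) i (degen X n j x) = degen X (Suc n) (Suc j) (degen X n i x)"
  and face_degen_less: "x \<in> L n \<Longrightarrow> i < j \<Longrightarrow> j \<le> n \<Longrightarrow>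
        face X (Suc n) i (degen X n j x) = degen X (n - 1) (j - 1) (face X n i x)"
  and face_degen: "x \<in> L n \<Longrightarrow> j \<le> n \<Longrightarrow> face X (Suc n) j (degen X n j x) = x"
  and face_Suc_degen: "x \<in> L n \<Longrightarrow> j \<le> n \<Longrightarrow> face X (Suc n) (Suc j) (degen X n j x) = x"
  and face_degen_greater: "x \<in> L n \<Longrightarrow> Suc j < i \<Longrightarrow> i \<le> Suc n \<Longrightarrow>
        face X (Suc n) i (degen X n j x) = degen X (n - 1) j (face X n (i - 1) x)"
  using simplicial unfolding simplicial_space_def by (simp_all add: numeral_2_eq_2)

lemma face_in: "x \<in> L (Suc n) \<Longrightarrow> i \<le> Suc n \<Longrightarrow> face X (Suc n) i x \<in> L n"
  using continuous_map_app[OF face_cont] by blast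

lemma degen_in: "x \<in> L n \<Longrightarrow> j \<le> n \<Longrightarrow> degen X n j x \<in> L (Suc n)"
  using continuous_map_app[OF degen_cont] by blast

lemma degens_cont: "J \<in> admissible n t \<Longrightarrow> continuous_map (level X (n - t)) (level X n) (degens X n J)"
proof (induction t arbitrary: J n)
  case 0
  then show ?case by (simp add: admissible_0 degens.simps(1)[abs_def])
next
  case (Suc t)
  from Suc.prems show ?case
  proof (rule admissible_SucE)
    fix i J' m assume J: "J = i # J'" "n = Suc m" "i \<le> m" "J' \<in> admissible m t"
    from continuous_map_comp[OF Suc.IH[OF J(4)] degen_cont[OF J(3)]] J
    show ?thesis by (simp add: degens.simps(2)[abs_def])
  qed
qed

lemma faces_cont: "J \<in> admissible n t \<Longrightarrow> continuous_map (level X n) (level X (n - t)) (faces X n J)"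
proof (induction t arbitrary: J n)
  case 0
  then show ?case by (simp add: admissible_0 faces.simps(1)[abs_def])
next
  case (Suc t)
  from Suc.prems show ?case
  proof (rule admissible_SucE)
    fix i J' m assume J: "J = i # J'" "n = Suc m" "i \<le> m" "J' \<in> admissible m t"
    from J(3) have "i \<le> Suc m" by simp
    from continuous_map_comp[OF face_cont[OF this] Suc.IH[OF J(4)]] J
    show ?thesis by (simp add: faces.simps(2)[abs_def])
  qed
qed

lemma degens_in: "J \<in> admissible n t \<Longrightarrow> x \<in> L (n - t) \<Longrightarrow> degens X n J x \<in> L n"
  by (rule continuous_map_app[OF degens_cont])

lemma faces_in: "J \<in> admissible n t \<Longrightarrow> x \<in> L n \<Longrightarrow> faces X n J x \<in> L (n - t)"
  by (rule continuous_map_app[OF faces_cont])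

lemma faces_degens: "J \<in> admissible n t \<Longrightarrow> x \<in> L (n - t) \<Longrightarrow> faces X n J (degens X n J x) = x"
proof (induction t arbitrary: J n)
  case 0
  then show ?case by (simp add: admissible_0)
next
  case (Suc t)
  from Suc.prems(1) show ?case
  proof (rule admissible_SucE)
    fix i J' m assume J: "J = i # J'" "n = Suc m" "i \<le> m" "J' \<in> admissible m t"
    with Suc show ?thesis by (simp add: face_degen[OF degens_in])
  qed
qed

lemma degen_filtration_subset: "D t n \<subseteq> L n"
proof (induction t arbitrary: n)
  case (Suc t)
  then show ?case by (cases n) (auto dest!: degen_in subsetD)
qed simp

lemma degen_filtration_in: "x \<in> D t n \<Longrightarrow> x \<in> L n"
  using degen_filtration_subset by blast

lemma degen_filtration_Suc: "D (Suc t) n \<subseteq> D t n"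
proof (induction t arbitrary: n)
  case 0
  then show ?case using degen_filtration_subset[of "Suc 0" n] by simp
next
  case (Suc t)
  then show ?case by (cases n) auto
qed

lemma degen_filtration_empty: "n < t \<Longrightarrow> D t n = {}"
proof (induction t arbitrary: n)
  case (Suc t)
  then show ?case by (cases n) auto
qed simp

text \<open>A face passes by degeneracies until it cancels one, so it lowers the filtration by at
  most one. For \<open>t = 0\<close> the truncated difference leaves only membership in the
  level.\<close>

lemma face_degen_filtration: "x \<in> D t (Suc n) \<Longrightarrow> i \<le> Suc n \<Longrightarrow> face X (Suc n) i x \<in> D (t - 1) n"
proof (induction n arbitrary: t i x)
  case 0
  show ?case
  proof (cases t)
    case 0
    then show ?thesis using face_in \<open>x \<in> D t (Suc 0)\<close> \<open>i \<le> Suc 0\<close> by simp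
  next
    case (Suc s)
    then obtain y where y: "y \<in> D s 0" "x = degen X 0 0 y" using \<open>x \<in> D t (Suc 0)\<close> by auto
    have "y \<in> L 0" by (rule degen_filtration_in[OF y(1)])
    with face_degen[of y 0 0] face_Suc_degen[of y 0 0] show ?thesis
      using y Suc \<open>i \<le> Suc 0\<close> by (cases "i = 0") (auto simp: le_Suc_eq)
  qed
next
  case (Suc m)
  show ?case
  proof (cases t)
    case 0
    then show ?thesis using face_in Suc.prems by simp
  next
    case t: (Suc s)
    then obtain j y where y: "j \<le> Suc m" "y \<in> D s (Suc m)" "x = degen X (Suc m) j y"
      using Suc.prems by auto
    have yL: "y \<in> L (Suc m)" using degen_filtration_in y(2) .
    have deg: "degen X m k z \<in> D s (Suc m)" if "z \<in> D (s - 1) m" "k \<le> m" for z k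
      using that degen_in by (cases s) auto
    consider "i < j" | "i = j \<or> i = Suc j" | "Suc j < i" by linarith
    then show ?thesis
    proof cases
      case 1
      then have "i \<le> Suc m" "j - 1 \<le> m" using y by auto
      then show ?thesis using face_degen_less[OF yL 1 y(1)] deg Suc.IH[OF y(2)] t y(3) by simp
    next
      case 2
      then show ?thesis using face_degen[OF yL y(1)] face_Suc_degen[OF yL y(1)] t y by auto
    next
      case 3
      then have "i - 1 \<le> Suc m" "j \<le> m" using Suc.prems by auto
      then show ?thesis using face_degen_greater[OF yL 3 Suc.prems(2)] deg Suc.IH[OF y(2)] t y(3) by simp
    qed
  qed
qed

lemma faces_degen_filtration:
  "J \<in> admissible n t \<Longrightarrow> x \<in> D (t + r) n \<Longrightarrow> faces X n J x \<in> D r (n - t)"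
proof (induction t arbitrary: J n x)
  case 0
  then show ?case by (simp add: admissible_0)
next
  case (Suc t)
  from Suc.prems(1) show ?case
  proof (rule admissible_SucE)
    fix i J' m assume J: "J = i # J'" "n = Suc m" "i \<le> m" "J' \<in> admissible m t"
    then have "face X (Suc m) i x \<in> D (t + r) m"
      using face_degen_filtration[of x "Suc t + r" m i] Suc.prems(2) by simp
    from Suc.IH[OF J(4) this] J show ?thesis by simp
  qed
qed

lemma degens_degen_filtration:
  "J \<in> admissible n t \<Longrightarrow> x \<in> D r (n - t) \<Longrightarrow> degens X n J x \<in> D (t + r) n"
proof (induction t arbitrary: J n x)
  case 0
  then show ?case by (simp add: admissible_0)
next
  case (Suc t)
  from Suc.prems(1) show ?case
  proof (rule admissible_SucE)
    fix i J' m assume J: "J = i # J'" "n = Suc m" "i \<le> m" "J' \<in> admissible m t"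
    then have "degens X m J' x \<in> D (t + r) m" using Suc.IH[OF J(4)] Suc.prems(2) by simp
    then show ?thesis using J by auto
  qed
qed

text \<open>All letters of \<open>J\<close> are smaller than \<open>c\<close>, so d_i s_c = s_{c-1}
  d_i moves the degeneracy out past each face without its being cancelled. The bound persists
  because the later letters of \<open>J\<close> are below i, hence below c - 1.\<close>

lemma faces_degen_low:
  "J \<in> admissible c t \<Longrightarrow> c \<le> m \<Longrightarrow> z \<in> L m \<Longrightarrow> faces X (Suc m) J (degen X m c z) \<in> D (Suc 0) (Suc m - t)"
proof (induction t arbitrary: J c m z)
  case 0
  then show ?case by (auto simp: admissible_0)
next
  case (Suc t)
  from Suc.prems(1) show ?case
  proof (rule admissible_SucE)
    fix i J' c' assume J: "J = i # J'" "c = Suc c'" "i \<le> c'" "J' \<in> admissible c' t"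
    then obtain m' where m: "m = Suc m'" "c' \<le> m'" using Suc.prems(2) by (cases m) auto
    have "face X (Suc m) i (degen X m c z) = degen X m' c' (face X m i z)"
      using face_degen_less[OF Suc.prems(3), of i c] J m by simp
    moreover have "face X m i z \<in> L m'" using face_in Suc.prems(3) m J by simp
    ultimately show ?thesis using Suc.IH[OF J(4) m(2)] J m by simp
  qed
qed

text \<open>Equal leading letters cancel. At the first difference i < k the degeneracy s_k turns
  into s_{k-1} outside d_i; the remaining letters of \<open>J\<close> are below i, hence below k -
  1, and \<open>faces_degen_low\<close> shows that this degeneracy survives.\<close>

lemma faces_degens_less:
  "J \<in> admissible n t \<Longrightarrow> K \<in> admissible n t \<Longrightarrow> J < K \<Longrightarrow> x \<in> L (n - t) \<Longrightarrow>
    faces X n J (degens X n K x) \<in> D (Suc 0) (n - t)"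
proof (induction t arbitrary: J K n)
  case 0
  then show ?case by (simp add: admissible_0)
next
  case (Suc t)
  obtain i J' m where J: "J = i # J'" "n = Suc m" "i \<le> m" "J' \<in> admissible i t" "J' \<in> admissible m t"
    using Suc.prems(1) by (rule admissible_SucE)
  obtain k K' where K: "K = k # K'" "k \<le> m" "K' \<in> admissible k t" "K' \<in> admissible m t"
    using Suc.prems(2) J(2) by (auto elim!: admissible_SucE)
  have x: "x \<in> L (m - t)" using Suc.prems(4) J(2) by simp
  have y: "degens X m K' x \<in> L m" by (rule degens_in[OF K(4) x])
  show ?case
  proof (cases "i = k")
    case True
    then have "J' < K'" using Suc.prems(3) J K by simp
    then have "faces X m J' (degens X m K' x) \<in> D (Suc 0) (m - t)"
      by (rule Suc.IH[OF J(5) K(4) _ x])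
    then show ?thesis using True J K face_degen[OF y K(2)] by simp
  next
    case False
    then have ik: "i < k" using Suc.prems(3) J K by simp
    then obtain m' where m: "m = Suc m'" "k - 1 \<le> m'" "i \<le> k - 1" using K(2) by (cases m) auto
    have "faces X (Suc m') J' (degen X m' (k - 1) (face X m i (degens X m K' x))) \<in> D (Suc 0) (Suc m' - t)"
    proof (rule faces_degen_low[OF _ m(2)])
      show "J' \<in> admissible (k - 1) t" by (rule admissible_mono[OF m(3) J(4)])
      show "face X m i (degens X m K' x) \<in> L m'" using face_in y m J(3) by simp
    qed
    then show ?thesis using J K m face_degen_less[OF y ik K(2)] by simp
  qed
qed

text \<open>Insertion of a letter into a decreasing word by means of s_i s_j = s_{j+1} s_i for i
  \<le> j. The bound \<open>Suc (max i m)\<close> keeps the word decreasing when the shifted letter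
  j + 1 is put back in front.\<close>

lemma degen_degens:
  "J \<in> admissible m t \<Longrightarrow> m \<le> n \<Longrightarrow> i \<le> n \<Longrightarrow> t \<le> n \<Longrightarrow>
    \<exists>K \<in> admissible (Suc (max i m)) (Suc t). \<forall>x \<in> L (n - t). degen X n i (degens X n J x) = degens X (Suc n) K x"
proof (induction t arbitrary: J m n i)
  case 0
  then show ?case by (auto simp: admissible_0 admissible_Cons intro!: bexI[of _ "[i]"])
next
  case (Suc t)
  obtain j J' m' where J: "J = j # J'" "m = Suc m'" "j \<le> m'" "J' \<in> admissible j t"
    using Suc.prems(1) by (rule admissible_SucE)
  show ?case
  proof (cases "i \<le> j")
    case False
    then have "i # J \<in> admissible (Suc (max i m)) (Suc (Suc t))"
      using J by (simp add: admissible_Cons)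
    then show ?thesis by (intro bexI[of _ "i # J"]) auto
  next
    case True
    obtain n' where n: "n = Suc n'" "j \<le> n'" "t \<le> n'" using Suc.prems J by (cases n) auto
    obtain K where K: "K \<in> admissible (Suc (max i j)) (Suc t)"
      "\<And>x. x \<in> L (n' - t) \<Longrightarrow> degen X n' i (degens X n' J' x) = degens X (Suc n') K x"
      using Suc.IH[OF J(4) n(2), of i] True n by auto
    have "Suc j # K \<in> admissible (Suc (max i m)) (Suc (Suc t))"
      using K(1) True J by (simp add: admissible_Cons max_absorb2)
    moreover have "degen X n i (degens X n J x) = degens X (Suc n) (Suc j # K) x" if "x \<in> L (n - Suc t)" for x
    proof -
      have x: "x \<in> L (n' - t)" using that n by simp
      have "degens X n' J' x \<in> L n'" by (rule degens_in[OF admissible_mono[OF n(2) J(4)] x])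
      from degen_degen[OF this True n(2)] K(2)[OF x] show ?thesis using J n by simp
    qed
    ultimately show ?thesis by blast
  qed
qed

lemma degen_filtration_eq: "t \<le> n \<Longrightarrow> D t n = (\<Union>J \<in> admissible n t. degens X n J ` L (n - t))"
proof (induction t arbitrary: n)
  case 0
  then show ?case by (simp add: admissible_0)
next
  case (Suc t)
  then obtain m where m: "n = Suc m" "t \<le> m" by (cases n) auto
  show ?case
  proof
    show "D (Suc t) n \<subseteq> (\<Union>J \<in> admissible n (Suc t). degens X n J ` L (n - Suc t))"
    proof
      fix x assume "x \<in> D (Suc t) n"
      then obtain i J y where "i \<le> m" "J \<in> admissible m t" "y \<in> L (m - t)" "x = degen X m i (degens X m J y)"
        using Suc.IH[OF m(2)] m by auto
      with degen_degens[of J m t m i] m show "x \<in> (\<Union>J \<in> admissible n (Suc t). degens X n J ` L (n - Suc t))"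
        by (auto simp: max_absorb2)
    qed
    show "(\<Union>J \<in> admissible n (Suc t). degens X n J ` L (n - Suc t)) \<subseteq> D (Suc t) n"
      using degens_degen_filtration[of _ n "Suc t" _ 0] by auto
  qed
qed

end

section \<open>Retracts of compactly generated weak Hausdorff spaces\<close>

lemma test_map_image_closed:
  fixes X :: "'a topology" and K :: "'a set set topology"
  assumes wH: "weak_Hausdorff_space X" and f: "test_map K X f" and C: "closedin K C"
  shows "closedin X (f ` C)"
proof -
  have "test_map (subtopology K C) X f"
    using f C by (auto simp: test_map_def closedin_compact_space compact_space_subtopology Hausdorff_space_subtopology
        intro: continuous_map_from_subtopology)
  then have "closedin X (f ` topspace (subtopology K C))"
    using wH unfolding weak_Hausdorff_space_def by blast
  then show ?thesis using closedin_subset[OF C] by (simp add: inf.absorb2)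
qed

text \<open>The fibres over the two points are disjoint closed sets in the normal space
  \<open>K\<close>. Separating them there and removing from \<open>X\<close> the closed images of
  the complements gives open sets that are disjoint on the image of \<open>K\<close>.\<close>

lemma test_map_separation:
  fixes X :: "'a topology" and K :: "'a set set topology"
  assumes wH: "weak_Hausdorff_space X" and f: "test_map K X f"
    and k: "k \<in> topspace K" "l \<in> topspace K" "f k \<noteq> f l"
  obtains U V where "openin X U" "openin X V" "f k \<in> U" "f l \<in> V" "U \<inter> V \<inter> f ` topspace K = {}"
proof -
  have fc: "continuous_map K X f" and K: "compact_space K" "Hausdorff_space K" using f by (auto simp: test_map_def)
  let ?F = "\<lambda>m. {x \<in> topspace K. f x \<in> {f m}}"
  have cl: "closedin K (?F m)" if "m \<in> topspace K" for m
  proof (rule closedin_continuous_map_preimage[OF fc])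
    have "closedin K {m}" using K that by (simp add: closedin_Hausdorff_singleton)
    from test_map_image_closed[OF wH f this] show "closedin X {f m}" by simp
  qed
  have "normal_space K" using K by (simp add: compact_Hausdorff_or_regular_imp_normal_space)
  moreover have "disjnt (?F k) (?F l)" using k by (auto simp: disjnt_iff)
  ultimately obtain U V where UV: "openin K U" "openin K V" "?F k \<subseteq> U" "?F l \<subseteq> V" "disjnt U V"
    using cl k unfolding normal_space_def by meson
  define U' where "U' = topspace X - f ` (topspace K - U)"
  define V' where "V' = topspace X - f ` (topspace K - V)"
  show ?thesis
  proof
    show "openin X U'" "openin X V'" unfolding U'_def V'_def
      using UV by (auto intro!: openin_diff test_map_image_closed[OF wH f])
    show "f k \<in> U'" "f l \<in> V'" unfolding U'_def V'_def
      using UV k continuous_map_app[OF fc] by auto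
    show "U' \<inter> V' \<inter> f ` topspace K = {}"
      using UV(5) unfolding U'_def V'_def disjnt_def by blast
  qed
qed

text \<open>The image is the fixed point set of \<open>e\<close>. Since \<open>X\<close> need not be
  Hausdorff, its closedness is tested on compact Hausdorff spaces. This yields closedness of the
  images of the degeneracies s_J, which are the images of the idempotents s_J d_J.\<close>

lemma closedin_retract_cgwh:
  fixes X :: "'a topology"
  assumes X: "cgwh_space X" and e: "continuous_map X X e" "\<And>x. x \<in> topspace X \<Longrightarrow> e (e x) = e x"
  shows "closedin X (e ` topspace X)"
proof -
  have wH: "weak_Hausdorff_space X" and cg: "compactly_generated_space X" using X by (auto simp: cgwh_space_def)
  have eq: "e ` topspace X = {x \<in> topspace X. e x = x}"
    using e(2) continuous_map_app[OF e(1)] by force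
  have "closedin K {k \<in> topspace K. f k \<in> {x \<in> topspace X. e x = x}}"
    if f: "test_map K X f" for K :: "'a set set topology" and f
  proof -
    have fc: "continuous_map K X f" using f by (auto simp: test_map_def)
    have efc: "continuous_map K X (\<lambda>x. e (f x))" by (rule continuous_map_comp[OF fc e(1)])
    have clf: "closedin X (f ` topspace K)" using wH f by (auto simp: weak_Hausdorff_space_def)
    let ?N = "{k \<in> topspace K. e (f k) \<noteq> f k}"
    have "openin K ?N"
    proof (subst openin_subopen, intro ballI)
      fix k assume k: "k \<in> ?N"
      show "\<exists>T. openin K T \<and> k \<in> T \<and> T \<subseteq> ?N"
      \<comment> \<open>If \<open>e (f k)\<close> misses the image of \<open>K\<close>, which is
        closed, the complement of that image gives the neighbourhood. Otherwise \<open>f k\<close>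
        and \<open>e (f k)\<close> are two values of \<open>f\<close>, and
        \<open>test_map_separation\<close> separates them.\<close>
      proof (cases "e (f k) \<in> f ` topspace K")
        case False
        let ?T = "{x \<in> topspace K. e (f x) \<in> topspace X - f ` topspace K}"
        have "openin K ?T" by (rule openin_continuous_map_preimage[OF efc]) (use clf in auto)
        moreover have "k \<in> ?T" using k False continuous_map_app[OF efc] by auto
        moreover have "?T \<subseteq> ?N" by force
        ultimately show ?thesis by blast
      next
        case True
        then obtain l where l: "l \<in> topspace K" "e (f k) = f l" by auto
        then have kl: "k \<in> topspace K" "f k \<noteq> f l" using k by auto
        obtain U V where UV: "openin X U" "openin X V" "f k \<in> U" "f l \<in> V" "U \<inter> V \<inter> f ` topspace K = {}"
          using test_map_separation[OF wH f kl(1) l(1) kl(2)] by metis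
        let ?T = "{x \<in> topspace K. f x \<in> U} \<inter> {x \<in> topspace K. e (f x) \<in> V}"
        have "openin K ?T"
          by (intro openin_Int openin_continuous_map_preimage[OF fc] openin_continuous_map_preimage[OF efc] UV)
        moreover have "k \<in> ?T" using k l UV by auto
        moreover have "?T \<subseteq> ?N" using UV(5) by auto
        ultimately show ?thesis by blast
      qed
    qed
    then have "closedin K (topspace K - ?N)" by (rule closedin_diff[OF closedin_topspace])
    moreover have "topspace K - ?N = {k \<in> topspace K. f k \<in> {x \<in> topspace X. e x = x}}"
      using continuous_map_app[OF fc] by auto
    ultimately show ?thesis by simp
  qed
  then show ?thesis unfolding eq
    by (intro cg[unfolded compactly_generated_space_def, rule_format]) auto
qed

section \<open>Functoriality of suspensions and quotients\<close>

text \<open>In contrast to \<open>map_susp\<close>, which acts on the innermost labels, this acts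
  directly below the outermost suspension coordinate. So it suspends maps that are not induced by a
  map of labels.\<close>

definition smap :: "('a susp \<Rightarrow> 'b susp) \<Rightarrow> 'a susp \<Rightarrow> 'b susp" where
  "smap g z = (case z of South \<Rightarrow> South | North \<Rightarrow> North | Mid x s \<Rightarrow> Mid (g x) s | Pt _ \<Rightarrow> undefined)"

lemma smap_simps [simp]:
  "smap g South = South" "smap g North = North" "smap g (Mid x s) = Mid (g x) s"
  by (simp_all add: smap_def)

lemma smap_susp_point: "smap g (susp_point (x, s)) = susp_point (g x, s)"
  by (simp add: susp_point_def)

lemma smap_o: "z \<in> topspace (suspension A) \<Longrightarrow> smap (g \<circ> f) z = smap g (smap f z)"
  by (auto elim!: suspensionE simp: smap_susp_point)

lemma continuous_map_smap:
  assumes "continuous_map A B g"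
  shows "continuous_map (suspension A) (suspension B) (smap g)"
proof (rule continuous_compose_quotient_map[OF quotient_map_susp_point])
  have "continuous_map (prod_topology A I01) (suspension B) (\<lambda>w. susp_point (g (fst w), snd w))"
    by (rule continuous_map_comp[OF _ quotient_imp_continuous_map[OF quotient_map_susp_point]])
      (intro continuous_map_pairedI continuous_map_comp[OF continuous_map_fst assms] continuous_map_snd)
  then show "continuous_map (prod_topology A I01) (suspension B) (smap g \<circ> susp_point)"
    by (rule continuous_map_eq) (auto simp: smap_susp_point)
qed

lemma homeomorphic_maps_smap:
  assumes "homeomorphic_maps A B f g"
  shows "homeomorphic_maps (suspension A) (suspension B) (smap f) (smap g)"
  using assms unfolding homeomorphic_maps_def
  by (auto intro!: continuous_map_smap elim!: suspensionE simp: smap_susp_point)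

text \<open>The zeroth suspension: a copy of \<open>A\<close> inside the type of suspension points,
  to which \<open>suspension\<close> can be applied repeatedly.\<close>

definition ptop :: "'a topology \<Rightarrow> 'a susp topology" where
  "ptop A = quotient_topology A Pt"

definition unPt :: "'a susp \<Rightarrow> 'a" where
  "unPt z = (case z of Pt x \<Rightarrow> x | _ \<Rightarrow> undefined)"

lemma unPt_Pt [simp]: "unPt (Pt x) = x"
  by (simp add: unPt_def)

lemma quotient_map_Pt: "quotient_map A (ptop A) Pt"
  unfolding ptop_def by (rule quotient_map_quotient_topology)

lemma topspace_ptop: "topspace (ptop A) = Pt ` topspace A"
  by (simp add: ptop_def topspace_quotient_topology)

lemma homeomorphic_maps_Pt: "homeomorphic_maps A (ptop A) Pt unPt"
proof -
  have "continuous_map (ptop A) A unPt"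
    by (rule continuous_compose_quotient_map[OF quotient_map_Pt]) (simp add: o_def)
  then show ?thesis
    using quotient_imp_continuous_map[OF quotient_map_Pt, of A] by (auto simp: homeomorphic_maps_def topspace_ptop)
qed

lemma continuous_map_Pt: "continuous_map A (ptop A) Pt"
  and continuous_map_unPt: "continuous_map (ptop A) A unPt"
  using homeomorphic_maps_Pt[of A] by (auto simp: homeomorphic_maps_def)

lemma continuous_map_ptop:
  assumes "continuous_map A B g"
  shows "continuous_map (ptop A) (ptop B) (map_susp g)"
proof (rule continuous_compose_quotient_map[OF quotient_map_Pt])
  show "continuous_map A (ptop B) (map_susp g \<circ> Pt)"
    using continuous_map_comp[OF assms continuous_map_Pt] by (simp add: o_def)
qed

lemma homeomorphic_maps_Pt_subtopology:
  "homeomorphic_maps (subtopology A S) (subtopology (ptop A) (Pt ` S)) Pt unPt"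
  unfolding homeomorphic_maps_def
proof (intro conjI ballI)
  show "continuous_map (subtopology A S) (subtopology (ptop A) (Pt ` S)) Pt"
    by (rule continuous_map_into_subtopology[OF continuous_map_from_subtopology[OF continuous_map_Pt]]) auto
  show "continuous_map (subtopology (ptop A) (Pt ` S)) (subtopology A S) unPt"
    by (rule continuous_map_into_subtopology[OF continuous_map_from_subtopology[OF continuous_map_unPt]]) auto
qed auto

lemma NDR_data_homeomorphic:
  assumes fg: "homeomorphic_maps X X' f g" and n: "NDR_data X A u h"
  shows "NDR_data X' (f ` A) (u \<circ> g) (\<lambda>w. f (h (g (fst w), snd w)))"
proof -
  note nd = NDR_dataD[OF n]
  have fc: "continuous_map X X' f" and gc: "continuous_map X' X g"
    and gf: "\<And>x. x \<in> topspace X \<Longrightarrow> g (f x) = x" "\<And>x. x \<in> topspace X' \<Longrightarrow> f (g x) = x"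
    using fg by (auto simp: homeomorphic_maps_def)
  have gX: "g x \<in> topspace X" if "x \<in> topspace X'" for x using continuous_map_app[OF gc that] .
  have fX: "f x \<in> topspace X'" if "x \<in> topspace X" for x using continuous_map_app[OF fc that] .
  show ?thesis unfolding NDR_data_def
  proof (intro conjI ballI impI)
    show "continuous_map X' I01 (u \<circ> g)" by (rule continuous_map_compose[OF gc nd(1)])
    show "continuous_map (prod_topology X' I01) X' (\<lambda>w. f (h (g (fst w), snd w)))"
      by (intro continuous_map_comp[OF _ fc] continuous_map_comp[OF _ nd(2)] continuous_map_pairedI
          continuous_map_comp[OF continuous_map_fst gc] continuous_map_snd)
    show "f ` A = {x \<in> topspace X'. (u \<circ> g) x = 0}"
    proof
      show "f ` A \<subseteq> {x \<in> topspace X'. (u \<circ> g) x = 0}" using nd(4,5) gf(1) fX by auto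
      show "{x \<in> topspace X'. (u \<circ> g) x = 0} \<subseteq> f ` A"
      proof
        fix x assume "x \<in> {x \<in> topspace X'. (u \<circ> g) x = 0}"
        then have "g x \<in> A" "x = f (g x)" using nd(10) gX gf(2) by auto
        then show "x \<in> f ` A" by blast
      qed
    qed
    show "f (h (g (fst (x, 0)), snd (x, 0))) = x" if "x \<in> topspace X'" for x
      using nd(3)[OF gX[OF that]] gf(2)[OF that] by simp
    show "f (h (g (fst (x, t)), snd (x, t))) \<in> f ` A" if "x \<in> f ` A" "t \<in> {0..1}" for x t
      using that gf(1) nd(5,6) by auto
    show "f (h (g (fst (x, 1)), snd (x, 1))) \<in> f ` A" if "x \<in> topspace X'" "(u \<circ> g) x < 1" for x
      using nd(7)[OF gX[OF that(1)]] that(2) by auto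
  qed
qed

lemma quotient_map_collapse: "quotient_map X (quotient_space X A) (collapse A)"
  unfolding quotient_space_def by (rule quotient_map_quotient_topology)

lemma topspace_quotient_space: "topspace (quotient_space X A) = collapse A ` topspace X"
  by (simp add: quotient_space_def topspace_quotient_topology)

lemma quotient_space_map_collapse:
  assumes "x \<in> A \<Longrightarrow> f x \<in> B"
  shows "quotient_space_map B f (collapse A x) = collapse B (f x)"
  using assms by (auto simp: quotient_space_map_def collapse_def)

lemma continuous_map_quotient_space_map:
  assumes f: "continuous_map X Y f" and AB: "\<And>x. x \<in> topspace X \<Longrightarrow> x \<in> A \<Longrightarrow> f x \<in> B"
  shows "continuous_map (quotient_space X A) (quotient_space Y B) (quotient_space_map B f)"
proof (rule continuous_compose_quotient_map[OF quotient_map_collapse])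
  have "continuous_map X (quotient_space Y B) (\<lambda>x. collapse B (f x))"
    by (rule continuous_map_comp[OF f quotient_imp_continuous_map[OF quotient_map_collapse]])
  then show "continuous_map X (quotient_space Y B) (quotient_space_map B f \<circ> collapse A)"
    by (rule continuous_map_eq) (use AB in \<open>auto simp: quotient_space_map_collapse\<close>)
qed

lemma collapses_quotient_space:
  "collapses X A (ptop (quotient_space X A)) (Pt \<circ> collapse A) (Pt None)"
  unfolding collapses_def
  by (intro conjI quotient_map_compose[OF quotient_map_collapse quotient_map_Pt])
    (auto simp: collapse_def split: if_splits)

lemma collapses_homeomorphic:
  assumes q: "collapses X A Y q y0" and fg: "homeomorphic_maps X X' f g" and A: "A \<subseteq> topspace X"
  shows "collapses X' (f ` A) Y (q \<circ> g) y0"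
proof -
  have gf: "\<And>x. x \<in> topspace X \<Longrightarrow> g (f x) = x" "\<And>x. x \<in> topspace X' \<Longrightarrow> f (g x) = x"
    and gX: "\<And>x. x \<in> topspace X' \<Longrightarrow> g x \<in> topspace X"
    using fg continuous_map_app[of X' X g] by (auto simp: homeomorphic_maps_def)
  have "homeomorphic_map X' X g"
    using fg by (metis homeomorphic_maps_map homeomorphic_maps_sym)
  then have "quotient_map X' Y (q \<circ> g)"
    using q by (intro quotient_map_compose[of _ X]) (auto simp: collapses_def homeomorphic_map_def)
  moreover have "x = x' \<or> x \<in> f ` A \<and> x' \<in> f ` A"
    if "x \<in> topspace X'" "x' \<in> topspace X'" "(q \<circ> g) x = (q \<circ> g) x'" for x x'
  proof -
    have "f (g x) = x" "f (g x') = x'" using gf(2) that by auto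
    moreover have "g x = g x' \<or> g x \<in> A \<and> g x' \<in> A" using q gX that unfolding collapses_def by simp
    then have "f (g x) = f (g x') \<or> f (g x) \<in> f ` A \<and> f (g x') \<in> f ` A" by auto
    ultimately show ?thesis by simp
  qed
  moreover have "(q \<circ> g) x = y0" if "x \<in> f ` A" for x
    using that q gf(1) A unfolding collapses_def by auto
  ultimately show ?thesis unfolding collapses_def by (intro conjI ballI impI)
qed

section \<open>Splitting the suspension of a simplicial level\<close>

definition adm_list :: "nat \<Rightarrow> nat \<Rightarrow> nat list list" where
  "adm_list n t = sorted_list_of_set (admissible n t)"

definition words :: "nat \<Rightarrow> nat list set" where
  "words n = (\<Union>t\<le>n. admissible n t)"

text \<open>The only admissible word of length \<open>n\<close>; it consists of all letters below
  \<open>n\<close>.\<close>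

definition top_word :: "nat \<Rightarrow> nat list" where
  "top_word n = rev [0..<n]"

lemma set_adm_list [simp]: "set (adm_list n t) = admissible n t"
  by (simp add: adm_list_def finite_admissible)

lemma admissible_top: "admissible n n = {top_word n}"
proof (induction n)
  case 0
  then show ?case by (simp add: admissible_0 top_word_def)
next
  case (Suc n)
  have 1: "J = n # top_word n" if J: "J \<in> admissible (Suc n) (Suc n)" for J
    using J
  proof (rule admissible_SucE)
    fix i J' m assume "J = i # J'" "Suc n = Suc m" "i \<le> m" "J' \<in> admissible i n" "J' \<in> admissible m n"
    then show ?thesis using admissible_le[of J' i n] Suc by auto
  qed
  have 2: "n # top_word n \<in> admissible (Suc n) (Suc n)" using Suc by (simp add: admissible_Cons)
  have "J \<in> admissible (Suc n) (Suc n) \<longleftrightarrow> J = n # top_word n" for J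
    using 1[of J] 2 by metis
  moreover have "top_word (Suc n) = n # top_word n" by (simp add: top_word_def)
  ultimately show ?case by (simp add: set_eq_iff)
qed

lemma length_top_word [simp]: "length (top_word n) = n"
  by (simp add: top_word_def)

lemma words_length: "J \<in> words n \<Longrightarrow> J \<in> admissible n (length J)"
  by (auto simp: words_def length_admissible)

lemma admissible_words: "t \<le> n \<Longrightarrow> admissible n t \<subseteq> words n"
  by (auto simp: words_def)

lemma admissible_words_iff: "t \<le> n \<Longrightarrow> J \<in> admissible n t \<longleftrightarrow> J \<in> words n \<and> length J = t"
  using words_length[of J n] admissible_words[of t n] length_admissible[of J n t] by auto

lemma words_length_le: "J \<in> words n \<Longrightarrow> length J \<le> n"
  using words_length admissible_le by blast

lemma wedge_loops_pull:
  assumes "\<And>i. i \<in> set L \<Longrightarrow> \<pi>' i x = \<pi> i (q x)"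
  shows "wedge_loops y \<pi>' L (x, s) = wedge_loops y \<pi> L (q x, s)"
  using assms by (induction L arbitrary: s) (auto simp: join_fam_def)

lemma splits_cong:
  assumes s: "splits b A V x y f" and eq: "\<And>a s. a \<in> topspace A \<Longrightarrow> s \<in> {0..1} \<Longrightarrow> f' (a, s) = f (a, s)"
  shows "splits b A V x y f'"
proof -
  obtain g where f: "pathfam A V x y f" "x \<in> topspace V" "y \<in> topspace V"
    and g: "continuous_map V (suspension A) g" "g x = South" "g y = pole b"
    "pathfam_homotopic A (suspension A) South (pole b) (g \<circ> f) (merid b)"
    "homotopic_with (\<lambda>k. k x = x \<and> k y = y) V V (susp_lift x y f \<circ> g) id"
    and b: "\<And>a. b = Some a \<Longrightarrow> a \<in> topspace A \<and> y = x \<and> pathfam_homotopic (subtopology A {a}) V x x f (\<lambda>_. x)"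
    using s unfolding splits_def by blast
  have f': "pathfam A V x y f'" by (rule pathfam_cong[OF _ f(1)]) (simp add: eq)
  have 1: "pathfam_homotopic A (suspension A) South (pole b) (g \<circ> f') (merid b)"
    using pathfam_homotopic_eq[OF pathfam_compose_left[OF f' g(1)], of "g \<circ> f"] eq g(2,3)
      pathfam_homotopic_trans[OF _ g(4)] by simp
  have 2: "a \<in> topspace A \<and> y = x \<and> pathfam_homotopic (subtopology A {a}) V x x f' (\<lambda>_. x)" if "b = Some a" for a
    using b[OF that] pathfam_homotopic_eq[OF pathfam_restrict[OF f', of "{a}"], of f] eq
      pathfam_homotopic_trans[of "subtopology A {a}" V x x f' f] by auto
  have 3: "homotopic_with (\<lambda>k. k x = x \<and> k y = y) V V (susp_lift x y f' \<circ> g) id"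
  proof (rule homotopic_with_eq[OF g(5)])
    fix v assume "v \<in> topspace V"
    then obtain a s where "g v = susp_point (a, s)" "a \<in> topspace A" "s \<in> {0..1}"
      using continuous_map_app[OF g(1)] suspensionE by metis
    then show "(susp_lift x y f' \<circ> g) v = (susp_lift x y f \<circ> g) v"
      using susp_lift_point[OF f(1)] susp_lift_point[OF f'] eq by simp
  qed (use f in auto)
  show ?thesis unfolding splits_def using f f' g 1 2 3 by blast
qed

text \<open>A map on all of X_n, whose restriction to S^t(X_n) factors through
  \<open>quotient_face\<close> by \<open>level_face_quotient\<close>. That it extends beyond
  S^t(X_n) is the source of the stable retractions.\<close>

definition level_face :: "'a simpl_space \<Rightarrow> nat \<Rightarrow> nat list \<Rightarrow> 'a susp \<Rightarrow> 'a option susp" where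
  "level_face X n J = map_susp (\<lambda>x. collapse (degen_filtration X (Suc 0) (n - length J)) (faces X n J x))"

definition quotient_face :: "'a simpl_space \<Rightarrow> nat \<Rightarrow> nat list \<Rightarrow> 'a option susp \<Rightarrow> 'a option susp" where
  "quotient_face X n J = map_susp (quotient_space_map (degen_filtration X (Suc 0) (n - length J)) (faces X n J))"

definition quotient_degen :: "'a simpl_space \<Rightarrow> nat \<Rightarrow> nat list \<Rightarrow> 'a option susp \<Rightarrow> 'a option susp" where
  "quotient_degen X n J = map_susp (quotient_space_map (degen_filtration X (Suc (length J)) n) (degens X n J))"

definition susp_wedge :: "'a simpl_space \<Rightarrow> nat \<Rightarrow> nat list set \<Rightarrow> (nat list \<times> 'a option susp) option topology" where
  "susp_wedge X n I = wedge South I (\<lambda>J. suspension (ptop (degen_quotient (n - length J) 0 X)))"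

text \<open>
  The word of length \<open>n\<close> is exceptional: $S(X_0)$ is empty, so that $X_0/S(X_0)$ has no base point and
  only an unreduced suspension is split off.
\<close>

definition top_fam :: "nat \<Rightarrow> ('b \<Rightarrow> 'c susp) \<Rightarrow> 'b \<times> real \<Rightarrow> (nat list \<times> 'c susp) option" where
  "top_fam n g w = wedge_incl South (top_word n, susp_point (g (fst w), snd w))"

text \<open>Stage \<open>k\<close> involves the words of length at least n - k. The shorter words
  are put in front, as in \<open>splits_step\<close>, where the factor pulled back from the quotient
  precedes the family that splits already.\<close>

primrec split_fam :: "'a simpl_space \<Rightarrow> nat \<Rightarrow> nat \<Rightarrow> 'a susp \<times> real \<Rightarrow> (nat list \<times> 'a option susp) option" where
  "split_fam X n 0 = top_fam n (level_face X n (top_word n))"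
| "split_fam X n (Suc k) =
     join_fam (wedge_loops (\<lambda>_. Pt None) (level_face X n) (adm_list n (n - Suc k))) (split_fam X n k)"

definition quotient_fam :: "'a simpl_space \<Rightarrow> nat \<Rightarrow> nat \<Rightarrow> 'a option susp \<times> real \<Rightarrow> (nat list \<times> 'a option susp) option" where
  "quotient_fam X n t = (if t = n then top_fam n (quotient_face X n (top_word n))
     else wedge_loops (\<lambda>_. Pt None) (quotient_face X n) (adm_list n t))"

text \<open>Once X_0 is nonempty, so are all S^t(X_n) with t \<le> n, and the suspensions have
  poles. The empty simplicial space is treated separately.\<close>

locale NDR_simplicial = simplicial +
  assumes cgwh: "\<And>n. cgwh_space (level X n)" and NDR: "simplicially_NDR X" and nonempty: "L 0 \<noteq> {}"
begin

lemma L_nonempty: "L n \<noteq> {}"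
proof (induction n)
  case (Suc n)
  then show ?case using degen_in[of _ n 0] by blast
qed (rule nonempty)

lemma degen_filtration_nonempty: "t \<le> n \<Longrightarrow> D t n \<noteq> {}"
proof (induction t arbitrary: n)
  case 0
  then show ?case using L_nonempty by simp
next
  case (Suc t)
  then show ?case by (cases n) auto
qed

lemma NDR_filtration:
  obtains u h where "NDR_data (subtopology (level X n) (D t n)) (D (Suc t) n) u h"
  using NDR unfolding simplicially_NDR_def NDR_pair_def by (metis One_nat_def diff_Suc_1 le_add1 plus_1_eq_Suc)

abbreviation "Y m \<equiv> ptop (degen_quotient m 0 X)"

lemma degen_quotient_0: "degen_quotient m 0 X = quotient_space (level X m) (D (Suc 0) m)"
  by (simp add: degen_quotient_def)

lemma topspace_Y: "topspace (Y m) = (\<lambda>x. Pt (collapse (D (Suc 0) m) x)) ` L m"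
  by (auto simp: topspace_ptop degen_quotient_0 topspace_quotient_space)

lemma Y_nonempty: "topspace (Y m) \<noteq> {}"
  using L_nonempty by (simp add: topspace_Y)

text \<open>For m > 0 the set S(X_m) is nonempty, so X_m/S(X_m) has a base point, to which the NDR
  data descend.\<close>

lemma NDR_Y:
  assumes "0 < m"
  shows "NDR_pair (Y m) {Pt None}" "Pt None \<in> topspace (Y m)"
proof -
  obtain u h where n: "NDR_data (level X m) (D (Suc 0) m) u h"
    using NDR_filtration[of m 0] by auto
  obtain u' h' where n': "NDR_data (Y m) {Pt None} u' h'"
    using collapses_NDR[OF n collapses_quotient_space] degen_filtration_nonempty[of "Suc 0" m] assms
    unfolding degen_quotient_0 by auto
  then show "NDR_pair (Y m) {Pt None}" by (auto simp: NDR_pair_def)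
  show "Pt None \<in> topspace (Y m)" using NDR_dataD(5)[OF n'] by simp
qed

abbreviation "Yo n t \<equiv> ptop (degen_quotient n t X)"

lemma topspace_Yo: "topspace (Yo n t) = (\<lambda>x. Pt (collapse (D (Suc t) n) x)) ` D t n"
  using degen_filtration_subset[of t n]
  by (auto simp: topspace_ptop degen_quotient_def topspace_quotient_space inf.absorb2)

lemma collapses_Yo:
  "collapses (subtopology (level X n) (D t n)) (D (Suc t) n) (Yo n t) (Pt \<circ> collapse (D (Suc t) n)) (Pt None)"
  using collapses_quotient_space by (simp add: degen_quotient_def)

context
  fixes n t J assumes J: "J \<in> admissible n t"
begin

lemma continuous_map_quotient_face: "continuous_map (Yo n t) (Y (n - t)) (quotient_face X n J)"
proof -
  have "continuous_map (subtopology (level X n) (D t n)) (level X (n - t)) (faces X n J)"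
    by (rule continuous_map_from_subtopology[OF faces_cont[OF J]])
  then show ?thesis unfolding quotient_face_def length_admissible[OF J] degen_quotient_0
    unfolding degen_quotient_def by (intro continuous_map_ptop continuous_map_quotient_space_map)
      (use faces_degen_filtration[OF J, of _ "Suc 0"] in auto)
qed

lemma continuous_map_quotient_degen: "continuous_map (Y (n - t)) (Yo n t) (quotient_degen X n J)"
proof -
  have "continuous_map (level X (n - t)) (subtopology (level X n) (D t n)) (degens X n J)"
    by (rule continuous_map_into_subtopology[OF degens_cont[OF J]])
      (use degens_degen_filtration[OF J, of _ 0] in auto)
  then show ?thesis unfolding quotient_degen_def length_admissible[OF J] degen_quotient_0 degen_quotient_def Suc_eq_plus1
    by (intro continuous_map_ptop continuous_map_quotient_space_map)
      (use degens_degen_filtration[OF J, of _ "Suc 0"] in auto)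
qed

lemma degens_Suc_iff: "x \<in> L (n - t) \<Longrightarrow> degens X n J x \<in> D (Suc t) n \<longleftrightarrow> x \<in> D (Suc 0) (n - t)"
  using degens_degen_filtration[OF J, of x "Suc 0"] faces_degen_filtration[OF J, of "degens X n J x" "Suc 0"]
    faces_degens[OF J, of x] by auto

lemma quotient_degen_collapse:
  "x \<in> L (n - t) \<Longrightarrow> quotient_degen X n J (Pt (collapse (D (Suc 0) (n - t)) x)) = Pt (collapse (D (Suc t) n) (degens X n J x))"
  by (simp add: quotient_degen_def length_admissible[OF J] quotient_space_map_collapse degens_Suc_iff)

lemma quotient_face_collapse:
  "x \<in> D t n \<Longrightarrow> quotient_face X n J (Pt (collapse (D (Suc t) n) x)) = Pt (collapse (D (Suc 0) (n - t)) (faces X n J x))"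
  using faces_degen_filtration[OF J, of x "Suc 0"]
  by (simp add: quotient_face_def length_admissible[OF J] quotient_space_map_collapse)

lemma level_face_Pt:
  "level_face X n J (Pt x) = Pt (collapse (D (Suc 0) (n - t)) (faces X n J x))"
  by (simp add: level_face_def length_admissible[OF J])

lemma quotient_face_degen: "z \<in> topspace (Y (n - t)) \<Longrightarrow> quotient_face X n J (quotient_degen X n J z) = z"
  using degens_degen_filtration[OF J, of _ 0]
  by (auto simp: topspace_Y quotient_degen_collapse quotient_face_collapse faces_degens[OF J] simp del: degens.simps faces.simps)

lemma closedin_degens_image: "closedin (level X n) (degens X n J ` L (n - t))"
proof -
  have "closedin (level X n) ((\<lambda>x. degens X n J (faces X n J x)) ` L n)"
    by (rule closedin_retract_cgwh[OF cgwh continuous_map_comp[OF faces_cont[OF J] degens_cont[OF J]]])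
      (simp add: faces_degens[OF J] faces_in[OF J])
  moreover have "(\<lambda>x. degens X n J (faces X n J x)) ` L n = degens X n J ` L (n - t)"
    using faces_degens[OF J] faces_in[OF J] degens_in[OF J] by (force simp: image_iff)
  ultimately show ?thesis by simp
qed

text \<open>For t < n the image contains the base point. Its preimage in S^t(X_n) therefore consists
  of S^{t+1}(X_n) and of s_J(X_{n-t}), the first closed by the NDR condition and the second as a
  retract.\<close>

lemma closedin_quotient_degen_image:
  assumes "t < n"
  shows "closedin (Yo n t) (quotient_degen X n J ` topspace (Y (n - t)))"
proof -
  let ?S = "subtopology (level X n) (D t n)" and ?q = "Pt \<circ> collapse (D (Suc t) n)"
  have q: "quotient_map ?S (Yo n t) ?q" using collapses_Yo by (simp add: collapses_def)
  have "D (Suc 0) (n - t) \<noteq> {}" by (rule degen_filtration_nonempty) (use assms in simp)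
  then obtain d where d: "d \<in> D (Suc 0) (n - t)" by blast
  have None: "Pt None \<in> quotient_degen X n J ` topspace (Y (n - t))"
    using d degen_filtration_in[OF d] NDR_Y(2)[of "n - t"] assms
    by (auto simp: quotient_degen_def quotient_space_map_def intro!: image_eqI[of _ _ "Pt None"])
  have sub: "quotient_degen X n J ` topspace (Y (n - t)) \<subseteq> topspace (Yo n t)"
    using continuous_map_app[OF continuous_map_quotient_degen] by blast
  have "{x \<in> topspace ?S. ?q x \<in> quotient_degen X n J ` topspace (Y (n - t))}
      = D (Suc t) n \<union> (degens X n J ` L (n - t) \<inter> D t n)" (is "?l = ?r")
  proof
    show "?l \<subseteq> ?r"
    proof
      fix x assume x: "x \<in> ?l"
      then obtain y where y: "y \<in> L (n - t)" "collapse (D (Suc t) n) x = collapse (D (Suc t) n) (degens X n J y)"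
        by (auto simp: topspace_Y quotient_degen_collapse)
      then show "x \<in> ?r" using x by (auto simp: collapse_def split: if_splits)
    qed
    show "?r \<subseteq> ?l"
    proof
      fix x assume x: "x \<in> ?r"
      then have xD: "x \<in> D t n" "x \<in> topspace ?S"
        using degen_filtration_Suc[of t n] degen_filtration_subset[of t n] by auto
      show "x \<in> ?l"
      proof (cases "x \<in> D (Suc t) n")
        case True
        then show ?thesis using xD None by (auto simp: collapse_def)
      next
        case False
        then obtain y where "y \<in> L (n - t)" "x = degens X n J y" using x by auto
        then show ?thesis using xD by (auto simp: topspace_Y image_iff quotient_degen_collapse intro!: bexI[of _ y])
      qed
    qed
  qed
  moreover have "closedin ?S ?r"
  proof (rule closedin_Un)
    obtain u h where "NDR_data ?S (D (Suc t) n) u h" by (rule NDR_filtration)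
    then show "closedin ?S (D (Suc t) n)" by (rule NDR_data_closed)
    show "closedin ?S (degens X n J ` L (n - t) \<inter> D t n)"
      using closedin_degens_image closedin_subtopology by blast
  qed
  ultimately have "closedin ?S {x \<in> topspace ?S. ?q x \<in> quotient_degen X n J ` topspace (Y (n - t))}" by simp
  then show ?thesis using q sub unfolding quotient_map_closedin by blast
qed

end

lemma quotient_face_degen_less:
  assumes "J \<in> admissible n t" "K \<in> admissible n t" "J < K" "z \<in> topspace (Y (n - t))"
  shows "quotient_face X n J (quotient_degen X n K z) = Pt None"
proof -
  obtain x where x: "x \<in> L (n - t)" "z = Pt (collapse (D (Suc 0) (n - t)) x)" using assms(4) by (auto simp: topspace_Y)
  have "degens X n K x \<in> D t n" using degens_degen_filtration[OF assms(2), of x 0] x by simp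
  then show ?thesis
    using x quotient_degen_collapse[OF assms(2)] quotient_face_collapse[OF assms(1)] faces_degens_less[OF assms(1-3) x(1)]
    by (simp add: collapse_def)
qed

lemma triangular_wedge:
  assumes "t < n" "admissible n t \<subseteq> I"
  shows "triangular_wedge (Yo n t) (Pt None) I (admissible n t) (\<lambda>J. Y (n - length J)) (\<lambda>_. Pt None)
    (quotient_degen X n) (quotient_face X n)"
proof -
  note [simp] = length_admissible
  obtain J0 where J0: "J0 \<in> admissible n t"
    using degen_filtration_eq[of t n] degen_filtration_nonempty[of t n] assms by auto
  have None: "Pt None \<in> topspace (Y (n - t))" by (rule NDR_Y(2)) (use assms in simp)
  obtain d where d: "d \<in> D (Suc t) n" using degen_filtration_nonempty[of "Suc t" n] assms by auto
  show ?thesis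
  proof
    show "I \<noteq> {}" using J0 assms by auto
    show "topspace (Y (n - length i)) \<noteq> {}" for i by (rule Y_nonempty)
    show "Pt None \<in> topspace (Yo n t)"
      using d degen_filtration_Suc[of t n] by (auto simp: topspace_Yo collapse_def image_iff intro!: bexI[of _ d])
    have q: "quotient_map (subtopology (level X n) (D t n)) (Yo n t) (Pt \<circ> collapse (D (Suc t) n))"
      using collapses_Yo by (simp add: collapses_def)
    have e: "{x \<in> topspace (subtopology (level X n) (D t n)). (Pt \<circ> collapse (D (Suc t) n)) x \<in> {Pt None}} = D (Suc t) n"
      using degen_filtration_Suc[of t n] degen_filtration_subset[of t n] by (auto simp: collapse_def split: if_splits)
    obtain u h where "NDR_data (subtopology (level X n) (D t n)) (D (Suc t) n) u h" by (rule NDR_filtration)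
    then have "closedin (subtopology (level X n) (D t n)) (D (Suc t) n)" by (rule NDR_data_closed)
    then have "closedin (subtopology (level X n) (D t n)) {x \<in> topspace (subtopology (level X n) (D t n)). (Pt \<circ> collapse (D (Suc t) n)) x \<in> {Pt None}}"
      unfolding e .
    moreover have "{Pt None} \<subseteq> topspace (Yo n t)" using \<open>Pt None \<in> topspace (Yo n t)\<close> by simp
    ultimately show "closedin (Yo n t) {Pt None}"
      using q unfolding quotient_map_closedin by blast
    fix J assume J: "J \<in> admissible n t"
    show "Pt None \<in> topspace (Y (n - length J))" using J None by simp
    show "continuous_map (Y (n - length J)) (Yo n t) (quotient_degen X n J)"
      using continuous_map_quotient_degen[OF J] J by simp
    show "continuous_map (Yo n t) (Y (n - length J)) (quotient_face X n J)"
      using continuous_map_quotient_face[OF J] J by simp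
    show "quotient_face X n J (quotient_degen X n J z) = z" if "z \<in> topspace (Y (n - length J))" for z
      using quotient_face_degen[OF J] J that by simp
    show "quotient_degen X n J (Pt None) = Pt None" "quotient_face X n J (Pt None) = Pt None"
      by (simp_all add: quotient_degen_def quotient_face_def quotient_space_map_def)
    show "closedin (Yo n t) (quotient_degen X n J ` topspace (Y (n - length J)))"
      using closedin_quotient_degen_image[OF J assms(1)] J by simp
    show "NDR_pair (Y (n - length J)) {Pt None}" using NDR_Y(1)[of "n - t"] J assms by simp
  qed (use assms in auto)
qed

lemma splits_quotient:
  assumes "t < n" "admissible n t \<subseteq> I"
  shows "splits (Some (Pt None)) (Yo n t) (subtopology (susp_wedge X n I) (wedge_part (admissible n t))) None None
    (wedge_loops (\<lambda>_. Pt None) (quotient_face X n) (adm_list n t))"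
proof -
  note [simp] = length_admissible
  interpret tw: triangular_wedge "Yo n t" "Pt None" I "admissible n t" "\<lambda>J. Y (n - length J)" "\<lambda>_. Pt None"
    "quotient_degen X n" "quotient_face X n" by (rule triangular_wedge[OF assms])
  have "splits (Some (Pt None)) (subtopology (Yo n t) (tw.part (adm_list n t)))
     (subtopology tw.W (wedge_part (set (adm_list n t)))) None None (tw.loops (adm_list n t))"
  proof (rule tw.splits_loops)
    show "distinct (adm_list n t)" by (simp add: adm_list_def)
    \<comment> \<open>The order on words is lexicographic; an earlier face kills a later degeneracy
      by \<open>quotient_face_degen_less\<close>, which is triangularity for this list.\<close>
    have "sorted_wrt (<) (adm_list n t)" by (simp add: adm_list_def)
    then show "sorted_wrt (\<lambda>i k. \<forall>z\<in>topspace (Y (n - length k)). quotient_face X n i (quotient_degen X n k z) = Pt None) (adm_list n t)"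
      by (rule sorted_wrt_mono_rel[rotated]) (auto intro!: quotient_face_degen_less)
  qed simp
  moreover have "tw.part (adm_list n t) = topspace (Yo n t)"
  proof
    show "tw.part (adm_list n t) \<subseteq> topspace (Yo n t)" by (rule tw.part_subset) simp
    show "topspace (Yo n t) \<subseteq> tw.part (adm_list n t)"
    proof
      fix z assume "z \<in> topspace (Yo n t)"
      then obtain x where x: "x \<in> D t n" "z = Pt (collapse (D (Suc t) n) x)" by (auto simp: topspace_Yo)
      then obtain J y where J: "J \<in> admissible n t" "y \<in> L (n - t)" "x = degens X n J y"
        using degen_filtration_eq[of t n] assms by auto
      then have "z \<in> quotient_degen X n J ` topspace (Y (n - t))"
        using x by (auto simp: topspace_Y image_iff quotient_degen_collapse intro!: bexI[of _ y])
      then show "z \<in> tw.part (adm_list n t)" using J by (auto simp: tw.part_def)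
    qed
  qed
  ultimately show ?thesis by (simp add: susp_wedge_def)
qed

text \<open>For t = n there is a single word \<open>J\<close>, nothing is collapsed, and d_J maps
  S^n(X_n) homeomorphically to X_0. The homeomorphism \<open>r\<close> makes the result available
  both for \<open>Yo n n\<close> and for its copy inside X_n.\<close>

lemma splits_quotient_top:
  assumes A: "homeomorphic_maps A (Yo n n) r r'" and I: "top_word n \<in> I"
  shows "splits None A (subtopology (susp_wedge X n I) (wedge_part {top_word n})) None (Some (top_word n, North))
    (top_fam n (quotient_face X n (top_word n) \<circ> r))"
proof -
  let ?J = "top_word n"
  have J: "?J \<in> admissible n n" by (simp add: admissible_top)
  have "homeomorphic_maps (Yo n n) (Y (n - n)) (quotient_face X n ?J) (quotient_degen X n ?J)"
    unfolding homeomorphic_maps_def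
  proof (intro conjI ballI continuous_map_quotient_face[OF J] continuous_map_quotient_degen[OF J])
    show "quotient_degen X n ?J (quotient_face X n ?J z) = z" if z: "z \<in> topspace (Yo n n)" for z
    proof -
      obtain x where x: "x \<in> D n n" "z = Pt (collapse (D (Suc n) n) x)"
        using z unfolding topspace_Yo by blast
      obtain y where y: "y \<in> L (n - n)" "x = degens X n ?J y"
        using degen_filtration_eq[of n n] x(1) by (auto simp: admissible_top)
      have "z = quotient_degen X n ?J (Pt (collapse (D (Suc 0) (n - n)) y))"
        using quotient_degen_collapse[OF J y(1)] x y by simp
      then show ?thesis using quotient_face_degen[OF J] y(1) by (simp add: topspace_Y)
    qed
    show "quotient_face X n ?J (quotient_degen X n ?J z) = z" if "z \<in> topspace (Y (n - n))" for z
      using quotient_face_degen[OF J that] .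
  qed
  from homeomorphic_maps_compose[OF conjI[OF A this]]
  have "homeomorphic_maps A (Y (n - n)) (quotient_face X n ?J \<circ> r) (r' \<circ> quotient_degen X n ?J)" .
  note h1 = homeomorphic_maps_smap[OF this]
  have "South \<in> topspace (suspension (Y (n - n)))" using Y_nonempty by (simp add: South_in_suspension)
  then have "homeomorphic_maps (suspension (Y (n - n))) (subtopology (susp_wedge X n I) (wedge_part {?J}))
      (\<lambda>z. wedge_incl South (?J, z)) (wedge_proj South ?J)"
    using homeomorphic_wedge_summand[OF I, of South "\<lambda>J. suspension (Y (n - length J))"]
    unfolding susp_wedge_def by simp
  note h2 = homeomorphic_maps_compose[OF conjI[OF h1 this]]
  have "topspace A \<noteq> {}"
  proof -
    obtain x where "x \<in> D n n" using degen_filtration_nonempty[of n n] by auto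
    then have "Pt (collapse (D (Suc n) n) x) \<in> topspace (Yo n n)" by (auto simp: topspace_Yo)
    then show ?thesis using A continuous_map_app[of "Yo n n" A r'] by (auto simp: homeomorphic_maps_def)
  qed
  from splits_homeomorphic_unpointed[OF h2 this]
  have s: "splits None A (subtopology (susp_wedge X n I) (wedge_part {?J})) None (Some (?J, North))
    ((\<lambda>z. wedge_incl South (?J, z)) \<circ> smap (quotient_face X n ?J \<circ> r) \<circ> susp_point)"
    by (simp add: wedge_incl_def)
  have "(\<lambda>z. wedge_incl South (?J, z)) \<circ> smap (quotient_face X n ?J \<circ> r) \<circ> susp_point =
      top_fam n (quotient_face X n ?J \<circ> r)"
    by (rule ext) (auto simp: top_fam_def smap_susp_point)
  then show ?thesis using s by simp
qed

section \<open>Descending induction over the degeneracy filtration\<close>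

lemma level_face_quotient:
  assumes "J \<in> admissible n t" "x \<in> D t n"
  shows "level_face X n J (Pt x) = quotient_face X n J (Pt (collapse (D (Suc t) n) x))"
  using level_face_Pt[OF assms(1)] quotient_face_collapse[OF assms] by simp

abbreviation "WW n \<equiv> susp_wedge X n (words n)"
abbreviation "XX n \<equiv> ptop (level X n)"
abbreviation "long_words n t \<equiv> {J \<in> words n. t \<le> length J}"

lemma long_words_Suc: "t \<le> n \<Longrightarrow> long_words n t = admissible n t \<union> long_words n (Suc t)"
  by (auto simp: admissible_words_iff)

lemma long_words_top: "long_words n n = {top_word n}"
proof -
  have "long_words n n = admissible n n"
    using words_length_le[of _ n] by (auto simp: admissible_words_iff dest: antisym)
  then show ?thesis by (simp add: admissible_top)
qed

lemma continuous_map_level_face: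
  assumes "J \<in> admissible n t"
  shows "continuous_map (XX n) (Y (n - length J)) (level_face X n J)"
  unfolding level_face_def degen_quotient_0 length_admissible[OF assms]
  by (intro continuous_map_ptop continuous_map_comp[OF faces_cont[OF assms]]
      quotient_imp_continuous_map[OF quotient_map_collapse])

lemma closed_wedge_part_WW: "closedin (WW n) (topspace (WW n) \<inter> wedge_part M)"
  unfolding susp_wedge_def
proof (rule closedin_wedge_part)
  fix J
  have "South \<in> topspace (suspension (Y (n - length J)))" using Y_nonempty by (simp add: South_in_suspension)
  then show "closedin (suspension (Y (n - length J))) {South}" using closedin_South[of "Y (n - length J)"] by simp
qed

lemma None_in_WW: "None \<in> topspace (WW n)"
proof -
  have "South \<in> topspace (suspension (Y (n - length (top_word n))))" using Y_nonempty by (simp add: South_in_suspension)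
  then show ?thesis unfolding susp_wedge_def
    by (rule wedge_None[rotated]) (use admissible_top admissible_words[of n n] in auto)
qed

lemma pathfam_split_fam:
  "k \<le> n \<Longrightarrow> pathfam (XX n) (subtopology (WW n) (wedge_part (long_words n (n - k)))) None (Some (top_word n, North)) (split_fam X n k)"
proof (induction k)
  case 0
  let ?J = "top_word n"
  have J: "?J \<in> admissible n n" "?J \<in> words n" using admissible_top admissible_words[of n n] by auto
  have "continuous_map (suspension (Y (n - length ?J))) (subtopology (WW n) (wedge_part {?J})) (\<lambda>z. wedge_incl South (?J, z))"
    unfolding susp_wedge_def
    by (rule continuous_map_into_subtopology[OF continuous_map_wedge_incl[OF J(2)]]) (auto simp: wedge_incl_part)
  from pathfam_compose_right[OF pathfam_compose_left[OF pathfam_susp_point this] continuous_map_level_face[OF J(1)]]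
  show ?case using long_words_top[of n] by (simp add: top_fam_def[abs_def] case_prod_unfold wedge_incl_def)
next
  case (Suc k)
  define t where "t = n - Suc k"
  have t: "t < n" "n - k = Suc t" using Suc.prems by (auto simp: t_def)
  have mono: "pathfam (XX n) (subtopology (WW n) (wedge_part (long_words n t))) None z f"
    if "pathfam (XX n) (subtopology (WW n) (wedge_part M)) None z f" "M \<subseteq> long_words n t" for M f z
  proof -
    have "continuous_map (subtopology (WW n) (wedge_part M)) (subtopology (WW n) (wedge_part (long_words n t))) id"
      by (rule continuous_map_into_subtopology[OF continuous_map_id_subt]) (use wedge_part_mono[OF that(2)] in auto)
    from pathfam_compose_left[OF that(1) this] show ?thesis by simp
  qed
  interpret tw: triangular_wedge "Yo n t" "Pt None" "words n" "admissible n t" "\<lambda>J. Y (n - length J)" "\<lambda>_. Pt None"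
    "quotient_degen X n" "quotient_face X n"
    by (rule triangular_wedge) (use t admissible_words in auto)
  have "pathfam (XX n) (subtopology tw.W (wedge_part (set (adm_list n t)))) None None
      (wedge_loops (\<lambda>_. Pt None) (level_face X n) (adm_list n t))"
    by (rule tw.pathfam_wedge_loops) (use continuous_map_level_face in auto)
  then have 1: "pathfam (XX n) (subtopology (WW n) (wedge_part (long_words n t))) None None
      (wedge_loops (\<lambda>_. Pt None) (level_face X n) (adm_list n t))"
    by (intro mono[of "admissible n t"]) (use long_words_Suc[of t n] t in \<open>auto simp: susp_wedge_def\<close>)
  have 2: "pathfam (XX n) (subtopology (WW n) (wedge_part (long_words n t))) None (Some (top_word n, North)) (split_fam X n k)"
    by (rule mono[OF Suc.IH]) (use Suc.prems t in auto)
  show ?case using pathfam_join[OF 1 2] by (simp add: t_def)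
qed

lemma splits_split_fam:
  "k \<le> n \<Longrightarrow> splits None (subtopology (XX n) (Pt ` D (n - k) n)) (subtopology (WW n) (wedge_part (long_words n (n - k))))
     None (Some (top_word n, North)) (split_fam X n k)"
proof (induction k)
  case 0
  let ?J = "top_word n" and ?A = "subtopology (XX n) (Pt ` D n n)"
  have J: "?J \<in> admissible n n" "?J \<in> words n" using admissible_top admissible_words[of n n] by auto
  let ?r = "(Pt \<circ> collapse (D (Suc n) n)) \<circ> unPt"
  \<comment> \<open>S^{n+1}(X_n) is empty, so this collapse is injective and hence a
    homeomorphism.\<close>
  have "collapses ?A (Pt ` D (Suc n) n) (Yo n n) ?r (Pt None)"
    by (rule collapses_homeomorphic[OF collapses_Yo homeomorphic_maps_Pt_subtopology]) (simp add: degen_filtration_empty)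
  then have "quotient_map ?A (Yo n n) ?r" "inj_on ?r (topspace ?A)"
    unfolding collapses_def inj_on_def by (auto simp: degen_filtration_empty)
  then obtain r' where r': "homeomorphic_maps ?A (Yo n n) ?r r'"
    by (metis homeomorphic_map_def homeomorphic_map_maps)
  have s: "splits None ?A (subtopology (WW n) (wedge_part {?J})) None (Some (?J, North)) (top_fam n (quotient_face X n ?J \<circ> ?r))"
    by (rule splits_quotient_top[OF r' J(2)])
  have "splits None ?A (subtopology (WW n) (wedge_part {?J})) None (Some (?J, North)) (split_fam X n 0)"
  proof (rule splits_cong[OF s])
    fix a and s :: real assume "a \<in> topspace ?A"
    then obtain x where "a = Pt x" "x \<in> D n n" by auto
    then show "split_fam X n 0 (a, s) = top_fam n (quotient_face X n ?J \<circ> ?r) (a, s)"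
      by (simp add: top_fam_def level_face_quotient[OF J(1)])
  qed
  then show ?case using long_words_top[of n] by simp
next
  case (Suc k)
  define t where "t = n - Suc k"
  have t: "t < n" "n - k = Suc t" "t \<le> n" using Suc.prems by (auto simp: t_def)
  let ?A = "subtopology (XX n) (Pt ` D t n)" and ?B = "Pt ` D (Suc t) n"
  let ?W = "subtopology (WW n) (wedge_part (long_words n t))"
  let ?U = "topspace ?W \<inter> wedge_part (admissible n t)" and ?V = "topspace ?W \<inter> wedge_part (long_words n (Suc t))"
  let ?q = "(Pt \<circ> collapse (D (Suc t) n)) \<circ> unPt"
  have lw: "admissible n t \<subseteq> long_words n t" "long_words n (Suc t) \<subseteq> long_words n t"
    "admissible n t \<inter> long_words n (Suc t) = {}"
    using long_words_Suc[OF t(3)] by (auto simp: length_admissible)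
  have WU: "subtopology ?W ?U = subtopology (WW n) (wedge_part (admissible n t))"
    "subtopology ?W ?V = subtopology (WW n) (wedge_part (long_words n (Suc t)))"
    by (rule subtopology_wedge_part[OF lw(1)], rule subtopology_wedge_part[OF lw(2)])
  obtain u h where "NDR_data (subtopology (level X n) (D t n)) (D (Suc t) n) u h" by (rule NDR_filtration)
  from NDR_data_homeomorphic[OF homeomorphic_maps_Pt_subtopology this]
  obtain u' h' where ndr: "NDR_data ?A ?B u' h'" by blast
  have col: "collapses ?A ?B (Yo n t) ?q (Pt None)"
    by (rule collapses_homeomorphic[OF collapses_Yo homeomorphic_maps_Pt_subtopology])
      (use degen_filtration_Suc[of t n] degen_filtration_subset[of "Suc t" n] in auto)
  let ?\<phi> = "wedge_loops (\<lambda>_. Pt None) (quotient_face X n) (adm_list n t)"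
  have s: "splits None ?A ?W None (Some (top_word n, North)) (join_fam (\<lambda>(x, s). ?\<phi> (?q x, s)) (split_fam X n k))"
  proof (rule splits_step[OF ndr col, of _ ?U ?V])
    show "closedin ?W ?U" "closedin ?W ?V"
      by (rule closedin_subtopology_wedge_part[OF closed_wedge_part_WW])+
    have "topspace ?W \<subseteq> wedge_part (admissible n t) \<union> wedge_part (long_words n (Suc t))"
      unfolding wedge_part_Un long_words_Suc[OF t(3)] by simp
    then show "?U \<union> ?V = topspace ?W" by blast
    have "wedge_part (admissible n t) \<inter> wedge_part (long_words n (Suc t)) = {None}"
      unfolding wedge_part_Int lw(3) by (rule wedge_part_empty)
    moreover have "None \<in> topspace ?W" using None_in_WW by simp
    ultimately show "?U \<inter> ?V = {None}" by blast
    have "Pt ` D t n \<inter> ?B = ?B" using degen_filtration_Suc[of t n] by auto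
    then have "subtopology ?A ?B = subtopology (XX n) ?B" by (simp add: subtopology_subtopology)
    then show "splits None (subtopology ?A ?B) (subtopology ?W ?V) None (Some (top_word n, North)) (split_fam X n k)"
      unfolding WU using Suc.IH Suc.prems t by simp
    \<comment> \<open>The family found so far is made of faces of X_n, so it extends from
      S^{t+1}(X_n) to S^t(X_n). This is the hypothesis of \<open>splits_step\<close> that provides
      the stable retraction.\<close>
    show "pathfam ?A (subtopology ?W ?V) None (Some (top_word n, North)) (split_fam X n k)"
      unfolding WU using pathfam_restrict[OF pathfam_split_fam[of k n]] Suc.prems t by simp
    show "splits (Some (Pt None)) (Yo n t) (subtopology ?W ?U) None None ?\<phi>"
      unfolding WU by (rule splits_quotient[OF t(1) admissible_words[OF t(3)]])
  qed
  have "splits None ?A ?W None (Some (top_word n, North)) (split_fam X n (Suc k))"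
  proof (rule splits_cong[OF s])
    fix a and s :: real assume "a \<in> topspace ?A"
    then obtain x where a: "a = Pt x" "x \<in> D t n" by auto
    have "wedge_loops (\<lambda>_. Pt None) (level_face X n) (adm_list n t) (a, s') = ?\<phi> (?q a, s')" for s'
      by (rule wedge_loops_pull) (use a level_face_quotient in auto)
    then show "split_fam X n (Suc k) (a, s) = join_fam (\<lambda>(x, s). ?\<phi> (?q x, s)) (split_fam X n k) (a, s)"
      by (simp add: join_fam_def t_def)
  qed
  then show ?case by (simp add: t_def)
qed

theorem splits_level: "splits None (XX n) (WW n) None (Some (top_word n, North)) (split_fam X n n)"
proof -
  have "subtopology (WW n) (wedge_part (long_words n 0)) = WW n"
  proof -
    have "topspace (WW n) \<subseteq> wedge_part (words n)" unfolding susp_wedge_def by (rule topspace_wedge_subset)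
    then show ?thesis by (simp add: subtopology_superset)
  qed
  moreover have "subtopology (XX n) (Pt ` D 0 n) = XX n" by (simp add: topspace_ptop subtopology_superset)
  ultimately show ?thesis using splits_split_fam[of n n] by simp
qed

theorem splits_quotient_fam:
  assumes "t \<le> n"
  shows "\<exists>b. splits b (Yo n t) (susp_wedge X n (admissible n t)) None (if t = n then Some (top_word n, North) else None)
    (quotient_fam X n t)"
proof -
  have "topspace (susp_wedge X n (admissible n t)) \<subseteq> wedge_part (admissible n t)"
    unfolding susp_wedge_def by (rule topspace_wedge_subset)
  then have W: "subtopology (susp_wedge X n (admissible n t)) (wedge_part (admissible n t)) = susp_wedge X n (admissible n t)"
    by (simp add: subtopology_superset)
  show ?thesis
  proof (cases "t = n")
    case True
    have "homeomorphic_maps (Yo n n) (Yo n n) id id" by (simp add: homeomorphic_maps_def)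
    from splits_quotient_top[OF this, of "admissible n n"] show ?thesis
      using W True by (auto simp: quotient_fam_def admissible_top)
  next
    case False
    then show ?thesis using splits_quotient[of t n "admissible n t"] W assms by (auto simp: quotient_fam_def)
  qed
qed

end

section \<open>Homotopy equivalences between suspensions and wedges\<close>

lemma homotopy_equivalence_map_compose:
  assumes "homotopy_equivalence_map A B f" "homotopy_equivalence_map B C g"
  shows "homotopy_equivalence_map A C (g \<circ> f)"
proof -
  obtain f' where f: "continuous_map A B f" "continuous_map B A f'"
    "homotopic_with (\<lambda>_. True) A A (f' \<circ> f) id" "homotopic_with (\<lambda>_. True) B B (f \<circ> f') id"
    using assms(1) unfolding homotopy_equivalence_map_def by blast
  obtain g' where g: "continuous_map B C g" "continuous_map C B g'"
    "homotopic_with (\<lambda>_. True) B B (g' \<circ> g) id" "homotopic_with (\<lambda>_. True) C C (g \<circ> g') id"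
    using assms(2) unfolding homotopy_equivalence_map_def by blast
  have "homotopic_with (\<lambda>_. True) A A (f' \<circ> ((g' \<circ> g) \<circ> f)) (f' \<circ> (id \<circ> f))"
    by (rule homotopic_with_compose_continuous_map_left[OF homotopic_with_compose_continuous_map_right[OF g(3) f(1)] f(2)]) auto
  then have 1: "homotopic_with (\<lambda>_. True) A A ((f' \<circ> g') \<circ> (g \<circ> f)) id"
    using homotopic_with_trans[OF _ f(3)] by (simp add: o_assoc)
  have "homotopic_with (\<lambda>_. True) C C (g \<circ> ((f \<circ> f') \<circ> g')) (g \<circ> (id \<circ> g'))"
    by (rule homotopic_with_compose_continuous_map_left[OF homotopic_with_compose_continuous_map_right[OF f(4) g(2)] g(1)]) auto
  then have 2: "homotopic_with (\<lambda>_. True) C C ((g \<circ> f) \<circ> (f' \<circ> g')) id"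
    using homotopic_with_trans[OF _ g(4)] by (simp add: o_assoc)
  show ?thesis unfolding homotopy_equivalence_map_def
    using 1 2 continuous_map_compose[OF f(1) g(1)] continuous_map_compose[OF g(2) f(2)] by blast
qed

lemma homotopy_equivalence_map_homeomorphic:
  assumes "homeomorphic_maps A B f g"
  shows "homotopy_equivalence_map A B f"
proof -
  have fg: "continuous_map A B f" "continuous_map B A g" "\<And>x. x \<in> topspace A \<Longrightarrow> g (f x) = x" "\<And>x. x \<in> topspace B \<Longrightarrow> f (g x) = x"
    using assms by (auto simp: homeomorphic_maps_def)
  show ?thesis unfolding homotopy_equivalence_map_def
    by (intro conjI exI[of _ g] homotopic_with_id2 fg)
qed

lemma homotopy_equivalence_map_empty:
  assumes "topspace A = {}" "topspace B = {}"
  shows "homotopy_equivalence_map A B f"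
proof -
  have "homeomorphic_maps A B f undefined" using assms by (simp add: homeomorphic_maps_def continuous_map_def)
  then show ?thesis by (rule homotopy_equivalence_map_homeomorphic)
qed

text \<open>Homotopies on the summands of a wedge fit together only if they fix the base
  points.\<close>

definition based_equivalence :: "'a topology \<Rightarrow> 'a \<Rightarrow> 'b topology \<Rightarrow> 'b \<Rightarrow> ('a \<Rightarrow> 'b) \<Rightarrow> bool" where
  "based_equivalence A a B b f \<longleftrightarrow> continuous_map A B f \<and> f a = b \<and>
     (\<exists>g. continuous_map B A g \<and> g b = a \<and>
        homotopic_with (\<lambda>k. k a = a) A A (g \<circ> f) id \<and> homotopic_with (\<lambda>k. k b = b) B B (f \<circ> g) id)"

lemma homotopic_smap:
  assumes "homotopic_with (\<lambda>_. True) A B f g"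
  shows "homotopic_with (\<lambda>k. k South = South) (suspension A) (suspension B) (smap f) (smap g)"
proof -
  obtain h where h: "continuous_map (prod_topology I01 A) B h" "\<And>x. h (0, x) = f x" "\<And>x. h (1, x) = g x"
    using assms unfolding homotopic_with_def by blast
  let ?H = "\<lambda>(t, z). smap (\<lambda>x. h (t, x)) z"
  have "continuous_map (prod_topology I01 (suspension A)) (suspension B) ?H"
  proof (rule continuous_compose_quotient_map[OF quotient_map_homotopy_susp_point])
    let ?X = "prod_topology I01 (prod_topology A I01)"
    have "continuous_map ?X (suspension B) (\<lambda>w. susp_point (h (fst w, fst (snd w)), snd (snd w)))"
      by (rule continuous_map_comp[OF _ quotient_imp_continuous_map[OF quotient_map_susp_point]])
        (intro continuous_map_pairedI continuous_map_comp[OF _ h(1)] continuous_map_fst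
          continuous_map_fst_comp[OF continuous_map_snd] continuous_map_snd_comp[OF continuous_map_snd])
    then show "continuous_map ?X (suspension B) (?H \<circ> (\<lambda>(t, w). (t, susp_point w)))"
      by (rule continuous_map_eq) (auto simp: smap_susp_point)
  qed
  then show ?thesis unfolding homotopic_with_def
    by (intro exI[of _ ?H]) (auto simp: h(2,3))
qed

lemma smap_id: "z \<in> topspace (suspension A) \<Longrightarrow> smap id z = z"
  by (auto elim!: suspensionE simp: smap_susp_point)

text \<open>A suspended homotopy does not move the poles. So one suspension turns an unbased
  equivalence into one based at South.\<close>

lemma based_equivalence_smap:
  assumes "homotopy_equivalence_map A B f"
  shows "based_equivalence (suspension A) South (suspension B) South (smap f)"
proof -
  obtain g where f: "continuous_map A B f" "continuous_map B A g"
    "homotopic_with (\<lambda>_. True) A A (g \<circ> f) id" "homotopic_with (\<lambda>_. True) B B (f \<circ> g) id"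
    using assms unfolding homotopy_equivalence_map_def by blast
  have c: "homotopic_with (\<lambda>k. k South = South) (suspension C) (suspension C) (smap k \<circ> smap l) id"
    if h: "homotopic_with (\<lambda>_. True) C C (k \<circ> l) id" for C :: "'c susp topology" and k :: "'d susp \<Rightarrow> _" and l
  proof (cases "topspace C = {}")
    case True
    then have "topspace (suspension C) = {}" by (simp add: topspace_suspension)
    then show ?thesis by (intro homotopic_with_equal) (auto simp: continuous_map_def)
  next
    case False
    show ?thesis
      by (rule homotopic_with_eq[OF homotopic_smap[OF h]])
        (use False in \<open>auto simp: smap_o smap_id South_in_suspension\<close>)
  qed
  show ?thesis unfolding based_equivalence_def
    using continuous_map_smap[OF f(1)] continuous_map_smap[OF f(2)] c[OF f(3)] c[OF f(4)]
    by (auto intro!: exI[of _ "smap g"])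
qed

lemma based_equivalence_imp: "based_equivalence A a B b f \<Longrightarrow> homotopy_equivalence_map A B f"
  unfolding based_equivalence_def homotopy_equivalence_map_def
  by (auto intro: homotopic_with_mono)

lemma homotopy_equivalence_map_smap:
  "homotopy_equivalence_map A B f \<Longrightarrow> homotopy_equivalence_map (suspension A) (suspension B) (smap f)"
  by (rule based_equivalence_imp[OF based_equivalence_smap])

lemma homotopy_equivalence_map_smap_funpow:
  "homotopy_equivalence_map A B f \<Longrightarrow> homotopy_equivalence_map ((suspension ^^ m) A) ((suspension ^^ m) B) ((smap ^^ m) f)"
  by (induction m) (auto intro: homotopy_equivalence_map_smap)

section \<open>Wedges of based equivalences\<close>

lemma wedge_map_incl: "g i b = b' \<Longrightarrow> wedge_map b' g (wedge_incl b (i, z)) = wedge_incl b' (i, g i z)"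
  by (auto simp: wedge_map_def wedge_incl_def)

lemma continuous_map_wedge_map:
  assumes "\<And>i. i \<in> I \<Longrightarrow> continuous_map (Z i) (Z' i) (g i)" "\<And>i. i \<in> I \<Longrightarrow> g i b = b'"
  shows "continuous_map (wedge b I Z) (wedge b' I Z') (wedge_map b' g)"
proof (rule continuous_map_wedge)
  fix i assume i: "i \<in> I"
  show "continuous_map (Z i) (wedge b' I Z') (\<lambda>z. wedge_map b' g (wedge_incl b (i, z)))"
    unfolding wedge_map_incl[of g i, OF assms(2)[OF i]]
    by (rule continuous_map_comp[OF assms(1)[OF i] continuous_map_wedge_incl[OF i, of Z' b']])
qed

lemma homotopic_wedge_map_id:
  assumes fin: "finite I" and cl: "\<And>i. i \<in> I \<Longrightarrow> closedin (Z i) {b}"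
    and h: "\<And>i. i \<in> I \<Longrightarrow> homotopic_with (\<lambda>k. k b = b) (Z i) (Z i) (k i) id"
  shows "homotopic_with (\<lambda>_. True) (wedge b I Z) (wedge b I Z) (wedge_map b k) id"
proof -
  let ?W = "wedge b I Z"
  have b: "b \<in> topspace (Z i)" if "i \<in> I" for i using closedin_subset[OF cl[OF that]] by simp
  have kb: "k i b = b" if "i \<in> I" for i using homotopic_with_imp_property[OF h[OF that]] by simp
  have "homotopic_with (\<lambda>k. \<forall>x\<in>{None} \<inter> topspace ?W. k x = id x) ?W ?W (wedge_map b k) id"
  proof (rule homotopic_with_paste[OF fin, where T = "\<lambda>i. topspace ?W \<inter> wedge_part {i}"])
    show "closedin ?W (topspace ?W \<inter> wedge_part {i})" for i by (rule closedin_wedge_part[OF cl])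
    show "topspace ?W \<subseteq> (\<Union>i\<in>I. topspace ?W \<inter> wedge_part {i})"
    proof
      fix w assume w: "w \<in> topspace ?W"
      then obtain i z where "i \<in> I" "w = wedge_incl b (i, z)" by (rule wedgeE)
      then show "w \<in> (\<Union>i\<in>I. topspace ?W \<inter> wedge_part {i})" using w wedge_incl_part[of i "{i}" b z] by blast
    qed
    show "topspace ?W \<inter> wedge_part {i} \<inter> (topspace ?W \<inter> wedge_part {j}) \<subseteq> {None} \<inter> topspace ?W" if "i \<noteq> j" for i j
    proof -
      have "wedge_part {i} \<inter> wedge_part {j} = ({None} :: ('a \<times> 'b) option set)"
        using that by (simp add: wedge_part_Int wedge_part_empty)
      then show ?thesis by blast
    qed
    fix i assume i: "i \<in> I"
    let ?P = "subtopology ?W (topspace ?W \<inter> wedge_part {i})"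
    have P: "?P = subtopology ?W (wedge_part {i})" by (metis subtopology_restrict)
    have p: "continuous_map ?P (Z i) (wedge_proj b i)"
      by (rule continuous_map_from_subtopology[OF continuous_map_wedge_proj[of b Z i, OF b[OF i]]])
    have e: "homotopic_with (\<lambda>k. k None = None) ?P ?W ((\<lambda>z. wedge_incl b (i, z)) \<circ> (k i \<circ> wedge_proj b i)) ((\<lambda>z. wedge_incl b (i, z)) \<circ> (id \<circ> wedge_proj b i))"
    proof (rule homotopic_with_compose_continuous_map_left[OF homotopic_with_compose_continuous_map_right[OF h[OF i] p]
          continuous_map_wedge_incl[OF i, of Z b]])
      show "(j \<circ> wedge_proj b i) None = b" if "j b = b" for j using that by (simp add: wedge_proj_def)
      show "((\<lambda>z. wedge_incl b (i, z)) \<circ> j) None = None" if "j None = b" for j using that by simp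
    qed
    have inc: "wedge_incl b (i, wedge_proj b i w) = w" if "w \<in> topspace ?P" for w
      using homeomorphic_wedge_summand[OF i, of b Z, OF b[OF i]] that unfolding P homeomorphic_maps_def by blast
    have e': "homotopic_with (\<lambda>k. k None = None) ?P ?W (wedge_map b k) id"
    proof (rule homotopic_with_eq[OF e])
      show "wedge_map b k w = ((\<lambda>z. wedge_incl b (i, z)) \<circ> (k i \<circ> wedge_proj b i)) w" if w: "w \<in> topspace ?P" for w
        using wedge_map_incl[of k i b b "wedge_proj b i w", OF kb[OF i]] inc[OF w] by simp
      show "h None = None \<longleftrightarrow> k None = None" if "\<And>x. x \<in> topspace ?P \<Longrightarrow> h x = k x" for h k
      proof -
        have "None \<in> topspace ?P" using wedge_None[OF i, of b Z, OF b[OF i]] by simp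
        then show ?thesis using that by simp
      qed
    qed (use inc in auto)
    show "homotopic_with (\<lambda>k. \<forall>x\<in>{None} \<inter> topspace ?W \<inter> (topspace ?W \<inter> wedge_part {i}). k x = id x) ?P ?W (wedge_map b k) id"
      by (rule homotopic_with_mono[OF e']) auto
  qed auto
  then show ?thesis by (rule homotopic_with_mono) auto
qed

lemma wedge_map_o:
  assumes "\<And>i. i \<in> I \<Longrightarrow> f i b = b'" "w \<in> topspace (wedge b I Z)" "\<And>i. i \<in> I \<Longrightarrow> g i b' = b''"
  shows "wedge_map b'' g (wedge_map b' f w) = wedge_map b'' (\<lambda>i. g i \<circ> f i) w"
  using assms by (auto elim!: wedgeE simp: wedge_map_incl)

lemma homotopy_equivalence_wedge_map:
  assumes fin: "finite I" and cl: "\<And>i. i \<in> I \<Longrightarrow> closedin (Z i) {b}" "\<And>i. i \<in> I \<Longrightarrow> closedin (Z' i) {b'}"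
    and f: "\<And>i. i \<in> I \<Longrightarrow> based_equivalence (Z i) b (Z' i) b' (f i)"
  shows "homotopy_equivalence_map (wedge b I Z) (wedge b' I Z') (wedge_map b' f)"
proof -
  define R where "R i g \<longleftrightarrow> continuous_map (Z i) (Z' i) (f i) \<and> f i b = b' \<and> continuous_map (Z' i) (Z i) g \<and> g b' = b \<and>
        homotopic_with (\<lambda>k. k b = b) (Z i) (Z i) (g \<circ> f i) id \<and> homotopic_with (\<lambda>k. k b' = b') (Z' i) (Z' i) (f i \<circ> g) id" for i g
  have "\<forall>i. \<exists>g. i \<in> I \<longrightarrow> R i g" using f unfolding based_equivalence_def R_def by blast
  then obtain g where "\<And>i. i \<in> I \<Longrightarrow> R i (g i)" by metis
  note g = this[unfolded R_def]
  have fc: "continuous_map (wedge b I Z) (wedge b' I Z') (wedge_map b' f)"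
    and gc: "continuous_map (wedge b' I Z') (wedge b I Z) (wedge_map b g)"
    by (rule continuous_map_wedge_map; use g in blast)+
  have 1: "homotopic_with (\<lambda>_. True) (wedge b I Z) (wedge b I Z) (wedge_map b (\<lambda>i. g i \<circ> f i)) id"
    by (rule homotopic_wedge_map_id[OF fin cl(1)]) (use g in auto)
  have 2: "homotopic_with (\<lambda>_. True) (wedge b' I Z') (wedge b' I Z') (wedge_map b' (\<lambda>i. f i \<circ> g i)) id"
    by (rule homotopic_wedge_map_id[OF fin cl(2)]) (use g in auto)
  have "homotopic_with (\<lambda>_. True) (wedge b I Z) (wedge b I Z) (wedge_map b g \<circ> wedge_map b' f) id"
    by (rule homotopic_with_eq[OF 1]) (use g wedge_map_o[of I f b b' _ Z g b] in auto)
  moreover have "homotopic_with (\<lambda>_. True) (wedge b' I Z') (wedge b' I Z') (wedge_map b' f \<circ> wedge_map b g) id"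
    by (rule homotopic_with_eq[OF 2]) (use g wedge_map_o[of I g b' b _ Z' f b'] in auto)
  ultimately show ?thesis unfolding homotopy_equivalence_map_def using fc gc by blast
qed

section \<open>Collapsing contractible subspaces\<close>

definition contractible_NDR :: "'a topology \<Rightarrow> 'a set \<Rightarrow> bool" where
  "contractible_NDR X D \<longleftrightarrow> (\<exists>u h. NDR_data X D u h) \<and>
     (\<exists>k d. d \<in> D \<and> continuous_map (prod_topology I01 (subtopology X D)) (subtopology X D) k \<and>
        (\<forall>x \<in> D. k (1, x) = x \<and> k (0, x) = d))"

text \<open>The classical argument extends the contraction of \<open>D\<close> over
  \<open>X\<close>. Here \<open>NDR_extension\<close> extends it up to composition with
  \<open>h (_, 1)\<close>, and this is enough because \<open>h\<close> deforms the identity of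
  \<open>X\<close> while preserving \<open>D\<close>.\<close>

lemma homotopy_equivalence_collapse:
  assumes D: "contractible_NDR X D" and q: "collapses X D Y q y0"
  shows "homotopy_equivalence_map X Y q"
proof -
  obtain u h k d where ndr: "NDR_data X D u h" and d: "d \<in> D"
    and k: "continuous_map (prod_topology I01 (subtopology X D)) (subtopology X D) k"
      "\<And>x. x \<in> D \<Longrightarrow> k (1, x) = x" "\<And>x. x \<in> D \<Longrightarrow> k (0, x) = d"
    using D unfolding contractible_NDR_def by blast
  note nd = NDR_dataD[OF ndr]
  \<comment> \<open>\<open>NDR_extension\<close> carries a parameter space, which is a single point
    here.\<close>
  let ?T = "discrete_topology {()}"
  have qA: "q x = y0" if "x \<in> D" for x using q that by (auto simp: collapses_def)
  have qc: "continuous_map X Y q" by (rule collapses_continuous[OF q])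
  have kD: "k (t, x) \<in> D" if "t \<in> {0..1}" "x \<in> D" for t x
    using continuous_map_app[OF k(1), of "(t, x)"] that nd(5) by auto
  have "continuous_map (prod_topology (prod_topology X ?T) I01) X
    (\<lambda>w. if u (fst (fst w)) < 1 then (\<lambda>v. k (snd v, fst (fst v))) ((h (fst (fst w), 1), snd (fst w)), max (u (fst (fst w))) (snd w))
         else fst (h (fst (fst w), 1), snd (fst w)))"
  proof (rule NDR_extension[OF ndr])
    show "continuous_map (prod_topology X ?T) X fst" by (rule continuous_map_fst)
    show "continuous_map (prod_topology (prod_topology (subtopology X D) ?T) I01) X (\<lambda>v. k (snd v, fst (fst v)))"
      by (rule continuous_map_into_fulltopology[OF continuous_map_comp[OF _ k(1)]])
        (intro continuous_map_pairedI continuous_map_snd continuous_map_fst_comp[OF continuous_map_fst])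
  qed (simp add: k(2))
  note E = this
  \<comment> \<open>At time 1 this is \<open>h (_, 1)\<close>, at time 0 it sends all of
    \<open>D\<close> to \<open>d\<close> and so descends to the inverse \<open>g\<close>. Both
    \<open>e\<close> and \<open>h\<close> preserve \<open>D\<close>, so the homotopies descend to
    \<open>Y\<close> as well.\<close>
  define e where "e = (\<lambda>w. if u (fst w) < 1 then k (max (u (fst w)) (snd w), h (fst w, 1)) else h (fst w, 1))"
  have ec: "continuous_map (prod_topology X I01) X e"
  proof -
    have "continuous_map (prod_topology X I01) (prod_topology (prod_topology X ?T) I01) (\<lambda>w. ((fst w, ()), snd w))"
      by (intro continuous_map_pairedI continuous_map_fst continuous_map_snd) auto
    from continuous_map_comp[OF this E, unfolded fst_conv snd_conv] show ?thesis unfolding e_def .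
  qed
  have eD: "e (x, t) \<in> D" if "x \<in> D" "t \<in> {0..1}" for x t
    using that nd(4,6) kD by (auto simp: e_def)
  have eX: "e (x, t) \<in> topspace X" if "x \<in> topspace X" "t \<in> {0..1}" for x t
    using continuous_map_app[OF ec, of "(x, t)"] that by auto
  have e0: "e (x, 0) = d" if "x \<in> D" for x using that nd(4,6) k(3) by (auto simp: e_def)
  have e1: "e (x, 1) = h (x, 1)" if "x \<in> topspace X" for x
    using that nd(7,8)[of x] k(2) by (auto simp: e_def max_def)
  have ec0: "continuous_map X X (\<lambda>x. e (x, 0))"
    by (rule continuous_map_comp[OF _ ec]) (intro continuous_map_pairedI continuous_map_id[unfolded id_def], auto)
  have qq: "quotient_map X Y q" and inj: "\<And>x x'. x \<in> topspace X \<Longrightarrow> x' \<in> topspace X \<Longrightarrow> q x = q x' \<Longrightarrow> x = x' \<or> x \<in> D \<and> x' \<in> D"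
    using q unfolding collapses_def by blast+
  obtain g where g: "continuous_map Y X g" "\<And>x. x \<in> topspace X \<Longrightarrow> g (q x) = e (x, 0)"
  proof (rule quotient_map_lift_exists[OF qq ec0])
    show "e (x, 0) = e (y, 0)" if "x \<in> topspace X" "y \<in> topspace X" "q x = q y" for x y
      using inj[OF that] e0 by auto
  qed blast
  have sw: "continuous_map (prod_topology I01 C) (prod_topology C I01) (\<lambda>w. (snd w, fst w))" for C :: "'d topology"
    by (intro continuous_map_pairedI continuous_map_fst continuous_map_snd)
  have 1: "homotopic_with (\<lambda>_. True) X X (g \<circ> q) id"
  proof -
    have "homotopic_with (\<lambda>_. True) X X (\<lambda>x. h (x, 0)) (\<lambda>x. h (x, 1))"
      unfolding homotopic_with_def
      by (intro exI[of _ "\<lambda>w. h (snd w, fst w)"]) (auto intro: continuous_map_comp[OF sw nd(2)])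
    moreover have "homotopic_with (\<lambda>_. True) X X (\<lambda>x. e (x, 0)) (\<lambda>x. e (x, 1))"
      unfolding homotopic_with_def
      by (intro exI[of _ "\<lambda>w. e (snd w, fst w)"]) (auto intro: continuous_map_comp[OF sw ec])
    then have "homotopic_with (\<lambda>_. True) X X (\<lambda>x. e (x, 0)) (\<lambda>x. h (x, 1))"
      by (rule homotopic_with_eq) (auto simp: e1)
    ultimately have "homotopic_with (\<lambda>_. True) X X (\<lambda>x. e (x, 0)) (\<lambda>x. h (x, 0))"
      using homotopic_with_trans homotopic_with_symD by metis
    then show ?thesis by (rule homotopic_with_eq) (auto simp: g(2) nd(3))
  qed
  have desc: "homotopic_with (\<lambda>_. True) Y Y f0 f1"
    if c: "continuous_map (prod_topology X I01) X c" and cD: "\<And>x t. x \<in> D \<Longrightarrow> t \<in> {0..1} \<Longrightarrow> c (x, t) \<in> D"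
      and f: "\<And>x. x \<in> topspace X \<Longrightarrow> f0 (q x) = q (c (x, 0))" "\<And>x. x \<in> topspace X \<Longrightarrow> f1 (q x) = q (c (x, 1))" for c f0 f1
  proof -
    have "continuous_map (prod_topology X I01) Y (\<lambda>w. q (c w))" by (rule continuous_map_comp[OF c qc])
    then obtain c' where c': "continuous_map (prod_topology Y I01) Y c'"
      "\<And>x t. x \<in> topspace X \<Longrightarrow> t \<in> topspace I01 \<Longrightarrow> c' (q x, t) = q (c (x, t))"
      by (rule collapses_lift[OF q locally_compact_I01 Hausdorff_I01]) (use cD qA in auto)
    have "homotopic_with (\<lambda>_. True) Y Y (\<lambda>y. c' (y, 0)) (\<lambda>y. c' (y, 1))"
      unfolding homotopic_with_def
      by (intro exI[of _ "\<lambda>w. c' (snd w, fst w)"]) (auto intro: continuous_map_comp[OF sw c'(1)])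
    then show ?thesis
      by (rule homotopic_with_eq) (use c'(2) f collapses_image[OF q] in auto)
  qed
  have 2: "homotopic_with (\<lambda>_. True) Y Y (q \<circ> g) id"
  proof -
    obtain m where m: "continuous_map Y Y m" "\<And>x. x \<in> topspace X \<Longrightarrow> m (q x) = q (h (x, 1))"
    proof (rule quotient_map_lift_exists[OF qq])
      show "continuous_map X Y (\<lambda>x. q (h (x, 1)))"
        by (intro continuous_map_comp[OF _ qc] continuous_map_comp[OF _ nd(2)] continuous_map_pairedI
            continuous_map_id[unfolded id_def]) auto
      show "q (h (x, 1)) = q (h (y, 1))" if "x \<in> topspace X" "y \<in> topspace X" "q x = q y" for x y
        using inj[OF that] nd(6) qA by auto
    qed blast
    have "homotopic_with (\<lambda>_. True) Y Y (q \<circ> g) m"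
      by (rule desc[OF ec eD]) (auto simp: g(2) m(2) e1)
    moreover have "homotopic_with (\<lambda>_. True) Y Y id m"
      by (rule desc[OF nd(2,6)]) (auto simp: nd(3) m(2))
    ultimately show ?thesis using homotopic_with_trans homotopic_with_symD by metis
  qed
  show ?thesis unfolding homotopy_equivalence_map_def using qc g(1) 1 2 by blast
qed

text \<open>The suspension of \<open>D\<close> inside that of \<open>X\<close>. Both poles belong to
  it even where no point of \<open>D\<close> lies on their meridians, which makes it the image of a
  closed saturated subset of the cylinder.\<close>

definition susp_part :: "'a susp topology \<Rightarrow> 'a susp set \<Rightarrow> 'a susp set" where
  "susp_part X D = {z \<in> topspace (suspension X). \<forall>x s. z = Mid x s \<longrightarrow> x \<in> D}"

lemma susp_point_in_part:
  "x \<in> topspace X \<Longrightarrow> s \<in> {0..1} \<Longrightarrow> susp_point (x, s) \<in> susp_part X D \<longleftrightarrow> x \<in> D \<or> s = 0 \<or> s = 1"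
  using susp_point_in[of x X s] by (auto simp: susp_part_def susp_point_def)

lemma pathfam_susp_map:
  assumes u: "continuous_map (prod_topology X I01) Z u"
    and e: "\<And>x. x \<in> topspace X \<Longrightarrow> u (x, 0) = a \<and> u (x, 1) = b"
  shows "continuous_map (suspension X) Z (susp_lift a b u)"
  by (rule continuous_map_susp_lift) (use u e in \<open>simp add: pathfam_def\<close>)

lemma quotient_map_susp_point_prod:
  "quotient_map (prod_topology (prod_topology X I01) I01) (prod_topology (suspension X) I01) (\<lambda>(w, t). (susp_point w, t))"
  by (rule quotient_map_prod_left[OF locally_compact_I01 disjI1[OF Hausdorff_I01] quotient_map_susp_point])

text \<open>
  Here \<open>l\<close> is a homotopy of the suspension coordinate relative to its end points.
\<close>

lemma continuous_map_susp_homotopy: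
  assumes h: "continuous_map (prod_topology X I01) X h"
    and l: "continuous_map (prod_topology I01 I01) I01 (\<lambda>w. l (fst w) (snd w))"
      "\<And>t. t \<in> {0..1} \<Longrightarrow> l 0 t = 0 \<and> l 1 t = 1"
  shows "continuous_map (prod_topology (suspension X) I01) (suspension X)
    (\<lambda>(z, t). susp_lift South North (\<lambda>w. susp_point (h (fst w, t), l (snd w) t)) z)"
proof (rule continuous_compose_quotient_map[OF quotient_map_susp_point_prod])
  let ?P = "prod_topology (prod_topology X I01) I01"
  let ?k = "\<lambda>(z, t). susp_lift South North (\<lambda>w. susp_point (h (fst w, t), l (snd w) t)) z"
  have "continuous_map ?P (suspension X) (\<lambda>w. susp_point (h (fst (fst w), snd w), l (snd (fst w)) (snd w)))"
  proof (rule continuous_map_comp[OF _ quotient_imp_continuous_map[OF quotient_map_susp_point]], intro continuous_map_pairedI)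
    show "continuous_map ?P X (\<lambda>w. h (fst (fst w), snd w))"
      by (rule continuous_map_comp[OF _ h]) (intro continuous_map_pairedI continuous_map_snd continuous_map_fst_comp[OF continuous_map_fst])
    have "continuous_map ?P (prod_topology I01 I01) (\<lambda>w. (snd (fst w), snd w))"
      by (intro continuous_map_pairedI continuous_map_snd continuous_map_snd_comp[OF continuous_map_fst])
    from continuous_map_comp[OF this l(1)] show "continuous_map ?P I01 (\<lambda>w. l (snd (fst w)) (snd w))" by simp
  qed
  then show "continuous_map ?P (suspension X) (?k \<circ> (\<lambda>(w, t). (susp_point w, t)))"
    by (rule continuous_map_eq) (auto simp: susp_point_def l(2))
qed

lemma NDR_susp_part:
  assumes "NDR_data X D u h"
  shows "\<exists>u' h'. NDR_data (suspension X) (susp_part X D) u' h'"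
proof -
  note nd = NDR_dataD[OF assms]
  \<comment> \<open>It vanishes over \<open>D\<close> and at both ends. If it is below 1, then
    \<open>u x < 1\<close> or s < 1/3 or s > 2/3. The factor 3 is matched to \<open>l\<close>, which
    at time 1 pushes [0,1/3] to 0 and [2/3,1] to 1.\<close>
  define u' where "u' = susp_lift 0 0 (\<lambda>w. min 1 (3 * (u (fst w) * min (snd w) (1 - snd w))))"
  define l where "l = (\<lambda>s t::real. max 0 (min 1 ((1 - t) * s + t * (3 * s - 1))))"
  define h' where "h' = (\<lambda>(z, t). susp_lift South North (\<lambda>w. susp_point (h (fst w, t), l (snd w) t)) z)"
  have u'p: "u' (susp_point (x, s)) = min 1 (3 * (u x * min s (1 - s)))" for x s
    by (auto simp: u'_def susp_point_def)
  have h'p: "h' (susp_point (x, s), t) = susp_point (h (x, t), l s t)" if "t \<in> {0..1}" for x s t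
    using that by (auto simp: h'_def susp_point_def l_def)
  have fst01: "continuous_map (prod_topology X I01) euclideanreal (\<lambda>w. u (fst w))"
    by (rule continuous_map_comp[OF continuous_map_fst continuous_map_I01D[OF nd(1)]])
  have snd01: "continuous_map (prod_topology X I01) euclideanreal snd" by (rule continuous_map_I01D[OF continuous_map_snd])
  have "NDR_data (suspension X) (susp_part X D) u' h'"
    unfolding NDR_data_def
  proof (intro conjI ballI impI)
    show "continuous_map (suspension X) I01 u'" unfolding u'_def
    proof (rule pathfam_susp_map, rule continuous_map_I01I)
      show "continuous_map (prod_topology X I01) euclideanreal (\<lambda>w. min 1 (3 * (u (fst w) * min (snd w) (1 - snd w))))"
        by (intro continuous_map_real_min continuous_map_real_mult_left continuous_map_real_mult continuous_map_diff
            continuous_map_canonical_const fst01 snd01)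
    qed (use nd(8) in auto)
    show "continuous_map (prod_topology (suspension X) I01) (suspension X) h'" unfolding h'_def
    proof (rule continuous_map_susp_homotopy[OF nd(2)])
      have f: "continuous_map (prod_topology I01 I01) euclideanreal fst" "continuous_map (prod_topology I01 I01) euclideanreal snd"
        by (rule continuous_map_I01D[OF continuous_map_fst] continuous_map_I01D[OF continuous_map_snd])+
      show "continuous_map (prod_topology I01 I01) I01 (\<lambda>w. l (fst w) (snd w))" unfolding l_def
        by (rule continuous_map_I01I) (intro cint f, auto)
    qed (auto simp: l_def)
    show "susp_part X D = {z \<in> topspace (suspension X). u' z = 0}"
    proof -
      have "z \<in> susp_part X D \<longleftrightarrow> u' z = 0" if z: "z \<in> topspace (suspension X)" for z
      proof -
        obtain x s where xs: "x \<in> topspace X" "s \<in> {0..1}" "z = susp_point (x, s)" using z by (rule suspensionE)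
        have "u' z = 0 \<longleftrightarrow> x \<in> D \<or> s = 0 \<or> s = 1"
          using xs nd(4)[of x] nd(10)[OF xs(1)] by (auto simp: u'p min_def split: if_splits)
        then show ?thesis using susp_point_in_part[OF xs(1,2)] xs(3) by simp
      qed
      then show ?thesis by (auto simp: susp_part_def)
    qed
    show "h' (z, 0) = z" if z: "z \<in> topspace (suspension X)" for z
    proof -
      obtain x s where xs: "x \<in> topspace X" "s \<in> {0..1}" "z = susp_point (x, s)" using z by (rule suspensionE)
      then have "l s 0 = s" by (auto simp: l_def)
      then show ?thesis using xs nd(3) by (simp add: h'p)
    qed
    show "h' (z, t) \<in> susp_part X D" if z: "z \<in> susp_part X D" and t: "t \<in> {0..1}" for z t
    proof -
      obtain x s where xs: "x \<in> topspace X" "s \<in> {0..1}" "z = susp_point (x, s)"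
        using z suspensionE unfolding susp_part_def by blast
      have "h (x, t) \<in> topspace X" "l s t \<in> {0..1}" using nd(9) xs t by (auto simp: l_def)
      moreover have "x \<in> D \<or> s = 0 \<or> s = 1" using z xs susp_point_in_part by metis
      moreover have "l 0 t = 0" "l 1 t = 1" using t by (auto simp: l_def)
      ultimately show ?thesis using nd(6) t xs by (auto simp: h'p susp_point_in_part)
    qed
    show "h' (z, 1) \<in> susp_part X D" if z: "z \<in> topspace (suspension X)" and u: "u' z < 1" for z
    proof -
      obtain x s where xs: "x \<in> topspace X" "s \<in> {0..1}" "z = susp_point (x, s)" using z by (rule suspensionE)
      have "u x < 1 \<or> s < 1/3 \<or> 2/3 < s"
      proof (rule ccontr)
        assume "\<not> ?thesis"
        then have "u x = 1" "1/3 \<le> s" "s \<le> 2/3" using nd(8)[OF xs(1)] by auto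
        then show False using u xs by (auto simp: u'p min_def split: if_splits)
      qed
      then have "h (x, 1) \<in> D \<or> l s 1 = 0 \<or> l s 1 = 1" using nd(7)[OF xs(1)] by (auto simp: l_def)
      moreover have "h (x, 1) \<in> topspace X" "l s 1 \<in> {0..1}" using nd(9) xs by (auto simp: l_def)
      ultimately show ?thesis using xs by (simp add: h'p susp_point_in_part)
    qed
  qed
  then show ?thesis by blast
qed

lemma NDR_South:
  assumes "topspace X \<noteq> {}"
  shows "NDR_pair (suspension X) {South}"
proof -
  \<comment> \<open>Only the suspension coordinate is deformed; the homotopy of \<open>X\<close>
    itself is stationary, hence the \<open>fst\<close>. At time 1 \<open>l\<close> sends [0,1/2] to
    0, and this covers the region where \<open>u\<close> is below 1.\<close>
  define u where "u = susp_lift 0 1 (\<lambda>w::'a susp \<times> real. min 1 (2 * snd w))"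
  define l where "l = (\<lambda>s t::real. max 0 ((1 - t) * s + t * (2 * s - 1)))"
  define h where "h = (\<lambda>(z, t). susp_lift South North (\<lambda>w. susp_point (fst (fst w :: 'a susp, t), l (snd w) t)) z)"
  have up: "u (susp_point (x, s)) = min 1 (2 * s)" for x s by (auto simp: u_def susp_point_def)
  have hp: "h (susp_point (x, s), t) = susp_point (x, l s t)" if "t \<in> {0..1}" for x s t
    using that by (auto simp: h_def susp_point_def l_def)
  have l01: "0 \<le> l s t \<and> l s t \<le> 1" if "s \<in> {0..1}" "t \<in> {0..1}" for s t
  proof -
    have "(1 - t) * s + t * (2 * s - 1) = s - t * (1 - s)" by (simp add: algebra_simps)
    moreover have "0 \<le> t * (1 - s)" "0 \<le> s" "s \<le> 1" using that by simp_all
    then have "s - t * (1 - s) \<le> 1" by linarith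
    ultimately show ?thesis by (simp add: l_def)
  qed
  have "NDR_data (suspension X) {South} u h"
    unfolding NDR_data_def
  proof (intro conjI ballI impI)
    show "continuous_map (suspension X) I01 u" unfolding u_def
      by (rule pathfam_susp_map, rule continuous_map_I01I)
        (auto intro!: cint continuous_map_real_mult_left continuous_map_I01D[OF continuous_map_snd])
    show "continuous_map (prod_topology (suspension X) I01) (suspension X) h" unfolding h_def
    proof (rule continuous_map_susp_homotopy[OF continuous_map_fst])
      have f: "continuous_map (prod_topology I01 I01) euclideanreal fst" "continuous_map (prod_topology I01 I01) euclideanreal snd"
        by (rule continuous_map_I01D[OF continuous_map_fst] continuous_map_I01D[OF continuous_map_snd])+
      show "continuous_map (prod_topology I01 I01) I01 (\<lambda>w. l (fst w) (snd w))"
      proof (rule continuous_map_I01I)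
        show "continuous_map (prod_topology I01 I01) euclideanreal (\<lambda>w. l (fst w) (snd w))"
          unfolding l_def by (intro cint f)
      qed (use l01 in auto)
    qed (auto simp: l_def)
    show "{South} = {z \<in> topspace (suspension X). u z = 0}"
    proof -
      have "z = South \<longleftrightarrow> u z = 0" if z: "z \<in> topspace (suspension X)" for z
      proof -
        obtain x s where xs: "z = susp_point (x, s)" "s \<in> {0..1}" using z by (auto elim: suspensionE)
        then have "u z = 0 \<longleftrightarrow> s = 0" by (simp only: up) (auto simp: min_def)
        moreover have "z = South \<longleftrightarrow> s = 0" using xs by (simp add: susp_point_def)
        ultimately show ?thesis by simp
      qed
      moreover have "South \<in> topspace (suspension X)" using assms by (simp add: South_in_suspension)
      ultimately show ?thesis by blast
    qed
    show "h (z, 0) = z" if "z \<in> topspace (suspension X)" for z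
    proof -
      obtain x s where xs: "x \<in> topspace X" "s \<in> {0..1}" "z = susp_point (x, s)" using \<open>z \<in> topspace (suspension X)\<close> by (rule suspensionE)
      then have "l s 0 = s" by (auto simp: l_def)
      then show ?thesis using xs by (simp add: hp)
    qed
    show "h (a, t) \<in> {South}" if "a \<in> {South}" "t \<in> {0..1}" for a t using that by (simp add: h_def)
    show "h (z, 1) \<in> {South}" if "z \<in> topspace (suspension X)" "u z < 1" for z
    proof -
      obtain x s where xs: "x \<in> topspace X" "s \<in> {0..1}" "z = susp_point (x, s)" using \<open>z \<in> topspace (suspension X)\<close> by (rule suspensionE)
      then have "l s 1 = 0" using that by (auto simp: l_def up min_def split: if_splits)
      then show ?thesis using xs by (simp add: hp)
    qed
  qed
  then show ?thesis by (auto simp: NDR_pair_def)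
qed

lemma contractible_NDR_suspension:
  assumes "contractible_NDR X D"
  shows "contractible_NDR (suspension X) (susp_part X D)"
proof -
  obtain u h k d where ndr: "NDR_data X D u h" and d: "d \<in> D"
    and k: "continuous_map (prod_topology I01 (subtopology X D)) (subtopology X D) k"
      "\<And>x. x \<in> D \<Longrightarrow> k (1, x) = x" "\<And>x. x \<in> D \<Longrightarrow> k (0, x) = d"
    using assms unfolding contractible_NDR_def by blast
  note nd = NDR_dataD[OF ndr]
  have dX: "d \<in> topspace X" using nd(5) d by blast
  obtain u' h' where ndr': "NDR_data (suspension X) (susp_part X D) u' h'" using NDR_susp_part[OF ndr] by blast
  let ?S = "subtopology (suspension X) (susp_part X D)"
  define P where "P = {w \<in> topspace (prod_topology X I01). susp_point w \<in> susp_part X D}"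
  have Peq: "P = {(x, s). x \<in> topspace X \<and> s \<in> {0..1} \<and> (x \<in> D \<or> s = 0 \<or> s = 1)}"
    unfolding P_def by (auto simp: susp_point_in_part simp del: susp_point_simps)
  let ?P = "subtopology (prod_topology X I01) P"
  have "quotient_map ?P ?S susp_point"
    by (rule quotient_map_restriction[OF quotient_map_susp_point P_def[symmetric]]) (use NDR_data_closed[OF ndr'] in blast)
  then have q: "quotient_map (prod_topology I01 ?P) (prod_topology I01 ?S) (\<lambda>(t, w). (t, susp_point w))"
    by (rule quotient_map_prod_right[OF locally_compact_I01 disjI1[OF Hausdorff_I01]])
  \<comment> \<open>Read backwards in time: \<open>D\<close> is contracted to \<open>d\<close>,
    which leaves the meridian through \<open>d\<close>; then this meridian shrinks to South and
    takes North along.\<close>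
  define K where "K = (\<lambda>(t, z). susp_lift South (susp_point (d, min 1 (2 * t)))
     (\<lambda>w. susp_point (k (max 0 (2 * t - 1), fst w), min 1 (2 * t) * snd w)) z)"
  let ?Q = "prod_topology I01 ?P"
  have K1: "K (t, susp_point (x, s)) = susp_point (k (max 0 (2 * t - 1), x), min 1 (2 * t) * s)"
    if "x \<in> D" for t x s
  proof (cases "t \<le> 1/2")
    case True
    then show ?thesis using that k(3) by (auto simp: K_def susp_point_def max_def)
  qed (auto simp: K_def susp_point_def)
  have K2: "K (t, susp_point (x, s)) = susp_point (d, min 1 (2 * t) * s)" if "s = 0 \<or> s = 1" for t x s
    using that by (auto simp: K_def)
  have tm: "continuous_map ?Q euclideanreal fst" by (rule continuous_map_I01D[OF continuous_map_fst])
  have xm: "continuous_map ?Q X (\<lambda>w. fst (snd w))"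
    by (rule continuous_map_fst_comp[OF continuous_map_into_fulltopology[OF continuous_map_snd]])
  have sm: "continuous_map ?Q I01 (\<lambda>w. snd (snd w))"
    by (rule continuous_map_snd_comp[OF continuous_map_into_fulltopology[OF continuous_map_snd]])
  have m01: "continuous_map ?Q I01 (\<lambda>w. min 1 (2 * fst w) * snd (snd w))"
  proof (rule continuous_map_I01I)
    show "continuous_map ?Q euclideanreal (\<lambda>w. min 1 (2 * fst w) * snd (snd w))"
      by (intro continuous_map_real_mult continuous_map_real_min continuous_map_real_mult_left
          continuous_map_canonical_const tm continuous_map_I01D[OF sm])
  qed (auto intro: mult_le_one)
  \<comment> \<open>Over points outside \<open>D\<close>, where \<open>k\<close> has no meaning,
    only the poles occur. There the formula with \<open>d\<close> is used, and at the poles over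
    points of \<open>D\<close> the two formulas agree.\<close>
  have KS: "continuous_map ?Q (suspension X) (\<lambda>w. K (fst w, susp_point (snd w)))"
  proof (rule continuous_map_paste_closed)
    show "closedin ?Q {w \<in> topspace ?Q. fst (snd w) \<in> D}"
      by (rule closedin_continuous_map_preimage[OF xm NDR_data_closed[OF ndr]])
    show "closedin ?Q {w \<in> topspace ?Q. snd (snd w) \<in> {0, 1}}"
      by (rule closedin_continuous_map_preimage[OF sm]) (simp add: closed_subset)
    show "topspace ?Q \<subseteq> {w \<in> topspace ?Q. fst (snd w) \<in> D} \<union> {w \<in> topspace ?Q. snd (snd w) \<in> {0, 1}}"
      by (auto simp: Peq)
    let ?Q1 = "subtopology ?Q {w \<in> topspace ?Q. fst (snd w) \<in> D}"
    have "continuous_map ?Q1 (subtopology X D) (\<lambda>w. fst (snd w))"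
      by (rule continuous_map_into_subtopology[OF continuous_map_from_subtopology[OF xm]]) auto
    moreover have "continuous_map ?Q1 I01 (\<lambda>w. max 0 (2 * fst w - 1))"
    proof (rule continuous_map_I01I)
      show "continuous_map ?Q1 euclideanreal (\<lambda>w. max 0 (2 * fst w - 1))"
        by (intro continuous_map_diff continuous_map_real_max continuous_map_real_mult_left
            continuous_map_canonical_const continuous_map_from_subtopology[OF tm])
    qed auto
    ultimately have "continuous_map ?Q1 X (\<lambda>w. k (max 0 (2 * fst w - 1), fst (snd w)))"
      by (intro continuous_map_into_fulltopology[OF continuous_map_comp[OF _ k(1)]] continuous_map_pairedI)
    then show "continuous_map ?Q1 (suspension X) (\<lambda>w. susp_point (k (max 0 (2 * fst w - 1), fst (snd w)), min 1 (2 * fst w) * snd (snd w)))"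
      by (intro continuous_map_comp[OF _ quotient_imp_continuous_map[OF quotient_map_susp_point]] continuous_map_pairedI
          continuous_map_from_subtopology[OF m01])
    show "continuous_map (subtopology ?Q {w \<in> topspace ?Q. snd (snd w) \<in> {0, 1}}) (suspension X)
        (\<lambda>w. susp_point (d, min 1 (2 * fst w) * snd (snd w)))"
      by (intro continuous_map_comp[OF _ quotient_imp_continuous_map[OF quotient_map_susp_point]] continuous_map_pairedI
          continuous_map_from_subtopology[OF m01]) (use dX in auto)
    show "K (fst w, susp_point (snd w)) = susp_point (k (max 0 (2 * fst w - 1), fst (snd w)), min 1 (2 * fst w) * snd (snd w))"
      if "w \<in> {w \<in> topspace ?Q. fst (snd w) \<in> D}" for w
      using that K1[of "fst (snd w)" "fst w" "snd (snd w)"] by simp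
    show "K (fst w, susp_point (snd w)) = susp_point (d, min 1 (2 * fst w) * snd (snd w))"
      if "w \<in> {w \<in> topspace ?Q. snd (snd w) \<in> {0, 1}}" for w
      using that K2[of "snd (snd w)" "fst w" "fst (snd w)"] by simp
  qed
  have kD: "k (t, x) \<in> D" if "t \<in> {0..1}" "x \<in> D" for t x
    using continuous_map_app[OF k(1), of "(t, x)"] that nd(5) by auto
  have Kc: "continuous_map (prod_topology I01 ?S) ?S K"
  proof (rule continuous_compose_quotient_map[OF q], rule continuous_map_into_subtopology)
    show "continuous_map ?Q (suspension X) (K \<circ> (\<lambda>(t, w). (t, susp_point w)))"
      using KS by (simp add: o_def case_prod_unfold)
    show "K \<circ> (\<lambda>(t, w). (t, susp_point w)) \<in> topspace ?Q \<rightarrow> susp_part X D"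
    proof
      fix w assume w: "w \<in> topspace ?Q"
      obtain t x s where "w = (t, (x, s))" by (metis surj_pair)
      then have txs: "w = (t, (x, s))" "t \<in> {0..1}" "x \<in> topspace X" "s \<in> {0..1}" "x \<in> D \<or> s = 0 \<or> s = 1"
        using w by (auto simp: Peq)
      have m: "min 1 (2 * t) * s \<in> {0..1}" "max 0 (2 * t - 1) \<in> {0..1}" using txs by (auto intro: mult_le_one)
      show "(K \<circ> (\<lambda>(t, w). (t, susp_point w))) w \<in> susp_part X D"
      proof (cases "x \<in> D")
        case True
        then have kx: "k (max 0 (2 * t - 1), x) \<in> D" using kD m by blast
        then have "k (max 0 (2 * t - 1), x) \<in> topspace X" using nd(5) by blast
        then show ?thesis using K1[OF True] kx m txs by (simp add: susp_point_in_part)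
      next
        case False
        then show ?thesis using K2[of s] d dX m txs by (simp add: susp_point_in_part)
      qed
    qed
  qed
  have "South \<in> susp_part X D" using susp_point_in_part[OF dX, of 0 D] by simp
  moreover have "K (1, z) = z \<and> K (0, z) = South" if "z \<in> susp_part X D" for z
  proof -
    obtain x s where xs: "x \<in> topspace X" "s \<in> {0..1}" "z = susp_point (x, s)"
      using \<open>z \<in> susp_part X D\<close> suspensionE unfolding susp_part_def by blast
    then have "x \<in> D \<or> s = 0 \<or> s = 1" using that susp_point_in_part by metis
    then show ?thesis using K1[of x 1 s] K1[of x 0 s] K2[of s 1 x] K2[of s 0 x] k(2) xs by auto
  qed
  ultimately show ?thesis unfolding contractible_NDR_def using ndr' Kc by blast
qed

lemma map_susp_susp_point: "map_susp f (susp_point (x, s)) = susp_point (map_susp f x, s)"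
  by (simp add: susp_point_def)

lemma map_susp_merid: "map_susp f (merid (Some y) (x, s)) = merid (Some (map_susp f y)) (map_susp f x, s)"
  by (simp add: merid_def join_fam_def ret_def map_susp_susp_point)

lemma wedge_loops_natural:
  assumes "\<And>i. i \<in> set L \<Longrightarrow> map_susp (f i) (\<pi> i x) = \<pi>' i x'" "\<And>i. i \<in> set L \<Longrightarrow> map_susp (f i) (y i) = y' i"
  shows "wedge_map South (\<lambda>i. map_susp (f i)) (wedge_loops y \<pi> L (x, s)) = wedge_loops y' \<pi>' L (x', s)"
  using assms
  by (induction L arbitrary: s) (auto simp: join_fam_def wedge_map_incl map_susp_merid wedge_map_def[of _ _ None])

section \<open>Suspensions of wedges\<close>

lemma wedge_proj_None: "wedge_proj b i None = b"
  by (simp add: wedge_proj_def)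

text \<open>The unreduced suspension of a wedge is in general not the wedge of the suspensions. The
  product of the loop families given by the projections to the summands compares the two; inclusions
  and projections form an identity matrix, so the triangular argument shows that it is an
  equivalence.\<close>

definition susp_wedge_map :: "'i list \<Rightarrow> ('i \<times> 'c susp) option susp \<Rightarrow> ('i \<times> 'c susp) option" where
  "susp_wedge_map L = susp_lift None None (wedge_loops (\<lambda>_. South) (\<lambda>i z. wedge_proj South i (unPt z)) L)"

lemma homotopy_equivalence_susp_wedge_map:
  assumes L: "distinct L" "L \<noteq> []" and A: "\<And>i. i \<in> set L \<Longrightarrow> topspace (A i) \<noteq> {}"
  shows "homotopy_equivalence_map (suspension (ptop (wedge South (set L) (\<lambda>i. suspension (A i)))))
    (wedge South (set L) (\<lambda>i. suspension (suspension (A i)))) (susp_wedge_map L)"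
proof -
  let ?I = "set L" and ?V = "\<lambda>i. suspension (A i)"
  let ?W = "wedge South ?I ?V"
  have S: "South \<in> topspace (?V i)" if "i \<in> ?I" for i using A[OF that] by (simp add: South_in_suspension)
  have cl: "closedin (?V i) {South}" if "i \<in> ?I" for i using closedin_South[of "A i"] S[OF that] by simp
  have clP: "closedin (ptop ?W) (Pt ` C)" if "closedin ?W C" for C
  proof -
    have "homeomorphic_map ?W (ptop ?W) Pt" using homeomorphic_maps_Pt homeomorphic_map_maps by blast
    then show ?thesis using that homeomorphic_imp_closed_map closed_map_def by blast
  qed
  have part: "(\<lambda>z. wedge_incl South (i, z)) ` topspace (?V i) = topspace ?W \<inter> wedge_part {i}" if "i \<in> ?I" for i
  proof -
    have "homeomorphic_maps (?V i) (subtopology ?W (wedge_part {i})) (\<lambda>z. wedge_incl South (i, z)) (wedge_proj South i)"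
      by (rule homeomorphic_wedge_summand[OF that, of South ?V, OF S[OF that]])
    then have "(\<lambda>z. wedge_incl South (i, z)) ` topspace (?V i) = topspace (subtopology ?W (wedge_part {i}))"
      by (metis homeomorphic_imp_surjective_map homeomorphic_maps_map)
    then show ?thesis by simp
  qed
  obtain i0 where i0: "i0 \<in> ?I" using L by (cases L) auto
  interpret tw: triangular_wedge "ptop ?W" "Pt None" ?I ?I ?V "\<lambda>_. South"
    "\<lambda>i z. Pt (wedge_incl South (i, z))" "\<lambda>i z. wedge_proj South i (unPt z)"
  proof
    have "None \<in> topspace ?W" by (rule wedge_None[OF i0, of South ?V, OF S[OF i0]])
    then show "Pt None \<in> topspace (ptop ?W)" by (simp add: topspace_ptop)
    have "closedin ?W (topspace ?W \<inter> wedge_part {})" by (rule closedin_wedge_part[OF cl])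
    then have "closedin ?W {None}" using \<open>None \<in> topspace ?W\<close> by (simp add: wedge_part_empty)
    from clP[OF this] show "closedin (ptop ?W) {Pt None}" by simp
    fix i assume i: "i \<in> ?I"
    show "South \<in> topspace (?V i)" by (rule S[OF i])
    then show "topspace (?V i) \<noteq> {}" by blast
    show "continuous_map (?V i) (ptop ?W) (\<lambda>z. Pt (wedge_incl South (i, z)))"
      by (rule continuous_map_comp[OF continuous_map_wedge_incl[OF i, of ?V South] continuous_map_Pt])
    show "continuous_map (ptop ?W) (?V i) (\<lambda>z. wedge_proj South i (unPt z))"
      by (rule continuous_map_comp[OF continuous_map_unPt continuous_map_wedge_proj[of South ?V i, OF S[OF i]]])
    have "(\<lambda>z. Pt (wedge_incl South (i, z))) ` topspace (?V i) = Pt ` (topspace ?W \<inter> wedge_part {i})"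
      unfolding part[OF i, symmetric] by (simp add: image_image)
    moreover have "closedin ?W (topspace ?W \<inter> wedge_part {i})" by (rule closedin_wedge_part[OF cl])
    ultimately show "closedin (ptop ?W) ((\<lambda>z. Pt (wedge_incl South (i, z))) ` topspace (?V i))"
      using clP by simp
    show "NDR_pair (?V i) {South}" by (rule NDR_South[OF A[OF i]])
  qed (use i0 in \<open>auto simp: wedge_proj_incl wedge_proj_None\<close>)
  have s: "splits (Some (Pt None)) (subtopology (ptop ?W) (tw.part L)) (subtopology tw.W (wedge_part ?I)) None None (tw.loops L)"
    by (rule tw.splits_loops) (use L sorted_wrt_iff_nth_less in \<open>auto simp: wedge_proj_incl sorted_wrt_iff_nth_less nth_eq_iff_index_eq\<close>)
  have "tw.part L = topspace (ptop ?W)"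
  proof
    show "tw.part L \<subseteq> topspace (ptop ?W)" by (rule tw.part_subset) simp
    show "topspace (ptop ?W) \<subseteq> tw.part L"
      by (auto simp: topspace_ptop topspace_wedge tw.part_def)
  qed
  moreover have "subtopology tw.W (wedge_part ?I) = tw.W"
    by (rule subtopology_superset[OF topspace_wedge_subset])
  ultimately have "splits (Some (Pt None)) (ptop ?W) tw.W None None (tw.loops L)" using s by simp
  from splits_imp_homotopy_equivalence[OF this] show ?thesis by (simp add: susp_wedge_map_def)
qed

text \<open>Each step moves the innermost suspension into the wedge. The power of
  \<open>smap\<close> acts below the \<open>m\<close> suspensions that remain outside, and
  \<open>Pt\<close> makes the new wedge a zeroth suspension again.\<close>

primrec iter_susp_wedge_map :: "'i list \<Rightarrow> nat \<Rightarrow> ('i \<times> 'c susp) option susp \<Rightarrow> ('i \<times> 'c susp) option" where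
  "iter_susp_wedge_map L 0 = unPt"
| "iter_susp_wedge_map L (Suc m) = iter_susp_wedge_map L m \<circ> (smap ^^ m) (Pt \<circ> susp_wedge_map L)"

lemma homotopy_equivalence_Pt_comp:
  assumes "homotopy_equivalence_map A B f"
  shows "homotopy_equivalence_map A (ptop B) (Pt \<circ> f)"
  using homotopy_equivalence_map_compose[OF assms homotopy_equivalence_map_homeomorphic[OF homeomorphic_maps_Pt]] .

lemma suspension_funpow_Suc: "(suspension ^^ Suc k) A = suspension ((suspension ^^ k) A)"
  by simp

lemma suspension_funpow_inner: "(suspension ^^ Suc m) A = (suspension ^^ m) (suspension A)"
  by (simp only: funpow_Suc_right o_apply)

lemma suspension_funpow_nonempty: "topspace A \<noteq> {} \<Longrightarrow> topspace ((suspension ^^ k) A) \<noteq> {}"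
proof (induction k)
  case (Suc k)
  then show ?case using South_in_suspension[of "(suspension ^^ k) A"] by auto
qed simp

text \<open>The number of suspensions inside the wedge grows during the induction on
  \<open>m\<close>, so \<open>k\<close> is arbitrary. One of them is there from the start, because
  the south pole serves as a base point with NDR data.\<close>

lemma homotopy_equivalence_iter_susp_wedge_map:
  assumes L: "distinct L" "L \<noteq> []" and A: "\<And>i. i \<in> set L \<Longrightarrow> topspace (A i) \<noteq> {}"
  shows "homotopy_equivalence_map ((suspension ^^ m) (ptop (wedge South (set L) (\<lambda>i. (suspension ^^ Suc k) (A i)))))
    (wedge South (set L) (\<lambda>i. (suspension ^^ (Suc (k + m))) (A i))) (iter_susp_wedge_map L m)"
proof (induction m arbitrary: k)
  case 0
  have "homotopy_equivalence_map (ptop B) B unPt" for B :: "('a \<times> 'b susp) option topology"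
    using homotopy_equivalence_map_homeomorphic homeomorphic_maps_Pt homeomorphic_maps_sym by blast
  then show ?case by simp
next
  case (Suc m)
  have "homotopy_equivalence_map (suspension (ptop (wedge South (set L) (\<lambda>i. suspension ((suspension ^^ k) (A i))))))
      (wedge South (set L) (\<lambda>i. suspension (suspension ((suspension ^^ k) (A i))))) (susp_wedge_map L)"
    by (rule homotopy_equivalence_susp_wedge_map[OF L suspension_funpow_nonempty[OF A]])
  from homotopy_equivalence_map_smap_funpow[OF homotopy_equivalence_Pt_comp[OF this], of m]
  have 1: "homotopy_equivalence_map ((suspension ^^ Suc m) (ptop (wedge South (set L) (\<lambda>i. (suspension ^^ Suc k) (A i)))))
     ((suspension ^^ m) (ptop (wedge South (set L) (\<lambda>i. (suspension ^^ Suc (Suc k)) (A i))))) ((smap ^^ m) (Pt \<circ> susp_wedge_map L))"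
    unfolding suspension_funpow_inner[where A = "ptop B" for B] unfolding suspension_funpow_Suc .
  from homotopy_equivalence_map_compose[OF 1 Suc.IH[of "Suc k"]]
  show ?case by (simp only: iter_susp_wedge_map.simps add_Suc add_Suc_right)
qed

lemma susp_wedge_map_natural:
  assumes "z \<in> topspace (suspension (ptop (wedge South (set L) V)))"
  shows "wedge_map South (\<lambda>i. map_susp (f i)) (susp_wedge_map L z)
    = susp_wedge_map L (map_susp (wedge_map South (\<lambda>i. map_susp (f i))) z)"
proof -
  let ?g = "wedge_map South (\<lambda>i. map_susp (f i))"
  obtain w s where w: "w \<in> topspace (wedge South (set L) V)" "z = susp_point (Pt w, s)" "s \<in> {0..1}"
    using assms by (auto elim!: suspensionE simp: topspace_ptop)
  have p: "map_susp (f i) (wedge_proj South i w) = wedge_proj South i (?g w)" if "i \<in> set L" for i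
    using w(1) by (auto elim!: wedgeE simp: wedge_map_incl wedge_proj_incl)
  have "?g (wedge_loops (\<lambda>_. South) (\<lambda>i z. wedge_proj South i (unPt z)) L (Pt w, s'))
    = wedge_loops (\<lambda>_. South) (\<lambda>i z. wedge_proj South i (unPt z)) L (Pt (?g w), s')" for s'
    by (rule wedge_loops_natural) (use p in auto)
  then show ?thesis using w
    by (auto simp: susp_wedge_map_def map_susp_susp_point susp_point_def wedge_map_def[of _ _ None])
qed

lemma smap_funpow_natural:
  assumes "\<And>z. z \<in> topspace A \<Longrightarrow> map_susp g (k z) = k' (map_susp f z)" "z \<in> topspace ((suspension ^^ m) A)"
  shows "map_susp g ((smap ^^ m) k z) = (smap ^^ m) k' (map_susp f z)"
  using assms(2)
proof (induction m arbitrary: z)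
  case 0
  then show ?case using assms(1) by simp
next
  case (Suc m)
  then show ?case by (auto elim!: suspensionE simp: smap_susp_point map_susp_susp_point)
qed

lemma iter_susp_wedge_map_natural:
  assumes L: "distinct L" "L \<noteq> []" and A: "\<And>i. i \<in> set L \<Longrightarrow> topspace (A i) \<noteq> {}"
  shows "z \<in> topspace ((suspension ^^ m) (ptop (wedge South (set L) (\<lambda>i. (suspension ^^ Suc k) (A i))))) \<Longrightarrow>
    wedge_map South (\<lambda>i. map_susp (f i)) (iter_susp_wedge_map L m z)
      = iter_susp_wedge_map L m (map_susp (wedge_map South (\<lambda>i. map_susp (f i))) z)"
proof (induction m arbitrary: k z)
  case 0
  then show ?case by (auto simp: topspace_ptop)
next
  case (Suc m)
  let ?g = "wedge_map South (\<lambda>i. map_susp (f i))"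
  let ?W = "wedge South (set L) (\<lambda>i. (suspension ^^ Suc k) (A i))"
  have z: "z \<in> topspace ((suspension ^^ m) (suspension (ptop ?W)))"
    using Suc.prems unfolding suspension_funpow_inner[where A = "ptop B" for B] .
  have "homotopy_equivalence_map (suspension (ptop (wedge South (set L) (\<lambda>i. suspension ((suspension ^^ k) (A i))))))
      (wedge South (set L) (\<lambda>i. suspension (suspension ((suspension ^^ k) (A i))))) (susp_wedge_map L)"
    by (rule homotopy_equivalence_susp_wedge_map[OF L suspension_funpow_nonempty[OF A]])
  from homotopy_equivalence_map_smap_funpow[OF homotopy_equivalence_Pt_comp[OF this], of m]
  have "continuous_map ((suspension ^^ m) (suspension (ptop ?W)))
     ((suspension ^^ m) (ptop (wedge South (set L) (\<lambda>i. (suspension ^^ Suc (Suc k)) (A i))))) ((smap ^^ m) (Pt \<circ> susp_wedge_map L))"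
    unfolding homotopy_equivalence_map_def by simp
  from continuous_map_app[OF this z]
  have "?g (iter_susp_wedge_map L m ((smap ^^ m) (Pt \<circ> susp_wedge_map L) z))
      = iter_susp_wedge_map L m (map_susp ?g ((smap ^^ m) (Pt \<circ> susp_wedge_map L) z))"
    by (rule Suc.IH)
  moreover have "map_susp ?g ((smap ^^ m) (Pt \<circ> susp_wedge_map L) z) = (smap ^^ m) (Pt \<circ> susp_wedge_map L) (map_susp ?g z)"
  proof (rule smap_funpow_natural[OF _ z])
    show "map_susp ?g ((Pt \<circ> susp_wedge_map L) v) = (Pt \<circ> susp_wedge_map L) (map_susp ?g v)"
      if "v \<in> topspace (suspension (ptop ?W))" for v
      using susp_wedge_map_natural[OF that] by simp
  qed
  ultimately show ?case by simp
qed

section \<open>The filtration quotients of the realization\<close>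

definition drop_coord :: "nat \<Rightarrow> (nat \<Rightarrow> real) \<Rightarrow> nat \<Rightarrow> real" where
  "drop_coord i p k = (if k < i then p k else p (Suc k))"

lemma simplical_face_drop_coord: "p i = 0 \<Longrightarrow> simplical_face i (drop_coord i p) = p"
  by (auto simp: simplical_face_def drop_coord_def fun_eq_iff)

lemma drop_coord_simplical_face: "drop_coord i (simplical_face i p) = p"
  by (auto simp: simplical_face_def drop_coord_def fun_eq_iff)

lemma simplical_face_at [simp]: "simplical_face i p i = 0"
  by (simp add: simplical_face_def)

lemma drop_coord_simplex:
  assumes "p \<in> standard_simplex (Suc n)" "p i = 0" "i \<le> Suc n"
  shows "drop_coord i p \<in> standard_simplex n"
proof -
  have p: "\<And>k. 0 \<le> p k \<and> p k \<le> 1" "\<And>k. k > Suc n \<Longrightarrow> p k = 0" "sum p {..Suc n} = 1"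
    using assms(1) by (auto simp: standard_simplex_def)
  have "sum p {..Suc n} = sum p ({..Suc n} - {i})"
    using assms by (subst sum.remove[of _ i]) auto
  also have "\<dots> = sum (drop_coord i p) {..n}"
  proof (rule sum.reindex_bij_witness[of _ "\<lambda>k. if k < i then k else Suc k" "\<lambda>k. if k < i then k else k - 1"])
  qed (use assms(3) in \<open>auto simp: drop_coord_def split: if_splits\<close>)
  finally have "sum (drop_coord i p) {..n} = 1" using p by simp
  moreover have "0 \<le> drop_coord i p k \<and> drop_coord i p k \<le> 1" for k using p(1) by (simp add: drop_coord_def)
  moreover have "drop_coord i p k = 0" if "k > n" for k using that p(2) assms(3) by (auto simp: drop_coord_def)
  ultimately show ?thesis by (simp add: standard_simplex_def)
qed

lemma codegeneracy_simplex:
  assumes "p \<in> standard_simplex (Suc n)" "j \<le> n"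
  shows "codegeneracy j p \<in> standard_simplex n"
proof -
  have p: "\<And>k. 0 \<le> p k \<and> p k \<le> 1" "\<And>k. k > Suc n \<Longrightarrow> p k = 0" "sum p {..Suc n} = 1"
    using assms(1) by (auto simp: standard_simplex_def)
  \<comment> \<open>The weight at j + 1 is moved to j, and the zero it leaves behind is removed by
    \<open>drop_coord\<close>. This reduces the claim to \<open>drop_coord_simplex\<close>.\<close>
  define p' where "p' k = (if k = j then p j + p (Suc j) else if k = Suc j then 0 else p k)" for k
  have c: "codegeneracy j p = drop_coord (Suc j) p'"
    by (auto simp: codegeneracy_def drop_coord_def p'_def fun_eq_iff)
  have s: "sum p {..Suc n} = sum p ({..Suc n} - {j} - {Suc j}) + p j + p (Suc j)"
    using assms(2) sum.remove[of "{..Suc n}" j p] sum.remove[of "{..Suc n} - {j}" "Suc j" p] by simp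
  have "sum p' {..Suc n} = sum p' ({..Suc n} - {j} - {Suc j}) + p' j + p' (Suc j)"
    using assms(2) sum.remove[of "{..Suc n}" j p'] sum.remove[of "{..Suc n} - {j}" "Suc j" p'] by simp
  also have "sum p' ({..Suc n} - {j} - {Suc j}) = sum p ({..Suc n} - {j} - {Suc j})"
    by (rule sum.cong) (auto simp: p'_def)
  finally have s': "sum p' {..Suc n} = 1" using s p(3) by (simp add: p'_def)
  have "p j + p (Suc j) \<le> 1"
  proof -
    have "0 \<le> sum p ({..Suc n} - {j} - {Suc j})" by (rule sum_nonneg) (use p(1) in auto)
    then show ?thesis using s p(3) by simp
  qed
  then have "p' \<in> standard_simplex (Suc n)"
    unfolding standard_simplex_def using s' p assms(2) by (auto simp: p'_def)
  then show ?thesis unfolding c by (rule drop_coord_simplex) (use assms(2) in \<open>auto simp: p'_def\<close>)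
qed

lemma drop_drop: "i < j \<Longrightarrow> drop_coord (j - 1) (drop_coord i p) = drop_coord i (drop_coord j p)"
  by (auto simp: drop_coord_def fun_eq_iff)

lemma codegeneracy_drop_less: "i < j \<Longrightarrow> codegeneracy (j - 1) (drop_coord i p) = drop_coord i (codegeneracy j p)"
  by (auto simp: drop_coord_def codegeneracy_def fun_eq_iff)

lemma codegeneracy_drop_greater: "Suc j < i \<Longrightarrow> codegeneracy j (drop_coord i p) = drop_coord (i - 1) (codegeneracy j p)"
  by (auto simp: drop_coord_def codegeneracy_def fun_eq_iff)

lemma codegeneracy_eq_drop: "p i = 0 \<Longrightarrow> i = j \<or> i = Suc j \<Longrightarrow> codegeneracy j p = drop_coord i p"
  by (auto simp: drop_coord_def codegeneracy_def fun_eq_iff)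

lemma codegeneracy_codegeneracy: "i < j \<Longrightarrow> codegeneracy (j - 1) (codegeneracy i p) = codegeneracy i (codegeneracy j p)"
  by (auto simp: codegeneracy_def fun_eq_iff)

text \<open>
  Orienting the relation towards lower dimensions makes it confluent; the irreducible points consist
  of a nondegenerate simplex and an interior point.
\<close>

inductive reduction :: "'a simpl_space \<Rightarrow> 'a rpoint \<Rightarrow> 'a rpoint \<Rightarrow> bool"
  for X :: "'a simpl_space" where
  face: "\<lbrakk>x \<in> topspace (level X (Suc n)); p \<in> standard_simplex (Suc n); i \<le> Suc n; p i = 0\<rbrakk> \<Longrightarrow>
    reduction X (Suc n, x, p) (n, face X (Suc n) i x, drop_coord i p)"
| degen: "\<lbrakk>x \<in> topspace (level X n); p \<in> standard_simplex (Suc n); j \<le> n\<rbrakk> \<Longrightarrow>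
    reduction X (Suc n, degen X n j x, p) (n, x, codegeneracy j p)"

lemma realization_step_iff: "realization_step X a b \<or> realization_step X b a \<longleftrightarrow> reduction X a b \<or> reduction X b a"
proof -
  have 1: "reduction X a b \<or> reduction X b a" if "realization_step X a b" for a b
    using that
  proof cases
    case (face x n p i)
    then have "simplical_face i p \<in> standard_simplex (Suc n)"
      using simplical_face_in_standard_simplex[of "Suc n" i p] by simp
    with face reduction.face[of x X n "simplical_face i p" i] show ?thesis by (simp add: drop_coord_simplical_face)
  next
    case (degen x n p j)
    then show ?thesis using reduction.degen[of x X n p j] by simp
  qed
  have 2: "realization_step X a b \<or> realization_step X b a" if "reduction X a b" for a b
    using that
  proof cases
    case (face x n p i)
    with realization_step.face[of x X n "drop_coord i p" i] show ?thesis
      by (simp add: drop_coord_simplex simplical_face_drop_coord)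
  next
    case (degen x n p j)
    then show ?thesis using realization_step.degen[of x X n p j] by simp
  qed
  show ?thesis using 1 2 by blast
qed

lemma equivclp_realization_step: "equivclp (realization_step X) = equivclp (reduction X)"
proof -
  have "symclp (realization_step X) = symclp (reduction X)"
    unfolding symclp_def fun_eq_iff using realization_step_iff[of X] by blast
  then show ?thesis by (simp add: equivclp_def)
qed

context simplicial
begin

text \<open>Two reductions of one point have equal results or close up in a single step, by the
  simplicial identities and their duals for the coordinates.\<close>

lemma reduction_diamond:
  assumes "reduction X a b" "reduction X a c"
  shows "b = c \<or> (\<exists>d. reduction X b d \<and> reduction X c d)"
proof -
  have face_face': "b = c \<or> (\<exists>d. reduction X b d \<and> reduction X c d)"
    if a: "x \<in> L (Suc n)" "p \<in> standard_simplex (Suc n)" "p i = 0" "p j = 0" "i < j" "j \<le> Suc n"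
      and b: "b = (n, face X (Suc n) i x, drop_coord i p)" and c: "c = (n, face X (Suc n) j x, drop_coord j p)"
    for x n p i j b c
  proof -
    \<comment> \<open>The two coordinates of a point of the 1-simplex cannot both vanish. So the
      dimension is at least 2 and a second face can be taken.\<close>
    have "n \<noteq> 0"
    proof
      assume "n = 0"
      then have "sum p {..Suc 0} = 0" using a by (auto simp: le_Suc_eq less_Suc_eq)
      then show False using a(2) \<open>n = 0\<close> by (simp add: standard_simplex_def)
    qed
    then obtain m where m: "n = Suc m" by (cases n) auto
    have "drop_coord i p (j - 1) = 0" "drop_coord j p i = 0" using a by (auto simp: drop_coord_def)
    then have "reduction X b (m, face X (Suc m) (j - 1) (face X (Suc n) i x), drop_coord (j - 1) (drop_coord i p))"
      "reduction X c (m, face X (Suc m) i (face X (Suc n) j x), drop_coord i (drop_coord j p))"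
      unfolding b c m using a m by (auto intro!: reduction.face face_in drop_coord_simplex)
    then show ?thesis using face_face[of x m i j] drop_drop[OF a(5)] a m by auto
  qed
  have face_degen': "b = c \<or> (\<exists>d. reduction X b d \<and> reduction X c d)"
    if a: "y \<in> L n" "p \<in> standard_simplex (Suc n)" "p i = 0" "i \<le> Suc n" "j \<le> n"
      and b: "b = (n, face X (Suc n) i (degen X n j y), drop_coord i p)" and c: "c = (n, y, codegeneracy j p)"
    for y n p i j b c
  proof -
    have dp: "drop_coord i p \<in> standard_simplex n" "codegeneracy j p \<in> standard_simplex n"
      using a by (auto intro: drop_coord_simplex codegeneracy_simplex)
    consider "i < j" | "i = j \<or> i = Suc j" | "Suc j < i" by linarith
    then show ?thesis
    proof cases
      case 1
      then obtain m where m: "n = Suc m" "j - 1 \<le> m" "i \<le> Suc m" using a by (cases n) auto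
      have "reduction X b (m, face X n i y, codegeneracy (j - 1) (drop_coord i p))"
        unfolding b using face_degen_less[OF a(1) 1 a(5)] m a dp
        by (auto intro!: reduction.degen face_in)
      moreover have "codegeneracy j p i = 0" using 1 a by (simp add: codegeneracy_def)
      then have "reduction X c (m, face X n i y, drop_coord i (codegeneracy j p))"
        unfolding c using m a dp by (auto intro!: reduction.face)
      ultimately show ?thesis using codegeneracy_drop_less[OF 1] by auto
    next
      case 2
      then have "face X (Suc n) i (degen X n j y) = y" using face_degen face_Suc_degen a by auto
      then show ?thesis using codegeneracy_eq_drop[of p i j, OF a(3) 2] b c by simp
    next
      case 3
      then obtain m where m: "n = Suc m" "j \<le> m" "i - 1 \<le> Suc m" using a by (cases n) auto
      have "reduction X b (m, face X n (i - 1) y, codegeneracy j (drop_coord i p))"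
        unfolding b using face_degen_greater[OF a(1) 3 a(4)] m a dp
        by (auto intro!: reduction.degen face_in)
      moreover have "codegeneracy j p (i - 1) = 0" using 3 a by (auto simp: codegeneracy_def)
      then have "reduction X c (m, face X n (i - 1) y, drop_coord (i - 1) (codegeneracy j p))"
        unfolding c using m a dp by (auto intro!: reduction.face)
      ultimately show ?thesis using codegeneracy_drop_greater[OF 3] by auto
    qed
  qed
  have degen_degen': "b = c \<or> (\<exists>d. reduction X b d \<and> reduction X c d)"
    if a: "x \<in> L n" "y \<in> L n" "p \<in> standard_simplex (Suc n)" "i < j" "j \<le> n" "degen X n i x = degen X n j y"
      and b: "b = (n, x, codegeneracy i p)" and c: "c = (n, y, codegeneracy j p)"
    for x y n p i j b c
  proof -
    obtain m where m: "n = Suc m" "j - 1 \<le> m" "i \<le> m" "i \<le> n" using a by (cases n) auto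
    \<comment> \<open>A point degenerate in two ways is doubly degenerate: applying d_{j+1} to s_i x
      = s_j y gives y = s_i z, and applying d_i gives x = s_{j-1} z.\<close>
    define z where "z = face X n j x"
    have z: "z \<in> L m" using a m by (auto simp: z_def intro: face_in)
    have "y = face X (Suc n) (Suc j) (degen X n i x)" using face_Suc_degen[OF a(2,5)] a(6) by simp
    also have "\<dots> = degen X m i z" using face_degen_greater[OF a(1), of i "Suc j"] a m by (simp add: z_def)
    finally have y: "y = degen X m i z" .
    have "x = face X (Suc n) i (degen X n j y)" using face_degen[OF a(1) m(4)] a(6) by simp
    also have "\<dots> = degen X m (j - 1) (face X n i y)" using face_degen_less[OF a(2,4,5)] m by simp
    also have "face X n i y = z" using face_degen[OF z m(3)] y m by simp
    finally have x: "x = degen X m (j - 1) z" .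
    have "reduction X b (m, z, codegeneracy (j - 1) (codegeneracy i p))"
      "reduction X c (m, z, codegeneracy i (codegeneracy j p))"
      unfolding b c using x y z m a codegeneracy_simplex[of p n] by (auto intro!: reduction.degen)
    then show ?thesis using codegeneracy_codegeneracy[OF a(4)] by auto
  qed
  show ?thesis
    using assms(1)
  proof cases
    case (face x n p i)
    note 1 = face
    show ?thesis using assms(2)
    proof cases
      case (face x' n' p' j)
      with 1 show ?thesis using face_face'[of x n p i j b c] face_face'[of x n p j i c b]
        by (cases i j rule: linorder_cases) auto
    next
      case (degen y n' p' j)
      with 1 show ?thesis using face_degen'[of y n p i j b c] by auto
    qed
  next
    case (degen y n p j)
    note 1 = degen
    show ?thesis using assms(2)
    proof cases
      case (face x' n' p' i)
      with 1 show ?thesis using face_degen'[of y n p i j c b] by auto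
    next
      case (degen x' n' p' i)
      with 1 show ?thesis
      proof (cases i j rule: linorder_cases)
        case equal
        then show ?thesis using 1 degen face_degen[of y n j] face_degen[of x' n j] by auto
      qed (use 1 degen degen_degen'[of y n x' p j i b c] degen_degen'[of x' n y p i j c b] in auto)
    qed
  qed
qed

lemma confluentp_reduction: "confluentp (reduction X)"
proof (rule strong_confluentp_imp_confluentp, rule strong_confluentpI)
  show "\<exists>u. (reduction X)\<^sup>*\<^sup>* y u \<and> (reduction X)\<^sup>=\<^sup>= z u" if "reduction X x y" "reduction X x z" for x y z
    using reduction_diamond[OF that] by blast
qed

lemma realization_class_eq_iff:
  "realization_class X a = realization_class X b \<longleftrightarrow> (\<exists>c. (reduction X)\<^sup>*\<^sup>* a c \<and> (reduction X)\<^sup>*\<^sup>* b c)"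
proof -
  have "realization_class X a = realization_class X b \<longleftrightarrow> equivclp (reduction X) a b"
    unfolding realization_class_def equivclp_realization_step
    by (auto intro: equivclp_sym equivclp_trans)
  also have "\<dots> \<longleftrightarrow> (\<exists>c. (reduction X)\<^sup>*\<^sup>* a c \<and> (reduction X)\<^sup>*\<^sup>* b c)"
    using semiconfluentp_equivclp[OF confluentp_imp_semiconfluentp[OF confluentp_reduction]]
    by (auto simp: rtranclp_conversep OO_def)
  finally show ?thesis .
qed

lemma realization_class_reduction: "reduction X a b \<Longrightarrow> realization_class X a = realization_class X b"
  unfolding realization_class_eq_iff by blast

lemma reduction_fst: "reduction X a b \<Longrightarrow> fst a = Suc (fst b)"
  by (cases rule: reduction.cases) auto

lemma reductions_fst: "(reduction X)\<^sup>*\<^sup>* a b \<Longrightarrow> fst b \<le> fst a"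
  by (induction rule: rtranclp_induct) (auto dest: reduction_fst)

definition rpoints :: "'a rpoint set" where
  "rpoints = {(n, x, p). x \<in> L n \<and> p \<in> standard_simplex n}"

lemma reduction_rpoints: "reduction X a b \<Longrightarrow> b \<in> rpoints"
  by (cases rule: reduction.cases) (auto simp: rpoints_def intro!: face_in drop_coord_simplex codegeneracy_simplex)

lemma reductions_rpoints: "(reduction X)\<^sup>*\<^sup>* a b \<Longrightarrow> a \<in> rpoints \<Longrightarrow> b \<in> rpoints"
  by (induction rule: rtranclp_induct) (auto dest: reduction_rpoints)

lemma realization_filtration_eq: "realization_filtration X j = realization_class X ` {a \<in> rpoints. int (fst a) \<le> j}"
  unfolding realization_filtration_def by (rule arg_cong[of _ _ "(`) (realization_class X)"]) (auto simp: rpoints_def)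

lemma class_in_filtration_iff:
  assumes "a \<in> rpoints"
  shows "realization_class X a \<in> realization_filtration X j \<longleftrightarrow> (\<exists>c. (reduction X)\<^sup>*\<^sup>* a c \<and> int (fst c) \<le> j)"
proof
  assume "realization_class X a \<in> realization_filtration X j"
  then obtain b where b: "int (fst b) \<le> j" "realization_class X a = realization_class X b"
    unfolding realization_filtration_eq by auto
  then obtain c where c: "(reduction X)\<^sup>*\<^sup>* a c" "(reduction X)\<^sup>*\<^sup>* b c"
    unfolding realization_class_eq_iff by blast
  then show "\<exists>c. (reduction X)\<^sup>*\<^sup>* a c \<and> int (fst c) \<le> j"
    using reductions_fst[OF c(2)] b(1) by (intro exI[of _ c]) simp
next
  assume "\<exists>c. (reduction X)\<^sup>*\<^sup>* a c \<and> int (fst c) \<le> j"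
  then obtain c where c: "(reduction X)\<^sup>*\<^sup>* a c" "int (fst c) \<le> j" by blast
  then have "realization_class X a = realization_class X c" unfolding realization_class_eq_iff by blast
  then show "realization_class X a \<in> realization_filtration X j"
    unfolding realization_filtration_eq using c reductions_rpoints[OF c(1) assms] by auto
qed

definition boundary :: "nat \<Rightarrow> ('a \<times> (nat \<Rightarrow> real)) set" where
  "boundary j = {(x, p). x \<in> D (Suc 0) j \<or> (\<exists>i\<le>j. p i = 0)}"

lemma reducible_iff:
  assumes "x \<in> L j" "p \<in> standard_simplex j"
  shows "(\<exists>b. reduction X (j, x, p) b) \<longleftrightarrow> (x, p) \<in> boundary j"
proof
  assume "\<exists>b. reduction X (j, x, p) b"
  then obtain b where "reduction X (j, x, p) b" by blast
  then show "(x, p) \<in> boundary j" by (cases rule: reduction.cases) (auto simp: boundary_def)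
next
  assume b: "(x, p) \<in> boundary j"
  show "\<exists>b. reduction X (j, x, p) b"
  proof (cases j)
    case 0
    then show ?thesis using b assms by (auto simp: boundary_def standard_simplex_def)
  next
    case (Suc n)
    then consider i where "i \<le> Suc n" "p i = 0" | y i where "i \<le> n" "y \<in> L n" "x = degen X n i y"
      using b by (auto simp: boundary_def)
    then show ?thesis using assms Suc reduction.face[of x X n p] reduction.degen[of _ X n p]
      by cases blast+
  qed
qed

text \<open>The characteristic map from X_j \<times> \<Delta>^j to F_j/F_{j-1}.\<close>

definition filtration_point :: "nat \<Rightarrow> 'a \<times> (nat \<Rightarrow> real) \<Rightarrow> 'a rpoint set option" where
  "filtration_point j w = collapse (realization_filtration X (int j - 1)) (realization_class X (j, w))"

lemma filtration_point_None:
  assumes "x \<in> L j" "p \<in> standard_simplex j"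
  shows "filtration_point j (x, p) = None \<longleftrightarrow> (x, p) \<in> boundary j"
proof -
  have "(j, x, p) \<in> rpoints" using assms by (simp add: rpoints_def)
  from class_in_filtration_iff[OF this, of "int j - 1"]
  have "filtration_point j (x, p) = None \<longleftrightarrow> (\<exists>c. (reduction X)\<^sup>*\<^sup>* (j, x, p) c \<and> fst c < j)"
    by (simp add: filtration_point_def collapse_def)
  also have "\<dots> \<longleftrightarrow> (\<exists>b. reduction X (j, x, p) b)"
  proof
    assume "\<exists>c. (reduction X)\<^sup>*\<^sup>* (j, x, p) c \<and> fst c < j"
    then show "\<exists>b. reduction X (j, x, p) b" by (metis converse_rtranclpE fst_conv less_irrefl)
  next
    assume "\<exists>b. reduction X (j, x, p) b"
    then obtain b where b: "reduction X (j, x, p) b" by blast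
    then have "(reduction X)\<^sup>*\<^sup>* (j, x, p) b" "fst b < j" using reduction_fst[OF b] by auto
    then show "\<exists>c. (reduction X)\<^sup>*\<^sup>* (j, x, p) c \<and> fst c < j" by blast
  qed
  finally show ?thesis using reducible_iff[OF assms] by simp
qed

text \<open>A point outside the boundary is irreducible, and by confluence a class contains at most
  one irreducible point.\<close>

lemma filtration_point_inj:
  assumes "x \<in> L j" "p \<in> standard_simplex j" "y \<in> L j" "q \<in> standard_simplex j"
    and eq: "filtration_point j (x, p) = filtration_point j (y, q)"
  shows "(x, p) = (y, q) \<or> (x, p) \<in> boundary j \<and> (y, q) \<in> boundary j"
proof (cases "filtration_point j (x, p) = None")
  case True
  then show ?thesis using filtration_point_None assms by metis
next
  case False
  then have "realization_class X (j, x, p) = realization_class X (j, y, q)"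
    using eq by (auto simp: filtration_point_def collapse_def split: if_splits)
  then obtain c where c: "(reduction X)\<^sup>*\<^sup>* (j, x, p) c" "(reduction X)\<^sup>*\<^sup>* (j, y, q) c"
    unfolding realization_class_eq_iff by blast
  have "\<not> (\<exists>b. reduction X (j, x, p) b)" "\<not> (\<exists>b. reduction X (j, y, q) b)"
    using False eq filtration_point_None reducible_iff assms by metis+
  then have "c = (j, x, p)" "c = (j, y, q)" using c by (metis converse_rtranclpE)+
  then show ?thesis by simp
qed

end

section \<open>The topology of the filtration quotients\<close>

lemma topspace_simplex_space [simp]: "topspace (simplex_space n) = standard_simplex n"
  by (simp add: simplex_space_def)

lemma continuous_map_simplex_coord: "continuous_map (simplex_space n) euclideanreal (\<lambda>p. p k)"
  unfolding simplex_space_def by (rule continuous_map_from_subtopology[OF continuous_map_product_projection]) simp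

lemma continuous_map_into_simplex:
  assumes "\<And>k. continuous_map T euclideanreal (\<lambda>t. f t k)" "\<And>t. t \<in> topspace T \<Longrightarrow> f t \<in> standard_simplex n"
  shows "continuous_map T (simplex_space n) f"
  unfolding simplex_space_def
  by (rule continuous_map_into_subtopology) (use assms in \<open>auto simp: continuous_map_componentwise_UNIV\<close>)

context NDR_simplicial
begin

abbreviation "LD n \<equiv> prod_topology (level X n) (simplex_space n)"

lemma closedin_degen_image:
  assumes "i \<le> n"
  shows "closedin (level X (Suc n)) (degen X n i ` L n)"
proof -
  have "[i] \<in> admissible (Suc n) 1" using assms by (simp add: admissible_def)
  from closedin_degens_image[OF this] show ?thesis by simp
qed

text \<open>Closedness in the realization has to be tested in every dimension. Below j the preimage
  is everything or empty. Above j each point whose class lies in F_j is reducible, so the preimage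
  is a finite union of sets pulled back from one dimension lower, along faces of the simplex and
  along the closed images of degeneracies.\<close>

lemma closedin_class_preimage:
  assumes W: "W \<subseteq> topspace (realization_quotient (int j) X)"
    and c: "closedin (LD j) {w \<in> topspace (LD j). filtration_point j w \<in> W}"
  shows "closedin (LD m) {w \<in> topspace (LD m). realization_class X (m, w) \<in>
    {c \<in> realization_filtration X (int j). collapse (realization_filtration X (int j - 1)) c \<in> W}}"
proof (induction m)
  let ?C = "{c \<in> realization_filtration X (int j). collapse (realization_filtration X (int j - 1)) c \<in> W}"
  have base: "closedin (LD m) {w \<in> topspace (LD m). realization_class X (m, w) \<in> ?C}" if "m \<le> j" for m
  proof (cases "m = j")
    case True
    have "realization_class X (j, w) \<in> realization_filtration X (int j)" if "w \<in> topspace (LD j)" for w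
      using that unfolding realization_filtration_eq by (cases w) (auto simp: rpoints_def)
    then have "{w \<in> topspace (LD j). realization_class X (j, w) \<in> ?C} = {w \<in> topspace (LD j). filtration_point j w \<in> W}"
      by (auto simp: filtration_point_def)
    then show ?thesis using c True by simp
  next
    case False
    have "realization_class X (m, w) \<in> realization_filtration X (int j) \<and> realization_class X (m, w) \<in> realization_filtration X (int j - 1)"
      if "w \<in> topspace (LD m)" for w
      using that False \<open>m \<le> j\<close> unfolding realization_filtration_eq by (cases w) (auto simp: rpoints_def)
    then have "{w \<in> topspace (LD m). realization_class X (m, w) \<in> ?C} = (if None \<in> W then topspace (LD m) else {})"
      by (auto simp: collapse_def)
    then show ?thesis by (cases "None \<in> W") (simp_all only: if_True if_False closedin_topspace closedin_empty simp_thms)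
  qed
  {
    case 0
    show ?case by (rule base) simp
  next
    case (Suc n)
    show ?case
    proof (cases "Suc n \<le> j")
      case True
      then show ?thesis by (rule base)
    next
      case False
      let ?Cn = "{w \<in> topspace (LD n). realization_class X (n, w) \<in> ?C}"
      let ?F = "\<lambda>i. {w \<in> {w \<in> topspace (LD (Suc n)). snd w i \<in> {0}}. (face X (Suc n) i (fst w), drop_coord i (snd w)) \<in> ?Cn}"
      \<comment> \<open>On the image of s_i the face d_i recovers the simplex that was degenerated.
        So the condition becomes the preimage of \<open>?Cn\<close> under a map that is continuous
        on the whole product.\<close>
      let ?G = "\<lambda>i. {w \<in> topspace (LD (Suc n)). fst w \<in> degen X n i ` L n} \<inter>
        {w \<in> topspace (LD (Suc n)). (face X (Suc n) i (fst w), codegeneracy i (snd w)) \<in> ?Cn}"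
      have coord: "continuous_map (LD (Suc n)) euclideanreal (\<lambda>w. snd w k)" for k
        by (rule continuous_map_comp[OF continuous_map_snd continuous_map_simplex_coord])
      have clF: "closedin (LD (Suc n)) (?F i)" if "i \<le> Suc n" for i
      proof -
        let ?S = "{w \<in> topspace (LD (Suc n)). snd w i \<in> {0}}"
        have S: "closedin (LD (Suc n)) ?S"
          by (rule closedin_continuous_map_preimage[OF coord]) simp
        let ?T = "subtopology (LD (Suc n)) ?S"
        have "continuous_map ?T (LD n) (\<lambda>w. (face X (Suc n) i (fst w), drop_coord i (snd w)))"
        proof (rule continuous_map_pairedI)
          show "continuous_map ?T (level X n) (\<lambda>w. face X (Suc n) i (fst w))"
            by (rule continuous_map_from_subtopology[OF continuous_map_comp[OF continuous_map_fst face_cont[OF that]]])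
          show "continuous_map ?T (simplex_space n) (\<lambda>w. drop_coord i (snd w))"
          proof (rule continuous_map_into_simplex)
            show "continuous_map ?T euclideanreal (\<lambda>w. drop_coord i (snd w) k)" for k
              unfolding drop_coord_def using continuous_map_from_subtopology[OF coord] by (cases "k < i") auto
            show "drop_coord i (snd w) \<in> standard_simplex n" if "w \<in> topspace ?T" for w
              using that \<open>i \<le> Suc n\<close> by (auto intro!: drop_coord_simplex)
          qed
        qed
        from closedin_continuous_map_preimage[OF this Suc.IH]
        have "closedin ?T {w \<in> topspace ?T. (face X (Suc n) i (fst w), drop_coord i (snd w)) \<in> ?Cn}" .
        moreover have "topspace ?T = ?S" by auto
        ultimately have "closedin ?T (?F i)" by simp
        then show ?thesis by (rule closedin_trans_full[OF _ S])
      qed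
      have clG: "closedin (LD (Suc n)) (?G i)" if "i \<le> n" for i
      proof (rule closedin_Int)
        show "closedin (LD (Suc n)) {w \<in> topspace (LD (Suc n)). fst w \<in> degen X n i ` L n}"
          by (rule closedin_continuous_map_preimage[OF continuous_map_fst closedin_degen_image[OF that]])
        have i: "i \<le> Suc n" using that by simp
        have "continuous_map (LD (Suc n)) (LD n) (\<lambda>w. (face X (Suc n) i (fst w), codegeneracy i (snd w)))"
        proof (rule continuous_map_pairedI)
          show "continuous_map (LD (Suc n)) (level X n) (\<lambda>w. face X (Suc n) i (fst w))"
            by (rule continuous_map_comp[OF continuous_map_fst face_cont[OF i]])
          show "continuous_map (LD (Suc n)) (simplex_space n) (\<lambda>w. codegeneracy i (snd w))"
          proof (rule continuous_map_into_simplex)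
            show "continuous_map (LD (Suc n)) euclideanreal (\<lambda>w. codegeneracy i (snd w) k)" for k
              unfolding codegeneracy_def using coord continuous_map_add[OF coord coord]
              by (cases "k < i"; cases "k = i") auto
          qed (use that in \<open>auto intro!: codegeneracy_simplex\<close>)
        qed
        from closedin_continuous_map_preimage[OF this Suc.IH]
        show "closedin (LD (Suc n)) {w \<in> topspace (LD (Suc n)). (face X (Suc n) i (fst w), codegeneracy i (snd w)) \<in> ?Cn}" .
      qed
      have "{w \<in> topspace (LD (Suc n)). realization_class X (Suc n, w) \<in> ?C} = (\<Union>i\<le>Suc n. ?F i) \<union> (\<Union>i\<le>n. ?G i)" (is "?l = ?r")
      proof
        show "?l \<subseteq> ?r"
        proof
          fix w assume w: "w \<in> ?l"
          obtain x p where xp: "w = (x, p)" by (cases w)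
          then have x: "x \<in> L (Suc n)" "p \<in> standard_simplex (Suc n)" and cl: "realization_class X (Suc n, x, p) \<in> ?C"
            using w by auto
          have "(Suc n, x, p) \<in> rpoints" using x by (simp add: rpoints_def)
          then obtain c where c: "(reduction X)\<^sup>*\<^sup>* (Suc n, x, p) c" "int (fst c) \<le> int j"
            using cl class_in_filtration_iff by auto
          then have "c \<noteq> (Suc n, x, p)" using False by auto
          then obtain b where b: "reduction X (Suc n, x, p) b" using c by (metis converse_rtranclpE)
          have cb: "realization_class X b \<in> ?C" using realization_class_reduction[OF b] cl by simp
          from b show "w \<in> ?r"
          proof cases
            case (face i)
            then have "w \<in> ?F i" using cb x xp face_in drop_coord_simplex by auto
            then show ?thesis using face by blast
          next
            case (degen y i)
            then have "w \<in> ?G i" using cb x xp codegeneracy_simplex face_degen by auto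
            then show ?thesis using degen by blast
          qed
        qed
        show "?r \<subseteq> ?l"
        proof
          fix w assume "w \<in> ?r"
          then consider i where "i \<le> Suc n" "w \<in> ?F i" | i where "i \<le> n" "w \<in> ?G i" by blast
          then show "w \<in> ?l"
          proof cases
            case 1
            obtain x p where w: "w = (x, p)" by (cases w)
            have "reduction X (Suc n, x, p) (n, face X (Suc n) i x, drop_coord i p)"
              by (rule reduction.face) (use 1 w in auto)
            from realization_class_reduction[OF this] show ?thesis using 1 w by auto
          next
            case 2
            obtain x p where w: "w = (x, p)" by (cases w)
            obtain y where y: "y \<in> L n" "x = degen X n i y" using 2 w by auto
            have "reduction X (Suc n, degen X n i y, p) (n, y, codegeneracy i p)"
              by (rule reduction.degen) (use 2 w y in auto)
            from realization_class_reduction[OF this] show ?thesis using 2 w y face_degen[OF y(1) 2(1)] by auto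
          qed
        qed
      qed
      moreover have "closedin (LD (Suc n)) ?r"
        by (intro closedin_Un closedin_Union) (use clF clG in auto)
      ultimately show ?thesis by simp
    qed
  }
qed

text \<open>F_j carries the subspace topology of the whole realization. The point is that a set with
  closed preimage in X_j \<times> \<Delta>^j comes from a closed set of the realization, by
  \<open>closedin_class_preimage\<close>.\<close>

theorem quotient_map_filtration_point:
  "quotient_map (LD j) (realization_quotient (int j) X) (filtration_point j)"
proof -
  let ?F = "realization_filtration X (int j)" and ?F' = "realization_filtration X (int j - 1)"
  let ?S = "sum_topology LD UNIV"
  have qR: "quotient_map ?S (realization X) (realization_class X)"
    unfolding realization_def by (rule quotient_map_quotient_topology)
  have tS: "topspace ?S = rpoints" by (auto simp: rpoints_def)
  have tR: "topspace (realization X) = realization_class X ` rpoints"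
    using quotient_imp_surjective_map[OF qR] unfolding tS by simp
  have FR: "?F \<subseteq> topspace (realization X)" unfolding tR realization_filtration_eq by blast
  have tF: "topspace (subtopology (realization X) ?F) = ?F" using FR by auto
  have qQ: "quotient_map (subtopology (realization X) ?F) (realization_quotient (int j) X) (collapse ?F')"
    unfolding realization_quotient_def by (rule quotient_map_collapse)
  have tQ: "topspace (realization_quotient (int j) X) = collapse ?F' ` ?F"
    using quotient_imp_surjective_map[OF qQ] unfolding tF by simp
  have cF: "realization_class X (j, w) \<in> ?F" if "w \<in> topspace (LD j)" for w
    using that unfolding realization_filtration_eq by (cases w) (auto simp: rpoints_def)
  have cont: "continuous_map (LD j) (realization_quotient (int j) X) (filtration_point j)"
  proof -
    have "continuous_map (LD j) (realization X) (\<lambda>w. realization_class X (j, w))"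
      by (rule continuous_map_comp[OF continuous_map_component_injection quotient_imp_continuous_map[OF qR]]) simp
    then have "continuous_map (LD j) (subtopology (realization X) ?F) (\<lambda>w. realization_class X (j, w))"
      by (rule continuous_map_into_subtopology) (use cF in auto)
    from continuous_map_comp[OF this quotient_imp_continuous_map[OF qQ]] show ?thesis
      by (simp add: filtration_point_def[abs_def])
  qed
  have surj: "filtration_point j ` topspace (LD j) = topspace (realization_quotient (int j) X)"
  proof
    show "filtration_point j ` topspace (LD j) \<subseteq> topspace (realization_quotient (int j) X)"
      using continuous_map_image_subset_topspace[OF cont] .
    show "topspace (realization_quotient (int j) X) \<subseteq> filtration_point j ` topspace (LD j)"
    proof
      fix z assume "z \<in> topspace (realization_quotient (int j) X)"
      then obtain a where a: "a \<in> rpoints" "fst a \<le> j" "z = collapse ?F' (realization_class X a)"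
        unfolding tQ realization_filtration_eq by auto
      show "z \<in> filtration_point j ` topspace (LD j)"
      proof (cases "fst a = j")
        case True
        then obtain w where "a = (j, w)" by (cases a) auto
        moreover from this have "w \<in> topspace (LD j)" using a(1) by (cases w) (auto simp: rpoints_def)
        ultimately show ?thesis using a(3) by (auto simp: filtration_point_def)
      next
        case False
        then have "realization_class X a \<in> ?F'" unfolding realization_filtration_eq using a by auto
        then have z: "z = None" using a(3) by (simp add: collapse_def)
        \<comment> \<open>Here j > 0, so X_j contains a degenerate point, and it represents the base
          point.\<close>
        have "D (Suc 0) j \<noteq> {}" by (rule degen_filtration_nonempty) (use False a in simp)
        then obtain x where x: "x \<in> D (Suc 0) j" by blast
        obtain p where p: "p \<in> standard_simplex j" using nonempty_standard_simplex by blast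
        have xL: "x \<in> L j" by (rule degen_filtration_in[OF x])
        have "filtration_point j (x, p) = None"
          using filtration_point_None[OF xL p] x by (simp add: boundary_def)
        then show ?thesis using z xL p by force
      qed
    qed
  qed
  show ?thesis unfolding quotient_map_closedin
  proof (intro conjI allI impI surj iffI)
    fix W assume W: "W \<subseteq> topspace (realization_quotient (int j) X)"
    {
      assume "closedin (realization_quotient (int j) X) W"
      then show "closedin (LD j) {x \<in> topspace (LD j). filtration_point j x \<in> W}"
        by (rule closedin_continuous_map_preimage[OF cont])
    next
      assume c: "closedin (LD j) {x \<in> topspace (LD j). filtration_point j x \<in> W}"
      let ?C = "{c \<in> ?F. collapse ?F' c \<in> W}"
      have "closedin ?S {a \<in> topspace ?S. realization_class X a \<in> ?C}"
        unfolding closedin_sum_topology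
      proof (intro conjI ballI)
        fix m
        have "{w. (m, w) \<in> {a \<in> topspace ?S. realization_class X a \<in> ?C}} = {w \<in> topspace (LD m). realization_class X (m, w) \<in> ?C}"
          by auto
        then show "closedin (LD m) {w. (m, w) \<in> {a \<in> topspace ?S. realization_class X a \<in> ?C}}"
          using closedin_class_preimage[OF W c, of m] by simp
      qed auto
      moreover have "?C \<subseteq> topspace (realization X)" using FR by blast
      ultimately have "closedin (realization X) ?C" using qR unfolding quotient_map_closedin by blast
      then have "closedin (subtopology (realization X) ?F) ?C"
        by (rule closedin_subset_topspace) blast
      then have "closedin (subtopology (realization X) ?F) {c \<in> topspace (subtopology (realization X) ?F). collapse ?F' c \<in> W}"
        unfolding tF .
      then show "closedin (realization_quotient (int j) X) W"
        using qQ W unfolding quotient_map_closedin by blast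
    }
  qed
qed

end

section \<open>Filtration quotients as suspensions\<close>

definition cone_coord :: "nat \<Rightarrow> (nat \<Rightarrow> real) \<times> real \<Rightarrow> nat \<Rightarrow> real" where
  "cone_coord k w i = (if i \<le> k then (1 - snd w) * fst w i else if i = Suc k then snd w else 0)"

definition base_coord :: "nat \<Rightarrow> (nat \<Rightarrow> real) \<Rightarrow> nat \<Rightarrow> real" where
  "base_coord k p i = (if i \<le> k then p i / (1 - p (Suc k)) else 0)"

text \<open>
  The simplex of dimension \<open>k + 1\<close> is the cone on the one of dimension \<open>k\<close>; the last barycentric
  coordinate becomes the last suspension coordinate. If it is 1, then \<^const>\<open>base_coord\<close> is a junk
  value, which \<^const>\<open>susp_point\<close> discards.
\<close>

primrec simplex_to_susp :: "'a set \<Rightarrow> nat \<Rightarrow> 'a \<times> (nat \<Rightarrow> real) \<Rightarrow> 'a option susp" where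
  "simplex_to_susp S 0 = (\<lambda>w. Pt (collapse S (fst w)))"
| "simplex_to_susp S (Suc k) = (\<lambda>w. susp_point (simplex_to_susp S k (fst w, base_coord k (snd w)), snd w (Suc k)))"

lemma cone_coord_simplex:
  assumes "p \<in> standard_simplex k" "t \<in> {0..1}"
  shows "cone_coord k (p, t) \<in> standard_simplex (Suc k)"
proof -
  have p: "\<And>i. 0 \<le> p i \<and> p i \<le> 1" "sum p {..k} = 1" using assms(1) by (auto simp: standard_simplex_def)
  have "sum (cone_coord k (p, t)) {..k} = sum (\<lambda>i. (1 - t) * p i) {..k}"
    by (rule sum.cong) (auto simp: cone_coord_def)
  also have "\<dots> = (1 - t)" using p(2) by (simp flip: sum_distrib_left)
  finally have "sum (cone_coord k (p, t)) {..Suc k} = 1" by (simp add: cone_coord_def)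
  moreover have "0 \<le> cone_coord k (p, t) i \<and> cone_coord k (p, t) i \<le> 1" for i
    using p(1)[of i] assms(2) by (auto simp: cone_coord_def intro: mult_le_one)
  ultimately show ?thesis by (auto simp: standard_simplex_def cone_coord_def)
qed

lemma base_coord_simplex:
  assumes "p \<in> standard_simplex (Suc k)" "p (Suc k) \<noteq> 1"
  shows "base_coord k p \<in> standard_simplex k"
proof -
  have p: "\<And>i. 0 \<le> p i \<and> p i \<le> 1" "sum p {..k} + p (Suc k) = 1" using assms(1) by (auto simp: standard_simplex_def)
  have t: "0 < 1 - p (Suc k)" using p(1)[of "Suc k"] assms(2) by auto
  have "sum (base_coord k p) {..k} = sum p {..k} / (1 - p (Suc k))"
    by (simp add: base_coord_def sum_divide_distrib)
  also have "sum p {..k} = 1 - p (Suc k)" using p(2) by simp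
  finally have "sum (base_coord k p) {..k} = 1" using t by simp
  moreover have "p i \<le> 1 - p (Suc k)" if "i \<le> k" for i
    using member_le_sum[of i "{..k}" p] p that by auto
  then have "0 \<le> base_coord k p i \<and> base_coord k p i \<le> 1" for i
    using t p(1)[of i] by (auto simp: base_coord_def)
  ultimately show ?thesis by (auto simp: standard_simplex_def base_coord_def)
qed

lemma base_cone_coord:
  assumes "p \<in> standard_simplex k" "t \<noteq> 1"
  shows "base_coord k (cone_coord k (p, t)) = p"
  using assms by (auto simp: base_coord_def cone_coord_def standard_simplex_def fun_eq_iff)

lemma cone_base_coord:
  assumes "p \<in> standard_simplex (Suc k)" "p (Suc k) \<noteq> 1"
  shows "cone_coord k (base_coord k p, p (Suc k)) = p"
  using assms by (auto simp: base_coord_def cone_coord_def standard_simplex_def fun_eq_iff not_le Suc_lessI)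

lemma simplex_vertex: "p \<in> standard_simplex (Suc k) \<Longrightarrow> p (Suc k) = 1 \<Longrightarrow> i \<le> k \<Longrightarrow> p i = 0"
proof -
  assume p: "p \<in> standard_simplex (Suc k)" "p (Suc k) = 1" and i: "i \<le> k"
  then have "sum p {..k} = 0" "\<And>i. 0 \<le> p i" by (auto simp: standard_simplex_def)
  then show "p i = 0" using i sum_nonneg_eq_0_iff[of "{..k}" p] by auto
qed

lemma compact_space_simplex: "compact_space (simplex_space k)"
  unfolding simplex_space_def by (rule compact_space_subtopology[OF compactin_standard_simplex])

lemma Hausdorff_space_simplex: "Hausdorff_space (simplex_space k)"
  unfolding simplex_space_def
  by (intro Hausdorff_space_subtopology) (simp add: Hausdorff_space_product_topology)

text \<open>The cone coordinates map a compact space to a Hausdorff one, so they form a proper map.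
  Properness survives the product with an arbitrary \<open>A\<close>, whereas being a quotient map
  need not.\<close>

lemma quotient_map_cone:
  "quotient_map (prod_topology (prod_topology A (simplex_space k)) I01) (prod_topology A (simplex_space (Suc k)))
     (\<lambda>((x, p), t). (x, cone_coord k (p, t)))"
proof -
  let ?C = "prod_topology (simplex_space k) I01"
  have cc: "continuous_map ?C (simplex_space (Suc k)) (cone_coord k)"
  proof (rule continuous_map_into_simplex)
    have p: "continuous_map ?C euclideanreal (\<lambda>w. fst w i)" for i
      by (rule continuous_map_comp[OF continuous_map_fst continuous_map_simplex_coord])
    have t: "continuous_map ?C euclideanreal snd" by (rule continuous_map_I01D[OF continuous_map_snd])
    have "continuous_map ?C euclideanreal (\<lambda>w. (1 - snd w) * fst w i)" for i
      by (intro continuous_map_real_mult continuous_map_diff continuous_map_canonical_const p t)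
    then show "continuous_map ?C euclideanreal (\<lambda>w. cone_coord k w i)" for i
      unfolding cone_coord_def using t by (cases "i \<le> k"; cases "i = Suc k") auto
  qed (use cone_coord_simplex in auto)
  have "compact_space ?C"
    by (simp add: compact_space_prod_topology compact_space_simplex compact_space_subtopology)
  then have pc: "proper_map ?C (simplex_space (Suc k)) (cone_coord k)"
    using cc Hausdorff_space_simplex Hausdorff_imp_kc_space continuous_imp_proper_map by blast
  have pm: "proper_map (prod_topology A ?C) (prod_topology A (simplex_space (Suc k))) (\<lambda>(x, w). (id x, cone_coord k w))"
    unfolding proper_map_prod using pc homeomorphic_imp_proper_map[of A A id] by (simp add: homeomorphic_map_id[unfolded id_def] id_def)
  have "quotient_map (prod_topology A ?C) (prod_topology A (simplex_space (Suc k))) (\<lambda>(x, w). (id x, cone_coord k w))"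
  proof (rule continuous_closed_imp_quotient_map[OF _ proper_imp_closed_map[OF pm]])
    show "continuous_map (prod_topology A ?C) (prod_topology A (simplex_space (Suc k))) (\<lambda>(x, w). (id x, cone_coord k w))"
      unfolding case_prod_unfold id_apply by (intro continuous_map_pairedI continuous_map_fst continuous_map_comp[OF continuous_map_snd cc])
    show "(\<lambda>(x, w). (id x, cone_coord k w)) ` topspace (prod_topology A ?C) = topspace (prod_topology A (simplex_space (Suc k)))"
    proof
      show "(\<lambda>(x, w). (id x, cone_coord k w)) ` topspace (prod_topology A ?C) \<subseteq> topspace (prod_topology A (simplex_space (Suc k)))"
        using cone_coord_simplex by auto
      show "topspace (prod_topology A (simplex_space (Suc k))) \<subseteq> (\<lambda>(x, w). (id x, cone_coord k w)) ` topspace (prod_topology A ?C)"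
      proof
        fix w assume "w \<in> topspace (prod_topology A (simplex_space (Suc k)))"
        then obtain x p where w: "w = (x, p)" "x \<in> topspace A" "p \<in> standard_simplex (Suc k)" by (cases w) auto
        have "\<exists>v \<in> topspace ?C. cone_coord k v = p"
        proof (cases "p (Suc k) = 1")
          case True
          obtain q where q: "q \<in> standard_simplex k" using nonempty_standard_simplex by blast
          have "cone_coord k (q, 1) = p"
            using simplex_vertex[OF w(3) True] True w(3) by (auto simp: cone_coord_def standard_simplex_def fun_eq_iff not_le Suc_lessI)
          then show ?thesis using q by (intro bexI[of _ "(q, 1)"]) auto
        next
          case False
          have "p (Suc k) \<in> {0..1}" using w(3) by (auto simp: standard_simplex_def)
          then show ?thesis using cone_base_coord[OF w(3) False] base_coord_simplex[OF w(3) False]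
            by (intro bexI[of _ "(base_coord k p, p (Suc k))"]) auto
        qed
        then show "w \<in> (\<lambda>(x, w). (id x, cone_coord k w)) ` topspace (prod_topology A ?C)" using w by force
      qed
    qed
  qed
  moreover have "quotient_map (prod_topology (prod_topology A (simplex_space k)) I01) (prod_topology A ?C) (\<lambda>((x, p), t). (x, (p, t)))"
  proof -
    have "homeomorphic_maps (prod_topology (prod_topology A (simplex_space k)) I01) (prod_topology A ?C)
       (\<lambda>w. (fst (fst w), (snd (fst w), snd w))) (\<lambda>w. ((fst w, fst (snd w)), snd (snd w)))"
      unfolding homeomorphic_maps_def
      by (intro conjI continuous_map_pairedI continuous_map_fst_comp[OF continuous_map_fst] continuous_map_snd_comp[OF continuous_map_fst]
          continuous_map_snd_comp[OF continuous_map_snd] continuous_map_fst_comp[OF continuous_map_snd] continuous_map_fst continuous_map_snd) auto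
    then have "homeomorphic_map (prod_topology (prod_topology A (simplex_space k)) I01) (prod_topology A ?C)
       (\<lambda>w. (fst (fst w), (snd (fst w), snd w)))"
      using homeomorphic_map_maps by blast
    then show ?thesis by (simp add: homeomorphic_map_def case_prod_unfold)
  qed
  ultimately have "quotient_map (prod_topology (prod_topology A (simplex_space k)) I01) (prod_topology A (simplex_space (Suc k)))
     ((\<lambda>(x, w). (id x, cone_coord k w)) \<circ> (\<lambda>((x, p), t). (x, (p, t))))"
    using quotient_map_compose by blast
  then show ?thesis by (rule quotient_map_eq) auto
qed

lemma quotient_map_simplex_to_susp:
  "quotient_map (prod_topology A (simplex_space k)) ((suspension ^^ k) (ptop (quotient_space A S))) (simplex_to_susp S k)"
proof (induction k)
  case 0
  have "quotient_map (prod_topology A (simplex_space 0)) A fst"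
    using nonempty_standard_simplex[of 0] by (auto simp: quotient_map_fst simp flip: topspace_simplex_space)
  from quotient_map_compose[OF this quotient_map_compose[OF quotient_map_collapse quotient_map_Pt]]
  show ?case by (simp add: o_def)
next
  case (Suc k)
  let ?P = "prod_topology (prod_topology A (simplex_space k)) I01"
  have "quotient_map ?P (prod_topology ((suspension ^^ k) (ptop (quotient_space A S))) I01) (\<lambda>(w, t). (simplex_to_susp S k w, t))"
    by (rule quotient_map_prod_left[OF locally_compact_I01 disjI1[OF Hausdorff_I01] Suc.IH])
  from quotient_map_compose[OF this quotient_map_susp_point]
  have "quotient_map ?P ((suspension ^^ Suc k) (ptop (quotient_space A S))) (susp_point \<circ> (\<lambda>(w, t). (simplex_to_susp S k w, t)))"
    by simp
  then have "quotient_map ?P ((suspension ^^ Suc k) (ptop (quotient_space A S)))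
     (simplex_to_susp S (Suc k) \<circ> (\<lambda>((x, p), t). (x, cone_coord k (p, t))))"
  proof (rule quotient_map_eq)
    fix w assume "w \<in> topspace ?P"
    then obtain x p t where w: "w = ((x, p), t)" "p \<in> standard_simplex k" by auto
    have "cone_coord k (p, t) (Suc k) = t" by (simp add: cone_coord_def)
    then show "(susp_point \<circ> (\<lambda>(w, t). (simplex_to_susp S k w, t))) w =
        (simplex_to_susp S (Suc k) \<circ> (\<lambda>((x, p), t). (x, cone_coord k (p, t)))) w"
      \<comment> \<open>At t = 1 the base coordinates are not recovered, but there both sides are
        North.\<close>
      using w base_cone_coord[OF w(2)] by (cases "t = 1") auto
  qed
  then show ?case using quotient_map_compose_eq[OF quotient_map_cone] by blast
qed

text \<open>If \<open>Y\<close> has a base point, this is its k-fold unreduced suspension, a disc of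
  dimension k. By \<open>simplex_to_susp_disc\<close> it corresponds to the degenerate and the
  boundary points, which the filtration quotient identifies to one point.\<close>

primrec susp_disc :: "'a option topology \<Rightarrow> nat \<Rightarrow> 'a option susp set" where
  "susp_disc Y 0 = {Pt None} \<inter> topspace (ptop Y)"
| "susp_disc Y (Suc k) = susp_part ((suspension ^^ k) (ptop Y)) (susp_disc Y k)"

lemma susp_disc_subset: "susp_disc Y k \<subseteq> topspace ((suspension ^^ k) (ptop Y))"
  by (cases k) (auto simp: susp_part_def)

lemma simplex_to_susp_in:
  "x \<in> topspace A \<Longrightarrow> p \<in> standard_simplex k \<Longrightarrow> simplex_to_susp S k (x, p) \<in> topspace ((suspension ^^ k) (ptop (quotient_space A S)))"
  using continuous_map_app[OF quotient_imp_continuous_map[OF quotient_map_simplex_to_susp]] by force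

lemma simplex_to_susp_disc:
  "x \<in> topspace A \<Longrightarrow> p \<in> standard_simplex k \<Longrightarrow>
    simplex_to_susp S k (x, p) \<in> susp_disc (quotient_space A S) k \<longleftrightarrow> x \<in> S \<or> (\<exists>i\<le>k. p i = 0)"
proof (induction k arbitrary: p)
  case 0
  then have "p 0 = 1" by (auto simp: standard_simplex_def)
  then show ?case using 0 by (auto simp: collapse_def topspace_ptop topspace_quotient_space image_iff)
next
  case (Suc k)
  let ?Z = "(suspension ^^ k) (ptop (quotient_space A S))"
  have t: "p (Suc k) \<in> {0..1}" using Suc.prems by (auto simp: standard_simplex_def)
  show ?case
  proof (cases "p (Suc k) = 1")
    case True
    have "topspace ?Z \<noteq> {}" using Suc.prems(1)
      by (intro suspension_funpow_nonempty) (auto simp: topspace_ptop topspace_quotient_space)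
    then have "North \<in> susp_part ?Z (susp_disc (quotient_space A S) k)" by (simp add: susp_part_def North_in_suspension)
    then show ?thesis using True simplex_vertex[OF Suc.prems(2) True, of 0] by auto
  next
    case False
    have b: "base_coord k p \<in> standard_simplex k" by (rule base_coord_simplex[OF Suc.prems(2) False])
    have "simplex_to_susp S (Suc k) (x, p) \<in> susp_disc (quotient_space A S) (Suc k) \<longleftrightarrow>
        (x \<in> S \<or> (\<exists>i\<le>k. base_coord k p i = 0)) \<or> p (Suc k) = 0"
      using susp_point_in_part[OF simplex_to_susp_in[OF Suc.prems(1) b] t] Suc.IH[OF Suc.prems(1) b] False by simp
    also have "(\<exists>i\<le>k. base_coord k p i = 0) \<longleftrightarrow> (\<exists>i\<le>k. p i = 0)" using False by (auto simp: base_coord_def)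
    finally show ?thesis by (auto simp: le_Suc_eq)
  qed
qed

lemma simplex_to_susp_inj:
  "x \<in> topspace A \<Longrightarrow> p \<in> standard_simplex k \<Longrightarrow> y \<in> topspace A \<Longrightarrow> q \<in> standard_simplex k \<Longrightarrow>
    simplex_to_susp S k (x, p) = simplex_to_susp S k (y, q) \<Longrightarrow>
    (x, p) = (y, q) \<or> (x \<in> S \<or> (\<exists>i\<le>k. p i = 0)) \<and> (y \<in> S \<or> (\<exists>i\<le>k. q i = 0))"
proof (induction k arbitrary: p q)
  case 0
  then have "p = q" by (simp add: standard_simplex_0)
  then show ?case using 0 by (auto simp: collapse_def split: if_splits)
next
  case (Suc k)
  have eq: "p (Suc k) = q (Suc k)" "p (Suc k) = 0 \<or> p (Suc k) = 1 \<or>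
      simplex_to_susp S k (x, base_coord k p) = simplex_to_susp S k (y, base_coord k q)"
    using susp_point_eqD Suc.prems(5) by force+
  consider "p (Suc k) = 0" | "p (Suc k) = 1" | "p (Suc k) \<noteq> 0" "p (Suc k) \<noteq> 1" by blast
  then show ?case
  proof cases
    case 1
    then show ?thesis using eq(1) by auto
  next
    case 2
    then show ?thesis using eq(1) simplex_vertex[OF Suc.prems(2), of 0] simplex_vertex[OF Suc.prems(4), of 0] by auto
  next
    case 3
    have b: "base_coord k p \<in> standard_simplex k" "base_coord k q \<in> standard_simplex k"
      using base_coord_simplex Suc.prems(2,4) 3 eq(1) by auto
    have "(x, base_coord k p) = (y, base_coord k q) \<or>
      (x \<in> S \<or> (\<exists>i\<le>k. base_coord k p i = 0)) \<and> (y \<in> S \<or> (\<exists>i\<le>k. base_coord k q i = 0))"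
      by (rule Suc.IH[OF Suc.prems(1) b(1) Suc.prems(3) b(2)]) (use eq(2) 3 in simp)
    then show ?thesis
    proof
      assume e: "(x, base_coord k p) = (y, base_coord k q)"
      have "q (Suc k) \<noteq> 1" using 3(2) eq(1) by simp
      from cone_base_coord[OF Suc.prems(4) this] cone_base_coord[OF Suc.prems(2) 3(2)] have "p = q"
        using e eq(1) by (metis prod.inject)
      then show ?thesis using e by simp
    next
      assume bd: "(x \<in> S \<or> (\<exists>i\<le>k. base_coord k p i = 0)) \<and> (y \<in> S \<or> (\<exists>i\<le>k. base_coord k q i = 0))"
      have face: "\<exists>i\<le>Suc k. r i = 0" if r: "\<exists>i\<le>k. base_coord k r i = 0" "r (Suc k) \<noteq> 1" for r
      proof -
        obtain i where "i \<le> k" "base_coord k r i = 0" using r(1) by blast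
        then show ?thesis using r(2) by (intro exI[of _ i]) (simp add: base_coord_def)
      qed
      have "x \<in> S \<or> (\<exists>i\<le>Suc k. p i = 0)" using bd face[of p] 3(2) by blast
      moreover have "q (Suc k) \<noteq> 1" using 3(2) eq(1) by simp
      then have "y \<in> S \<or> (\<exists>i\<le>Suc k. q i = 0)" using bd face[of q] by blast
      ultimately show ?thesis by blast
    qed
  qed
qed

text \<open>The choice of a preimage does not matter: two points of X_j \<times> \<Delta>^j with the
  same image in the suspension are equal or both in the boundary, and the whole boundary goes to the
  base point.\<close>

definition susp_to_filtration :: "'a simpl_space \<Rightarrow> nat \<Rightarrow> 'a option susp \<Rightarrow> 'a rpoint set option" where
  "susp_to_filtration X j z = collapse (realization_filtration X (int j - 1)) (realization_class X (j,
     SOME w. w \<in> topspace (level X j) \<times> standard_simplex j \<and> simplex_to_susp (degen_filtration X (Suc 0) j) j w = z))"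

context NDR_simplicial
begin

lemma susp_to_filtration_point:
  assumes w: "w \<in> L j \<times> standard_simplex j"
  shows "susp_to_filtration X j (simplex_to_susp (D (Suc 0) j) j w) = filtration_point j w"
proof -
  let ?o = "simplex_to_susp (D (Suc 0) j) j"
  define v where "v = (SOME v. v \<in> L j \<times> standard_simplex j \<and> ?o v = ?o w)"
  have v: "v \<in> L j \<times> standard_simplex j \<and> ?o v = ?o w"
    unfolding v_def by (rule someI[of _ w]) (use w in simp)
  obtain x p where wx: "w = (x, p)" by (cases w)
  obtain y q where vy: "v = (y, q)" by (cases v)
  have m: "y \<in> L j" "q \<in> standard_simplex j" "x \<in> L j" "p \<in> standard_simplex j"
    "?o (y, q) = ?o (x, p)" using v w unfolding vy wx by auto
  from simplex_to_susp_inj[OF m] have "(y, q) = (x, p) \<or> (y, q) \<in> boundary j \<and> (x, p) \<in> boundary j"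
    by (auto simp: boundary_def)
  then have "filtration_point j v = filtration_point j w"
    unfolding vy wx using filtration_point_None[OF m(1,2)] filtration_point_None[OF m(3,4)] by auto
  then show ?thesis unfolding susp_to_filtration_def v_def[symmetric] filtration_point_def .
qed

abbreviation "SY j \<equiv> (suspension ^^ j) (Y j)"

lemma SY_surj:
  assumes "z \<in> topspace (SY j)"
  obtains x p where "x \<in> L j" "p \<in> standard_simplex j" "z = simplex_to_susp (D (Suc 0) j) j (x, p)"
proof -
  have "topspace (SY j) = simplex_to_susp (D (Suc 0) j) j ` topspace (LD j)"
    using quotient_imp_surjective_map[OF quotient_map_simplex_to_susp[where A = "level X j" and k = j and S = "D (Suc 0) j"]]
    by (simp add: degen_quotient_0)
  then show ?thesis using assms that by auto
qed

text \<open>Both spaces are quotients of X_j \<times> \<Delta>^j by identifications within the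
  boundary. The filtration quotient makes the boundary a single point, while in the suspension it
  becomes the disc.\<close>

lemma collapses_susp_to_filtration:
  "collapses (SY j) (susp_disc (degen_quotient j 0 X) j) (realization_quotient (int j) X) (susp_to_filtration X j) None"
proof -
  let ?o = "simplex_to_susp (D (Suc 0) j) j"
  have qo: "quotient_map (LD j) (SY j) ?o" unfolding degen_quotient_0 by (rule quotient_map_simplex_to_susp)
  have "quotient_map (LD j) (realization_quotient (int j) X) (susp_to_filtration X j \<circ> ?o)"
    by (rule quotient_map_eq[OF quotient_map_filtration_point]) (simp add: susp_to_filtration_point)
  then have q: "quotient_map (SY j) (realization_quotient (int j) X) (susp_to_filtration X j)"
    using quotient_map_compose_eq[OF qo] by blast
  have disc: "?o (x, p) \<in> susp_disc (degen_quotient j 0 X) j \<longleftrightarrow> (x, p) \<in> boundary j"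
    if "x \<in> L j" "p \<in> standard_simplex j" for x p
    using simplex_to_susp_disc[OF that] by (simp add: degen_quotient_0 boundary_def)
  show ?thesis unfolding collapses_def
  proof (intro conjI ballI impI q)
    show "susp_to_filtration X j z = None" if z: "z \<in> susp_disc (degen_quotient j 0 X) j" for z
    proof -
      have "z \<in> topspace (SY j)" using z susp_disc_subset by blast
      then obtain x p where "x \<in> L j" "p \<in> standard_simplex j" "z = ?o (x, p)" by (rule SY_surj)
      then show ?thesis using z disc filtration_point_None by (simp add: susp_to_filtration_point)
    qed
    show "z = z' \<or> z \<in> susp_disc (degen_quotient j 0 X) j \<and> z' \<in> susp_disc (degen_quotient j 0 X) j"
      if z: "z \<in> topspace (SY j)" "z' \<in> topspace (SY j)" and e: "susp_to_filtration X j z = susp_to_filtration X j z'" for z z'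
    proof -
      obtain x p where x: "x \<in> L j" "p \<in> standard_simplex j" "z = ?o (x, p)" using z(1) by (rule SY_surj)
      obtain y q where y: "y \<in> L j" "q \<in> standard_simplex j" "z' = ?o (y, q)" using z(2) by (rule SY_surj)
      have "filtration_point j (x, p) = filtration_point j (y, q)" using e x y by (simp add: susp_to_filtration_point)
      from filtration_point_inj[OF x(1,2) y(1,2) this] show ?thesis using x y disc by auto
    qed
  qed
qed

lemma homotopy_equivalence_susp_to_filtration:
  "homotopy_equivalence_map (SY j) (realization_quotient (int j) X) (susp_to_filtration X j)"
proof (cases "j = 0")
  case True
  \<comment> \<open>For j = 0 there is no base point, since S(X_0) is empty. Hence nothing is
    collapsed and the map is a homeomorphism.\<close>
  have e: "susp_disc (degen_quotient j 0 X) j = {}" using True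
    by (auto simp: topspace_Y collapse_def)
  have "homeomorphic_map (SY j) (realization_quotient (int j) X) (susp_to_filtration X j)"
    using collapses_susp_to_filtration[of j] unfolding e collapses_def homeomorphic_map_def inj_on_def by blast
  then show ?thesis using homeomorphic_map_maps homotopy_equivalence_map_homeomorphic by blast
next
  case False
  then have Y0: "NDR_pair (Y j) {Pt None}" "Pt None \<in> topspace (Y j)" using NDR_Y[of j] by auto
  have "contractible_NDR ((suspension ^^ k) (Y j)) (susp_disc (degen_quotient j 0 X) k)" for k
  proof (induction k)
    case 0
    have "continuous_map (prod_topology I01 (subtopology (Y j) {Pt None})) (subtopology (Y j) {Pt None}) snd"
      by (rule continuous_map_snd)
    then show ?case using Y0 unfolding contractible_NDR_def NDR_pair_def by auto
  next
    case (Suc k)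
    then show ?case using contractible_NDR_suspension by simp
  qed
  then show ?thesis by (rule homotopy_equivalence_collapse[OF _ collapses_susp_to_filtration])
qed

end

lemma simplicial_map_degen_filtration:
  assumes f: "simplicial_map X Y f" and X: "simplicial_space X" and x: "x \<in> degen_filtration X t n"
  shows "f n x \<in> degen_filtration Y t n"
  using x
proof (induction t arbitrary: n x)
  case 0
  have "continuous_map (level X n) (level Y n) (f n)" using f by (simp add: simplicial_map_def)
  then show ?case using 0 continuous_map_app by fastforce
next
  case (Suc t)
  interpret X: simplicial X by standard (rule X)
  show ?case
  proof (cases n)
    case (Suc m)
    then obtain i y where y: "i \<le> m" "y \<in> degen_filtration X t m" "x = degen X m i y" using Suc.prems by auto
    have "y \<in> topspace (level X m)" by (rule X.degen_filtration_in[OF y(2)])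
    then have "f n x = degen Y m i (f m y)" using f y Suc by (simp add: simplicial_map_def)
    then show ?thesis using Suc y Suc.IH[OF y(2)] by auto
  qed (use Suc.prems in simp)
qed

text \<open>\<open>f\<close> carries realization steps to realization steps, so all members of the
  union that defines \<open>realization_map\<close> on a class coincide.\<close>

lemma realization_map_class:
  assumes f: "simplicial_map X Y f"
  shows "realization_map Y f (realization_class X (n, x, p)) = realization_class Y (n, f n x, p)"
proof -
  let ?f = "\<lambda>(n, x, p). (n, f n x, p)"
  have rs: "realization_step Y (?f a) (?f b)" if "realization_step X a b" for a b
    using that
  proof cases
    case (face x n p i)
    have "f n (face X (Suc n) i x) = face Y (Suc n) i (f (Suc n) x)" "f (Suc n) x \<in> topspace (level Y (Suc n))"
      using f face continuous_map_app[of "level X (Suc n)" "level Y (Suc n)" "f (Suc n)"] by (auto simp: simplicial_map_def)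
    then show ?thesis using face realization_step.face[of "f (Suc n) x" Y n p i] by simp
  next
    case (degen x n p j)
    have "f (Suc n) (degen X n j x) = degen Y n j (f n x)" "f n x \<in> topspace (level Y n)"
      using f degen continuous_map_app[of "level X n" "level Y n" "f n"] by (auto simp: simplicial_map_def)
    then show ?thesis using degen realization_step.degen[of "f n x" Y n p j] by simp
  qed
  have eq: "realization_class Y (?f a) = realization_class Y (?f b)" if "equivclp (realization_step X) a b" for a b
    using that
  proof (induction rule: equivclp_induct)
    case (step b c)
    then have "equivclp (realization_step Y) (?f b) (?f c)" using rs[of b c] rs[of c b]
      by (meson equivclp_sym r_into_equivclp)
    then have "realization_class Y (?f b) = realization_class Y (?f c)"
      unfolding realization_class_def by (auto intro: equivclp_sym equivclp_trans)
    then show ?case using step.IH by simp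
  qed simp
  have "(n, x, p) \<in> realization_class X (n, x, p)" by (simp add: realization_class_def)
  moreover have "realization_class Y (?f b) = realization_class Y (n, f n x, p)" if "b \<in> realization_class X (n, x, p)" for b
    using eq[of "(n, x, p)" b] that by (simp add: realization_class_def)
  moreover have "realization_map Y f c = (\<Union>b \<in> c. realization_class Y (?f b))" for c
    unfolding realization_map_def by (rule SUP_cong) auto
  ultimately show ?thesis by auto
qed

lemma simplex_to_susp_natural:
  assumes "x \<in> S \<Longrightarrow> f x \<in> S'"
  shows "map_susp (quotient_space_map S' f) (simplex_to_susp S k (x, p)) = simplex_to_susp S' k (f x, p)"
  by (induction k arbitrary: p) (auto simp: quotient_space_map_collapse[of x S f S', OF assms] map_susp_susp_point)

lemma susp_to_filtration_natural:
  assumes X: "NDR_simplicial X" and Y: "NDR_simplicial Y" and f: "simplicial_map X Y f"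
    and z: "z \<in> topspace ((suspension ^^ j) (ptop (degen_quotient j 0 X)))"
  shows "susp_to_filtration Y j (map_susp (quotient_space_map (degen_filtration Y (Suc 0) j) (f j)) z)
    = realization_quotient_map (int j) Y f (susp_to_filtration X j z)"
proof -
  interpret X: NDR_simplicial X by (rule X)
  interpret Y: NDR_simplicial Y by (rule Y)
  obtain x p where x: "x \<in> X.L j" "p \<in> standard_simplex j" "z = simplex_to_susp (X.D (Suc 0) j) j (x, p)"
    using z by (rule X.SY_surj)
  have fx: "f j x \<in> Y.L j" using f x(1) continuous_map_app[of "level X j" "level Y j" "f j"] by (auto simp: simplicial_map_def)
  have "susp_to_filtration Y j (map_susp (quotient_space_map (Y.D (Suc 0) j) (f j)) z) = Y.filtration_point j (f j x, p)"
    using simplex_to_susp_natural[of x "X.D (Suc 0) j" "f j" "Y.D (Suc 0) j"] simplicial_map_degen_filtration[OF f X.simplicial]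
      Y.susp_to_filtration_point[of "(f j x, p)" j] fx x by simp
  moreover have "realization_quotient_map (int j) Y f (susp_to_filtration X j z) = Y.filtration_point j (f j x, p)"
  proof -
    have "realization_map Y f c \<in> realization_filtration Y (int j - 1)" if c: "c \<in> realization_filtration X (int j - 1)" for c
    proof -
      obtain i y q where y: "int i \<le> int j - 1" "y \<in> X.L i" "q \<in> standard_simplex i" "c = realization_class X (i, y, q)"
        using c unfolding realization_filtration_def by auto
      have "f i y \<in> Y.L i" using f y continuous_map_app[of "level X i" "level Y i" "f i"] by (auto simp: simplicial_map_def)
      then show ?thesis using y realization_map_class[OF f] unfolding realization_filtration_def by auto
    qed
    from quotient_space_map_collapse[of _ "realization_filtration X (int j - 1)", OF this]
    have "realization_quotient_map (int j) Y f (X.filtration_point j (x, p)) = Y.filtration_point j (f j x, p)"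
      unfolding realization_quotient_map_def X.filtration_point_def Y.filtration_point_def
      by (simp add: realization_map_class[OF f])
    then show ?thesis using x X.susp_to_filtration_point[of "(x, p)" j] by simp
  qed
  ultimately show ?thesis by simp
qed

section \<open>Naturality\<close>

lemma simplicial_map_cont: "simplicial_map X Y f \<Longrightarrow> continuous_map (level X n) (level Y n) (f n)"
  by (simp add: simplicial_map_def)

lemma simplicial_map_in: "simplicial_map X Y f \<Longrightarrow> x \<in> topspace (level X n) \<Longrightarrow> f n x \<in> topspace (level Y n)"
  by (rule continuous_map_app[OF simplicial_map_cont])

lemma faces_natural:
  assumes f: "simplicial_map X Y f" and X: "simplicial_space X"
    and "J \<in> admissible n t" "x \<in> topspace (level X n)"
  shows "f (n - t) (faces X n J x) = faces Y n J (f n x)"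
  using assms(3,4)
proof (induction t arbitrary: J n x)
  case 0
  then show ?case by (simp add: admissible_0)
next
  case (Suc t)
  interpret X: simplicial X by standard (rule X)
  obtain i J' m where J: "J = i # J'" "n = Suc m" "i \<le> m" "J' \<in> admissible m t"
    using Suc.prems(1) by (rule admissible_SucE)
  have "face X (Suc m) i x \<in> X.L m" using X.face_in[of x m i] J Suc.prems(2) by simp
  from Suc.IH[OF J(4) this] have "f (m - t) (faces X m J' (face X (Suc m) i x)) = faces Y m J' (f m (face X (Suc m) i x))" .
  moreover have "f m (face X (Suc m) i x) = face Y (Suc m) i (f (Suc m) x)"
    using f J Suc.prems(2) by (simp add: simplicial_map_def)
  ultimately show ?case using J by simp
qed

lemma susp_lift_natural:
  assumes "\<And>a s. a \<in> topspace A \<Longrightarrow> g (p (a, s)) = p' (map_susp f a, s)" "g x = x'" "g y = y'"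
    and "z \<in> topspace (suspension A)"
  shows "g (susp_lift x y p z) = susp_lift x' y' p' (map_susp f z)"
  using assms(4) by (rule suspensionE) (auto simp: susp_point_def assms(1-3))

lemma continuous_map_map_susp:
  assumes "continuous_map A B g"
  shows "continuous_map ((suspension ^^ k) (ptop A)) ((suspension ^^ k) (ptop B)) (map_susp g)"
proof (induction k)
  case 0
  then show ?case using continuous_map_ptop[OF assms] by simp
next
  case (Suc k)
  have "continuous_map (suspension ((suspension ^^ k) (ptop A))) (suspension ((suspension ^^ k) (ptop B))) (map_susp g)"
    by (rule continuous_map_eq[OF continuous_map_smap[OF Suc.IH]])
      (auto elim!: suspensionE simp: smap_susp_point map_susp_susp_point)
  then show ?case by simp
qed

lemma wedge_cong: "(\<And>i. i \<in> I \<Longrightarrow> Z i = Z' i) \<Longrightarrow> wedge b I Z = wedge b I Z'"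
proof -
  assume "\<And>i. i \<in> I \<Longrightarrow> Z i = Z' i"
  then have "Sigma I (topspace \<circ> Z) = Sigma I (topspace \<circ> Z')"
    "\<And>U. (\<forall>i\<in>I. openin (Z i) {x. (i, x) \<in> U}) \<longleftrightarrow> (\<forall>i\<in>I. openin (Z' i) {x. (i, x) \<in> U})"
    by (auto intro!: Sigma_cong)
  then have "sum_topology Z I = sum_topology Z' I" unfolding sum_topology_def by presburger
  then show ?thesis by (simp add: wedge_def)
qed

lemma homotopy_equivalence_imp_continuous: "homotopy_equivalence_map A B f \<Longrightarrow> continuous_map A B f"
  by (simp add: homotopy_equivalence_map_def)

text \<open>The squares will commute strictly on points, so the required homotopy is constant and
  only continuity of one composite is needed.\<close>

lemma natural_homotopy_equivalenceI:
  assumes "\<And>X. X \<in> \<C> \<Longrightarrow> homotopy_equivalence_map (A X) (B X) (K X)"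
    and "\<And>X Y f. X \<in> \<C> \<Longrightarrow> Y \<in> \<C> \<Longrightarrow> simplicial_map X Y f \<Longrightarrow> continuous_map (A X) (A Y) (FA Y f)"
    and "\<And>X Y f z. X \<in> \<C> \<Longrightarrow> Y \<in> \<C> \<Longrightarrow> simplicial_map X Y f \<Longrightarrow> z \<in> topspace (A X) \<Longrightarrow>
      FB Y f (K X z) = K Y (FA Y f z)"
  shows "natural_homotopy_equivalence \<C> A FA B FB K"
  unfolding natural_homotopy_equivalence_def
proof (intro conjI ballI allI impI assms(1))
  fix X Y f assume XY: "X \<in> \<C>" "Y \<in> \<C>" "simplicial_map X Y f"
  have c: "continuous_map (A X) (B Y) (K Y \<circ> FA Y f)"
    using assms(2)[OF XY] homotopy_equivalence_imp_continuous[OF assms(1)[OF XY(2)]] by (rule continuous_map_compose)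
  show "homotopic_with (\<lambda>_. True) (A X) (B Y) (K Y \<circ> FA Y f) (FB Y f \<circ> K X)"
  proof (rule homotopic_with_equal)
    show "(K Y \<circ> FA Y f) z = (FB Y f \<circ> K X) z" if "z \<in> topspace (A X)" for z
      using assms(3)[OF XY that] by simp
  qed (use c in auto)
qed

lemma faces_quotient_natural:
  assumes "simplicial X" "simplicial Y" "simplicial_map X Y f" "J \<in> admissible n t" "x \<in> topspace (level X n)"
  shows "quotient_space_map (degen_filtration Y (Suc 0) (n - t)) (f (n - t)) (collapse (degen_filtration X (Suc 0) (n - t)) (faces X n J x))
    = collapse (degen_filtration Y (Suc 0) (n - t)) (faces Y n J (f n x))"
proof -
  interpret X: simplicial X by (rule assms(1))
  have "quotient_space_map (degen_filtration Y (Suc 0) (n - t)) (f (n - t)) (collapse (degen_filtration X (Suc 0) (n - t)) (faces X n J x))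
    = collapse (degen_filtration Y (Suc 0) (n - t)) (f (n - t) (faces X n J x))"
    by (rule quotient_space_map_collapse) (rule simplicial_map_degen_filtration[OF assms(3) X.simplicial])
  then show ?thesis using faces_natural[OF assms(3) X.simplicial assms(4,5)] by simp
qed

text \<open>The exponent is read off from the word, and the set of words is arbitrary. So one
  construction serves the words of a fixed length as well as all words.\<close>

definition filtration_wedge :: "'a simpl_space \<Rightarrow> nat \<Rightarrow> nat list set \<Rightarrow> (nat list \<times> 'a rpoint set option susp) option topology" where
  "filtration_wedge X n I =
     wedge South I (\<lambda>J. (suspension ^^ Suc (length J)) (ptop (realization_quotient (int (n - length J)) X)))"

definition filtration_wedge_map :: "'b simpl_space \<Rightarrow> (nat \<Rightarrow> 'a \<Rightarrow> 'b) \<Rightarrow> nat \<Rightarrow>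
   (nat list \<times> 'a rpoint set option susp) option \<Rightarrow> (nat list \<times> 'b rpoint set option susp) option" where
  "filtration_wedge_map Y f n = wedge_map South (\<lambda>J. map_susp (realization_quotient_map (int (n - length J)) Y f))"

text \<open>The given splitting is suspended n times and these suspensions are moved into the wedge.
  On the summand of \<open>J\<close>, with m = n - |J|, the n + 1 suspensions of Y_m are then
  regrouped: the inner m of them give the filtration quotient and |J| + 1 remain.\<close>

definition to_filtration_wedge :: "'a simpl_space \<Rightarrow> nat \<Rightarrow> nat list list \<Rightarrow>
   ('c susp \<Rightarrow> (nat list \<times> 'a option susp) option) \<Rightarrow> 'c susp \<Rightarrow> (nat list \<times> 'a rpoint set option susp) option" where
  "to_filtration_wedge X n L \<phi> =
     wedge_map South (\<lambda>J. (smap ^^ Suc (length J)) (Pt \<circ> susp_to_filtration X (n - length J)))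
       \<circ> (iter_susp_wedge_map L n \<circ> (smap ^^ n) (Pt \<circ> \<phi>))"

lemma suspension_funpow_split: "l \<le> n \<Longrightarrow> (suspension ^^ n) A = (suspension ^^ l) ((suspension ^^ (n - l)) A)"
  by (metis comp_apply funpow_add le_add_diff_inverse)

context NDR_simplicial
begin

context
  fixes n L A \<phi>
  assumes L: "distinct L" "L \<noteq> []" "set L \<subseteq> words n"
    and \<phi>: "homotopy_equivalence_map (suspension A) (susp_wedge X n (set L)) \<phi>"
begin

lemma to_filtration_wedge_stage1:
  "homotopy_equivalence_map ((suspension ^^ Suc n) A) ((suspension ^^ n) (ptop (susp_wedge X n (set L)))) ((smap ^^ n) (Pt \<circ> \<phi>))"
  unfolding suspension_funpow_inner by (rule homotopy_equivalence_map_smap_funpow[OF homotopy_equivalence_Pt_comp[OF \<phi>]])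

lemma to_filtration_wedge_stage2:
  "homotopy_equivalence_map ((suspension ^^ n) (ptop (susp_wedge X n (set L))))
     (wedge South (set L) (\<lambda>J. (suspension ^^ Suc n) (Y (n - length J)))) (iter_susp_wedge_map L n)"
  using homotopy_equivalence_iter_susp_wedge_map[OF L(1,2), of "\<lambda>J. Y (n - length J)" n 0] Y_nonempty
  by (simp add: susp_wedge_def)

lemma homotopy_equivalence_to_filtration_wedge:
  "homotopy_equivalence_map ((suspension ^^ Suc n) A) (filtration_wedge X n (set L)) (to_filtration_wedge X n L \<phi>)"
proof -
  have "homotopy_equivalence_map (wedge South (set L) (\<lambda>J. (suspension ^^ Suc n) (Y (n - length J)))) (filtration_wedge X n (set L))
     (wedge_map South (\<lambda>J. (smap ^^ Suc (length J)) (Pt \<circ> susp_to_filtration X (n - length J))))"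
    unfolding filtration_wedge_def
  proof (rule homotopy_equivalence_wedge_map)
    fix J assume "J \<in> set L"
    then have J: "length J \<le> n" using L(3) words_length_le by blast
    let ?R = "realization_quotient (int (n - length J)) X"
    have h: "homotopy_equivalence_map ((suspension ^^ n) (Y (n - length J))) ((suspension ^^ length J) (ptop ?R))
       ((smap ^^ length J) (Pt \<circ> susp_to_filtration X (n - length J)))"
      using homotopy_equivalence_map_smap_funpow[OF homotopy_equivalence_Pt_comp[OF homotopy_equivalence_susp_to_filtration[of "n - length J"]], of "length J"]
      unfolding suspension_funpow_split[OF J, of "Y (n - length J)", symmetric] .
    from based_equivalence_smap[OF h]
    show "based_equivalence ((suspension ^^ Suc n) (Y (n - length J))) South ((suspension ^^ Suc (length J)) (ptop ?R)) South
      ((smap ^^ Suc (length J)) (Pt \<circ> susp_to_filtration X (n - length J)))" by simp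
    have ne: "topspace ((suspension ^^ n) (Y (n - length J))) \<noteq> {}"
      by (rule suspension_funpow_nonempty[OF Y_nonempty])
    then show "closedin ((suspension ^^ Suc n) (Y (n - length J))) {South}"
      using closedin_South[of "(suspension ^^ n) (Y (n - length J))"] by (simp add: South_in_suspension)
    have "topspace ((suspension ^^ length J) (ptop ?R)) \<noteq> {}"
      using ne continuous_map_app[OF homotopy_equivalence_imp_continuous[OF h]] by blast
    then show "closedin ((suspension ^^ Suc (length J)) (ptop ?R)) {South}"
      using closedin_South[of "(suspension ^^ length J) (ptop ?R)"] by (simp add: South_in_suspension)
  qed simp
  then show ?thesis unfolding to_filtration_wedge_def
    using homotopy_equivalence_map_compose[OF homotopy_equivalence_map_compose[OF to_filtration_wedge_stage1 to_filtration_wedge_stage2]]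
    by blast
qed

end

end

locale NDR_simplicial_map = X: NDR_simplicial X + Y: NDR_simplicial Y
  for X :: "'a simpl_space" and Y :: "'b simpl_space" +
  fixes f assumes f: "simplicial_map X Y f"
begin

abbreviation "g m \<equiv> degen_quotient_map m 0 Y f"
abbreviation "gw n \<equiv> wedge_map South (\<lambda>J. map_susp (g (n - length J)))"

lemma to_filtration_wedge_natural:
  assumes L: "distinct L" "L \<noteq> []" "set L \<subseteq> words n"
    and \<phi>: "homotopy_equivalence_map (suspension A) (susp_wedge X n (set L)) \<phi>"
    and nat: "\<And>z. z \<in> topspace (suspension A) \<Longrightarrow> gw n (\<phi> z) = \<psi> (map_susp h z)"
    and z: "z \<in> topspace ((suspension ^^ Suc n) A)"
  shows "filtration_wedge_map Y f n (to_filtration_wedge X n L \<phi> z) = to_filtration_wedge Y n L \<psi> (map_susp h z)"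
proof -
  define z1 where "z1 = (smap ^^ n) (Pt \<circ> \<phi>) z"
  define z2 where "z2 = iter_susp_wedge_map L n z1"
  have z1: "z1 \<in> topspace ((suspension ^^ n) (ptop (susp_wedge X n (set L))))" unfolding z1_def
    by (rule continuous_map_app[OF homotopy_equivalence_imp_continuous[OF X.to_filtration_wedge_stage1[OF L \<phi>]] z])
  have z2: "z2 \<in> topspace (wedge South (set L) (\<lambda>J. (suspension ^^ Suc n) (X.Y (n - length J))))" unfolding z2_def
    by (rule continuous_map_app[OF homotopy_equivalence_imp_continuous[OF X.to_filtration_wedge_stage2[OF L \<phi>]] z1])
  have "map_susp (gw n) z1 = (smap ^^ n) (Pt \<circ> \<psi>) (map_susp h z)" unfolding z1_def
    by (rule smap_funpow_natural[of "suspension A"]) (use nat z in \<open>simp_all add: suspension_funpow_inner del: funpow.simps\<close>)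
  moreover have "gw n z2 = iter_susp_wedge_map L n (map_susp (gw n) z1)" unfolding z2_def
    using iter_susp_wedge_map_natural[OF L(1,2), of "\<lambda>J. X.Y (n - length J)" z1 n 0 "\<lambda>J. g (n - length J)"] X.Y_nonempty z1
    by (simp add: susp_wedge_def)
  moreover have "filtration_wedge_map Y f n
      (wedge_map South (\<lambda>J. (smap ^^ Suc (length J)) (Pt \<circ> susp_to_filtration X (n - length J))) z2)
    = wedge_map South (\<lambda>J. (smap ^^ Suc (length J)) (Pt \<circ> susp_to_filtration Y (n - length J))) (gw n z2)"
    using z2
  proof (cases rule: wedgeE)
    case (1 J v)
    then have J: "length J \<le> n" using L(3) words_length_le by blast
    have v: "v \<in> topspace ((suspension ^^ Suc (length J)) ((suspension ^^ (n - length J)) (X.Y (n - length J))))"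
      using 1 suspension_funpow_split[of "Suc (length J)" "Suc n" "X.Y (n - length J)"] J by (simp del: funpow.simps)
    let ?r = "realization_quotient_map (int (n - length J)) Y f"
    have "map_susp ?r ((smap ^^ Suc (length J)) (Pt \<circ> susp_to_filtration X (n - length J)) v)
      = (smap ^^ Suc (length J)) (Pt \<circ> susp_to_filtration Y (n - length J)) (map_susp (g (n - length J)) v)"
      by (rule smap_funpow_natural[OF _ v])
        (use susp_to_filtration_natural[OF X.NDR_simplicial_axioms Y.NDR_simplicial_axioms f] in \<open>simp add: degen_quotient_map_def\<close>)
    then show ?thesis using 1 by (simp add: wedge_map_incl filtration_wedge_map_def)
  qed
  ultimately show ?thesis by (simp add: to_filtration_wedge_def z1_def z2_def)
qed

lemma level_face_natural:
  assumes "J \<in> admissible n t" "x \<in> X.L n"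
  shows "map_susp (g (n - length J)) (level_face X n J (Pt x)) = level_face Y n J (Pt (f n x))"
  using faces_quotient_natural[OF X.simplicial_axioms Y.simplicial_axioms f assms] length_admissible[OF assms(1)]
  by (simp add: level_face_def degen_quotient_map_def)

lemma quotient_face_natural:
  assumes J: "J \<in> admissible n t" and z: "z \<in> topspace (X.Yo n t)"
  shows "map_susp (g (n - length J)) (quotient_face X n J z) = quotient_face Y n J (map_susp (degen_quotient_map n t Y f) z)"
proof -
  obtain x where x: "x \<in> X.D t n" "z = Pt (collapse (X.D (Suc t) n) x)" using z X.topspace_Yo by auto
  have xL: "x \<in> X.L n" by (rule X.degen_filtration_in[OF x(1)])
  have Xf: "quotient_space_map (X.D (Suc 0) (n - t)) (faces X n J) (collapse (X.D (Suc t) n) x)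
      = collapse (X.D (Suc 0) (n - t)) (faces X n J x)"
    by (rule quotient_space_map_collapse) (use X.faces_degen_filtration[OF J, of _ "Suc 0"] in auto)
  have ff: "quotient_space_map (Y.D (Suc t) n) (f n) (collapse (X.D (Suc t) n) x) = collapse (Y.D (Suc t) n) (f n x)"
    by (rule quotient_space_map_collapse) (rule simplicial_map_degen_filtration[OF f X.simplicial])
  have Yf: "quotient_space_map (Y.D (Suc 0) (n - t)) (faces Y n J) (collapse (Y.D (Suc t) n) (f n x))
      = collapse (Y.D (Suc 0) (n - t)) (faces Y n J (f n x))"
    by (rule quotient_space_map_collapse) (use Y.faces_degen_filtration[OF J, of _ "Suc 0"] in auto)
  show ?thesis
    using faces_quotient_natural[OF X.simplicial_axioms Y.simplicial_axioms f J xL] length_admissible[OF J] Xf ff Yf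
    by (simp add: quotient_face_def degen_quotient_map_def x(2))
qed

lemma g_None: "map_susp (g m) (Pt None) = Pt None"
  by (simp add: degen_quotient_map_def quotient_space_map_def)

lemma top_fam_natural:
  assumes "map_susp (g (n - length (top_word n))) (p x) = p' x'"
  shows "gw n (top_fam n p (x, s)) = top_fam n p' (x', s)"
  using assms by (simp add: top_fam_def wedge_map_incl map_susp_susp_point)

lemma split_fam_natural:
  assumes "x \<in> X.L n" "k \<le> n"
  shows "gw n (split_fam X n k (Pt x, s)) = split_fam Y n k (Pt (f n x), s)"
  using assms(2)
proof (induction k arbitrary: s)
  case 0
  have "top_word n \<in> admissible n n" by (simp add: admissible_top)
  from level_face_natural[OF this assms(1)] show ?case unfolding split_fam.simps by (rule top_fam_natural)
next
  case (Suc k)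
  have "gw n (wedge_loops (\<lambda>_. Pt None) (level_face X n) (adm_list n (n - Suc k)) (Pt x, s))
    = wedge_loops (\<lambda>_. Pt None) (level_face Y n) (adm_list n (n - Suc k)) (Pt (f n x), s)" for s
    by (rule wedge_loops_natural) (use level_face_natural[OF _ assms(1)] g_None in auto)
  then show ?case using Suc by (simp add: join_fam_def)
qed

lemma quotient_fam_natural:
  assumes z: "z \<in> topspace (X.Yo n t)"
  shows "gw n (quotient_fam X n t (z, s)) = quotient_fam Y n t (map_susp (degen_quotient_map n t Y f) z, s)"
proof (cases "t = n")
  case True
  have "top_word n \<in> admissible n t" using True by (simp add: admissible_top)
  from quotient_face_natural[OF this z] show ?thesis
    unfolding quotient_fam_def if_P[OF True] by (rule top_fam_natural)
next
  case False
  have "gw n (wedge_loops (\<lambda>_. Pt None) (quotient_face X n) (adm_list n t) (z, s))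
    = wedge_loops (\<lambda>_. Pt None) (quotient_face Y n) (adm_list n t) (map_susp (degen_quotient_map n t Y f) z, s)"
    by (rule wedge_loops_natural) (use quotient_face_natural[OF _ z] g_None in auto)
  then show ?thesis using False by (simp add: quotient_fam_def)
qed

lemma gw_None: "gw n None = None" and gw_North: "gw n (Some (J, North)) = Some (J, North)"
  by (simp_all add: wedge_map_def wedge_incl_def)

end

section \<open>Assembling the two natural equivalences\<close>

definition word_list :: "nat \<Rightarrow> nat list list" where
  "word_list n = sorted_list_of_set (words n)"

lemma finite_words: "finite (words n)"
  by (simp add: words_def finite_admissible)

lemma word_list: "set (word_list n) = words n" "distinct (word_list n)" "word_list n \<noteq> []"
proof -
  show s: "set (word_list n) = words n" by (simp add: word_list_def finite_words)
  show "distinct (word_list n)" by (simp add: word_list_def)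
  have "top_word n \<in> words n" using admissible_top admissible_words[of n n] by auto
  then show "word_list n \<noteq> []" using s by auto
qed

lemma adm_list: "distinct (adm_list n t)" "t \<le> n \<Longrightarrow> adm_list n t \<noteq> []" "t \<le> n \<Longrightarrow> set (adm_list n t) \<subseteq> words n"
proof -
  show "distinct (adm_list n t)" by (simp add: adm_list_def)
  assume t: "t \<le> n"
  have "rev [0..<t] \<in> admissible n t" using t by (auto simp: admissible_def sorted_wrt_rev)
  then show "adm_list n t \<noteq> []" using set_adm_list[of n t] by (metis empty_iff list.set(1))
  show "set (adm_list n t) \<subseteq> words n" using t by (auto simp: words_def)
qed

definition quotient_split :: "nat \<Rightarrow> nat \<Rightarrow> 'a simpl_space \<Rightarrow> 'a option susp \<Rightarrow> (nat list \<times> 'a rpoint set option susp) option" where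
  "quotient_split n t X = to_filtration_wedge X n (adm_list n t)
     (susp_lift None (if t = n then Some (top_word n, North) else None) (quotient_fam X n t))"

text \<open>A word determines \<open>t\<close> as its length, so the double wedge has the same
  points as the single wedge over all words. The base point of each inner wedge is
  \<open>None\<close>, which is then also the base point used by the outer one.\<close>

definition regroup :: "(nat list \<times> 'b) option \<Rightarrow> (nat \<times> (nat list \<times> 'b) option) option" where
  "regroup w = (case w of None \<Rightarrow> None | Some (J, z) \<Rightarrow> Some (length J, Some (J, z)))"

definition ungroup :: "(nat \<times> (nat list \<times> 'b) option) option \<Rightarrow> (nat list \<times> 'b) option" where
  "ungroup w = (case w of None \<Rightarrow> None | Some (t, v) \<Rightarrow> v)"

definition level_split :: "nat \<Rightarrow> 'a simpl_space \<Rightarrow> 'a susp \<Rightarrow> (nat \<times> (nat list \<times> 'a rpoint set option susp) option) option" where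
  "level_split n X = regroup \<circ> to_filtration_wedge X n (word_list n)
     (susp_lift None (Some (top_word n, North)) (split_fam X n n))"

lemma realization_wedge_eq:
  assumes "t \<le> n"
  shows "realization_wedge n t X = filtration_wedge X n (admissible n t)"
  unfolding realization_wedge_def filtration_wedge_def
  by (rule wedge_cong) (use assms in \<open>simp add: iterated_suspension_def ptop_def length_admissible of_nat_diff\<close>)

lemma realization_wedge_map_eq:
  assumes "t \<le> n" "w \<in> topspace (filtration_wedge X n (admissible n t))"
  shows "realization_wedge_map n t Y f w = filtration_wedge_map Y f n w"
  using assms(2) unfolding filtration_wedge_def
  by (cases rule: wedgeE)
    (use assms(1) in \<open>simp add: realization_wedge_map_def filtration_wedge_map_def wedge_map_incl length_admissible of_nat_diff\<close>)

lemma regroup_incl: "regroup (wedge_incl b (J, z)) = wedge_incl None (length J, wedge_incl b (J, z))"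
  by (simp add: regroup_def wedge_incl_def)

lemma ungroup_incl: "ungroup (wedge_incl None (t, v)) = v"
  by (simp add: ungroup_def wedge_incl_def)

lemma homeomorphic_maps_regroup:
  "homeomorphic_maps (filtration_wedge X n (words n)) (wedge None {0..n} (\<lambda>t. realization_wedge n t X)) regroup ungroup"
  unfolding homeomorphic_maps_def
proof (intro conjI ballI)
  let ?Z = "\<lambda>J. (suspension ^^ Suc (length J)) (ptop (realization_quotient (int (n - length J)) X))"
  show "continuous_map (filtration_wedge X n (words n)) (wedge None {0..n} (\<lambda>t. realization_wedge n t X)) regroup"
    unfolding filtration_wedge_def
  proof (rule continuous_map_wedge)
    fix J assume J: "J \<in> words n"
    have l: "length J \<in> {0..n}" using words_length_le[OF J] by simp
    note J' = words_length[OF J]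
    have "continuous_map (?Z J) (realization_wedge n (length J) X) (\<lambda>z. wedge_incl South (J, z))"
      using l realization_wedge_eq[of "length J" n X] continuous_map_wedge_incl[OF J', of ?Z South]
      by (simp add: filtration_wedge_def)
    from continuous_map_comp[OF this continuous_map_wedge_incl[OF l, of "\<lambda>t. realization_wedge n t X" None]]
    show "continuous_map (?Z J) (wedge None {0..n} (\<lambda>t. realization_wedge n t X)) (\<lambda>z. regroup (wedge_incl South (J, z)))"
      unfolding regroup_incl .
  qed
  show "continuous_map (wedge None {0..n} (\<lambda>t. realization_wedge n t X)) (filtration_wedge X n (words n)) ungroup"
  proof (rule continuous_map_wedge)
    fix t assume t: "t \<in> {0..n}"
    have "continuous_map (filtration_wedge X n (admissible n t)) (filtration_wedge X n (words n)) (\<lambda>v. v)"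
      unfolding filtration_wedge_def
    proof (rule continuous_map_wedge)
      fix J assume "J \<in> admissible n t"
      then have "J \<in> words n" using t by (auto simp: words_def)
      from continuous_map_wedge_incl[OF this, of ?Z South]
      show "continuous_map (?Z J) (wedge South (words n) ?Z) (\<lambda>z. wedge_incl South (J, z))" .
    qed
    then show "continuous_map (realization_wedge n t X) (filtration_wedge X n (words n)) (\<lambda>v. ungroup (wedge_incl None (t, v)))"
      using t by (simp add: ungroup_incl realization_wedge_eq)
  qed
  show "ungroup (regroup w) = w" for w :: "(nat list \<times> 'a rpoint set option susp) option"
    by (auto simp: regroup_def ungroup_def split: option.split)
  fix w assume "w \<in> topspace (wedge None {0..n} (\<lambda>t. realization_wedge n t X))"
  then show "regroup (ungroup w) = w"
  proof (cases rule: wedgeE)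
    case (1 t v)
    then have "v \<in> topspace (wedge South (admissible n t) ?Z)" using realization_wedge_eq[of t n X] by (simp add: filtration_wedge_def)
    then show ?thesis
    proof (cases rule: wedgeE)
      case (1 J z)
      then show ?thesis using \<open>w = wedge_incl None (t, v)\<close> regroup_incl[of South J z] length_admissible[of J n t]
        by (simp add: ungroup_incl)
    qed
  qed
qed

lemma regroup_natural:
  assumes "w \<in> topspace (filtration_wedge X n (words n))"
  shows "wedge_map None (\<lambda>t. realization_wedge_map n t Y f) (regroup w) = regroup (filtration_wedge_map Y f n w)"
  using assms unfolding filtration_wedge_def
proof (cases rule: wedgeE)
  case (1 J z)
  have "wedge_map None (\<lambda>t. realization_wedge_map n t Y f) (regroup w)
    = wedge_incl None (length J, realization_wedge_map n (length J) Y f (wedge_incl South (J, z)))"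
    using 1 by (simp add: regroup_incl wedge_map_incl realization_wedge_map_def wedge_map_def[of _ _ None])
  also have "realization_wedge_map n (length J) Y f (wedge_incl South (J, z)) = filtration_wedge_map Y f n w"
    using 1 words_length_le[of J n] by (simp add: realization_wedge_map_def filtration_wedge_map_def wedge_map_incl of_nat_diff)
  also have "wedge_incl None (length J, filtration_wedge_map Y f n w) = regroup (filtration_wedge_map Y f n w)"
    using 1 by (simp add: filtration_wedge_map_def wedge_map_incl regroup_incl)
  finally show ?thesis .
qed

context NDR_simplicial
begin

lemma homotopy_equivalence_quotient_fam:
  "t \<le> n \<Longrightarrow> homotopy_equivalence_map (suspension (Yo n t)) (susp_wedge X n (set (adm_list n t)))
    (susp_lift None (if t = n then Some (top_word n, North) else None) (quotient_fam X n t))"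
  using splits_quotient_fam[of t n] splits_imp_homotopy_equivalence by auto

lemma homotopy_equivalence_split_fam:
  "homotopy_equivalence_map (suspension (ptop (level X n))) (susp_wedge X n (set (word_list n)))
    (susp_lift None (Some (top_word n, North)) (split_fam X n n))"
  unfolding word_list(1) by (rule splits_imp_homotopy_equivalence[OF splits_level])

lemma homotopy_equivalence_quotient_split:
  assumes "t \<le> n"
  shows "homotopy_equivalence_map ((suspension ^^ Suc n) (Yo n t)) (realization_wedge n t X) (quotient_split n t X)"
  using homotopy_equivalence_to_filtration_wedge[OF adm_list(1) adm_list(2,3)[OF assms] homotopy_equivalence_quotient_fam[OF assms]]
  by (simp add: quotient_split_def realization_wedge_eq[OF assms] del: funpow.simps)

lemma homotopy_equivalence_level_to_filtration:
  "homotopy_equivalence_map ((suspension ^^ Suc n) (ptop (level X n))) (filtration_wedge X n (words n))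
    (to_filtration_wedge X n (word_list n) (susp_lift None (Some (top_word n, North)) (split_fam X n n)))"
  using homotopy_equivalence_to_filtration_wedge[OF word_list(2,3) _ homotopy_equivalence_split_fam]
  by (simp add: word_list(1) del: funpow.simps)

lemma homotopy_equivalence_level_split:
  "homotopy_equivalence_map ((suspension ^^ Suc n) (ptop (level X n))) (wedge None {0..n} (\<lambda>t. realization_wedge n t X)) (level_split n X)"
  unfolding level_split_def
  by (rule homotopy_equivalence_map_compose[OF homotopy_equivalence_level_to_filtration
        homotopy_equivalence_map_homeomorphic[OF homeomorphic_maps_regroup]])

end

context NDR_simplicial_map
begin

lemma quotient_split_natural:
  assumes t: "t \<le> n" and z: "z \<in> topspace ((suspension ^^ Suc n) (X.Yo n t))"
  shows "realization_wedge_map n t Y f (quotient_split n t X z) = quotient_split n t Y (map_susp (degen_quotient_map n t Y f) z)"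
proof -
  let ?y = "if t = n then Some (top_word n, North) else None"
  have "quotient_split n t X z \<in> topspace (filtration_wedge X n (admissible n t))"
    using continuous_map_app[OF homotopy_equivalence_imp_continuous[OF X.homotopy_equivalence_quotient_split[OF t]] z]
    by (simp add: realization_wedge_eq[OF t])
  from realization_wedge_map_eq[OF t this]
  have "realization_wedge_map n t Y f (quotient_split n t X z) = filtration_wedge_map Y f n (quotient_split n t X z)" .
  also have "\<dots> = quotient_split n t Y (map_susp (degen_quotient_map n t Y f) z)"
    unfolding quotient_split_def
  proof (rule to_filtration_wedge_natural[OF adm_list(1) adm_list(2,3)[OF t] X.homotopy_equivalence_quotient_fam[OF t] _ z])
    fix z assume "z \<in> topspace (suspension (X.Yo n t))"
    then show "gw n (susp_lift None ?y (quotient_fam X n t) z)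
      = susp_lift None ?y (quotient_fam Y n t) (map_susp (degen_quotient_map n t Y f) z)"
      by (intro susp_lift_natural[of "X.Yo n t"] quotient_fam_natural gw_None) (auto simp: gw_None gw_North)
  qed
  finally show ?thesis .
qed

lemma level_split_natural:
  assumes z: "z \<in> topspace ((suspension ^^ Suc n) (ptop (level X n)))"
  shows "wedge_map None (\<lambda>t. realization_wedge_map n t Y f) (level_split n X z) = level_split n Y (map_susp (f n) z)"
proof -
  let ?\<phi> = "\<lambda>X. susp_lift None (Some (top_word n, North)) (split_fam X n n)"
  have "filtration_wedge_map Y f n (to_filtration_wedge X n (word_list n) (?\<phi> X) z)
    = to_filtration_wedge Y n (word_list n) (?\<phi> Y) (map_susp (f n) z)"
  proof (rule to_filtration_wedge_natural[OF word_list(2,3) _ X.homotopy_equivalence_split_fam _ z])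
    show "set (word_list n) \<subseteq> words n" by (simp add: word_list(1))
    fix z assume z: "z \<in> topspace (suspension (ptop (level X n)))"
    show "gw n (?\<phi> X z) = ?\<phi> Y (map_susp (f n) z)"
    proof (rule susp_lift_natural[where A = "ptop (level X n)"])
      fix a s assume "a \<in> topspace (ptop (level X n))"
      then obtain x where "x \<in> X.L n" "a = Pt x" by (auto simp: topspace_ptop)
      then show "gw n (split_fam X n n (a, s)) = split_fam Y n n (map_susp (f n) a, s)"
        using split_fam_natural[of x n n s] by simp
    qed (fact gw_None gw_North z)+
  qed
  moreover have "to_filtration_wedge X n (word_list n) (?\<phi> X) z \<in> topspace (filtration_wedge X n (words n))"
    by (rule continuous_map_app[OF homotopy_equivalence_imp_continuous[OF X.homotopy_equivalence_level_to_filtration] z])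
  ultimately show ?thesis unfolding level_split_def o_apply using regroup_natural by metis
qed

end

section \<open>The empty simplicial space\<close>

lemma suspension_funpow_empty: "topspace A = {} \<Longrightarrow> topspace ((suspension ^^ k) A) = {}"
  by (induction k) (simp_all add: topspace_suspension)

lemma topspace_wedge_empty: "(\<And>i. i \<in> I \<Longrightarrow> topspace (Z i) = {}) \<Longrightarrow> topspace (wedge b I Z) = {}"
  by (auto simp: wedge_def topspace_quotient_topology topspace_sum_topology)

context simplicial
begin

context
  assumes empty: "L 0 = {}"
begin

lemma level_empty: "L n = {}"
proof (induction n)
  case (Suc n)
  then show ?case using face_in[of _ n 0] by blast
qed (rule empty)

lemma degen_quotient_empty: "topspace (degen_quotient n t X) = {}"
  by (simp add: degen_quotient_def topspace_quotient_space level_empty)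

lemma realization_wedge_empty: "topspace (realization_wedge n t X) = {}"
  unfolding realization_wedge_def
proof (rule topspace_wedge_empty)
  have "topspace (realization_quotient j X) = {}" for j
    by (simp add: realization_quotient_def topspace_quotient_space realization_filtration_def level_empty case_prod_unfold)
  then show "topspace (iterated_suspension (t + 1) (realization_quotient (int n - int t) X)) = {}"
    unfolding iterated_suspension_def by (intro suspension_funpow_empty) (simp add: topspace_quotient_topology)
qed

end

end

theorem corollary1p8:
  fixes \<C> :: "'a simpl_space set"
  assumes "\<C> = {X. simplicial_space X \<and> (\<forall>n. cgwh_space (level X n)) \<and>
                   proper X \<and> simplicially_NDR X}"
  shows "(\<exists>K. \<forall>n t. t \<le> n \<longrightarrow>
            natural_homotopy_equivalence \<C>
              (\<lambda>X. iterated_suspension (n + 1) (degen_quotient n t X))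
              (\<lambda>Y f. map_susp (degen_quotient_map n t Y f))
              (realization_wedge n t)
              (realization_wedge_map n t)
              (K n t)) \<and>
         (\<exists>\<Theta>. \<forall>n.
            natural_homotopy_equivalence \<C>
              (\<lambda>X. iterated_suspension (n + 1) (level X n))
              (\<lambda>Y f. map_susp (f n))
              (\<lambda>X. wedge None {0..n} (\<lambda>t. realization_wedge n t X))
              (\<lambda>Y f. wedge_map None (\<lambda>t. realization_wedge_map n t Y f))
              (\<Theta> n))"
proof (intro conjI exI allI impI)
  have C: "simplicial_space X" "X \<in> \<C> \<Longrightarrow> topspace (level X 0) \<noteq> {} \<Longrightarrow> NDR_simplicial X" if "X \<in> \<C>" for X
    using that unfolding assms by (auto intro!: NDR_simplicial.intro simplicial.intro NDR_simplicial_axioms.intro)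
  have it: "iterated_suspension (n + 1) A = (suspension ^^ Suc n) (ptop A)" for n and A :: "'c topology"
    by (simp add: iterated_suspension_def ptop_def)
  have map: "NDR_simplicial_map X Y f" if "X \<in> \<C>" "Y \<in> \<C>" "simplicial_map X Y f" "topspace (level X 0) \<noteq> {}" for X Y f
  proof -
    \<comment> \<open>Nonemptiness passes along a simplicial map, so naturality distinguishes cases
      by the source only.\<close>
    have "topspace (level Y 0) \<noteq> {}" using simplicial_map_in[OF that(3)] that(4) by blast
    then show ?thesis using C that by (auto intro!: NDR_simplicial_map.intro NDR_simplicial_map_axioms.intro)
  qed
  have empty: "topspace ((suspension ^^ Suc n) (ptop (degen_quotient n t X))) = {}" "topspace (realization_wedge n t X) = {}"
    "topspace ((suspension ^^ Suc n) (ptop (level X n))) = {}"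
    "topspace (wedge None {0..n} (\<lambda>t. realization_wedge n t X)) = {}"
    if "X \<in> \<C>" "topspace (level X 0) = {}" for X n t
  proof -
    interpret simplicial X by standard (rule C(1)[OF that(1)])
    show "topspace ((suspension ^^ Suc n) (ptop (degen_quotient n t X))) = {}"
      by (intro suspension_funpow_empty) (simp add: topspace_ptop degen_quotient_empty[OF that(2)])
    show "topspace ((suspension ^^ Suc n) (ptop (level X n))) = {}"
      by (intro suspension_funpow_empty) (simp add: topspace_ptop level_empty[OF that(2)])
    show "topspace (realization_wedge n t X) = {}" "topspace (wedge None {0..n} (\<lambda>t. realization_wedge n t X)) = {}"
      by (intro topspace_wedge_empty realization_wedge_empty[OF that(2)])+
  qed
  show "natural_homotopy_equivalence \<C> (\<lambda>X. iterated_suspension (n + 1) (degen_quotient n t X))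
      (\<lambda>Y f. map_susp (degen_quotient_map n t Y f)) (realization_wedge n t) (realization_wedge_map n t) (quotient_split n t)"
    if t: "t \<le> n" for n t
    unfolding it
  proof (rule natural_homotopy_equivalenceI)
    fix X assume X: "X \<in> \<C>"
    show "homotopy_equivalence_map ((suspension ^^ Suc n) (ptop (degen_quotient n t X))) (realization_wedge n t X) (quotient_split n t X)"
    proof (cases "topspace (level X 0) = {}")
      case True
      then show ?thesis using empty[OF X] by (intro homotopy_equivalence_map_empty)
    next
      case False
      then show ?thesis using NDR_simplicial.homotopy_equivalence_quotient_split[OF C(2)[OF X X] t] by blast
    qed
    fix Y f assume Y: "Y \<in> \<C>" "simplicial_map X Y f"
    have "continuous_map (subtopology (level X n) (degen_filtration X t n)) (subtopology (level Y n) (degen_filtration Y t n)) (f n)"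
      using simplicial_map_degen_filtration[OF Y(2) C(1)[OF X]]
      by (intro continuous_map_into_subtopology continuous_map_from_subtopology simplicial_map_cont[OF Y(2)]) auto
    then show "continuous_map ((suspension ^^ Suc n) (ptop (degen_quotient n t X))) ((suspension ^^ Suc n) (ptop (degen_quotient n t Y)))
        (map_susp (degen_quotient_map n t Y f))"
      unfolding degen_quotient_def degen_quotient_map_def
      by (intro continuous_map_map_susp continuous_map_quotient_space_map)
        (use simplicial_map_degen_filtration[OF Y(2) C(1)[OF X]] in auto)
    fix z assume z: "z \<in> topspace ((suspension ^^ Suc n) (ptop (degen_quotient n t X)))"
    \<comment> \<open>The existence of the point \<open>z\<close> already excludes the empty
      simplicial space.\<close>
    then have "topspace (level X 0) \<noteq> {}" using empty(1)[OF X] by blast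
    from NDR_simplicial_map.quotient_split_natural[OF map[OF X Y this] t z]
    show "realization_wedge_map n t Y f (quotient_split n t X z) = quotient_split n t Y (map_susp (degen_quotient_map n t Y f) z)" .
  qed
  show "natural_homotopy_equivalence \<C> (\<lambda>X. iterated_suspension (n + 1) (level X n)) (\<lambda>Y f. map_susp (f n))
      (\<lambda>X. wedge None {0..n} (\<lambda>t. realization_wedge n t X)) (\<lambda>Y f. wedge_map None (\<lambda>t. realization_wedge_map n t Y f)) (level_split n)"
    for n
    unfolding it
  proof (rule natural_homotopy_equivalenceI)
    fix X assume X: "X \<in> \<C>"
    show "homotopy_equivalence_map ((suspension ^^ Suc n) (ptop (level X n))) (wedge None {0..n} (\<lambda>t. realization_wedge n t X)) (level_split n X)"
    proof (cases "topspace (level X 0) = {}")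
      case True
      then show ?thesis using empty[OF X] by (intro homotopy_equivalence_map_empty)
    next
      case False
      then show ?thesis using NDR_simplicial.homotopy_equivalence_level_split[OF C(2)[OF X X]] by blast
    qed
    fix Y f assume Y: "Y \<in> \<C>" "simplicial_map X Y f"
    show "continuous_map ((suspension ^^ Suc n) (ptop (level X n))) ((suspension ^^ Suc n) (ptop (level Y n))) (map_susp (f n))"
      by (rule continuous_map_map_susp[OF simplicial_map_cont[OF Y(2)]])
    fix z assume z: "z \<in> topspace ((suspension ^^ Suc n) (ptop (level X n)))"
    then have "topspace (level X 0) \<noteq> {}" using empty(3)[OF X] by blast
    from NDR_simplicial_map.level_split_natural[OF map[OF X Y this] z]
    show "wedge_map None (\<lambda>t. realization_wedge_map n t Y f) (level_split n X z) = level_split n Y (map_susp (f n) z)" .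
  qed
qed

end
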